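(* Let $\mathfrak g=\mathfrak l\oplus\mathfrak m$ be a reductive decomposition of a Lie algebra, $\mathcal G=(\mathfrak g,[\,,\,],\varpi,\varphi)$ a Lie quasi-bialgebra canonically compatible with it, with canonical double $\mathfrak d$, and $l=l^{\mathrm{can}}:U\to\mathcal A(\mathfrak g^*,\mathfrak g)$ the canonical dynamical $\ell$-matrix. For all $p\in U$, the map $$\phi_p:\mathfrak g^\star_p\to\mathfrak g^\star_0,\qquad X\mapsto\mathrm{Ad}^{\mathfrak d}_{e^{-sp}}\,\tau_{l_p}X$$ is (well defined and) a Lie algebra isomorphism. Consequently the bundle map $$\psi:U\times\mathfrak g^\star_0\to\mathrm{Ker}\,a^{N(U)}\subset U\times(\mathfrak l\oplus\mathfrak g^* ),\qquad(p,X)\mapsto(p,-\phi_p^{-1}X)$$ is an isomorphism of Lie algebra bundles, where $\mathrm{Ker}\,a^{N(U)}$ carries the fibrewise bracket induced from the Lie algebroid $N(U)$.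
   Context: Conventions: vector spaces are finite-dimensional over $\mathbb K=\mathbb R$ or $\mathbb C$; $f^*$ is the transpose of $f$; $\mathcal A(\mathfrak g^*,\mathfrak g)$ is the set of linear $t:\mathfrak g^*\to\mathfrak g$ with $t^*=-t$; $\mathrm{ad}^*_x$ is the transpose of $\mathrm{ad}_x$; $A^\perp$ is the annihilator of $A$; $\sum_{\mathrm{cyc}}$ is the sum over cyclic permutations. Lie quasi-bialgebra: $\mathcal G=(\mathfrak g,[\,,\,],\varpi,\varphi)$ with $\varpi:\mathfrak g\to\mathcal A(\mathfrak g^*,\mathfrak g)$ linear satisfying $\varpi_{[x,y]}=\mathrm{ad}_x\varpi_y+\varpi_y\mathrm{ad}^*_x-\mathrm{ad}_y\varpi_x-\varpi_x\mathrm{ad}^*_y$, $\varphi\in\wedge^3\mathfrak g$, such that $\mathfrak d=\mathfrak g\oplus\mathfrak g^*$ with $[x,y]_{\mathfrak d}=[x,y]$, $[x,\xi]_{\mathfrak d}=\varpi_x\xi-\mathrm{ad}^*_x\xi$, $[\xi,\eta]_{\mathfrak d}=\langle\eta,\varpi_\bullet\xi\rangle+\langle\xi\otimes\eta\otimes1,\varphi\rangle$ is a Lie algebra (the canonical double). $\mathrm p_{\mathfrak g}$ is the projection of $\mathfrak d$ on $\mathfrak g$ along $\mathfrak g^*$, $i_{\mathfrak g}:\mathfrak g\to\mathfrak d$ the inclusion, $\mathrm{Ad}^{\mathfrak d}_{e^X}=\exp(\mathrm{ad}^{\mathfrak d}_X)$. Twist: for $t\in\mathcal A(\mathfrak g^*,\mathfrak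 g)$, $\mathcal G^t=(\mathfrak g,[\,,\,],\varpi^t,\varphi^t)$ with $\varpi^t_x=\varpi_x+\mathrm{ad}_xt+t\,\mathrm{ad}^*_x$ and $\langle\xi\otimes\eta\otimes\zeta,\varphi^t\rangle=\langle\xi\otimes\eta\otimes\zeta,\varphi\rangle+\sum_{\mathrm{cyc}(\xi,\eta,\zeta)}\langle\zeta,[t\xi,t\eta]+\varpi_{t\xi}\eta\rangle$ is a Lie quasi-bialgebra, with double $\mathfrak d^t$; $\tau_t:\mathfrak d^t\to\mathfrak d$, $x+\xi\mapsto x+t\xi+\xi$ is a Lie algebra isomorphism. Reductive decomposition: $\mathfrak g=\mathfrak l\oplus\mathfrak m$, $\mathfrak l$ a subalgebra, $[\mathfrak l,\mathfrak m]\subset\mathfrak m$; $i:\mathfrak l\to\mathfrak g$ the inclusion, $\mathrm p_{\mathfrak l}$ the projection onto $\mathfrak l$ along $\mathfrak m$, $s=\mathrm p_{\mathfrak l}^*:\mathfrak l^*\to\mathfrak g^*$. $\mathcal G$ is canonically compatible with it if $\varpi_z=0$ for $z\in\mathfrak l$; $\langle\xi,\varpi_x\eta\rangle=0$ for $x\in\mathfrak g$, $\xi,\eta\in\mathfrak m^\perp$; $\varphi\in\mathrm{Alt}(\mathfrak l\otimes\mathfrak l\otimes\mathfrak l\oplus\mathfrak l\otimes\mathfrak m\otimes\mathfrak m\oplus\mathfrak m\otimes\mathfrak m\otimes\mathfrak m)$ and $\varphi$ vanishes on $(\mathfrak l^\perp)^3$. Canonical $\ell$-matrix: with $\mathfrak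 l\oplus\mathfrak l^*$ the double of the Lie quasi-bialgebra $(\mathfrak l,[\,,\,]_{\mathfrak l},0,\mathrm p_{\mathfrak l}^{\otimes3}\varphi)$, let $U=\{p\in\mathfrak l^*:\mathrm{Sp}(\mathrm{ad}^{\mathfrak l\oplus\mathfrak l^*}_p)\cap\mathrm i\pi(\mathbb Z\setminus\{0\})=\emptyset,\ \mathrm p_{\mathfrak g}\mathrm{Ad}^{\mathfrak d}_{e^{-sp}}i_{\mathfrak g}\text{ invertible}\}$ and, for $p\in U$, $\alpha\in\mathfrak l^*$, $\xi\in\mathfrak l^\perp$, $l^{\mathrm{can}}_p(s\alpha+\xi)=F(\mathrm{ad}^{\mathfrak l\oplus\mathfrak l^*}_p)\alpha-(\mathrm p_{\mathfrak g}\mathrm{Ad}^{\mathfrak d}_{e^{-sp}}i_{\mathfrak g})^{-1}\mathrm p_{\mathfrak g}\mathrm{Ad}^{\mathfrak d}_{e^{-sp}}\xi$ with $F(z)=\coth z-1/z$. $\mathfrak g^\star_p=\{z+\xi:\ z\in\mathfrak l,\ \xi\in\mathfrak g^*,\ i^*\xi=\mathrm{ad}^*_zp\}\subset\mathfrak g\oplus\mathfrak g^*$, a Lie subalgebra of the double $\mathfrak d^{l_p}$ of $\mathcal G^{l_p}$; in particular ($l_0=0$) $\mathfrak g_0^\star=\mathfrak l\oplus\mathfrak l^\perp\subset\mathfrak d$. Lie algebroid $N(U)=U\times\mathfrak l\times\mathfrak g^*$ over $U$: anchor $a^{N(U)}_p(z,\xi)=i^*\xi-\mathrm{ad}^*_zp$,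 and bracket on sections $$[(z,\xi),(z',\xi')]_p=\big(d_pz'(a_p(z_p,\xi_p))-d_pz(a_p(z'_p,\xi'_p))-[z_p,z'_p]+\langle\xi_p,d_pl(\cdot)\xi'_p\rangle,\ d_p\xi'(a_p(z_p,\xi_p))-d_p\xi(a_p(z'_p,\xi'_p))+\mathrm{ad}^*_{z_p}\xi'_p-\mathrm{ad}^*_{z'_p}\xi_p+\langle\xi_p,\varpi_\bullet\xi'_p\rangle+\mathrm{ad}^*_{l_p\xi_p}\xi'_p-\mathrm{ad}^*_{l_p\xi'_p}\xi_p\big).$$ *)

theory Defs
  imports
    "HOL-Analysis.Analysis"
    "HOL-Library.Function_Algebras"
    "HOL-Computational_Algebra.Polynomial"
begin

section \<open>Scalars and vector spaces\<close>

text \<open>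
  The axioms say that \<^term>\<open>to_complex\<close> identifies the scalar field with a subfield of the complex
  numbers that contains the reals, so the members of this class are exactly the real and the
  complex field.
\<close>

class real_or_complex = real_normed_field + euclidean_space +
  fixes to_complex :: "'a \<Rightarrow> complex"
  assumes to_complex_add: "to_complex (x + y) = to_complex x + to_complex y"
    and to_complex_mult: "to_complex (x * y) = to_complex x * to_complex y"
    and to_complex_scaleR_one: "to_complex (r *\<^sub>R 1) = of_real r"
    and norm_to_complex: "norm (to_complex x) = norm x"

instantiation real :: real_or_complex
begin
definition to_complex_real :: "real \<Rightarrow> complex" where "to_complex_real = of_real"
instance by standard (auto simp: to_complex_real_def)
end

instantiation complex :: real_or_complex
begin
definition to_complex_complex :: "complex \<Rightarrow> complex" where "to_complex_complex = id"
instance by standard (auto simp: to_complex_complex_def of_real_def)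
end

text \<open>
  A finite-dimensional \<open>'k\<close>-vector space is a type with a scalar multiplication \<open>sc\<close> by \<open>'k\<close>. The norm
  of the type only serves to provide the canonical topology; dimension zero is allowed.
\<close>

definition fin_dim_space :: "('k::real_or_complex \<Rightarrow> 'v::real_normed_vector \<Rightarrow> 'v) \<Rightarrow> bool" where
  "fin_dim_space sc \<longleftrightarrow>
     (\<exists>B. finite_dimensional_vector_space sc B) \<and> (\<forall>r x. sc (of_real r) x = r *\<^sub>R x)"

definition dual :: "('k::real_or_complex \<Rightarrow> 'v::ab_group_add \<Rightarrow> 'v) \<Rightarrow> ('v \<Rightarrow> 'k) set" where
  "dual sc = {\<xi>. Vector_Spaces.linear sc (*) \<xi>}"

text \<open>
  Addition, zero and the topology on \<open>'v \<Rightarrow> 'k\<close> are pointwise; on \<^term>\<open>dual sc\<close> the topology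
  induced by this is the canonical one of a finite-dimensional space.
\<close>

definition fun_scale :: "'k::real_or_complex \<Rightarrow> ('v \<Rightarrow> 'k) \<Rightarrow> 'v \<Rightarrow> 'k" where
  "fun_scale c \<xi> = (\<lambda>x. c * \<xi> x)"

definition sum_scale ::
  "('k::real_or_complex \<Rightarrow> 'v \<Rightarrow> 'v) \<Rightarrow> 'k \<Rightarrow> 'v \<times> ('w \<Rightarrow> 'k) \<Rightarrow> 'v \<times> ('w \<Rightarrow> 'k)" where
  "sum_scale sc c X = (sc c (fst X), fun_scale c (snd X))"

definition annihilator ::
  "('k::real_or_complex \<Rightarrow> 'v::ab_group_add \<Rightarrow> 'v) \<Rightarrow> 'v set \<Rightarrow> ('v \<Rightarrow> 'k) set" where
  "annihilator sc A = {\<xi> \<in> dual sc. \<forall>x\<in>A. \<xi> x = 0}"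

definition linear_between ::
  "('k::real_or_complex \<Rightarrow> 'v::ab_group_add \<Rightarrow> 'v) \<Rightarrow> 'v set \<Rightarrow>
   ('k \<Rightarrow> 'w::ab_group_add \<Rightarrow> 'w) \<Rightarrow> 'w set \<Rightarrow> ('v \<Rightarrow> 'w) \<Rightarrow> bool" where
  "linear_between sc V sc' W f \<longleftrightarrow>
     (\<forall>x\<in>V. f x \<in> W) \<and>
     (\<forall>x\<in>V. \<forall>y\<in>V. f (x + y) = f x + f y) \<and> (\<forall>c. \<forall>x\<in>V. f (sc c x) = sc' c (f x))"

text \<open>The linear maps \<open>t\<close> from the dual space to the space that satisfy \<open>t\<^sup>* = - t\<close>.\<close>

definition antisym_maps ::
  "('k::real_or_complex \<Rightarrow> 'v::ab_group_add \<Rightarrow> 'v) \<Rightarrow> (('v \<Rightarrow> 'k) \<Rightarrow> 'v) set" where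
  "antisym_maps sc =
     {t. linear_between fun_scale (dual sc) sc UNIV t \<and>
         (\<forall>\<xi>\<in>dual sc. \<forall>\<eta>\<in>dual sc. \<eta> (t \<xi>) = - \<xi> (t \<eta>))}"

section \<open>Tensors of degree three\<close>

text \<open>
  A tensor \<open>T\<close> is represented by the function \<open>\<lambda>\<xi> \<eta> \<zeta>. \<langle>\<xi> \<otimes> \<eta> \<otimes> \<zeta>, T\<rangle>\<close>. Only its values on linear
  functionals are meaningful.
\<close>

type_synonym ('k, 'v) tensor3 = "('v \<Rightarrow> 'k) \<Rightarrow> ('v \<Rightarrow> 'k) \<Rightarrow> ('v \<Rightarrow> 'k) \<Rightarrow> 'k"

definition tensor3_scale ::
  "'k::real_or_complex \<Rightarrow> ('k, 'v) tensor3 \<Rightarrow> ('k, 'v) tensor3" where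
  "tensor3_scale c T = (\<lambda>\<xi> \<eta> \<zeta>. c * T \<xi> \<eta> \<zeta>)"

definition pure_tensors ::
  "'v set \<Rightarrow> 'v set \<Rightarrow> 'v set \<Rightarrow> ('k::real_or_complex, 'v) tensor3 set" where
  "pure_tensors A B C = {(\<lambda>\<xi> \<eta> \<zeta>. \<xi> a * \<eta> b * \<zeta> c) | a b c. a \<in> A \<and> b \<in> B \<and> c \<in> C}"

definition Alt :: "('k::real_or_complex, 'v) tensor3 \<Rightarrow> ('k, 'v) tensor3" where
  "Alt T = (\<lambda>\<xi> \<eta> \<zeta>.
     (T \<xi> \<eta> \<zeta> + T \<eta> \<zeta> \<xi> + T \<zeta> \<xi> \<eta> - T \<eta> \<xi> \<zeta> - T \<xi> \<zeta> \<eta> - T \<zeta> \<eta> \<xi>) / 6)"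

text \<open>\<open>T\<close> is the antisymmetrization of an element of the span of \<open>S\<close>.\<close>

definition in_Alt_span ::
  "('k::real_or_complex \<Rightarrow> 'v::ab_group_add \<Rightarrow> 'v) \<Rightarrow> ('k, 'v) tensor3 set \<Rightarrow>
   ('k, 'v) tensor3 \<Rightarrow> bool" where
  "in_Alt_span sc S T \<longleftrightarrow>
     (\<exists>T'\<in>module.span tensor3_scale S.
        \<forall>\<xi>\<in>dual sc. \<forall>\<eta>\<in>dual sc. \<forall>\<zeta>\<in>dual sc. T \<xi> \<eta> \<zeta> = Alt T' \<xi> \<eta> \<zeta>)"

text \<open>\<open>\<langle>\<xi> \<otimes> \<eta> \<otimes> 1, T\<rangle>\<close>.\<close>

definition contract ::
  "('k::real_or_complex \<Rightarrow> 'v::ab_group_add \<Rightarrow> 'v) \<Rightarrow> ('k, 'v) tensor3 \<Rightarrow>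
   ('v \<Rightarrow> 'k) \<Rightarrow> ('v \<Rightarrow> 'k) \<Rightarrow> 'v" where
  "contract sc T \<xi> \<eta> = (THE x. \<forall>\<zeta>\<in>dual sc. \<zeta> x = T \<xi> \<eta> \<zeta>)"

section \<open>Lie algebras carried by subspaces\<close>

definition lie_algebra_on ::
  "('k::real_or_complex \<Rightarrow> 'v::ab_group_add \<Rightarrow> 'v) \<Rightarrow> 'v set \<Rightarrow> ('v \<Rightarrow> 'v \<Rightarrow> 'v) \<Rightarrow> bool" where
  "lie_algebra_on sc V br \<longleftrightarrow>
     module.subspace sc V \<and>
     (\<forall>x\<in>V. linear_between sc V sc V (br x) \<and> linear_between sc V sc V (\<lambda>y. br y x)) \<and>
     (\<forall>x\<in>V. br x x = 0) \<and>
     (\<forall>x\<in>V. \<forall>y\<in>V. \<forall>z\<in>V. br x (br y z) + br y (br z x) + br z (br x y) = 0)"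

definition lie_algebra_iso ::
  "('k::real_or_complex \<Rightarrow> 'v::ab_group_add \<Rightarrow> 'v) \<Rightarrow> 'v set \<Rightarrow> ('v \<Rightarrow> 'v \<Rightarrow> 'v) \<Rightarrow>
   ('k \<Rightarrow> 'w::ab_group_add \<Rightarrow> 'w) \<Rightarrow> 'w set \<Rightarrow> ('w \<Rightarrow> 'w \<Rightarrow> 'w) \<Rightarrow> ('v \<Rightarrow> 'w) \<Rightarrow> bool" where
  "lie_algebra_iso sc V br sc' W br' f \<longleftrightarrow>
     lie_algebra_on sc V br \<and> lie_algebra_on sc' W br' \<and>
     linear_between sc V sc' W f \<and> bij_betw f V W \<and>
     (\<forall>x\<in>V. \<forall>y\<in>V. f (br x y) = br' (f x) (f y))"

text \<open>\<open>coad br x \<xi>\<close> is \<open>ad\<^sub>x\<^sup>* \<xi>\<close>, with the plain transpose (no sign).\<close>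

definition coad :: "('v \<Rightarrow> 'v \<Rightarrow> 'v) \<Rightarrow> 'v \<Rightarrow> ('v \<Rightarrow> 'k) \<Rightarrow> 'v \<Rightarrow> 'k" where
  "coad br x \<xi> = (\<lambda>y. \<xi> (br x y))"

section \<open>Lie quasi-bialgebras, doubles and twists\<close>

record ('k, 'g) quasi_bialg =
  scl :: "'k \<Rightarrow> 'g \<Rightarrow> 'g"
  brk :: "'g \<Rightarrow> 'g \<Rightarrow> 'g"
  cobr :: "'g \<Rightarrow> ('g \<Rightarrow> 'k) \<Rightarrow> 'g"  \<comment> \<open>\<open>\<varpi>\<close>\<close>
  phi :: "('k, 'g) tensor3"

definition double_carrier ::
  "('k::real_or_complex, 'g::real_normed_vector) quasi_bialg \<Rightarrow> ('g \<times> ('g \<Rightarrow> 'k)) set" where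
  "double_carrier G = UNIV \<times> dual (scl G)"

definition double_brk ::
  "('k::real_or_complex, 'g::real_normed_vector) quasi_bialg \<Rightarrow>
   'g \<times> ('g \<Rightarrow> 'k) \<Rightarrow> 'g \<times> ('g \<Rightarrow> 'k) \<Rightarrow> 'g \<times> ('g \<Rightarrow> 'k)" where
  "double_brk G X Y = (case (X, Y) of ((x, \<xi>), (y, \<eta>)) \<Rightarrow>
     (brk G x y + cobr G x \<eta> - cobr G y \<xi> + contract (scl G) (phi G) \<xi> \<eta>,
      - coad (brk G) x \<eta> + coad (brk G) y \<xi> + (\<lambda>z. \<eta> (cobr G z \<xi>))))"

definition lie_quasi_bialgebra ::
  "('k::real_or_complex, 'g::real_normed_vector) quasi_bialg \<Rightarrow> bool" where
  "lie_quasi_bialgebra G \<longleftrightarrow>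
     fin_dim_space (scl G) \<and>
     lie_algebra_on (scl G) UNIV (brk G) \<and>
     (\<forall>x. cobr G x \<in> antisym_maps (scl G)) \<and>
     (\<forall>\<xi>\<in>dual (scl G). linear_between (scl G) UNIV (scl G) UNIV (\<lambda>x. cobr G x \<xi>)) \<and>
     (\<forall>x y. \<forall>\<xi>\<in>dual (scl G).
        cobr G (brk G x y) \<xi> =
          brk G x (cobr G y \<xi>) + cobr G y (coad (brk G) x \<xi>)
          - brk G y (cobr G x \<xi>) - cobr G x (coad (brk G) y \<xi>)) \<and>
     in_Alt_span (scl G) (pure_tensors UNIV UNIV UNIV) (phi G) \<and>
     lie_algebra_on (sum_scale (scl G)) (double_carrier G) (double_brk G)"

definition twist ::
  "('k::real_or_complex, 'g::real_normed_vector) quasi_bialg \<Rightarrow> (('g \<Rightarrow> 'k) \<Rightarrow> 'g) \<Rightarrow>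
   ('k, 'g) quasi_bialg" where
  "twist G t =
     \<lparr>scl = scl G, brk = brk G,
      cobr = (\<lambda>x \<xi>. cobr G x \<xi> + brk G x (t \<xi>) + t (coad (brk G) x \<xi>)),
      phi = (\<lambda>\<xi> \<eta> \<zeta>. phi G \<xi> \<eta> \<zeta>
        + \<zeta> (brk G (t \<xi>) (t \<eta>) + cobr G (t \<xi>) \<eta>)
        + \<xi> (brk G (t \<eta>) (t \<zeta>) + cobr G (t \<eta>) \<zeta>)
        + \<eta> (brk G (t \<zeta>) (t \<xi>) + cobr G (t \<zeta>) \<xi>))\<rparr>"

definition tau :: "(('g::plus \<Rightarrow> 'k) \<Rightarrow> 'g) \<Rightarrow> 'g \<times> ('g \<Rightarrow> 'k) \<Rightarrow> 'g \<times> ('g \<Rightarrow> 'k)" where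
  "tau t X = (fst X + t (snd X), snd X)"

definition exp_op ::
  "('k::real_or_complex \<Rightarrow> 'v::{comm_monoid_add, topological_space} \<Rightarrow> 'v) \<Rightarrow>
   ('v \<Rightarrow> 'v) \<Rightarrow> 'v \<Rightarrow> 'v" where
  "exp_op sc A v = (\<Sum>n. sc (inverse (fact n)) ((A ^^ n) v))"

text \<open>\<open>Ad_exp G X\<close> is the adjoint action of \<open>e\<^sup>X\<close> on the double.\<close>

definition Ad_exp ::
  "('k::real_or_complex, 'g::real_normed_vector) quasi_bialg \<Rightarrow> 'g \<times> ('g \<Rightarrow> 'k) \<Rightarrow>
   'g \<times> ('g \<Rightarrow> 'k) \<Rightarrow> 'g \<times> ('g \<Rightarrow> 'k)" where
  "Ad_exp G X = exp_op (sum_scale (scl G)) (double_brk G X)"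

section \<open>Reductive decompositions\<close>

text \<open>
  The subalgebra is a Lie algebra on a type \<open>'l\<close> of its own, embedded by \<open>incl\<close>, so that its dual
  and its double are instances of the general notions.
\<close>

record ('k, 'g, 'l) decomposition =
  lscl :: "'k \<Rightarrow> 'l \<Rightarrow> 'l"
  lbrk :: "'l \<Rightarrow> 'l \<Rightarrow> 'l"
  incl :: "'l \<Rightarrow> 'g"
  compl :: "'g set"  \<comment> \<open>the complement \<open>m\<close>\<close>

definition reductive_decomposition ::
  "('k::real_or_complex, 'g::real_normed_vector) quasi_bialg \<Rightarrow>
   ('k, 'g, 'l::real_normed_vector) decomposition \<Rightarrow> bool" where
  "reductive_decomposition G R \<longleftrightarrow>
     fin_dim_space (lscl R) \<and> lie_algebra_on (lscl R) UNIV (lbrk R) \<and>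
     Vector_Spaces.linear (lscl R) (scl G) (incl R) \<and> inj (incl R) \<and>
     (\<forall>y z. incl R (lbrk R y z) = brk G (incl R y) (incl R z)) \<and>
     module.subspace (scl G) (compl R) \<and>
     range (incl R) \<inter> compl R = {0} \<and> (\<forall>x. \<exists>z. \<exists>y\<in>compl R. x = incl R z + y) \<and>
     (\<forall>z. \<forall>y\<in>compl R. brk G (incl R z) y \<in> compl R)"

definition proj_l :: "('k, 'g::minus, 'l) decomposition \<Rightarrow> 'g \<Rightarrow> 'l" where
  "proj_l R x = (THE z. x - incl R z \<in> compl R)"

text \<open>\<open>s = p\<^sub>l\<^sup>*\<close> and \<open>i\<^sup>*\<close>.\<close>

definition lift_dual :: "('k, 'g::minus, 'l) decomposition \<Rightarrow> ('l \<Rightarrow> 'k) \<Rightarrow> 'g \<Rightarrow> 'k" where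
  "lift_dual R \<alpha> = \<alpha> \<circ> proj_l R"

definition restr_dual :: "('k, 'g, 'l) decomposition \<Rightarrow> ('g \<Rightarrow> 'k) \<Rightarrow> 'l \<Rightarrow> 'k" where
  "restr_dual R \<xi> = \<xi> \<circ> incl R"

definition canonically_compatible ::
  "('k::real_or_complex, 'g::real_normed_vector) quasi_bialg \<Rightarrow>
   ('k, 'g, 'l::real_normed_vector) decomposition \<Rightarrow> bool" where
  "canonically_compatible G R \<longleftrightarrow>
     (\<forall>z. \<forall>\<xi>\<in>dual (scl G). cobr G (incl R z) \<xi> = 0) \<and>
     (\<forall>x. \<forall>\<xi>\<in>annihilator (scl G) (compl R). \<forall>\<eta>\<in>annihilator (scl G) (compl R).
        \<xi> (cobr G x \<eta>) = 0) \<and>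
     (let L = range (incl R); M = compl R in
        in_Alt_span (scl G) (pure_tensors L L L \<union> pure_tensors L M M \<union> pure_tensors M M M)
          (phi G)) \<and>
     (let P = annihilator (scl G) (range (incl R)) in
        \<forall>\<xi>\<in>P. \<forall>\<eta>\<in>P. \<forall>\<zeta>\<in>P. phi G \<xi> \<eta> \<zeta> = 0)"

definition sub_quasi_bialg ::
  "('k::real_or_complex, 'g::real_normed_vector) quasi_bialg \<Rightarrow>
   ('k, 'g, 'l::real_normed_vector) decomposition \<Rightarrow> ('k, 'l) quasi_bialg" where
  "sub_quasi_bialg G R =
     \<lparr>scl = lscl R, brk = lbrk R, cobr = (\<lambda>_ _. 0),
      phi = (\<lambda>\<alpha> \<beta> \<gamma>. phi G (lift_dual R \<alpha>) (lift_dual R \<beta>) (lift_dual R \<gamma>))\<rparr>"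

section \<open>Spectrum and functional calculus\<close>

text \<open>
  The eigenvalues of the complexification of an operator \<open>A\<close> on the finite-dimensional subspace
  \<open>V\<close>: \<open>c\<close> are the complex coordinates of an eigenvector with respect to a basis \<open>B\<close> of \<open>V\<close>. For
  \<open>'k = complex\<close> these are the eigenvalues of \<open>A\<close>.
\<close>

definition spectrum ::
  "('k::real_or_complex \<Rightarrow> 'v::ab_group_add \<Rightarrow> 'v) \<Rightarrow> 'v set \<Rightarrow> ('v \<Rightarrow> 'v) \<Rightarrow> complex set" where
  "spectrum sc V A =
     {\<mu>. \<exists>B c. finite B \<and> \<not> module.dependent sc B \<and> module.span sc B = V \<and>
          (\<exists>b\<in>B. c b \<noteq> 0) \<and>
          (\<forall>b\<in>B. (\<Sum>b'\<in>B. to_complex (module.representation sc B (A b') b) * c b') = \<mu> * c b)}"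

definition poly_op ::
  "('k::real_or_complex \<Rightarrow> 'v::ab_group_add \<Rightarrow> 'v) \<Rightarrow> 'k poly \<Rightarrow> ('v \<Rightarrow> 'v) \<Rightarrow> 'v \<Rightarrow> 'v" where
  "poly_op sc q A v = (\<Sum>n\<le>degree q. sc (coeff q n) ((A ^^ n) v))"

text \<open>
  \<open>f(A)\<close> for \<open>f\<close> holomorphic near the spectrum of \<open>A\<close> (and, over the reals, commuting with complex
  conjugation): \<open>f(A) = q(A)\<close> for any polynomial \<open>q\<close> with the same derivatives as \<open>f\<close> at each
  eigenvalue, up to an order not less than the size of its Jordan blocks. The power
  series of \<open>f\<close> is not used since eigenvalues may lie outside its disc of convergence.
\<close>

definition interpolates ::
  "('k::real_or_complex \<Rightarrow> 'v::ab_group_add \<Rightarrow> 'v) \<Rightarrow> 'v set \<Rightarrow> ('v \<Rightarrow> 'v) \<Rightarrow>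
   (complex \<Rightarrow> complex) \<Rightarrow> 'k poly \<Rightarrow> bool" where
  "interpolates sc V A f q \<longleftrightarrow>
     (\<forall>\<mu>\<in>spectrum sc V A. \<forall>k < vector_space.dim sc V.
        (deriv ^^ k) f \<mu> = poly ((pderiv ^^ k) (map_poly to_complex q)) \<mu>)"

definition fun_calc ::
  "('k::real_or_complex \<Rightarrow> 'v::ab_group_add \<Rightarrow> 'v) \<Rightarrow> 'v set \<Rightarrow> (complex \<Rightarrow> complex) \<Rightarrow>
   ('v \<Rightarrow> 'v) \<Rightarrow> 'v \<Rightarrow> 'v" where
  "fun_calc sc V f A = poly_op sc (SOME q. interpolates sc V A f q) A"

text \<open>\<open>F(z) = coth z - 1/z\<close>, with the removable singularity at zero filled in.\<close>

definition F_can :: "complex \<Rightarrow> complex" where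
  "F_can z = (if z = 0 then 0 else cosh z / sinh z - 1 / z)"

section \<open>The canonical l-matrix\<close>

definition ad_l ::
  "('k::real_or_complex, 'g::real_normed_vector) quasi_bialg \<Rightarrow>
   ('k, 'g, 'l::real_normed_vector) decomposition \<Rightarrow> ('l \<Rightarrow> 'k) \<Rightarrow>
   'l \<times> ('l \<Rightarrow> 'k) \<Rightarrow> 'l \<times> ('l \<Rightarrow> 'k)" where
  "ad_l G R p = double_brk (sub_quasi_bialg G R) (0, p)"

text \<open>The adjoint action of \<open>e\<^sup>-\<^sup>s\<^sup>p\<close> on the double, and its component from \<open>g\<close> to \<open>g\<close>.\<close>

definition Ad_sp ::
  "('k::real_or_complex, 'g::real_normed_vector) quasi_bialg \<Rightarrow>
   ('k, 'g, 'l::real_normed_vector) decomposition \<Rightarrow> ('l \<Rightarrow> 'k) \<Rightarrow>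
   'g \<times> ('g \<Rightarrow> 'k) \<Rightarrow> 'g \<times> ('g \<Rightarrow> 'k)" where
  "Ad_sp G R p = Ad_exp G (0, - lift_dual R p)"

definition Ad_sp_gg ::
  "('k::real_or_complex, 'g::real_normed_vector) quasi_bialg \<Rightarrow>
   ('k, 'g, 'l::real_normed_vector) decomposition \<Rightarrow> ('l \<Rightarrow> 'k) \<Rightarrow> 'g \<Rightarrow> 'g" where
  "Ad_sp_gg G R p x = fst (Ad_sp G R p (x, 0))"

definition U_can ::
  "('k::real_or_complex, 'g::real_normed_vector) quasi_bialg \<Rightarrow>
   ('k, 'g, 'l::real_normed_vector) decomposition \<Rightarrow> ('l \<Rightarrow> 'k) set" where
  "U_can G R =
     {p \<in> dual (lscl R).
        spectrum (sum_scale (lscl R)) (double_carrier (sub_quasi_bialg G R)) (ad_l G R p)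
          \<inter> {\<i> * of_real pi * of_int n | n. n \<noteq> 0} = {} \<and>
        bij (Ad_sp_gg G R p)}"

text \<open>
  Evaluated at \<open>\<eta> = s\<alpha> + \<xi>\<close> with \<open>\<alpha> = i\<^sup>*\<eta>\<close> and \<open>\<xi> = \<eta> - s(i\<^sup>*\<eta>)\<close>, which annihilates \<open>l\<close>. As \<open>F\<close> is odd,
  \<open>F(ad\<^sub>p)\<alpha>\<close> lies in \<open>l\<close>, so the first component is the whole value.
\<close>

definition l_can ::
  "('k::real_or_complex, 'g::real_normed_vector) quasi_bialg \<Rightarrow>
   ('k, 'g, 'l::real_normed_vector) decomposition \<Rightarrow> ('l \<Rightarrow> 'k) \<Rightarrow> ('g \<Rightarrow> 'k) \<Rightarrow> 'g" where
  "l_can G R p \<eta> =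
     (let \<alpha> = restr_dual R \<eta>; \<xi> = \<eta> - lift_dual R \<alpha> in
        incl R (fst (fun_calc (sum_scale (lscl R)) (double_carrier (sub_quasi_bialg G R))
          F_can (ad_l G R p) (0, \<alpha>)))
        - inv (Ad_sp_gg G R p) (fst (Ad_sp G R p (0, \<xi>))))"

definition g_star ::
  "('k::real_or_complex, 'g::real_normed_vector) quasi_bialg \<Rightarrow>
   ('k, 'g, 'l::real_normed_vector) decomposition \<Rightarrow> ('l \<Rightarrow> 'k) \<Rightarrow> ('g \<times> ('g \<Rightarrow> 'k)) set" where
  "g_star G R p =
     {(incl R z, \<xi>) | z \<xi>. \<xi> \<in> dual (scl G) \<and> restr_dual R \<xi> = coad (lbrk R) z p}"

definition phi_map ::
  "('k::real_or_complex, 'g::real_normed_vector) quasi_bialg \<Rightarrow>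
   ('k, 'g, 'l::real_normed_vector) decomposition \<Rightarrow> ('l \<Rightarrow> 'k) \<Rightarrow>
   'g \<times> ('g \<Rightarrow> 'k) \<Rightarrow> 'g \<times> ('g \<Rightarrow> 'k)" where
  "phi_map G R p X = Ad_sp G R p (tau (l_can G R p) X)"

section \<open>Derivatives and smooth maps on the dual space\<close>

definition diff_quot ::
  "('k::real_or_complex \<Rightarrow> 'w::ab_group_add \<Rightarrow> 'w) \<Rightarrow> (('v \<Rightarrow> 'k) \<Rightarrow> 'w) \<Rightarrow>
   ('v \<Rightarrow> 'k) \<Rightarrow> ('v \<Rightarrow> 'k) \<Rightarrow> 'k \<Rightarrow> 'w" where
  "diff_quot sc f p \<alpha> t = sc (inverse t) (f (p + fun_scale t \<alpha>) - f p)"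

text \<open>\<open>d\<^sub>p f(\<alpha>)\<close>, as the derivative in the direction \<open>\<alpha>\<close> with respect to the scalar field \<open>'k\<close>.\<close>

definition dir_deriv ::
  "('k::real_or_complex \<Rightarrow> 'w::{ab_group_add, topological_space} \<Rightarrow> 'w) \<Rightarrow> (('v \<Rightarrow> 'k) \<Rightarrow> 'w) \<Rightarrow>
   ('v \<Rightarrow> 'k) \<Rightarrow> ('v \<Rightarrow> 'k) \<Rightarrow> 'w" where
  "dir_deriv sc f p \<alpha> = (THE w. (diff_quot sc f p \<alpha> \<longlongrightarrow> w) (at 0))"

text \<open>
  For \<open>U\<close> open in the finite-dimensional space \<open>D\<close>: all iterated directional derivatives up to order
  \<open>n\<close> exist and are continuous. Having this for every \<open>n\<close> means smooth for \<open>'k = real\<close> and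
  holomorphic for \<open>'k = complex\<close>.
\<close>

primrec Ck_on ::
  "nat \<Rightarrow> ('k::real_or_complex \<Rightarrow> 'w::{ab_group_add, topological_space} \<Rightarrow> 'w) \<Rightarrow>
   ('v \<Rightarrow> 'k) set \<Rightarrow> ('v \<Rightarrow> 'k) set \<Rightarrow> (('v \<Rightarrow> 'k) \<Rightarrow> 'w) \<Rightarrow> bool" where
  "Ck_on 0 sc D U f \<longleftrightarrow> continuous_on U f"
| "Ck_on (Suc n) sc D U f \<longleftrightarrow>
     continuous_on U f \<and>
     (\<forall>\<alpha>\<in>D. (\<forall>p\<in>U. (diff_quot sc f p \<alpha> \<longlongrightarrow> dir_deriv sc f p \<alpha>) (at 0)) \<and>
        Ck_on n sc D U (\<lambda>p. dir_deriv sc f p \<alpha>))"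

definition smooth_section ::
  "('k::real_or_complex \<Rightarrow> 'w::{ab_group_add, topological_space} \<Rightarrow> 'w) \<Rightarrow>
   ('v \<Rightarrow> 'k) set \<Rightarrow> ('v \<Rightarrow> 'k) set \<Rightarrow> (('v \<Rightarrow> 'k) \<Rightarrow> 'w set) \<Rightarrow> (('v \<Rightarrow> 'k) \<Rightarrow> 'w) \<Rightarrow> bool" where
  "smooth_section sc D U E \<sigma> \<longleftrightarrow> (\<forall>p\<in>U. \<sigma> p \<in> E p) \<and> (\<forall>n. Ck_on n sc D U \<sigma>)"

text \<open>
  An isomorphism over the identity of the open set \<open>U\<close> of \<open>D\<close>, between bundles with fibres
  \<open>E p\<close> and \<open>E' p\<close> in fixed vector spaces: a family of isomorphisms of the
  fibres that is smooth together with its inverse, i.e. carries smooth sections to smooth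
  sections in both directions.
\<close>

definition lie_algebra_bundle_iso ::
  "('v \<Rightarrow> 'k::real_or_complex) set \<Rightarrow> ('v \<Rightarrow> 'k) set \<Rightarrow>
   ('k \<Rightarrow> 'w::{ab_group_add, topological_space} \<Rightarrow> 'w) \<Rightarrow> (('v \<Rightarrow> 'k) \<Rightarrow> 'w set) \<Rightarrow>
   (('v \<Rightarrow> 'k) \<Rightarrow> 'w \<Rightarrow> 'w \<Rightarrow> 'w) \<Rightarrow>
   ('k \<Rightarrow> 'x::{ab_group_add, topological_space} \<Rightarrow> 'x) \<Rightarrow> (('v \<Rightarrow> 'k) \<Rightarrow> 'x set) \<Rightarrow>
   (('v \<Rightarrow> 'k) \<Rightarrow> 'x \<Rightarrow> 'x \<Rightarrow> 'x) \<Rightarrow>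
   (('v \<Rightarrow> 'k) \<Rightarrow> 'w \<Rightarrow> 'x) \<Rightarrow> bool" where
  "lie_algebra_bundle_iso D U sc E br sc' E' br' \<psi> \<longleftrightarrow>
     openin (top_of_set D) U \<and>
     (\<forall>p\<in>U. lie_algebra_iso sc (E p) (br p) sc' (E' p) (br' p) (\<psi> p)) \<and>
     (\<forall>\<sigma>. smooth_section sc D U E \<sigma> \<longrightarrow>
        smooth_section sc' D U E' (\<lambda>p. \<psi> p (\<sigma> p))) \<and>
     (\<forall>\<sigma>. smooth_section sc' D U E' \<sigma> \<longrightarrow>
        smooth_section sc D U E (\<lambda>p. inv_into (E p) (\<psi> p) (\<sigma> p)))"

section \<open>The Lie algebroid N(U)\<close>

definition N_fibre ::
  "('k::real_or_complex, 'g::real_normed_vector) quasi_bialg \<Rightarrow> ('l \<times> ('g \<Rightarrow> 'k)) set" where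
  "N_fibre G = UNIV \<times> dual (scl G)"

definition N_anchor ::
  "('k::real_or_complex, 'g, 'l) decomposition \<Rightarrow> ('l \<Rightarrow> 'k) \<Rightarrow> 'l \<times> ('g \<Rightarrow> 'k) \<Rightarrow> 'l \<Rightarrow> 'k" where
  "N_anchor R p u = restr_dual R (snd u) - coad (lbrk R) (fst u) p"

text \<open>\<open>\<langle>\<xi>, d\<^sub>p l(\<cdot>) \<xi>'\<rangle>\<close>, an element of the bidual of \<open>l\<close>, that is, of \<open>l\<close>.\<close>

definition dl_pairing ::
  "('k::real_or_complex, 'g::real_normed_vector) quasi_bialg \<Rightarrow>
   ('k, 'g, 'l::real_normed_vector) decomposition \<Rightarrow> (('l \<Rightarrow> 'k) \<Rightarrow> ('g \<Rightarrow> 'k) \<Rightarrow> 'g) \<Rightarrow>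
   ('l \<Rightarrow> 'k) \<Rightarrow> ('g \<Rightarrow> 'k) \<Rightarrow> ('g \<Rightarrow> 'k) \<Rightarrow> 'l" where
  "dl_pairing G R l p \<xi> \<xi>' =
     (THE z. \<forall>\<alpha>\<in>dual (lscl R). \<alpha> z = \<xi> (dir_deriv (scl G) (\<lambda>q. l q \<xi>') p \<alpha>))"

definition N_bracket ::
  "('k::real_or_complex, 'g::real_normed_vector) quasi_bialg \<Rightarrow>
   ('k, 'g, 'l::real_normed_vector) decomposition \<Rightarrow> (('l \<Rightarrow> 'k) \<Rightarrow> ('g \<Rightarrow> 'k) \<Rightarrow> 'g) \<Rightarrow>
   (('l \<Rightarrow> 'k) \<Rightarrow> 'l \<times> ('g \<Rightarrow> 'k)) \<Rightarrow> (('l \<Rightarrow> 'k) \<Rightarrow> 'l \<times> ('g \<Rightarrow> 'k)) \<Rightarrow>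
   ('l \<Rightarrow> 'k) \<Rightarrow> 'l \<times> ('g \<Rightarrow> 'k)" where
  "N_bracket G R l \<sigma> \<sigma>' p =
     (let z = fst (\<sigma> p); \<xi> = snd (\<sigma> p); z' = fst (\<sigma>' p); \<xi>' = snd (\<sigma>' p);
          a = N_anchor R p (\<sigma> p); a' = N_anchor R p (\<sigma>' p) in
       (dir_deriv (lscl R) (\<lambda>q. fst (\<sigma>' q)) p a - dir_deriv (lscl R) (\<lambda>q. fst (\<sigma> q)) p a'
          - lbrk R z z' + dl_pairing G R l p \<xi> \<xi>',
        dir_deriv fun_scale (\<lambda>q. snd (\<sigma>' q)) p a - dir_deriv fun_scale (\<lambda>q. snd (\<sigma> q)) p a'
          + coad (brk G) (incl R z) \<xi>' - coad (brk G) (incl R z') \<xi>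
          + (\<lambda>x. \<xi> (cobr G x \<xi>'))
          + coad (brk G) (l p \<xi>) \<xi>' - coad (brk G) (l p \<xi>') \<xi>))"

definition ker_anchor ::
  "('k::real_or_complex, 'g::real_normed_vector) quasi_bialg \<Rightarrow>
   ('k, 'g, 'l::real_normed_vector) decomposition \<Rightarrow> ('l \<Rightarrow> 'k) \<Rightarrow> ('l \<times> ('g \<Rightarrow> 'k)) set" where
  "ker_anchor G R p = {u \<in> N_fibre G. N_anchor R p u = 0}"

text \<open>
  The bracket induced on the kernel of the anchor at \<open>p\<close>: the value at \<open>p\<close> of the bracket of
  arbitrary smooth sections extending the two elements.
\<close>

definition ker_bracket ::
  "('k::real_or_complex, 'g::real_normed_vector) quasi_bialg \<Rightarrow>
   ('k, 'g, 'l::real_normed_vector) decomposition \<Rightarrow> (('l \<Rightarrow> 'k) \<Rightarrow> ('g \<Rightarrow> 'k) \<Rightarrow> 'g) \<Rightarrow>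
   ('l \<Rightarrow> 'k) set \<Rightarrow> ('l \<Rightarrow> 'k) \<Rightarrow>
   'l \<times> ('g \<Rightarrow> 'k) \<Rightarrow> 'l \<times> ('g \<Rightarrow> 'k) \<Rightarrow> 'l \<times> ('g \<Rightarrow> 'k)" where
  "ker_bracket G R l U p u v =
     (THE w. \<forall>\<sigma> \<sigma>'.
        smooth_section (sum_scale (lscl R)) (dual (lscl R)) U (\<lambda>_. N_fibre G) \<sigma> \<and>
        smooth_section (sum_scale (lscl R)) (dual (lscl R)) U (\<lambda>_. N_fibre G) \<sigma>' \<and>
        \<sigma> p = u \<and> \<sigma>' p = v \<longrightarrow> N_bracket G R l \<sigma> \<sigma>' p = w)"

text \<open>
  \<open>\<psi>(p, X) = (p, - \<phi>\<^sub>p\<^sup>-\<^sup>1 X)\<close>; the elements \<open>z + \<xi>\<close> of \<^term>\<open>g_star G R p\<close> are read as pairs in \<open>l \<oplus> g\<^sup>*\<close>.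
\<close>

definition psi_map ::
  "('k::real_or_complex, 'g::real_normed_vector) quasi_bialg \<Rightarrow>
   ('k, 'g, 'l::real_normed_vector) decomposition \<Rightarrow> ('l \<Rightarrow> 'k) \<Rightarrow>
   'g \<times> ('g \<Rightarrow> 'k) \<Rightarrow> 'l \<times> ('g \<Rightarrow> 'k)" where
  "psi_map G R p X =
     (let Y = - inv_into (g_star G R p) (phi_map G R p) X in (inv (incl R) (fst Y), snd Y))"

end

theory Submission
  imports Defs "HOL-Complex_Analysis.Complex_Analysis" "Jordan_Normal_Form.Char_Poly"
begin

text \<open>
  \<open>Ad\<close> is an automorphism of the double and \<open>\<tau>\<close> intertwines the brackets, so for \<open>\<phi>\<^sub>p\<close> only the image
  matters. Put \<open>A = ad\<^sub>p\<close> on \<open>l \<oplus> l\<^sup>*\<close> and \<open>S = sinh(A) / A\<close>, which is invertible exactly when the spectrum of \<open>A\<close>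
  avoids \<open>i \<pi> (Z - {0})\<close>; Hermite interpolation gives \<open>F(A) S = (cosh(A) - S) / A\<close>. If \<open>z = S w\<close>, then
  \<open>z + F(A) A z + A z = e\<^sup>A w\<close>, so \<open>\<phi>\<^sub>p\<close> sends \<open>z + s(ad\<^sup>*\<^sub>z p)\<close> to \<open>w\<close>. On the annihilator of \<open>l\<close> the second term of
  \<open>l\<^sub>p\<close> is chosen so that \<open>\<phi>\<^sub>p\<close> has no component in \<open>g\<close>.

  The bracket on the kernel of the anchor contains the derivative of \<open>l\<close>. Since \<open>l \<oplus> l\<^sup>\<bottom>\<close> is isotropic for
  the invariant form of the double, \<open>\<langle>\<phi>\<^sub>p X, \<phi>\<^sub>q Y\<^sub>q\<rangle> = 0\<close> for \<open>X\<close> in the fibre at \<open>p\<close> and \<open>Y\<^sub>q\<close> in the fibre at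
  \<open>q\<close>. Differentiating in \<open>q\<close> at \<open>p\<close> expresses the derivative through the bracket of the twisted double, and the
  bracket on the kernel becomes minus that bracket.

  Smoothness follows because the functional calculus is a quotient of entire power series, whose
  derivatives are upper right blocks of the same series in a matrix of twice the size.
\<close>

section \<open>Directional derivatives\<close>

text \<open>The functional calculus picks some interpolating polynomial for each \<open>p\<close>,
  and nothing controls how the choice varies. So, apart from its linearity, \<open>F(A)\<close> is
  used only through the identity \<open>F(A) S = C\<close>, where \<open>S\<close> and
  \<open>C\<close> are entire series in \<open>A\<close> and \<open>S\<close> is invertible on
  \<open>U\<close>: parity, skewness, the values of \<phi> and smoothness are all read off from it.
  \<open>A\<close> exchanges \<open>l\<close> and its dual. Even series in \<open>A\<close> respect
  the two summands and odd ones exchange them; so \<open>S\<close> restricts to a bijection of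
  \<open>l\<close>, and \<open>F(A)\<close> sends the dual of \<open>l\<close> into
  \<open>l\<close>. The factor \<open>S\<close> reappears when the canonical matrix is
  differentiated. Varying \<open>p\<close> in the adjoint action gives a bracket with an element
  built from the series \<open>(e^z - 1) / z\<close>, whose even part is again \<open>S\<close>. As
  \<phi> divides the \<open>l\<close>-component by \<open>S\<close>, the two factors cancel. The
  doubles are subspaces of products with function types, where convergence is pointwise; hence all
  analysis is done on the coordinates in a fixed basis.\<close>

lemma at_zero_neq_bot: "at (0::'k::real_or_complex) \<noteq> bot"
  by simp

lemma sum_fun_apply: "(\<Sum>i\<in>A. f i) x = (\<Sum>i\<in>A. f i x)" for f :: "'i \<Rightarrow> 'v \<Rightarrow> 'a::comm_monoid_add"
  by (induction A rule: infinite_finite_induct) auto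

text \<open>A basic open set of the product topology restricts only finitely many arguments, so the
  pointwise conditions hold eventually all at once.\<close>

lemma tendsto_fun_iff:
  fixes f :: "'a \<Rightarrow> 'v \<Rightarrow> 'k::topological_space"
  shows "(f \<longlongrightarrow> g) F \<longleftrightarrow> (\<forall>x. ((\<lambda>a. f a x) \<longlongrightarrow> g x) F)"
proof
  assume "(f \<longlongrightarrow> g) F"
  then show "\<forall>x. ((\<lambda>a. f a x) \<longlongrightarrow> g x) F"
    using continuous_on_tendsto_compose[of UNIV "\<lambda>h. h _" f g F]
    by (simp add: continuous_on_product_coordinates)
next
  assume *: "\<forall>x. ((\<lambda>a. f a x) \<longlongrightarrow> g x) F"
  show "(f \<longlongrightarrow> g) F"
  proof (rule topological_tendstoI)
    fix S assume "open S" "g \<in> S"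
    then obtain X where X: "g \<in> Pi\<^sub>E UNIV X" "\<And>i. open (X i)" "finite {i. X i \<noteq> UNIV}" "Pi\<^sub>E UNIV X \<subseteq> S"
      using product_topology_open_contains_basis[of "\<lambda>_. euclidean" UNIV S g]
      unfolding open_fun_def by (auto simp: euclidean_product_topology)
    have "\<forall>\<^sub>F a in F. \<forall>i\<in>{i. X i \<noteq> UNIV}. f a i \<in> X i"
      using X(1,2) * by (intro eventually_ball_finite X(3)) (auto simp: tendsto_def)
    then show "\<forall>\<^sub>F a in F. f a \<in> S"
      by eventually_elim (use X(4) in \<open>fastforce simp: PiE_iff\<close>)
  qed
qed

text \<open>For scalar values the derivative along a direction is the ordinary derivative in the
  line parameter, a complex one over complex scalars; the usual rules of differentiation become
  available.\<close>

lemma diff_quot_scalar_iff: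
  "(diff_quot (*) f p \<alpha> \<longlongrightarrow> w) (at 0) \<longleftrightarrow>
     ((\<lambda>t. f (p + fun_scale t \<alpha>)) has_field_derivative w) (at 0)"
proof -
  have "p + fun_scale 0 \<alpha> = p"
    by (auto simp: fun_scale_def)
  moreover have "diff_quot (*) f p \<alpha> = (\<lambda>h. (f (p + fun_scale h \<alpha>) - f p) / h)"
    by (auto simp: diff_quot_def fun_eq_iff field_simps)
  ultimately show ?thesis
    by (simp add: DERIV_def)
qed

lemma dir_deriv_scalar_eqI:
  assumes "((\<lambda>t. f (p + fun_scale t \<alpha>)) has_field_derivative w) (at 0)"
  shows "dir_deriv (*) f p \<alpha> = w"
  unfolding dir_deriv_def diff_quot_scalar_iff
  using assms DERIV_unique by (intro the_equality) blast+

lemma dir_deriv_congI: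
  assumes "\<forall>\<^sub>F t in at 0. diff_quot sc f p \<alpha> t = diff_quot sc g p \<alpha> t"
  shows "(diff_quot sc f p \<alpha> \<longlongrightarrow> w) (at 0) \<longleftrightarrow> (diff_quot sc g p \<alpha> \<longlongrightarrow> w) (at 0)"
    and "dir_deriv sc f p \<alpha> = dir_deriv sc g p \<alpha>"
  using filterlim_cong[OF refl refl assms] by (auto simp: dir_deriv_def)

text \<open>\<open>D\<close> is the ambient parameter space and \<open>U\<close> the relatively open
  part on which sections live. A line through a point of \<open>U\<close> stays in \<open>D\<close>,
  hence in \<open>U\<close> for small parameters, so the limits of difference quotients see only
  values on \<open>U\<close>.\<close>

locale open_region =
  fixes D U :: "('v \<Rightarrow> 'k::real_or_complex) set"
  assumes line_D: "p \<in> D \<Longrightarrow> \<alpha> \<in> D \<Longrightarrow> p + fun_scale t \<alpha> \<in> D"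
    and openin_U: "openin (top_of_set D) U"
begin

lemma U_subset: "p \<in> U \<Longrightarrow> p \<in> D"
  using openin_U openin_imp_subset by blast

lemma line_tendsto: "((\<lambda>t. p + fun_scale t \<alpha>) \<longlongrightarrow> p) (at 0)"
  unfolding tendsto_fun_iff
proof
  fix x
  have "((\<lambda>t. p x + t * \<alpha> x) \<longlongrightarrow> p x + 0 * \<alpha> x) (at 0)"
    by (intro tendsto_intros)
  then show "((\<lambda>t. (p + fun_scale t \<alpha>) x) \<longlongrightarrow> p x) (at 0)"
    by (simp add: fun_scale_def)
qed

lemma line_in_U:
  assumes "p \<in> U" "\<alpha> \<in> D"
  shows "\<forall>\<^sub>F t in at 0. p + fun_scale t \<alpha> \<in> U"
proof -
  obtain T where T: "open T" "U = D \<inter> T"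
    using openin_U by (auto simp: openin_open)
  have "\<forall>\<^sub>F t in at 0. p + fun_scale t \<alpha> \<in> T"
    using line_tendsto[of p \<alpha>] T assms by (auto simp: tendsto_def)
  then show ?thesis
    using T assms line_D by (auto elim: eventually_mono)
qed

lemma diff_quot_cong_on:
  assumes "\<And>q. q \<in> U \<Longrightarrow> f q = g q" "p \<in> U" "\<alpha> \<in> D"
  shows "\<forall>\<^sub>F t in at 0. diff_quot sc f p \<alpha> t = diff_quot sc g p \<alpha> t"
  using line_in_U[OF assms(2,3)] by eventually_elim (simp add: diff_quot_def assms)

lemma dir_deriv_cong_on:
  assumes "\<And>q. q \<in> U \<Longrightarrow> f q = g q" "p \<in> U" "\<alpha> \<in> D"
  shows "dir_deriv sc f p \<alpha> = dir_deriv sc g p \<alpha>"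
  by (rule dir_deriv_congI(2)[OF diff_quot_cong_on]) (use assms in auto)

lemma Ck_cong:
  assumes "\<And>q. q \<in> U \<Longrightarrow> f q = g q"
  shows "Ck_on n sc D U f \<longleftrightarrow> Ck_on n sc D U g"
  using assms
proof (induction n arbitrary: f g)
  case 0
  then show ?case by (simp cong: continuous_on_cong)
next
  case (Suc n)
  have *: "dir_deriv sc f p \<alpha> = dir_deriv sc g p \<alpha>" if "p \<in> U" "\<alpha> \<in> D" for p \<alpha>
    using dir_deriv_cong_on Suc.prems that by blast
  have "Ck_on n sc D U (\<lambda>p. dir_deriv sc f p \<alpha>) = Ck_on n sc D U (\<lambda>p. dir_deriv sc g p \<alpha>)"
    if "\<alpha> \<in> D" for \<alpha>
    by (rule Suc.IH) (use * that in auto)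
  moreover have "(diff_quot sc f p \<alpha> \<longlongrightarrow> w) (at 0) \<longleftrightarrow> (diff_quot sc g p \<alpha> \<longlongrightarrow> w) (at 0)"
    if "p \<in> U" "\<alpha> \<in> D" for p \<alpha> w
    using dir_deriv_congI(1)[OF diff_quot_cong_on] Suc.prems that by blast
  moreover have "continuous_on U f = continuous_on U g"
    using Suc.prems by (intro continuous_on_cong) auto
  ultimately show ?case
    using * by auto
qed

lemma Ck_mono: "Ck_on (Suc n) sc D U f \<Longrightarrow> Ck_on n sc D U f"
proof (induction n arbitrary: f)
  case (Suc n)
  then show ?case by (metis Ck_on.simps(2))
qed auto

text \<open>Replaces the definite description inside \<open>dir_deriv\<close> by an explicitly known
  derivative \<open>f'\<close>; the basic closure properties are inductions that supply such an
  \<open>f'\<close>.\<close>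

lemma Ck_SucI:
  assumes "continuous_on U f"
    and "\<And>p \<alpha>. p \<in> U \<Longrightarrow> \<alpha> \<in> D \<Longrightarrow> ((\<lambda>t. f (p + fun_scale t \<alpha>)) has_field_derivative f' \<alpha> p) (at 0)"
    and "\<And>\<alpha>. \<alpha> \<in> D \<Longrightarrow> Ck_on n (*) D U (f' \<alpha>)"
  shows "Ck_on (Suc n) (*) D U f"
proof -
  have *: "dir_deriv (*) f p \<alpha> = f' \<alpha> p" if "p \<in> U" "\<alpha> \<in> D" for p \<alpha>
    using assms(2)[OF that] by (rule dir_deriv_scalar_eqI)
  show ?thesis
    using assms * Ck_cong[of "\<lambda>p. dir_deriv (*) f p _" "f' _" n "(*)"]
    by (auto simp: diff_quot_scalar_iff)
qed

lemma Ck_SucD: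
  assumes "Ck_on (Suc n) (*) D U f" "\<alpha> \<in> D"
  shows "p \<in> U \<Longrightarrow> ((\<lambda>t. f (p + fun_scale t \<alpha>)) has_field_derivative dir_deriv (*) f p \<alpha>) (at 0)"
    and "Ck_on n (*) D U (\<lambda>p. dir_deriv (*) f p \<alpha>)"
  using assms by (auto simp: diff_quot_scalar_iff)

section \<open>Closure of the smoothness classes under algebraic operations\<close>

lemma Ck_const: "Ck_on n (*) D U (\<lambda>_. a)"
proof (induction n arbitrary: a)
  case (Suc n)
  show ?case by (rule Ck_SucI[where f' = "\<lambda>_ _. 0"]) (use Suc in auto)
qed simp

lemma line_0 [simp]: "p + fun_scale 0 \<alpha> = p"
  by (auto simp: fun_scale_def)

lemma Ck_add: "Ck_on n (*) D U f \<Longrightarrow> Ck_on n (*) D U g \<Longrightarrow> Ck_on n (*) D U (\<lambda>p. f p + g p)"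
proof (induction n arbitrary: f g)
  case 0
  then show ?case by (auto intro: continuous_intros)
next
  case (Suc n)
  show ?case
  proof (rule Ck_SucI)
    show "continuous_on U (\<lambda>p. f p + g p)"
      using Suc.prems by (intro continuous_intros) auto
    show "Ck_on n (*) D U (\<lambda>p. dir_deriv (*) f p \<alpha> + dir_deriv (*) g p \<alpha>)" if "\<alpha> \<in> D" for \<alpha>
      using Suc.IH Ck_SucD(2) Suc.prems that by blast
  qed (use Ck_SucD(1)[OF Suc.prems(1)] Ck_SucD(1)[OF Suc.prems(2)] in \<open>auto intro!: DERIV_add\<close>)
qed

lemma Ck_mult: "Ck_on n (*) D U f \<Longrightarrow> Ck_on n (*) D U g \<Longrightarrow> Ck_on n (*) D U (\<lambda>p. f p * g p)"
proof (induction n arbitrary: f g)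
  case 0
  then show ?case by (auto intro: continuous_intros)
next
  case (Suc n)
  show ?case
  proof (rule Ck_SucI)
    show "continuous_on U (\<lambda>p. f p * g p)"
      using Suc.prems by (intro continuous_intros) auto
    show "Ck_on n (*) D U (\<lambda>p. f p * dir_deriv (*) g p \<alpha> + dir_deriv (*) f p \<alpha> * g p)" if "\<alpha> \<in> D" for \<alpha>
      using Suc.IH Ck_SucD(2) Suc.prems Ck_mono that by (intro Ck_add Suc.IH) blast+
    show "((\<lambda>t. f (p + fun_scale t \<alpha>) * g (p + fun_scale t \<alpha>)) has_field_derivative
        f p * dir_deriv (*) g p \<alpha> + dir_deriv (*) f p \<alpha> * g p) (at 0)" if "p \<in> U" "\<alpha> \<in> D" for p \<alpha>
      using DERIV_mult'[OF Ck_SucD(1)[OF Suc.prems(1) that(2,1)] Ck_SucD(1)[OF Suc.prems(2) that(2,1)]]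
      by (simp only: line_0)
  qed
qed

lemma Ck_sum: "(\<And>i. i \<in> A \<Longrightarrow> Ck_on n (*) D U (f i)) \<Longrightarrow> Ck_on n (*) D U (\<lambda>p. \<Sum>i\<in>A. f i p)"
  by (induction A rule: infinite_finite_induct) (auto intro: Ck_const Ck_add)

lemma Ck_prod: "(\<And>i. i \<in> A \<Longrightarrow> Ck_on n (*) D U (f i)) \<Longrightarrow> Ck_on n (*) D U (\<lambda>p. \<Prod>i\<in>A. f i p)"
  by (induction A rule: infinite_finite_induct) (auto intro: Ck_const Ck_mult)

lemma Ck_uminus: "Ck_on n (*) D U f \<Longrightarrow> Ck_on n (*) D U (\<lambda>p. - f p)"
  using Ck_mult[OF Ck_const[of n "-1"]] by simp

lemma Ck_diff: "Ck_on n (*) D U f \<Longrightarrow> Ck_on n (*) D U g \<Longrightarrow> Ck_on n (*) D U (\<lambda>p. f p - g p)"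
  using Ck_add[OF _ Ck_uminus] by fastforce

lemma Ck_inverse:
  assumes "\<And>p. p \<in> U \<Longrightarrow> f p \<noteq> 0"
  shows "Ck_on n (*) D U f \<Longrightarrow> Ck_on n (*) D U (\<lambda>p. inverse (f p))"
proof (induction n)
  case 0
  then show ?case using assms by (auto intro: continuous_intros)
next
  case (Suc n)
  show ?case
  proof (rule Ck_SucI)
    show "continuous_on U (\<lambda>p. inverse (f p))"
      using Suc.prems assms by (intro continuous_intros) auto
    \<comment> \<open>The derivative is written as a product in \<open>inverse (f p)\<close> itself,
      so that the induction hypothesis applies to it.\<close>
    show "Ck_on n (*) D U (\<lambda>p. - (inverse (f p) * dir_deriv (*) f p \<alpha> * inverse (f p)))" if "\<alpha> \<in> D" for \<alpha>
      using Suc Ck_SucD(2) Ck_mono that by (intro Ck_uminus Ck_mult Suc.IH) blast+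
    show "((\<lambda>t. inverse (f (p + fun_scale t \<alpha>))) has_field_derivative
        - (inverse (f p) * dir_deriv (*) f p \<alpha> * inverse (f p))) (at 0)" if "p \<in> U" "\<alpha> \<in> D" for p \<alpha>
    proof -
      have "f (p + fun_scale 0 \<alpha>) \<noteq> 0"
        using assms[OF that(1)] by (simp only: line_0 not_False_eq_True)
      from DERIV_inverse'[OF Ck_SucD(1)[OF Suc.prems that(2,1)] this] show ?thesis
        by (simp only: line_0)
    qed
  qed
qed

end

section \<open>Finite-dimensional spaces in coordinates\<close>

lemma linear_betweenD:
  assumes "linear_between sc V sc' W f"
  shows "x \<in> V \<Longrightarrow> f x \<in> W"
    and "x \<in> V \<Longrightarrow> y \<in> V \<Longrightarrow> f (x + y) = f x + f y"
    and "x \<in> V \<Longrightarrow> f (sc a x) = sc' a (f x)"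
  using assms by (auto simp: linear_between_def)

lemma linear_between_sum:
  assumes "linear_between sc V sc' W f" "module.subspace sc V" "vector_space sc" "vector_space sc'"
    and "\<And>i. i \<in> A \<Longrightarrow> x i \<in> V"
  shows "f (\<Sum>i\<in>A. sc (a i) (x i)) = (\<Sum>i\<in>A. sc' (a i) (f (x i)))"
proof -
  interpret vector_space sc by fact
  interpret W: vector_space sc' by fact
  note f = linear_betweenD[OF assms(1)]
  have V: "x \<in> V \<Longrightarrow> y \<in> V \<Longrightarrow> x + y \<in> V" "x \<in> V \<Longrightarrow> sc b x \<in> V" "0 \<in> V" for x y b
    using assms(2) by (auto simp: subspace_def)
  have f0: "f 0 = 0"
    using f(3)[OF V(3), of 0] by simp
  show ?thesis
    using assms(5)
  proof (induction A rule: infinite_finite_induct)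
    case (insert i A)
    have "(\<Sum>i\<in>A. sc (a i) (x i)) \<in> V"
      using insert.prems assms(2) by (intro subspace_sum) (auto intro: V)
    then show ?case
      using insert by (simp add: f V)
  qed (auto simp: f0)
qed

section \<open>Coefficient sequences of entire functions\<close>

definition entire_coeffs :: "(nat \<Rightarrow> 'k::real_normed_field) \<Rightarrow> bool" where
  "entire_coeffs a \<longleftrightarrow> (\<forall>R\<ge>0. summable (\<lambda>k. norm (a k) * R ^ k))"

lemma entire_coeffs_bound:
  assumes "entire_coeffs a" "\<And>k. norm (x k) \<le> C * R ^ k" "R \<ge> 0"
  shows "summable (\<lambda>k. norm (a k * x k))"
proof (rule summable_comparison_test')
  show "summable (\<lambda>k. C * (norm (a k) * R ^ k))"
    using assms by (intro summable_mult) (auto simp: entire_coeffs_def)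
  show "norm (norm (a k * x k)) \<le> C * (norm (a k) * R ^ k)" if "k \<ge> 0" for k
    using mult_left_mono[OF assms(2)[of k], of "norm (a k)"] by (simp add: norm_mult mult_ac)
qed

lemma entire_coeffs_if_fact:
  fixes a :: "nat \<Rightarrow> 'k::real_normed_field"
  assumes "\<And>k. norm (a k) \<le> C / fact k"
  shows "entire_coeffs a"
  unfolding entire_coeffs_def
proof (intro allI impI)
  fix R :: real assume R: "R \<ge> 0"
  show "summable (\<lambda>k. norm (a k) * R ^ k)"
  proof (rule summable_comparison_test')
    show "summable (\<lambda>k. C * (inverse (fact k) * R ^ k))"
      by (intro summable_mult summable_exp)
    show "norm (norm (a k) * R ^ k) \<le> C * (inverse (fact k) * R ^ k)" if "k \<ge> 0" for k
      using mult_right_mono[OF assms[of k], of "R ^ k"] R by (simp add: field_simps)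
  qed
qed

lemma entire_coeffs_add:
  assumes "entire_coeffs a" "entire_coeffs b"
  shows "entire_coeffs (\<lambda>k. a k + b k)"
  unfolding entire_coeffs_def
proof (intro allI impI)
  fix R :: real assume R: "R \<ge> 0"
  show "summable (\<lambda>k. norm (a k + b k) * R ^ k)"
  proof (rule summable_comparison_test')
    show "summable (\<lambda>k. norm (a k) * R ^ k + norm (b k) * R ^ k)"
      using assms R by (intro summable_add) (auto simp: entire_coeffs_def)
    show "norm (norm (a k + b k) * R ^ k) \<le> norm (a k) * R ^ k + norm (b k) * R ^ k" if "k \<ge> 0" for k
      using mult_right_mono[OF norm_triangle_ineq[of "a k" "b k"], of "R ^ k"] R
      by (simp add: algebra_simps)
  qed
qed

lemma entire_coeffs_sign: "entire_coeffs a \<Longrightarrow> entire_coeffs (\<lambda>k. (- 1) ^ k * a k)"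
  by (simp add: entire_coeffs_def norm_mult norm_power)

definition exp_coeff :: "nat \<Rightarrow> 'k::real_normed_field" where
  "exp_coeff k = inverse (fact k)"

lemma entire_exp_coeff: "entire_coeffs exp_coeff"
  by (rule entire_coeffs_if_fact[of _ 1]) (simp add: exp_coeff_def norm_inverse norm_fact divide_inverse)

text \<open>\<open>dpow T E k\<close> is the coefficient of \<open>t\<close> in \<open>(T + t E)\<^sup>k\<close>.\<close>

primrec dpow :: "('w::ab_group_add \<Rightarrow> 'w) \<Rightarrow> ('w \<Rightarrow> 'w) \<Rightarrow> nat \<Rightarrow> 'w \<Rightarrow> 'w" where
  "dpow T E 0 v = 0"
| "dpow T E (Suc k) v = T (dpow T E k v) + E ((T ^^ k) v)"

text \<open>A finite-dimensional subspace \<open>V\<close> with basis \<open>e\<close> and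
  coordinates \<open>c\<close>, inside a type that has a topology but perhaps no norm. The
  topological assumptions make coordinatewise convergence the same as convergence in
  \<open>V\<close>; closedness keeps limits in \<open>V\<close>, and separation makes them
  unique.\<close>

locale coord_space = vector_space sc
  for sc :: "'k::real_or_complex \<Rightarrow> 'w::{ab_group_add,topological_space} \<Rightarrow> 'w" +
  fixes V :: "'w set" and n :: nat and e :: "nat \<Rightarrow> 'w" and c :: "nat \<Rightarrow> 'w \<Rightarrow> 'k"
  assumes subspace_V: "subspace V"
    and e_in: "i < n \<Longrightarrow> e i \<in> V"
    and c_add: "i < n \<Longrightarrow> x \<in> V \<Longrightarrow> y \<in> V \<Longrightarrow> c i (x + y) = c i x + c i y"
    and c_scale: "i < n \<Longrightarrow> x \<in> V \<Longrightarrow> c i (sc a x) = a * c i x"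
    and expand: "x \<in> V \<Longrightarrow> (\<Sum>i<n. sc (c i x) (e i)) = x"
    and c_e: "i < n \<Longrightarrow> j < n \<Longrightarrow> c i (e j) = (if i = j then 1 else 0)"
    and sum_continuous: "continuous_on UNIV (\<lambda>a. \<Sum>i<n. sc (a i) (e i))"
    and c_cont: "i < n \<Longrightarrow> continuous_on V (c i)"
    and closed_V: "closed V"
    and separated: "w \<noteq> (w' :: 'w) \<Longrightarrow> \<exists>A B. open A \<and> open B \<and> w \<in> A \<and> w' \<in> B \<and> A \<inter> B = {}"
begin

lemma lim_unique:
  fixes w w' :: 'w
  assumes "F \<noteq> bot" "(f \<longlongrightarrow> w) F" "(f \<longlongrightarrow> w') F"
  shows "w = w'"
proof (rule ccontr)
  assume "w \<noteq> w'"
  from separated[OF this] obtain A B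
    where AB: "open A" "open B" "w \<in> A" "w' \<in> B" "A \<inter> B = {}"
    by (elim exE conjE)
  have "\<forall>\<^sub>F x in F. f x \<in> A \<and> f x \<in> B"
    by (intro eventually_conj topological_tendstoD[OF assms(2)] topological_tendstoD[OF assms(3)] AB)
  then have "\<forall>\<^sub>F x in F. False"
    by eventually_elim (use AB in auto)
  then show False
    using assms(1) by simp
qed

definition combine :: "(nat \<Rightarrow> 'k) \<Rightarrow> 'w" where
  "combine a = (\<Sum>i<n. sc (a i) (e i))"

abbreviation lin :: "('w \<Rightarrow> 'w) \<Rightarrow> bool" where
  "lin T \<equiv> linear_between sc V sc V T"

abbreviation functional :: "('w \<Rightarrow> 'k) \<Rightarrow> bool" where
  "functional f \<equiv> linear_between sc V (*) UNIV f"

lemma V_simps [simp, intro]: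
  "0 \<in> V" "x \<in> V \<Longrightarrow> y \<in> V \<Longrightarrow> x + y \<in> V" "x \<in> V \<Longrightarrow> sc a x \<in> V"
  "x \<in> V \<Longrightarrow> y \<in> V \<Longrightarrow> x - y \<in> V" "x \<in> V \<Longrightarrow> - x \<in> V"
  using subspace_V by (auto simp: subspace_0 subspace_add subspace_scale subspace_diff subspace_neg)

lemma combine_in [simp, intro]: "combine a \<in> V"
  unfolding combine_def by (intro subspace_sum subspace_V V_simps e_in) auto

lemma functional_c: "i < n \<Longrightarrow> functional (c i)"
  by (auto simp: linear_between_def c_add c_scale)

lemma vs_mult: "vector_space ((*) :: 'k \<Rightarrow> _)"
  by standard (auto simp: algebra_simps)

lemma functional_sum:
  "functional f \<Longrightarrow> (\<And>i. i \<in> A \<Longrightarrow> x i \<in> V) \<Longrightarrow> f (\<Sum>i\<in>A. sc (a i) (x i)) = (\<Sum>i\<in>A. a i * f (x i))"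
  by (rule linear_between_sum[OF _ subspace_V vector_space_axioms vs_mult])

lemma functional_combine: "functional f \<Longrightarrow> f (combine a) = (\<Sum>i<n. a i * f (e i))"
  unfolding combine_def by (rule functional_sum) (auto simp: e_in)

lemma c_combine [simp]: "i < n \<Longrightarrow> c i (combine a) = a i"
  by (simp add: functional_combine[OF functional_c] c_e mult_delta_right)

lemma combine_c [simp]: "x \<in> V \<Longrightarrow> combine (\<lambda>i. c i x) = x"
  by (simp add: combine_def expand)

lemma combine_cong: "(\<And>i. i < n \<Longrightarrow> a i = b i) \<Longrightarrow> combine a = combine b"
  by (simp add: combine_def)

lemma coord_eqI: "x \<in> V \<Longrightarrow> y \<in> V \<Longrightarrow> (\<And>i. i < n \<Longrightarrow> c i x = c i y) \<Longrightarrow> x = y"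
  using combine_cong[of "\<lambda>i. c i x" "\<lambda>i. c i y"] by simp

lemma functional_expand: "functional f \<Longrightarrow> x \<in> V \<Longrightarrow> f x = (\<Sum>i<n. c i x * f (e i))"
  using functional_combine[of f "\<lambda>i. c i x"] by simp

lemma functional_D:
  assumes "functional f"
  shows "x \<in> V \<Longrightarrow> y \<in> V \<Longrightarrow> f (x + y) = f x + f y" "x \<in> V \<Longrightarrow> f (sc a x) = a * f x"
    "f 0 = 0" "x \<in> V \<Longrightarrow> f (- x) = - f x" "x \<in> V \<Longrightarrow> y \<in> V \<Longrightarrow> f (x - y) = f x - f y"
proof -
  note f = linear_betweenD[OF assms]
  show *: "x \<in> V \<Longrightarrow> y \<in> V \<Longrightarrow> f (x + y) = f x + f y" "x \<in> V \<Longrightarrow> f (sc a x) = a * f x" for x y a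
    by (auto simp: f)
  show "f 0 = 0"
    using *(2)[of 0 0] by simp
  show **: "x \<in> V \<Longrightarrow> f (- x) = - f x" for x
    using *(2)[of x "-1"] by simp
  show "x \<in> V \<Longrightarrow> y \<in> V \<Longrightarrow> f (x - y) = f x - f y"
    using *(1)[of x "-y"] **[of y] by simp
qed

lemmas c_simps [simp] = functional_D[OF functional_c]

lemma lin_D:
  assumes "lin T"
  shows "x \<in> V \<Longrightarrow> T x \<in> V" "x \<in> V \<Longrightarrow> y \<in> V \<Longrightarrow> T (x + y) = T x + T y"
    "x \<in> V \<Longrightarrow> T (sc a x) = sc a (T x)" "T 0 = 0" "x \<in> V \<Longrightarrow> T (- x) = - T x"
    "x \<in> V \<Longrightarrow> y \<in> V \<Longrightarrow> T (x - y) = T x - T y"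
proof -
  note f = linear_betweenD[OF assms]
  show "x \<in> V \<Longrightarrow> T x \<in> V" for x by (rule f)
  show *: "x \<in> V \<Longrightarrow> y \<in> V \<Longrightarrow> T (x + y) = T x + T y" "x \<in> V \<Longrightarrow> T (sc a x) = sc a (T x)" for x y a
    by (auto simp: f)
  show "T 0 = 0"
    using *(2)[of 0 0] by simp
  show **: "x \<in> V \<Longrightarrow> T (- x) = - T x" for x
    using *(2)[of x "-1"] by simp
  show "x \<in> V \<Longrightarrow> y \<in> V \<Longrightarrow> T (x - y) = T x - T y"
    using *(1)[of x "-y"] **[of y] by simp
qed

lemma lin_pow: "lin T \<Longrightarrow> lin (T ^^ k)"
  by (induction k) (auto simp: linear_between_def)

lemma lin_pow_in [simp]: "lin T \<Longrightarrow> x \<in> V \<Longrightarrow> (T ^^ k) x \<in> V"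
  by (rule lin_D(1)[OF lin_pow])

lemma functional_comp: "functional f \<Longrightarrow> lin T \<Longrightarrow> functional (\<lambda>x. f (T x))"
  by (auto simp: linear_between_def)

lemma lin_sum: "lin T \<Longrightarrow> (\<And>i. i \<in> A \<Longrightarrow> x i \<in> V) \<Longrightarrow> T (\<Sum>i\<in>A. sc (a i) (x i)) = (\<Sum>i\<in>A. sc (a i) (T (x i)))"
  by (rule linear_between_sum[OF _ subspace_V vector_space_axioms vector_space_axioms])

lemma lin_if_coords:
  assumes "\<And>x. x \<in> V \<Longrightarrow> T x \<in> V" "\<And>i. i < n \<Longrightarrow> functional (\<lambda>x. c i (T x))"
  shows "lin T"
  unfolding linear_between_def
  using assms by (auto intro!: coord_eqI simp: functional_D[OF assms(2)])

lemma tendsto_combine: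
  assumes "\<And>i. i < n \<Longrightarrow> ((\<lambda>x. a x i) \<longlongrightarrow> b i) F"
  shows "((\<lambda>x. combine (a x)) \<longlongrightarrow> combine b) F"
proof -
  \<comment> \<open>Indices from \<open>n\<close> on are set to 0, because convergence in the
    function space concerns all of them while the hypothesis controls only those below
    \<open>n\<close>.\<close>
  let ?r = "\<lambda>a i. if i < n then a i else (0::'k)"
  have "((\<lambda>x. ?r (a x)) \<longlongrightarrow> ?r b) F"
    unfolding tendsto_fun_iff using assms by auto
  from continuous_on_tendsto_compose[OF sum_continuous this]
  have "((\<lambda>x. combine (?r (a x))) \<longlongrightarrow> combine (?r b)) F"
    by (simp add: combine_def)
  moreover have "combine (?r d) = combine d" for d
    by (rule combine_cong) simp
  ultimately show ?thesis
    by simp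
qed

lemma tendsto_coords_iff:
  assumes "\<forall>\<^sub>F x in F. f x \<in> V" "w \<in> V"
  shows "(f \<longlongrightarrow> w) F \<longleftrightarrow> (\<forall>i<n. ((\<lambda>x. c i (f x)) \<longlongrightarrow> c i w) F)"
proof
  assume "(f \<longlongrightarrow> w) F"
  then show "\<forall>i<n. ((\<lambda>x. c i (f x)) \<longlongrightarrow> c i w) F"
    using continuous_on_tendsto_compose[OF c_cont _ assms(2,1)] by auto
next
  assume "\<forall>i<n. ((\<lambda>x. c i (f x)) \<longlongrightarrow> c i w) F"
  then have "((\<lambda>x. combine (\<lambda>i. c i (f x))) \<longlongrightarrow> combine (\<lambda>i. c i w)) F"
    by (intro tendsto_combine) auto
  moreover have "\<forall>\<^sub>F x in F. combine (\<lambda>i. c i (f x)) = f x"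
    using assms(1) by eventually_elim simp
  ultimately show "(f \<longlongrightarrow> w) F"
    using assms(2) by (auto dest: Lim_transform_eventually)
qed

lemma sums_coords_iff:
  assumes "\<And>k. f k \<in> V" "w \<in> V"
  shows "f sums w \<longleftrightarrow> (\<forall>i<n. (\<lambda>k. c i (f k)) sums c i w)"
proof -
  have *: "(\<Sum>k<m. f k) \<in> V" for m
    using assms subspace_V by (intro subspace_sum) auto
  have "c i (\<Sum>k<m. f k) = (\<Sum>k<m. c i (f k))" if "i < n" for i m
    using functional_sum[OF functional_c[OF that], of "{..<m}" f "\<lambda>_. 1"] assms(1) by simp
  then show ?thesis
    unfolding sums_def using * assms by (subst tendsto_coords_iff) auto
qed

lemma continuous_on_coords_iff:
  assumes "\<And>x. x \<in> S \<Longrightarrow> f x \<in> V"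
  shows "continuous_on S f \<longleftrightarrow> (\<forall>i<n. continuous_on S (\<lambda>x. c i (f x)))"
proof -
  have "\<forall>\<^sub>F y in at x within S. f y \<in> V" for x
    using assms by (auto simp: eventually_at_topological)
  then have "(f \<longlongrightarrow> f x) (at x within S) \<longleftrightarrow> (\<forall>i<n. ((\<lambda>y. c i (f y)) \<longlongrightarrow> c i (f x)) (at x within S))"
    if "x \<in> S" for x
    using tendsto_coords_iff assms that by blast
  then show ?thesis
    unfolding continuous_on_def by auto
qed

section \<open>Derivatives and smoothness read off from coordinates\<close>

lemma diff_quot_coord:
  assumes "f (p + fun_scale t \<alpha>) \<in> V" "f p \<in> V" "i < n"
  shows "c i (diff_quot sc f p \<alpha> t) = diff_quot (*) (\<lambda>q. c i (f q)) p \<alpha> t"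
  using assms by (simp add: diff_quot_def)

lemma dir_deriv_coords:
  assumes "open_region D U" "\<And>q. q \<in> U \<Longrightarrow> f q \<in> V" "p \<in> U" "\<alpha> \<in> D"
    and "\<And>i. i < n \<Longrightarrow> (diff_quot (*) (\<lambda>q. c i (f q)) p \<alpha> \<longlongrightarrow> w i) (at 0)"
  shows "(diff_quot sc f p \<alpha> \<longlongrightarrow> combine w) (at 0)" "dir_deriv sc f p \<alpha> = combine w"
proof -
  interpret open_region D U by fact
  have ev: "\<forall>\<^sub>F t in at 0. f (p + fun_scale t \<alpha>) \<in> V"
    using line_in_U[OF assms(3,4)] by eventually_elim (rule assms(2))
  have V: "\<forall>\<^sub>F t in at 0. diff_quot sc f p \<alpha> t \<in> V"
    using ev by eventually_elim (use assms in \<open>auto simp: diff_quot_def\<close>)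
  have "((\<lambda>t. c i (diff_quot sc f p \<alpha> t)) \<longlongrightarrow> w i) (at 0)" if "i < n" for i
    by (rule Lim_transform_eventually[OF assms(5)[OF that]])
      (use ev in eventually_elim, use assms that in \<open>simp add: diff_quot_coord\<close>)
  then show *: "(diff_quot sc f p \<alpha> \<longlongrightarrow> combine w) (at 0)"
    using tendsto_coords_iff[OF V combine_in] by simp
  show "dir_deriv sc f p \<alpha> = combine w"
    unfolding dir_deriv_def using * lim_unique[OF at_zero_neq_bot] by (intro the_equality) blast+
qed

lemma Ck_coordsI:
  assumes "open_region D U" "\<And>q. q \<in> U \<Longrightarrow> f q \<in> V"
    and "\<And>i. i < n \<Longrightarrow> Ck_on m (*) D U (\<lambda>q. c i (f q))"
  shows "Ck_on m sc D U f"
  using assms(2,3)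
proof (induction m arbitrary: f)
  case 0
  then show ?case using continuous_on_coords_iff[of U f] by auto
next
  case (Suc m)
  interpret open_region D U by fact
  let ?w = "\<lambda>\<alpha> p i. dir_deriv (*) (\<lambda>q. c i (f q)) p \<alpha>"
  have d: "(diff_quot sc f p \<alpha> \<longlongrightarrow> combine (?w \<alpha> p)) (at 0)" "dir_deriv sc f p \<alpha> = combine (?w \<alpha> p)"
    if "p \<in> U" "\<alpha> \<in> D" for p \<alpha>
    using dir_deriv_coords[OF assms(1) Suc.prems(1) that, where w = "?w \<alpha> p"] Suc.prems(2) that by auto
  have "Ck_on m sc D U (\<lambda>p. dir_deriv sc f p \<alpha>)" if "\<alpha> \<in> D" for \<alpha>
  proof -
    have "Ck_on m sc D U (\<lambda>p. combine (?w \<alpha> p))"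
      by (rule Suc.IH) (use Suc.prems(2) that in auto)
    then show ?thesis
      using Ck_cong[of "\<lambda>p. dir_deriv sc f p \<alpha>" "\<lambda>p. combine (?w \<alpha> p)"] d that by auto
  qed
  then show ?case
    using Suc.prems d continuous_on_coords_iff[of U f] by auto
qed

lemma Ck_coordsD:
  assumes "open_region D U" "\<And>q. q \<in> U \<Longrightarrow> f q \<in> V" "Ck_on m sc D U f" "i < n"
  shows "Ck_on m (*) D U (\<lambda>q. c i (f q))"
  using assms(2,3)
proof (induction m arbitrary: f)
  case 0
  then show ?case using continuous_on_coords_iff[of U f] assms(4) by auto
next
  case (Suc m)
  interpret open_region D U by fact
  have V: "\<forall>\<^sub>F t in at 0. diff_quot sc f p \<alpha> t \<in> V" if "p \<in> U" "\<alpha> \<in> D" for p \<alpha>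
    using line_in_U[OF that] by eventually_elim (use Suc.prems(1) that in \<open>auto simp: diff_quot_def\<close>)
  \<comment> \<open>A limit of difference quotients in \<open>V\<close> stays in \<open>V\<close>
    because \<open>V\<close> is closed; only then do the coordinates describe the
    derivative.\<close>
  have inV: "dir_deriv sc f p \<alpha> \<in> V" if "p \<in> U" "\<alpha> \<in> D" for p \<alpha>
  proof (rule Lim_in_closed_set[OF closed_V V[OF that] at_zero_neq_bot])
    show "(diff_quot sc f p \<alpha> \<longlongrightarrow> dir_deriv sc f p \<alpha>) (at 0)"
      using Suc.prems(2) that by auto
  qed
  have d: "(diff_quot (*) (\<lambda>q. c i (f q)) p \<alpha> \<longlongrightarrow> c i (dir_deriv sc f p \<alpha>)) (at 0)"
    if "p \<in> U" "\<alpha> \<in> D" for p \<alpha>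
  proof -
    have "((\<lambda>t. c i (diff_quot sc f p \<alpha> t)) \<longlongrightarrow> c i (dir_deriv sc f p \<alpha>)) (at 0)"
      using tendsto_coords_iff[OF V[OF that] inV[OF that]] Suc.prems(2) assms(4) that by auto
    moreover have "\<forall>\<^sub>F t in at 0. c i (diff_quot sc f p \<alpha> t) = diff_quot (*) (\<lambda>q. c i (f q)) p \<alpha> t"
      using line_in_U[OF that]
      by eventually_elim (intro diff_quot_coord Suc.prems(1) assms(4) that(1))
    ultimately show ?thesis
      by (rule Lim_transform_eventually)
  qed
  show ?case
  proof (rule Ck_SucI)
    show "continuous_on U (\<lambda>q. c i (f q))"
      using Suc.prems continuous_on_coords_iff[of U f] assms(4) by auto
    show "((\<lambda>t. c i (f (p + fun_scale t \<alpha>))) has_field_derivative c i (dir_deriv sc f p \<alpha>)) (at 0)"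
      if "p \<in> U" "\<alpha> \<in> D" for p \<alpha>
      using d[OF that] by (simp add: diff_quot_scalar_iff)
    show "Ck_on m (*) D U (\<lambda>p. c i (dir_deriv sc f p \<alpha>))" if "\<alpha> \<in> D" for \<alpha>
      by (rule Suc.IH) (use Suc.prems inV that in auto)
  qed
qed

end

section \<open>Power series in an operator\<close>

context coord_space
begin

text \<open>The sum norm in coordinates. It serves to bound the powers of an operator
  geometrically.\<close>

definition nrm :: "'w \<Rightarrow> real" where
  "nrm x = (\<Sum>i<n. norm (c i x))"

lemma functional_bound:
  assumes "functional f"
  shows "\<exists>C\<ge>0. \<forall>v\<in>V. norm (f v) \<le> C * nrm v"
proof (intro exI conjI ballI)
  let ?C = "\<Sum>i<n. norm (f (e i))"
  show "0 \<le> ?C" by (simp add: sum_nonneg)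
  fix v assume v: "v \<in> V"
  have "norm (f v) \<le> (\<Sum>i<n. norm (c i v * f (e i)))"
    unfolding functional_expand[OF assms v] by (rule norm_sum)
  also have "\<dots> \<le> (\<Sum>i<n. nrm v * norm (f (e i)))"
    unfolding norm_mult nrm_def
    by (intro sum_mono mult_right_mono member_le_sum) auto
  also have "\<dots> = ?C * nrm v"
    by (simp add: sum_distrib_left mult.commute)
  finally show "norm (f v) \<le> ?C * nrm v" .
qed

lemma lin_bound:
  assumes "lin T"
  shows "\<exists>r\<ge>0. \<forall>v\<in>V. nrm (T v) \<le> r * nrm v"
proof -
  have "\<exists>C\<ge>0. \<forall>v\<in>V. norm (c i (T v)) \<le> C * nrm v" if "i < n" for i
    using functional_bound[OF functional_comp[OF functional_c[OF that] assms]] .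
  then obtain C where C: "\<And>i. i < n \<Longrightarrow> C i \<ge> 0" "\<And>i v. i < n \<Longrightarrow> v \<in> V \<Longrightarrow> norm (c i (T v)) \<le> C i * nrm v"
    by metis
  have "nrm (T v) \<le> (\<Sum>i<n. C i) * nrm v" if "v \<in> V" for v
    unfolding nrm_def[of "T v"] sum_distrib_right using that by (intro sum_mono C(2)) auto
  moreover have "(\<Sum>i<n. C i) \<ge> 0"
    by (intro sum_nonneg C) auto
  ultimately show ?thesis by blast
qed

lemma pow_bound:
  assumes "lin T"
  shows "\<exists>r\<ge>0. \<forall>v\<in>V. \<forall>k. nrm ((T ^^ k) v) \<le> r ^ k * nrm v"
proof -
  obtain r where r: "r \<ge> 0" "\<And>v. v \<in> V \<Longrightarrow> nrm (T v) \<le> r * nrm v"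
    using lin_bound[OF assms] by blast
  have "nrm ((T ^^ k) v) \<le> r ^ k * nrm v" if "v \<in> V" for v k
  proof (induction k)
    case (Suc k)
    have "nrm ((T ^^ Suc k) v) \<le> r * nrm ((T ^^ k) v)"
      using r(2)[of "(T ^^ k) v"] assms that by simp
    also have "\<dots> \<le> r * (r ^ k * nrm v)"
      by (intro mult_left_mono Suc r)
    finally show ?case by (simp add: mult.assoc)
  qed simp
  then show ?thesis using r(1) by blast
qed

lemma functional_pow_bound:
  assumes "functional f" "lin T" "v \<in> V"
  shows "\<exists>C r. r \<ge> 0 \<and> (\<forall>k. norm (f ((T ^^ k) v)) \<le> C * r ^ k)"
proof -
  obtain C where C: "C \<ge> 0" "\<And>v. v \<in> V \<Longrightarrow> norm (f v) \<le> C * nrm v"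
    using functional_bound[OF assms(1)] by blast
  obtain r where r: "r \<ge> 0" "\<And>v k. v \<in> V \<Longrightarrow> nrm ((T ^^ k) v) \<le> r ^ k * nrm v"
    using pow_bound[OF assms(2)] by blast
  have "norm (f ((T ^^ k) v)) \<le> (C * nrm v) * r ^ k" for k
  proof -
    have "norm (f ((T ^^ k) v)) \<le> C * nrm ((T ^^ k) v)"
      by (rule C(2)) (use assms in simp)
    also have "\<dots> \<le> C * (r ^ k * nrm v)"
      by (intro mult_left_mono C r assms)
    finally show ?thesis by (simp add: mult_ac)
  qed
  then show ?thesis using r(1) by blast
qed

lemma opser_summable:
  assumes "entire_coeffs a" "functional f" "lin T" "v \<in> V"
  shows "summable (\<lambda>k. norm (a k * f ((T ^^ k) v)))"
proof -
  obtain C r where "r \<ge> 0" "\<And>k. norm (f ((T ^^ k) v)) \<le> C * r ^ k"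
    using functional_pow_bound[OF assms(2-4)] by auto
  then show ?thesis
    using entire_coeffs_bound[OF assms(1), of "\<lambda>k. f ((T ^^ k) v)"] by auto
qed

text \<open>The value at \<open>v\<close> of the power series with coefficients \<open>a\<close> in
  the operator \<open>T\<close>. Summing coordinate by coordinate reduces convergence to scalar
  series and places the result in \<open>V\<close> by construction.\<close>

definition opser :: "(nat \<Rightarrow> 'k) \<Rightarrow> ('w \<Rightarrow> 'w) \<Rightarrow> 'w \<Rightarrow> 'w" where
  "opser a T v = combine (\<lambda>i. \<Sum>k. a k * c i ((T ^^ k) v))"

lemma opser_in [simp, intro]: "opser a T v \<in> V"
  by (simp add: opser_def)

text \<open>A functional is a finite combination of coordinates, so it may be applied term by term.
  Identities between operator series are reduced to scalar series in this way.\<close>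

lemma opser_functional:
  assumes "entire_coeffs a" "functional f" "lin T" "v \<in> V"
  shows "(\<lambda>k. a k * f ((T ^^ k) v)) sums f (opser a T v)"
proof -
  have "(\<lambda>k. \<Sum>i<n. a k * c i ((T ^^ k) v) * f (e i)) sums (\<Sum>i<n. (\<Sum>k. a k * c i ((T ^^ k) v)) * f (e i))"
    by (intro sums_sum sums_mult2 summable_sums summable_norm_cancel[OF opser_summable] assms functional_c) auto
  also have "(\<Sum>i<n. (\<Sum>k. a k * c i ((T ^^ k) v)) * f (e i)) = f (opser a T v)"
    unfolding opser_def by (rule functional_combine[symmetric, OF assms(2)])
  also have "(\<lambda>k. \<Sum>i<n. a k * c i ((T ^^ k) v) * f (e i)) = (\<lambda>k. a k * f ((T ^^ k) v))"
    using assms by (auto simp: functional_expand[of f "(T ^^ _) v"] sum_distrib_left mult.assoc)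
  finally show ?thesis .
qed

lemma opser_eqI:
  assumes "entire_coeffs a" "lin T" "v \<in> V" "w \<in> V"
    and "\<And>i. i < n \<Longrightarrow> (\<lambda>k. a k * c i ((T ^^ k) v)) sums c i w"
  shows "opser a T v = w"
  using assms sums_unique2[OF opser_functional[OF assms(1) functional_c assms(2,3)]]
  by (intro coord_eqI) auto

lemma exp_op_eq_opser:
  assumes "lin T" "v \<in> V"
  shows "exp_op sc T v = opser exp_coeff T v"
proof -
  have "(\<lambda>k. sc (inverse (fact k)) ((T ^^ k) v)) sums opser exp_coeff T v"
    using assms opser_functional[OF entire_exp_coeff functional_c assms]
    by (subst sums_coords_iff) (auto simp: exp_coeff_def)
  then show ?thesis
    unfolding exp_op_def suminf_def sums_def
    using lim_unique[OF sequentially_bot] by (intro the_equality) blast+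
qed

lemma opser_lin:
  assumes "entire_coeffs a" "lin T"
  shows "lin (opser a T)"
proof (rule lin_if_coords)
  fix i assume i: "i < n"
  note S = opser_functional[OF assms(1) functional_c[OF i] assms(2)]
  note P = lin_D[OF lin_pow[OF assms(2)]]
  show "functional (\<lambda>x. c i (opser a T x))"
    unfolding linear_between_def
  proof (intro conjI ballI allI)
    fix x y assume "x \<in> V" "y \<in> V"
    then have "(\<lambda>k. a k * c i ((T ^^ k) (x + y))) sums (c i (opser a T x) + c i (opser a T y))"
      using sums_add[OF S S, of x y] i by (simp add: P algebra_simps)
    then show "c i (opser a T (x + y)) = c i (opser a T x) + c i (opser a T y)"
      using sums_unique2[OF S] \<open>x \<in> V\<close> \<open>y \<in> V\<close> by simp
  next
    fix x b assume "x \<in> V"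
    then have "(\<lambda>k. a k * c i ((T ^^ k) (sc b x))) sums (b * c i (opser a T x))"
      using sums_mult[OF S, of x b] i by (simp add: P algebra_simps)
    then show "c i (opser a T (sc b x)) = b * c i (opser a T x)"
      using sums_unique2[OF S] \<open>x \<in> V\<close> by simp
  qed auto
qed auto

lemma opser_add_coeffs:
  assumes "entire_coeffs a" "entire_coeffs b" "lin T" "v \<in> V"
  shows "opser (\<lambda>k. a k + b k) T v = opser a T v + opser b T v"
  by (rule opser_eqI) (use assms opser_functional[OF assms(1) functional_c assms(3,4)]
      opser_functional[OF assms(2) functional_c assms(3,4)] in
      \<open>auto simp: distrib_right entire_coeffs_add intro!: sums_add\<close>)

text \<open>An operator that intertwines \<open>T\<close> and \<open>T'\<close> intertwines all
  their powers. The two spaces may differ, since the lemma also carries series from \<open>l\<close>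
  and its dual into the large double.\<close>

lemma opser_intertwine:
  assumes "coord_space sc' W m e' c'" "entire_coeffs a" "lin T" "linear_between sc' W sc' W T'"
    and "linear_between sc V sc' W S" "\<And>x. x \<in> V \<Longrightarrow> S (T x) = T' (S x)" "v \<in> V"
  shows "S (opser a T v) = coord_space.opser sc' m e' c' a T' (S v)"
proof -
  interpret W: coord_space sc' W m e' c' by fact
  have pow: "S ((T ^^ k) v) = (T' ^^ k) (S v)" for k
    by (induction k) (use assms in auto)
  have "functional (\<lambda>x. c' i (S x))" if "i < m" for i
    using assms(5) W.functional_c[OF that] by (auto simp: linear_between_def)
  from opser_functional[OF assms(2) this assms(3,7)]
  have "(\<lambda>k. a k * c' i ((T' ^^ k) (S v))) sums c' i (S (opser a T v))" if "i < m" for i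
    using that by (simp add: pow)
  then show ?thesis
    using assms by (intro W.opser_eqI[symmetric]) (auto simp: linear_between_def)
qed

lemma opser_commute:
  assumes "entire_coeffs a" "lin T" "lin S" "\<And>x. x \<in> V \<Longrightarrow> S (T x) = T (S x)" "v \<in> V"
  shows "S (opser a T v) = opser a T (S v)"
  using opser_intertwine[OF coord_space_axioms assms(1,2,2,3,4,5)] .

lemma entire_coeffs_shift:
  assumes "entire_coeffs a"
  shows "entire_coeffs (\<lambda>k. if k = 0 then 0 else a (k - 1))"
  unfolding entire_coeffs_def
proof (intro allI impI)
  fix R :: real assume "R \<ge> 0"
  then have "summable (\<lambda>k. R * (norm (a k) * R ^ k))"
    using assms by (intro summable_mult) (auto simp: entire_coeffs_def)
  then show "summable (\<lambda>k. norm (if k = 0 then 0 else a (k - 1)) * R ^ k)"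
    by (subst summable_Suc_iff[symmetric]) (simp add: mult_ac)
qed

lemma opser_shift:
  assumes "entire_coeffs a" "lin T" "v \<in> V"
  shows "T (opser a T v) = opser (\<lambda>k. if k = 0 then 0 else a (k - 1)) T v"
proof (rule opser_eqI[symmetric])
  fix i assume i: "i < n"
  have "(\<lambda>k. a k * c i ((T ^^ Suc k) v)) sums c i (T (opser a T v))"
    using opser_functional[OF assms(1) functional_comp[OF functional_c[OF i] assms(2)] assms(2,3)] by simp
  from sums_Suc[of "\<lambda>k. (if k = 0 then 0 else a (k - 1)) * c i ((T ^^ k) v)", simplified, OF this[simplified]]
  show "(\<lambda>k. (if k = 0 then 0 else a (k - 1)) * c i ((T ^^ k) v)) sums c i (T (opser a T v))"
    by simp
qed (use assms lin_D(1) in \<open>auto intro: entire_coeffs_shift\<close>)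

lemma opser_finite:
  assumes "lin T" "v \<in> V"
  shows "opser (\<lambda>k. if k = 0 then 1 else 0) T v = v"
proof (rule opser_eqI)
  show "entire_coeffs (\<lambda>k. if k = 0 then 1 else 0 :: 'k)"
    unfolding entire_coeffs_def by (auto intro!: summable_finite[of "{0}"] split: if_splits)
  show "(\<lambda>k. (if k = 0 then 1 else 0) * c i ((T ^^ k) v)) sums c i v" for i
    using sums_finite[of "{0}" "\<lambda>k. (if k = 0 then 1 else 0) * c i ((T ^^ k) v)"] by simp
qed (use assms in auto)

text \<open>For each intermediate basis vector \<open>e j\<close> the composition is a Cauchy
  product of absolutely convergent scalar series; summing over \<open>j\<close> recombines
  \<open>T^k\<close> and \<open>T^(m - k)\<close> into \<open>T^m\<close>.\<close>

lemma opser_mult: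
  assumes a: "entire_coeffs a" and b: "entire_coeffs b" and d: "entire_coeffs d"
    and T: "lin T" and v: "v \<in> V"
    and ab: "\<And>m. (\<Sum>k\<le>m. a k * b (m - k)) = d m"
  shows "opser a T (opser b T v) = opser d T v"
proof (rule opser_eqI[OF d T v, symmetric])
  fix i assume i: "i < n"
  let ?f = "\<lambda>j k. a k * c i ((T ^^ k) (e j))" and ?g = "\<lambda>j k. b k * c j ((T ^^ k) v)"
  have "(\<lambda>m. \<Sum>k\<le>m. ?f j k * ?g j (m - k)) sums (c i (opser a T (e j)) * c j (opser b T v))" if "j < n" for j
    using Cauchy_product_sums[OF opser_summable[OF a functional_c[OF i] T e_in[OF that]]
        opser_summable[OF b functional_c[OF that] T v]]
      sums_unique[OF opser_functional[OF a functional_c[OF i] T e_in[OF that]]]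
      sums_unique[OF opser_functional[OF b functional_c[OF that] T v]] by simp
  then have "(\<lambda>m. \<Sum>j<n. \<Sum>k\<le>m. ?f j k * ?g j (m - k)) sums
      (\<Sum>j<n. c i (opser a T (e j)) * c j (opser b T v))"
    by (intro sums_sum) auto
  also have "(\<Sum>j<n. c i (opser a T (e j)) * c j (opser b T v)) = c i (opser a T (opser b T v))"
    using functional_expand[OF functional_comp[OF functional_c[OF i] opser_lin[OF a T]] opser_in]
    by (simp add: mult.commute)
  also have "(\<lambda>m. \<Sum>j<n. \<Sum>k\<le>m. ?f j k * ?g j (m - k)) = (\<lambda>m. d m * c i ((T ^^ m) v))"
  proof
    fix m
    have "(\<Sum>j<n. c i ((T ^^ k) (e j)) * c j ((T ^^ (m - k)) v)) = c i ((T ^^ m) v)" if "k \<le> m" for k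
    proof -
      have "c i ((T ^^ m) v) = c i ((T ^^ k) ((T ^^ (m - k)) v))"
        using that by (metis comp_apply funpow_add le_add_diff_inverse)
      then show ?thesis
        using functional_expand[OF functional_comp[OF functional_c[OF i] lin_pow[OF T, of k]], of "(T ^^ (m - k)) v"] T v
        by (simp add: mult.commute)
    qed
    then have "(\<Sum>k\<le>m. a k * b (m - k) * (\<Sum>j<n. c i ((T ^^ k) (e j)) * c j ((T ^^ (m - k)) v)))
        = (\<Sum>k\<le>m. a k * b (m - k) * c i ((T ^^ m) v))"
      by simp
    also have "\<dots> = d m * c i ((T ^^ m) v)"
      by (simp add: ab[symmetric] sum_distrib_right)
    finally show "(\<Sum>j<n. \<Sum>k\<le>m. ?f j k * ?g j (m - k)) = d m * c i ((T ^^ m) v)"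
      by (subst sum.swap) (simp add: sum_distrib_left mult_ac)
  qed
  finally show "(\<lambda>m. d m * c i ((T ^^ m) v)) sums c i (opser a T (opser b T v))" .
qed auto

section \<open>Series in skew operators and in derivations\<close>

definition bilin :: "('w \<Rightarrow> 'w \<Rightarrow> 'k) \<Rightarrow> bool" where
  "bilin \<beta> \<longleftrightarrow> (\<forall>x\<in>V. functional (\<beta> x)) \<and> (\<forall>y\<in>V. functional (\<lambda>x. \<beta> x y))"

text \<open>Expanded in coordinates, the bilinear form is a finite combination of products of two
  scalar series, to each of which the Cauchy product applies.\<close>

lemma opser_bilin:
  assumes \<beta>: "bilin \<beta>" and a: "entire_coeffs a" and b: "entire_coeffs b"
    and T: "lin T" and x: "x \<in> V" and y: "y \<in> V"
  shows "(\<lambda>m. \<Sum>k\<le>m. a k * b (m - k) * \<beta> ((T ^^ k) x) ((T ^^ (m - k)) y)) sums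
    \<beta> (opser a T x) (opser b T y)"
proof -
  have exp: "\<beta> u w = (\<Sum>i<n. \<Sum>j<n. c i u * c j w * \<beta> (e i) (e j))" if "u \<in> V" "w \<in> V" for u w
  proof -
    have "\<beta> u w = (\<Sum>i<n. c i u * \<beta> (e i) w)"
      using functional_expand[of "\<lambda>x. \<beta> x w" u] \<beta> that by (auto simp: bilin_def)
    also have "\<dots> = (\<Sum>i<n. c i u * (\<Sum>j<n. c j w * \<beta> (e i) (e j)))"
      using functional_expand[of "\<beta> (e _)" w] \<beta> \<open>w \<in> V\<close> e_in
      by (intro sum.cong refl) (auto simp: bilin_def)
    finally show ?thesis
      by (simp add: sum_distrib_left mult_ac)
  qed
  let ?f = "\<lambda>i k. a k * c i ((T ^^ k) x)" and ?g = "\<lambda>j k. b k * c j ((T ^^ k) y)"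
  have "(\<lambda>m. \<Sum>k\<le>m. ?f i k * ?g j (m - k)) sums (c i (opser a T x) * c j (opser b T y))" if "i < n" "j < n" for i j
    using Cauchy_product_sums[OF opser_summable[OF a functional_c[OF that(1)] T x]
        opser_summable[OF b functional_c[OF that(2)] T y]]
      sums_unique[OF opser_functional[OF a functional_c[OF that(1)] T x]]
      sums_unique[OF opser_functional[OF b functional_c[OF that(2)] T y]] by simp
  then have "(\<lambda>m. \<Sum>i<n. \<Sum>j<n. (\<Sum>k\<le>m. ?f i k * ?g j (m - k)) * \<beta> (e i) (e j)) sums
      (\<Sum>i<n. \<Sum>j<n. c i (opser a T x) * c j (opser b T y) * \<beta> (e i) (e j))"
    by (intro sums_sum sums_mult2) auto
  also have "(\<Sum>i<n. \<Sum>j<n. c i (opser a T x) * c j (opser b T y) * \<beta> (e i) (e j)) =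
      \<beta> (opser a T x) (opser b T y)"
    by (rule exp[symmetric]) auto
  also have "(\<lambda>m. \<Sum>i<n. \<Sum>j<n. (\<Sum>k\<le>m. ?f i k * ?g j (m - k)) * \<beta> (e i) (e j)) =
      (\<lambda>m. \<Sum>k\<le>m. a k * b (m - k) * \<beta> ((T ^^ k) x) ((T ^^ (m - k)) y))"
  proof
    fix m
    have "(\<Sum>k\<le>m. a k * b (m - k) * \<beta> ((T ^^ k) x) ((T ^^ (m - k)) y)) =
       (\<Sum>k\<le>m. \<Sum>i<n. \<Sum>j<n. ?f i k * ?g j (m - k) * \<beta> (e i) (e j))"
      by (intro sum.cong refl) (simp add: exp T x y sum_distrib_left mult_ac)
    also have "\<dots> = (\<Sum>i<n. \<Sum>k\<le>m. \<Sum>j<n. ?f i k * ?g j (m - k) * \<beta> (e i) (e j))"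
      by (rule sum.swap)
    also have "\<dots> = (\<Sum>i<n. \<Sum>j<n. \<Sum>k\<le>m. ?f i k * ?g j (m - k) * \<beta> (e i) (e j))"
      by (intro sum.cong refl sum.swap)
    finally show "(\<Sum>i<n. \<Sum>j<n. (\<Sum>k\<le>m. ?f i k * ?g j (m - k)) * \<beta> (e i) (e j)) =
      (\<Sum>k\<le>m. a k * b (m - k) * \<beta> ((T ^^ k) x) ((T ^^ (m - k)) y))"
      by (simp add: sum_distrib_right)
  qed
  finally show ?thesis .
qed

text \<open>Moving \<open>T^k\<close> across the form costs the sign \<open>(- 1)^k\<close>. This is
  applied to the adjoint action, which is skew for the invariant form.\<close>

lemma opser_adjoint:
  assumes \<beta>: "bilin \<beta>" and a: "entire_coeffs a" and T: "lin T" and x: "x \<in> V" and y: "y \<in> V"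
    and skew: "\<And>x y. x \<in> V \<Longrightarrow> y \<in> V \<Longrightarrow> \<beta> (T x) y = - \<beta> x (T y)"
  shows "\<beta> (opser a T x) y = \<beta> x (opser (\<lambda>k. (- 1) ^ k * a k) T y)"
proof -
  have pow: "\<beta> ((T ^^ k) x) y = (- 1) ^ k * \<beta> x ((T ^^ k) y)" if "x \<in> V" "y \<in> V" for k x y
    using that
  proof (induction k arbitrary: y)
    case (Suc k)
    then show ?case
      using skew[of "(T ^^ k) x" y] Suc.IH[of "T y"] T lin_D(1)[OF T]
      by (simp add: funpow_swap1)
  qed simp
  have "(\<lambda>k. a k * \<beta> ((T ^^ k) x) y) sums \<beta> (opser a T x) y"
    using opser_functional[OF a _ T x, of "\<lambda>x. \<beta> x y"] \<beta> y by (auto simp: bilin_def)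
  moreover have "(\<lambda>k. (- 1) ^ k * a k * \<beta> x ((T ^^ k) y)) sums \<beta> x (opser (\<lambda>k. (- 1) ^ k * a k) T y)"
    using opser_functional[OF entire_coeffs_sign[OF a] _ T y, of "\<beta> x"] \<beta> x by (auto simp: bilin_def)
  ultimately show ?thesis
    using pow[OF x y] by (auto simp: mult_ac intro: sums_unique2)
qed

text \<open>By the binomial theorem the product series has coefficients
  \<open>(- 1 + 1)^m / m!\<close>, which are those of the constant 1.\<close>

lemma opser_exp_neg:
  assumes "lin T" "v \<in> V"
  shows "opser (\<lambda>k. (- 1) ^ k * exp_coeff k) T (opser exp_coeff T v) = v"
    and "opser exp_coeff T (opser (\<lambda>k. (- 1) ^ k * exp_coeff k) T v) = v"
proof -
  have e: "(\<Sum>k\<le>m. (- 1) ^ k * exp_coeff k * exp_coeff (m - k)) = (if m = 0 then 1 else (0::'k))" for m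
  proof -
    have "(\<Sum>k\<le>m. (- 1) ^ k * exp_coeff k * exp_coeff (m - k)) =
        (\<Sum>k\<le>m. of_nat (m choose k) * (- 1) ^ k * 1 ^ (m - k)) / (fact m :: 'k)"
      unfolding sum_divide_distrib
      by (intro sum.cong refl) (simp add: exp_coeff_def binomial_fact field_simps)
    also have "\<dots> = (- 1 + 1) ^ m / fact m"
      by (subst binomial_ring) simp
    finally show ?thesis by (simp add: power_0_left)
  qed
  have e': "(\<Sum>k\<le>m. exp_coeff k * ((- 1) ^ (m - k) * exp_coeff (m - k))) = (if m = 0 then 1 else (0::'k))" for m
    using e[of m] by (subst sum.nat_diff_reindex[symmetric, where n = "Suc m", simplified lessThan_Suc_atMost])
      (simp add: mult_ac)
  have d: "entire_coeffs (\<lambda>k. if k = 0 then 1 else 0 :: 'k)"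
    unfolding entire_coeffs_def by (auto intro!: summable_finite[of "{0}"] split: if_splits)
  show "opser (\<lambda>k. (- 1) ^ k * exp_coeff k) T (opser exp_coeff T v) = v"
    using opser_mult[OF entire_coeffs_sign[OF entire_exp_coeff] entire_exp_coeff d assms e]
    by (simp add: opser_finite assms)
  show "opser exp_coeff T (opser (\<lambda>k. (- 1) ^ k * exp_coeff k) T v) = v"
    using opser_mult[OF entire_exp_coeff entire_coeffs_sign[OF entire_exp_coeff] d assms e']
    by (simp add: opser_finite assms)
qed

lemma opser_neg:
  assumes "entire_coeffs a" "lin T" "lin S" "\<And>x. x \<in> V \<Longrightarrow> S x = - T x" "v \<in> V"
  shows "opser a S v = opser (\<lambda>k. (- 1) ^ k * a k) T v"
proof -
  have "(S ^^ k) v = sc ((- 1) ^ k) ((T ^^ k) v)" for k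
  proof (induction k)
    case (Suc k)
    then show ?case
      using assms by (simp add: lin_D[OF assms(2)])
  qed simp
  then show ?thesis
    using assms by (auto simp: opser_def mult_ac intro!: combine_cong)
qed

text \<open>Stated after applying a linear functional, so that only scalar sums occur.\<close>

lemma derivation_pow:
  assumes T: "lin T" and f: "functional f"
    and der: "\<And>x y. x \<in> V \<Longrightarrow> y \<in> V \<Longrightarrow> T (br x y) = br (T x) y + br x (T y)"
    and br: "\<And>x y. x \<in> V \<Longrightarrow> y \<in> V \<Longrightarrow> br x y \<in> V"
    and "x \<in> V" "y \<in> V"
  shows "f ((T ^^ m) (br x y)) = (\<Sum>k\<le>m. of_nat (m choose k) * f (br ((T ^^ k) x) ((T ^^ (m - k)) y)))"
  using assms(5,6)
proof (induction m arbitrary: x y)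
  case (Suc m)
  let ?g = "\<lambda>k l. f (br ((T ^^ k) x) ((T ^^ l) y))"
  have "f ((T ^^ Suc m) (br x y)) = f ((T ^^ m) (br (T x) y)) + f ((T ^^ m) (br x (T y)))"
    using Suc.prems by (simp only: funpow_Suc_right comp_apply der)
      (simp add: lin_D[OF lin_pow[OF T]] functional_D[OF f] br lin_D[OF T] T)
  also have "\<dots> = (\<Sum>k\<le>m. of_nat (m choose k) * ?g (Suc k) (m - k)) + (\<Sum>k\<le>m. of_nat (m choose k) * ?g k (Suc m - k))"
    using Suc.IH[of "T x" y] Suc.IH[of x "T y"] Suc.prems
    by (simp add: lin_D[OF T] funpow_swap1 Suc_diff_le)
  also have "(\<Sum>k\<le>m. of_nat (m choose k) * ?g k (Suc m - k)) = ?g 0 (Suc m) + (\<Sum>k\<le>m. of_nat (m choose Suc k) * ?g (Suc k) (m - k))"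
  proof -
    have "(\<Sum>k\<le>m. of_nat (m choose k) * ?g k (Suc m - k)) = (\<Sum>k\<le>Suc m. of_nat (m choose k) * ?g k (Suc m - k))"
      by simp
    then show ?thesis
      by (subst (asm) sum.atMost_Suc_shift) simp
  qed
  also have "(\<Sum>k\<le>m. of_nat (m choose k) * ?g (Suc k) (m - k)) +
      (?g 0 (Suc m) + (\<Sum>k\<le>m. of_nat (m choose Suc k) * ?g (Suc k) (m - k))) =
      (\<Sum>k\<le>Suc m. of_nat (Suc m choose k) * ?g k (Suc m - k))"
    by (subst sum.atMost_Suc_shift) (simp add: distrib_right sum.distrib algebra_simps)
  finally show ?case .
qed simp

text \<open>The coefficients come from Pascal's rule: the outer \<open>T\<close> splits every
  bracket by the Leibniz rule, and the new summand \<open>br x (T^m y)\<close> supplies the missing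
  term with index 0. The functional is kept general in the induction so that it can absorb the outer
  \<open>T\<close>.\<close>

lemma derivation_dpow:
  assumes T: "lin T" and f: "functional f"
    and der: "\<And>x y. x \<in> V \<Longrightarrow> y \<in> V \<Longrightarrow> T (br x y) = br (T x) y + br x (T y)"
    and br: "\<And>x y. x \<in> V \<Longrightarrow> y \<in> V \<Longrightarrow> br x y \<in> V"
    and x: "x \<in> V" and y: "y \<in> V"
  shows "f (dpow T (br x) m y) =
      (\<Sum>k<m. of_nat (m choose Suc k) * f (br ((T ^^ k) x) ((T ^^ (m - Suc k)) y)))
    \<and> dpow T (br x) m y \<in> V"
  using f
proof (induction m arbitrary: f)
  case (Suc m)
  let ?g = "\<lambda>k l. f (br ((T ^^ k) x) ((T ^^ l) y))"
  have inV: "dpow T (br x) m y \<in> V"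
    using Suc.IH[OF Suc.prems] by simp
  have T1: "T (br ((T ^^ k) x) ((T ^^ l) y)) = br ((T ^^ Suc k) x) ((T ^^ l) y) + br ((T ^^ k) x) ((T ^^ Suc l) y)" for k l
    using der[of "(T ^^ k) x" "(T ^^ l) y"] T x y by simp
  have "f (dpow T (br x) (Suc m) y) = f (T (dpow T (br x) m y)) + ?g 0 m"
    using inV Suc.prems T x y by (simp add: functional_D lin_D[OF T] br)
  also have "f (T (dpow T (br x) m y)) =
      (\<Sum>k<m. of_nat (m choose Suc k) * (?g (Suc k) (m - Suc k) + ?g k (m - k)))"
    using Suc.IH[OF functional_comp[OF Suc.prems T]] Suc.prems T x y
    by (simp only: T1)
      (auto simp: functional_D(1)[OF Suc.prems] br lin_D[OF T] Suc_diff_Suc simp flip: funpow.simps(2) intro!: sum.cong)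
  also have "\<dots> = (\<Sum>k<m. of_nat (m choose Suc k) * ?g (Suc k) (m - Suc k)) + (\<Sum>k<m. of_nat (m choose Suc k) * ?g k (m - k))"
    by (simp add: distrib_left sum.distrib)
  finally have f: "f (dpow T (br x) (Suc m) y) =
      ((\<Sum>k<m. of_nat (m choose Suc k) * ?g (Suc k) (m - Suc k)) + ?g 0 m) +
      (\<Sum>k<Suc m. of_nat (m choose Suc k) * ?g k (m - k))"
    by simp
  have "(\<Sum>k<m. of_nat (m choose Suc k) * ?g (Suc k) (m - Suc k)) + ?g 0 m =
      (\<Sum>k<Suc m. of_nat (m choose k) * ?g k (m - k))"
    by (subst sum.lessThan_Suc_shift) simp
  then have "f (dpow T (br x) (Suc m) y) =
      (\<Sum>k<Suc m. of_nat (Suc m choose Suc k) * ?g k (Suc m - Suc k))"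
    unfolding f by (simp only: sum.distrib[symmetric] distrib_right[symmetric] of_nat_add[symmetric]
        binomial_Suc_Suc diff_Suc_Suc)
  moreover have "dpow T (br x) (Suc m) y \<in> V"
    using inV T x y by (simp add: lin_D[OF T] br)
  ultimately show ?case by blast
qed (simp add: functional_D)

lemma bilin_comp:
  assumes "\<And>x. x \<in> V \<Longrightarrow> lin (br x)" "\<And>y. y \<in> V \<Longrightarrow> lin (\<lambda>x. br x y)" "functional f"
  shows "bilin (\<lambda>x y. f (br x y))"
  unfolding bilin_def using functional_comp[OF assms(3) assms(1)] functional_comp[OF assms(3) assms(2)]
  by blast

text \<open>The Leibniz rule for \<open>T^m\<close>, divided by \<open>m!\<close>, is the Cauchy
  product of two exponential series, since the binomial coefficients split into inverse
  factorials.\<close>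

lemma exp_derivation_automorphism:
  assumes T: "lin T"
    and br: "\<And>x. x \<in> V \<Longrightarrow> lin (br x)" "\<And>y. y \<in> V \<Longrightarrow> lin (\<lambda>x. br x y)"
    and der: "\<And>x y. x \<in> V \<Longrightarrow> y \<in> V \<Longrightarrow> T (br x y) = br (T x) y + br x (T y)"
    and x: "x \<in> V" and y: "y \<in> V"
  shows "opser exp_coeff T (br x y) = br (opser exp_coeff T x) (opser exp_coeff T y)"
proof (rule opser_eqI[OF entire_exp_coeff T])
  have brV: "br x y \<in> V" if "x \<in> V" "y \<in> V" for x y
    using br(1)[OF that(1)] that(2) by (rule lin_D(1))
  show "br x y \<in> V" "br (opser exp_coeff T x) (opser exp_coeff T y) \<in> V"
    using x y by (auto intro: brV)
  fix i assume i: "i < n"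
  have "(\<Sum>k\<le>m. exp_coeff k * exp_coeff (m - k) * c i (br ((T ^^ k) x) ((T ^^ (m - k)) y))) =
      exp_coeff m * c i ((T ^^ m) (br x y))" for m
  proof -
    have "c i ((T ^^ m) (br x y)) = (\<Sum>k\<le>m. of_nat (m choose k) * c i (br ((T ^^ k) x) ((T ^^ (m - k)) y)))"
      by (rule derivation_pow[OF T functional_c[OF i]]) (auto intro: der brV x y)
    then show ?thesis
      by (simp only: sum_distrib_left) (intro sum.cong refl, simp add: exp_coeff_def binomial_fact field_simps)
  qed
  with opser_bilin[OF bilin_comp[OF br functional_c[OF i]] entire_exp_coeff entire_exp_coeff T x y]
  show "(\<lambda>k. exp_coeff k * c i ((T ^^ k) (br x y))) sums c i (br (opser exp_coeff T x) (opser exp_coeff T y))"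
    by simp
qed

text \<open>The differential of the exponential map, as \<open>dexp(T) = (\<Sum>k. T\<^sup>k / (k + 1)!)\<close> translated to the right.\<close>

lemma dexp_derivation:
  assumes T: "lin T" and f: "functional f"
    and br: "\<And>x. x \<in> V \<Longrightarrow> lin (br x)" "\<And>y. y \<in> V \<Longrightarrow> lin (\<lambda>x. br x y)"
    and der: "\<And>x y. x \<in> V \<Longrightarrow> y \<in> V \<Longrightarrow> T (br x y) = br (T x) y + br x (T y)"
    and x: "x \<in> V" and y: "y \<in> V"
  shows "(\<lambda>m. exp_coeff m * f (dpow T (br x) m y)) sums
    f (br (opser (\<lambda>k. inverse (fact (Suc k))) T x) (opser exp_coeff T y))"
proof -
  have brV: "br x y \<in> V" if "x \<in> V" "y \<in> V" for x y
    using br(1)[OF that(1)] that(2) by (rule lin_D(1))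
  have ent: "entire_coeffs (\<lambda>k. inverse (fact (Suc k)) :: 'k)"
  proof (rule entire_coeffs_if_fact[of _ 1])
    show "norm (inverse (fact (Suc k)) :: 'k) \<le> 1 / fact k" for k
      unfolding norm_inverse norm_fact by (simp add: field_simps del: fact_Suc) (simp add: fact_mono)
  qed
  have "(\<Sum>k\<le>m. inverse (fact (Suc k)) * exp_coeff (m - k) * f (br ((T ^^ k) x) ((T ^^ (m - k)) y))) =
      exp_coeff (Suc m) * f (dpow T (br x) (Suc m) y)" for m
  proof -
    have "f (dpow T (br x) (Suc m) y) =
        (\<Sum>k<Suc m. of_nat (Suc m choose Suc k) * f (br ((T ^^ k) x) ((T ^^ (Suc m - Suc k)) y)))"
      by (rule conjunct1[OF derivation_dpow[OF T f]]) (auto intro: der brV x y)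
    then show ?thesis
      by (simp only: sum_distrib_left lessThan_Suc_atMost)
        (intro sum.cong refl, simp add: exp_coeff_def binomial_fact field_simps del: fact_Suc binomial_Suc_Suc)
  qed
  with opser_bilin[OF bilin_comp[OF br f] ent entire_exp_coeff T x y]
  have "(\<lambda>m. exp_coeff (Suc m) * f (dpow T (br x) (Suc m) y)) sums
      f (br (opser (\<lambda>k. inverse (fact (Suc k))) T x) (opser exp_coeff T y))"
    by simp
  from sums_Suc[OF this] show ?thesis
    by (simp add: functional_D(3)[OF f])
qed

end

section \<open>Smooth dependence on parameters\<close>

primrec mat_pow :: "nat \<Rightarrow> (nat \<Rightarrow> nat \<Rightarrow> 'k::comm_ring_1) \<Rightarrow> nat \<Rightarrow> nat \<Rightarrow> nat \<Rightarrow> 'k" where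
  "mat_pow m N 0 = (\<lambda>i j. if i = j then 1 else 0)"
| "mat_pow m N (Suc k) = (\<lambda>i j. \<Sum>l<m. N i l * mat_pow m N k l j)"

primrec mat_dpow ::
  "nat \<Rightarrow> (nat \<Rightarrow> nat \<Rightarrow> 'k::comm_ring_1) \<Rightarrow> (nat \<Rightarrow> nat \<Rightarrow> 'k) \<Rightarrow> nat \<Rightarrow> nat \<Rightarrow> nat \<Rightarrow> 'k" where
  "mat_dpow m N E 0 = (\<lambda>i j. 0)"
| "mat_dpow m N E (Suc k) = (\<lambda>i j. \<Sum>l<m. N i l * mat_dpow m N E k l j + E i l * mat_pow m N k l j)"

text \<open>The block matrix with rows \<open>(N, E)\<close> and \<open>(0, N)\<close>. The upper right block of its \<open>k\<close>-th power is the
  derivative of \<open>N\<^sup>k\<close> in the direction \<open>E\<close>, so derivatives of power series are again power series.\<close>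

definition block_mat ::
  "nat \<Rightarrow> (nat \<Rightarrow> nat \<Rightarrow> 'k::comm_ring_1) \<Rightarrow> (nat \<Rightarrow> nat \<Rightarrow> 'k) \<Rightarrow> nat \<Rightarrow> nat \<Rightarrow> 'k" where
  "block_mat m N E i j =
     (if i < m then (if j < m then N i j else E i (j - m)) else (if j < m then 0 else N (i - m) (j - m)))"

lemma sum_double: "(\<Sum>l<m + m. f l) = (\<Sum>l<m. f l) + (\<Sum>l<m. f (m + l))" for f :: "nat \<Rightarrow> 'a::comm_monoid_add"
proof -
  have "(\<Sum>l<m + m. f l) = (\<Sum>l<m. f l) + (\<Sum>l=m..<m + m. f l)"
    by (metis sum.atLeastLessThan_concat le_add1 lessThan_atLeast0 zero_le)
  also have "(\<Sum>l=m..<m + m. f l) = (\<Sum>l<m. f (m + l))"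
    using sum.shift_bounds_nat_ivl[of f 0 m m] by (simp add: lessThan_atLeast0 add.commute)
  finally show ?thesis .
qed

lemma block_mat_pow:
  assumes "j < m"
  shows "i < m \<Longrightarrow> mat_pow (m + m) (block_mat m N E) k i (m + j) = mat_dpow m N E k i j"
    and "i < m \<Longrightarrow> mat_pow (m + m) (block_mat m N E) k (m + i) (m + j) = mat_pow m N k i j"
  using assms
  by (induction k arbitrary: i) (auto simp: sum_double block_mat_def sum.distrib)

lemma mat_pow_bound:
  fixes N :: "nat \<Rightarrow> nat \<Rightarrow> 'k::real_normed_field"
  assumes "\<And>i j. i < m \<Longrightarrow> j < m \<Longrightarrow> norm (N i j) \<le> r" "i < m" "j < m"
  shows "norm (mat_pow m N k i j) \<le> (real m * r) ^ k"
  using assms(2)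
proof (induction k arbitrary: i)
  case (Suc k)
  have "norm (mat_pow m N (Suc k) i j) \<le> (\<Sum>l<m. norm (N i l * mat_pow m N k l j))"
    by (simp add: norm_sum)
  also have "\<dots> \<le> (\<Sum>l<m. r * (real m * r) ^ k)"
    unfolding norm_mult using Suc assms
    by (intro sum_mono mult_mono) (auto intro: order_trans[OF norm_ge_zero])
  finally show ?case by simp
qed simp

lemma mat_pow_DERIV:
  fixes N E :: "nat \<Rightarrow> nat \<Rightarrow> 'k::real_normed_field"
  shows "((\<lambda>t. mat_pow m (\<lambda>i j. N i j + t * E i j) k i j) has_field_derivative
    mat_dpow m (\<lambda>i j. N i j + t * E i j) E k i j) (at t within S)"
proof (induction k arbitrary: i)
  case (Suc k)
  have "((\<lambda>t. \<Sum>l<m. (N i l + t * E i l) * mat_pow m (\<lambda>i j. N i j + t * E i j) k l j) has_field_derivative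
    (\<Sum>l<m. (N i l + t * E i l) * mat_dpow m (\<lambda>i j. N i j + t * E i j) E k l j
      + E i l * mat_pow m (\<lambda>i j. N i j + t * E i j) k l j)) (at t within S)"
    by (intro DERIV_sum DERIV_mult' Suc.IH) (auto intro!: derivative_eq_intros)
  then show ?case by simp
qed simp

definition mat_series :: "(nat \<Rightarrow> 'k::real_or_complex) \<Rightarrow> nat \<Rightarrow> (nat \<Rightarrow> nat \<Rightarrow> 'k) \<Rightarrow> nat \<Rightarrow> nat \<Rightarrow> 'k" where
  "mat_series a m N i j = (\<Sum>k. a k * mat_pow m N k i j)"

definition mat_dseries ::
  "(nat \<Rightarrow> 'k::real_or_complex) \<Rightarrow> nat \<Rightarrow> (nat \<Rightarrow> nat \<Rightarrow> 'k) \<Rightarrow> (nat \<Rightarrow> nat \<Rightarrow> 'k) \<Rightarrow> nat \<Rightarrow> nat \<Rightarrow> 'k" where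
  "mat_dseries a m N E i j = (\<Sum>k. a k * mat_dpow m N E k i j)"

lemma ex_bound: "\<exists>r\<ge>0. \<forall>i<m. \<forall>j<m. norm (N i j) \<le> r" for N :: "nat \<Rightarrow> nat \<Rightarrow> 'k::real_normed_field"
proof (intro exI conjI allI impI)
  show "0 \<le> (\<Sum>i<m. \<Sum>j<m. norm (N i j))"
    by (intro sum_nonneg) auto
  fix i j assume "i < m" "j < m"
  then have "norm (N i j) \<le> (\<Sum>j<m. norm (N i j))"
    by (intro member_le_sum) auto
  also have "\<dots> \<le> (\<Sum>i<m. \<Sum>j<m. norm (N i j))"
    using \<open>i < m\<close> by (intro member_le_sum[of i "{..<m}" "\<lambda>i. \<Sum>j<m. norm (N i j)"]) (auto intro: sum_nonneg)
  finally show "norm (N i j) \<le> (\<Sum>i<m. \<Sum>j<m. norm (N i j))" .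
qed

text \<open>The derivative is a block of a power of the doubled matrix, so the bound for plain
  powers applies with size \<open>m + m\<close>.\<close>

lemma mat_dpow_bound:
  fixes N E :: "nat \<Rightarrow> nat \<Rightarrow> 'k::real_normed_field"
  assumes "\<And>i j. i < m \<Longrightarrow> j < m \<Longrightarrow> norm (N i j) \<le> r" "\<And>i j. i < m \<Longrightarrow> j < m \<Longrightarrow> norm (E i j) \<le> r"
    and "i < m" "j < m"
  shows "norm (mat_dpow m N E k i j) \<le> (real (m + m) * r) ^ k"
proof -
  have "0 \<le> r"
    using assms by (meson norm_ge_zero order_trans)
  then have "norm (mat_pow (m + m) (block_mat m N E) k i (m + j)) \<le> (real (m + m) * r) ^ k"
    using assms by (intro mat_pow_bound) (auto simp: block_mat_def)
  then show ?thesis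
    using block_mat_pow(1)[OF assms(4,3)] by metis
qed

text \<open>For \<open>t\<close> in the unit ball the entries of \<open>N + t E\<close> stay below
  the sum of the two bounds. The Weierstrass test then gives uniform convergence of the
  differentiated series, which justifies termwise differentiation.\<close>

lemma mat_series_DERIV:
  fixes N E :: "nat \<Rightarrow> nat \<Rightarrow> 'k::real_or_complex"
  assumes "entire_coeffs a" "i < m" "j < m"
  shows "((\<lambda>t. mat_series a m (\<lambda>i j. N i j + t * E i j) i j) has_field_derivative mat_dseries a m N E i j) (at 0)"
proof -
  obtain r1 r2 where r: "r1 \<ge> 0" "r2 \<ge> 0" "\<And>i j. i < m \<Longrightarrow> j < m \<Longrightarrow> norm (N i j) \<le> r1"
    "\<And>i j. i < m \<Longrightarrow> j < m \<Longrightarrow> norm (E i j) \<le> r2"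
    using ex_bound[of m N] ex_bound[of m E] by auto
  let ?N = "\<lambda>t i j. N i j + t * E i j" and ?r = "r1 + r2"
  have N: "norm (?N t i j) \<le> ?r" if "t \<in> ball 0 1" "i < m" "j < m" for t i j
  proof -
    have "norm (?N t i j) \<le> norm (N i j) + norm t * norm (E i j)"
      using norm_triangle_ineq[of "N i j" "t * E i j"] by (simp add: norm_mult)
    also have "\<dots> \<le> r1 + 1 * r2"
      using that r by (intro add_mono mult_mono) auto
    finally show ?thesis by simp
  qed
  have E: "norm (E i j) \<le> ?r" if "i < m" "j < m" for i j
    using r that by (metis add_increasing)
  have u: "uniformly_convergent_on (ball 0 1) (\<lambda>n t. \<Sum>k<n. a k * mat_dpow m (?N t) E k i j)"
  proof (rule Weierstrass_m_test')
    show "summable (\<lambda>k. norm (a k) * (real (m + m) * ?r) ^ k)"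
      using assms(1) r by (auto simp: entire_coeffs_def)
    show "norm (a k * mat_dpow m (?N t) E k i j) \<le> norm (a k) * (real (m + m) * ?r) ^ k" if "t \<in> ball 0 1" for k t
      unfolding norm_mult using mat_dpow_bound[OF N[OF that] E assms(2,3)] by (intro mult_left_mono) auto
  qed
  have s: "summable (\<lambda>k. a k * mat_pow m (?N 0) k i j)"
    by (rule summable_norm_cancel, rule entire_coeffs_bound[OF assms(1), where C = 1 and R = "real m * r1"])
      (use mat_pow_bound[of m N r1 i j] r assms in auto)
  have "((\<lambda>t. \<Sum>k. a k * mat_pow m (?N t) k i j) has_field_derivative (\<Sum>k. a k * mat_dpow m (?N 0) E k i j)) (at 0)"
    by (rule has_field_derivative_series'(2)[where S = "ball 0 1" and ?x0.0 = 0
        and f = "\<lambda>k t. a k * mat_pow m (?N t) k i j" and f' = "\<lambda>k t. a k * mat_dpow m (?N t) E k i j"])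
      (use u s in \<open>auto intro!: DERIV_cmult mat_pow_DERIV\<close>)
  then show ?thesis
    by (simp add: mat_series_def mat_dseries_def)
qed

section \<open>Power series in matrices that depend affinely on a parameter\<close>

context open_region
begin

text \<open>\<open>L\<close> is the linear part of \<open>N\<close> along lines. Doubling in a fixed
  direction stays within this class, because the off-diagonal block is then constant; an induction
  on the order of differentiation rests on this.\<close>

definition affine_mats :: "(('v \<Rightarrow> 'k) \<Rightarrow> nat \<Rightarrow> nat \<Rightarrow> 'k) \<Rightarrow> (('v \<Rightarrow> 'k) \<Rightarrow> nat \<Rightarrow> nat \<Rightarrow> 'k) \<Rightarrow> bool" where
  "affine_mats N L \<longleftrightarrow>
     (\<forall>q\<in>D. \<forall>\<alpha>\<in>D. \<forall>t i j. N (q + fun_scale t \<alpha>) i j = N q i j + t * L \<alpha> i j) \<and>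
     (\<forall>i j. continuous_on D (\<lambda>q. N q i j))"

lemma affine_mats_block:
  assumes "affine_mats N L" "\<alpha> \<in> D"
  shows "affine_mats (\<lambda>q. block_mat m (N q) (L \<alpha>)) (\<lambda>\<beta>. block_mat m (L \<beta>) (\<lambda>_ _. 0))"
proof -
  have "continuous_on D (\<lambda>q. block_mat m (N q) (L \<alpha>) i j)" for i j
    using assms(1) unfolding affine_mats_def block_mat_def
    by (cases "i < m"; cases "j < m") simp_all
  then show ?thesis
    using assms unfolding affine_mats_def by (auto simp: block_mat_def)
qed

lemma continuous_on_mat_series:
  assumes "\<And>i j. continuous_on U (\<lambda>q. N q i j)" "entire_coeffs a" "i < m" "j < m"
  shows "continuous_on U (\<lambda>q. mat_series a m (N q) i j)"
  unfolding continuous_on_def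
proof
  fix p assume p: "p \<in> U"
  \<comment> \<open>Continuity is local: on the relatively open set where the entry sum
    \<open>R\<close> stays below \<open>R p + 1\<close>, the Weierstrass test gives uniform
    convergence.\<close>
  define R where "R = (\<lambda>q. \<Sum>i<m. \<Sum>j<m. norm (N q i j))"
  define r where "r = R p + 1"
  have R: "norm (N q i j) \<le> R q" if "i < m" "j < m" for q i j
  proof -
    have "norm (N q i j) \<le> (\<Sum>j<m. norm (N q i j))"
      using that by (intro member_le_sum) auto
    also have "\<dots> \<le> R q"
      unfolding R_def
      using that(1) by (intro member_le_sum[of i "{..<m}" "\<lambda>i. \<Sum>j<m. norm (N q i j)"]) (auto intro: sum_nonneg)
    finally show ?thesis .
  qed
  have "continuous_on U R"
    unfolding R_def by (intro continuous_intros assms)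
  then have "openin (top_of_set U) (U \<inter> R -` {..<r})"
    by (intro continuous_openin_preimage_gen) auto
  then obtain T where T: "open T" "U \<inter> R -` {..<r} = U \<inter> T"
    by (auto simp: openin_open)
  have pT: "p \<in> T"
    using T p by (auto simp: r_def)
  have r0: "r \<ge> 0"
    unfolding r_def R_def by (intro add_nonneg_nonneg sum_nonneg) auto
  have "uniform_limit (U \<inter> T) (\<lambda>n q. \<Sum>k<n. a k * mat_pow m (N q) k i j)
      (\<lambda>q. \<Sum>k. a k * mat_pow m (N q) k i j) sequentially"
  proof (rule Weierstrass_m_test)
    show "summable (\<lambda>k. norm (a k) * (real m * r) ^ k)"
      using assms r0 by (auto simp: entire_coeffs_def)
    fix k q assume "q \<in> U \<inter> T"
    then have "norm (N q i j) \<le> r" if "i < m" "j < m" for i j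
      using R[OF that, of q] T(2) by (smt (verit) IntD1 IntD2 \<open>q \<in> U \<inter> T\<close> lessThan_iff vimageD)
    from mat_pow_bound[OF this assms(3,4)]
    show "norm (a k * mat_pow m (N q) k i j) \<le> norm (a k) * (real m * r) ^ k"
      unfolding norm_mult by (intro mult_left_mono) auto
  qed
  moreover have "continuous_on U (\<lambda>q. mat_pow m (N q) k i j)" for k i
    by (induction k arbitrary: i) (auto intro!: continuous_intros assms)
  then have "\<forall>\<^sub>F n in sequentially. continuous_on (U \<inter> T) (\<lambda>q. \<Sum>k<n. a k * mat_pow m (N q) k i j)"
    by (intro always_eventually allI continuous_intros) (auto intro: continuous_on_subset)
  ultimately have "continuous_on (U \<inter> T) (\<lambda>q. mat_series a m (N q) i j)"
    unfolding mat_series_def by (intro uniform_limit_theorem) auto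
  then have "((\<lambda>q. mat_series a m (N q) i j) \<longlongrightarrow> mat_series a m (N p) i j) (at p within U \<inter> T)"
    using p pT by (auto simp: continuous_on_def)
  also have "at p within U \<inter> T = at p within U"
    using T(1) pT by (intro at_within_nhd[of p T]) auto
  finally show "((\<lambda>q. mat_series a m (N q) i j) \<longlongrightarrow> mat_series a m (N p) i j) (at p within U)" .
qed

text \<open>One derivative is traded for a matrix of twice the size, which is why the induction runs
  over all families and all sizes at once.\<close>

lemma Ck_mat_series:
  assumes "affine_mats N L" "entire_coeffs a" "i < m" "j < m"
  shows "Ck_on k (*) D U (\<lambda>q. mat_series a m (N q) i j)"
  using assms
proof (induction k arbitrary: N L m i j)
  case 0
  have "continuous_on D (\<lambda>q. N q i j)" for i j
    using 0 by (simp add: affine_mats_def)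
  then have "continuous_on U (\<lambda>q. N q i j)" for i j
    by (rule continuous_on_subset[OF _ openin_imp_subset[OF openin_U]])
  then show ?case
    using 0 by (auto intro: continuous_on_mat_series)
next
  case (Suc k)
  show ?case
  proof (rule Ck_SucI)
    have "continuous_on D (\<lambda>q. N q i j)" for i j
      using Suc.prems by (simp add: affine_mats_def)
    then have "continuous_on U (\<lambda>q. N q i j)" for i j
      by (rule continuous_on_subset[OF _ openin_imp_subset[OF openin_U]])
    then show "continuous_on U (\<lambda>q. mat_series a m (N q) i j)"
      using Suc.prems by (auto intro: continuous_on_mat_series)
    show "((\<lambda>t. mat_series a m (N (p + fun_scale t \<alpha>)) i j) has_field_derivative
        mat_dseries a m (N p) (L \<alpha>) i j) (at 0)" if "p \<in> U" "\<alpha> \<in> D" for p \<alpha>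
    proof -
      have "N (p + fun_scale t \<alpha>) = (\<lambda>i j. N p i j + t * L \<alpha> i j)" for t
        using Suc.prems(1) U_subset[OF that(1)] that(2) unfolding affine_mats_def by blast
      then show ?thesis
        using mat_series_DERIV[OF Suc.prems(2-4), of "N p" "L \<alpha>"] by (simp only:)
    qed
    show "Ck_on k (*) D U (\<lambda>p. mat_dseries a m (N p) (L \<alpha>) i j)" if "\<alpha> \<in> D" for \<alpha>
    proof -
      have "Ck_on k (*) D U (\<lambda>q. mat_series a (m + m) (block_mat m (N q) (L \<alpha>)) i (m + j))"
        by (rule Suc.IH[OF affine_mats_block[OF Suc.prems(1) that] Suc.prems(2)]) (use Suc.prems in auto)
      then show ?thesis
        using Suc.prems by (simp add: mat_series_def mat_dseries_def block_mat_pow)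
    qed
  qed
qed

end

section \<open>From operators to their matrices\<close>

lemma (in coord_space) coords_pow:
  assumes "lin T" "v \<in> V" "i < n"
  shows "c i ((T ^^ k) v) = (\<Sum>j<n. mat_pow n (\<lambda>i j. c i (T (e j))) k i j * c j v)"
  using assms(3)
proof (induction k arbitrary: i)
  case 0
  then show ?case by (simp add: mult_delta_left)
next
  case (Suc k)
  have "c i ((T ^^ Suc k) v) = (\<Sum>l<n. c i (T (e l)) * c l ((T ^^ k) v))"
    using functional_expand[OF functional_comp[OF functional_c[OF Suc.prems] assms(1)], of "(T ^^ k) v"] assms
    by (simp add: mult.commute)
  also have "\<dots> = (\<Sum>l<n. \<Sum>j<n. c i (T (e l)) * mat_pow n (\<lambda>i j. c i (T (e j))) k l j * c j v)"
    by (simp add: Suc.IH sum_distrib_left mult.assoc)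
  finally show ?case
    by (subst (asm) sum.swap) (simp add: sum_distrib_right)
qed

lemma (in coord_space) coords_dpow:
  assumes "lin T" "lin E" "v \<in> V" "i < n"
  shows "dpow T E k v \<in> V"
    and "c i (dpow T E k v) = (\<Sum>j<n. mat_dpow n (\<lambda>i j. c i (T (e j))) (\<lambda>i j. c i (E (e j))) k i j * c j v)"
proof -
  show V: "dpow T E k v \<in> V" for k
    by (induction k) (auto simp: assms lin_D[OF assms(1)] lin_D[OF assms(2)])
  show "c i (dpow T E k v) = (\<Sum>j<n. mat_dpow n (\<lambda>i j. c i (T (e j))) (\<lambda>i j. c i (E (e j))) k i j * c j v)"
    using assms(4)
  proof (induction k arbitrary: i)
    case (Suc k)
    let ?T = "\<lambda>i j. c i (T (e j))" and ?E = "\<lambda>i j. c i (E (e j))"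
    have "c i (dpow T E (Suc k) v) = c i (T (dpow T E k v)) + c i (E ((T ^^ k) v))"
      using V[of k] Suc.prems assms by (simp add: lin_D[OF assms(1)] lin_D[OF assms(2)])
    also have "\<dots> = (\<Sum>l<n. ?T i l * c l (dpow T E k v)) + (\<Sum>l<n. ?E i l * c l ((T ^^ k) v))"
      using functional_expand[OF functional_comp[OF functional_c[OF Suc.prems] assms(1)] V, of k]
        functional_expand[OF functional_comp[OF functional_c[OF Suc.prems] assms(2)], of "(T ^^ k) v"] assms
      by (simp add: mult.commute)
    also have "\<dots> = (\<Sum>l<n. \<Sum>j<n. (?T i l * mat_dpow n ?T ?E k l j + ?E i l * mat_pow n ?T k l j) * c j v)"
      using coords_pow[OF assms(1,3)]
      by (simp add: Suc.IH sum_distrib_left mult.assoc sum.distrib distrib_right)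
    finally show ?case
      by (subst (asm) sum.swap) (simp add: sum_distrib_right)
  qed simp
qed

lemma (in coord_space) opser_coords:
  assumes "entire_coeffs a" "lin T" "v \<in> V" "i < n"
  shows "c i (opser a T v) = (\<Sum>j<n. mat_series a n (\<lambda>i j. c i (T (e j))) i j * c j v)"
proof -
  have "c i (opser a T v) = (\<Sum>j<n. c j v * c i (opser a T (e j)))"
    using functional_expand[OF functional_comp[OF functional_c[OF assms(4)] opser_lin[OF assms(1,2)]] assms(3)] .
  moreover have "c i (opser a T (e j)) = mat_series a n (\<lambda>i j. c i (T (e j))) i j" if "j < n" for j
  proof -
    have "c i ((T ^^ k) (e j)) = mat_pow n (\<lambda>i j. c i (T (e j))) k i j" for k
      using that by (simp add: coords_pow[OF assms(2) e_in[OF that] assms(4)] c_e mult_delta_right)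
    then show ?thesis
      using sums_unique[OF opser_functional[OF assms(1) functional_c[OF assms(4)] assms(2) e_in[OF that]]]
      by (simp add: mat_series_def)
  qed
  ultimately show ?thesis
    by (simp add: mult.commute)
qed

text \<open>Operators depending affinely on the parameter, with linear part \<open>L\<close>. The
  two instances are the adjoint action of an element of the dual of \<open>l\<close>, once on the
  double of \<open>l\<close> and once, through \<open>lift\<close>, on the double of
  \<open>g\<close>.\<close>

locale operator_family = coord_space sc V n e c + open_region D U
  for sc :: "'k::real_or_complex \<Rightarrow> 'w::{ab_group_add,topological_space} \<Rightarrow> 'w" and V n e c
    and D U :: "('v \<Rightarrow> 'k) set" +
  fixes T L :: "('v \<Rightarrow> 'k) \<Rightarrow> 'w \<Rightarrow> 'w"
  assumes T_lin: "q \<in> D \<Longrightarrow> lin (T q)"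
    and L_lin: "q \<in> D \<Longrightarrow> lin (L q)"
    and T_affine: "q \<in> D \<Longrightarrow> \<alpha> \<in> D \<Longrightarrow> v \<in> V \<Longrightarrow> T (q + fun_scale t \<alpha>) v = T q v + sc t (L \<alpha> v)"
    and T_cont: "i < n \<Longrightarrow> j < n \<Longrightarrow> continuous_on D (\<lambda>q. c i (T q (e j)))"
begin

text \<open>\<open>affine_mats\<close> speaks about all index pairs, so the matrix is cut off to 0
  outside the range below \<open>n\<close>; the congruence lemmas for \<open>mat_pow\<close> and
  \<open>mat_dpow\<close> remove the cut-off again.\<close>

lemma affine_mats:
  "affine_mats (\<lambda>q i j. if i < n \<and> j < n then c i (T q (e j)) else 0)
     (\<lambda>q i j. if i < n \<and> j < n then c i (L q (e j)) else 0)"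
proof -
  have "continuous_on D (\<lambda>q. if i < n \<and> j < n then c i (T q (e j)) else 0)" for i j
    using T_cont by (cases "i < n \<and> j < n") auto
  then show ?thesis
    unfolding affine_mats_def by (auto simp: T_affine e_in lin_D(1)[OF T_lin] lin_D(1)[OF L_lin])
qed

lemma mat_pow_cong:
  "(\<And>i j. i < m \<Longrightarrow> j < m \<Longrightarrow> N i j = N' i j) \<Longrightarrow> i < m \<Longrightarrow> j < m \<Longrightarrow> mat_pow m N k i j = mat_pow m N' k i j"
  by (induction k arbitrary: i) auto

lemma mat_dpow_cong:
  "(\<And>i j. i < m \<Longrightarrow> j < m \<Longrightarrow> N i j = N' i j) \<Longrightarrow> (\<And>i j. i < m \<Longrightarrow> j < m \<Longrightarrow> E i j = E' i j) \<Longrightarrow>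
    i < m \<Longrightarrow> j < m \<Longrightarrow> mat_dpow m N E k i j = mat_dpow m N' E' k i j"
  by (induction k arbitrary: i) (auto simp: mat_pow_cong[of m N N'])

lemma opser_coords':
  assumes "entire_coeffs a" "q \<in> D" "v \<in> V" "i < n"
  shows "c i (opser a (T q) v) =
    (\<Sum>j<n. mat_series a n (\<lambda>i j. if i < n \<and> j < n then c i (T q (e j)) else 0) i j * c j v)"
  unfolding opser_coords[OF assms(1) T_lin[OF assms(2)] assms(3,4)] mat_series_def
  using assms(4) by (intro sum.cong refl arg_cong2[where f = "(*)"] suminf_cong mat_pow_cong) auto

lemma Ck_opser:
  assumes "entire_coeffs a" "v \<in> V" "i < n"
  shows "Ck_on k (*) D U (\<lambda>q. c i (opser a (T q) v))"
proof -
  have "Ck_on k (*) D U (\<lambda>q. \<Sum>j<n. mat_series a n (\<lambda>i j. if i < n \<and> j < n then c i (T q (e j)) else 0) i j * c j v)"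
    by (intro Ck_sum Ck_mult Ck_const Ck_mat_series[OF affine_mats]) (use assms in auto)
  then show ?thesis
    by (subst Ck_cong) (use assms U_subset in \<open>auto simp: opser_coords'\<close>)
qed

text \<open>The derivative enters as the sum \<open>d\<close> of the series in \<open>dpow\<close>,
  so that a closed form for this sum, as exists for the exponential of a derivation, can be
  inserted.\<close>

lemma opser_DERIV:
  assumes a: "entire_coeffs a" and v: "v \<in> V" and i: "i < n" and p: "p \<in> D" and \<alpha>: "\<alpha> \<in> D"
    and s: "(\<lambda>k. a k * c i (dpow (T p) (L \<alpha>) k v)) sums d"
  shows "((\<lambda>t. c i (opser a (T (p + fun_scale t \<alpha>)) v)) has_field_derivative d) (at 0)"
proof -
  let ?N = "\<lambda>q i j. if i < n \<and> j < n then c i (T q (e j)) else 0"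
  let ?L = "\<lambda>q i j. if i < n \<and> j < n then c i (L q (e j)) else 0"
  have N: "?N (p + fun_scale t \<alpha>) = (\<lambda>i j. ?N p i j + t * ?L \<alpha> i j)" for t
    using affine_mats p \<alpha> unfolding affine_mats_def by blast
  have "((\<lambda>t. \<Sum>j<n. mat_series a n (\<lambda>i j. ?N p i j + t * ?L \<alpha> i j) i j * c j v) has_field_derivative
      (\<Sum>j<n. mat_dseries a n (?N p) (?L \<alpha>) i j * c j v)) (at 0)"
    by (intro DERIV_sum DERIV_cmult_right mat_series_DERIV) (use a i in auto)
  then have D: "((\<lambda>t. c i (opser a (T (p + fun_scale t \<alpha>)) v)) has_field_derivative
      (\<Sum>j<n. mat_dseries a n (?N p) (?L \<alpha>) i j * c j v)) (at 0)"
    by (simp only: opser_coords'[OF a line_D[OF p \<alpha>] v i] N)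
  obtain r1 r2 where r: "r1 \<ge> 0" "r2 \<ge> 0" "\<And>i j. i < n \<Longrightarrow> j < n \<Longrightarrow> norm (?N p i j) \<le> r1"
    "\<And>i j. i < n \<Longrightarrow> j < n \<Longrightarrow> norm (?L \<alpha> i j) \<le> r2"
    using ex_bound[of n "?N p"] ex_bound[of n "?L \<alpha>"] by (elim exE conjE) blast
  have b: "norm (?N p i j) \<le> r1 + r2" "norm (?L \<alpha> i j) \<le> r1 + r2" if "i < n" "j < n" for i j
    using r(3)[OF that] r(4)[OF that] r(1,2) by linarith+
  have "summable (\<lambda>k. a k * mat_dpow n (?N p) (?L \<alpha>) k i j)" if "j < n" for j
  proof (rule summable_norm_cancel, rule entire_coeffs_bound[OF a, where C = 1 and R = "real (n + n) * (r1 + r2)"])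
    show "norm (mat_dpow n (?N p) (?L \<alpha>) k i j) \<le> 1 * (real (n + n) * (r1 + r2)) ^ k" for k
      unfolding mult_1
      by (rule mat_dpow_bound[OF b i that])
  qed (use r in auto)
  then have "(\<lambda>k. \<Sum>j<n. a k * mat_dpow n (?N p) (?L \<alpha>) k i j * c j v) sums
      (\<Sum>j<n. mat_dseries a n (?N p) (?L \<alpha>) i j * c j v)"
    unfolding mat_dseries_def by (intro sums_sum sums_mult2 summable_sums) auto
  also have "(\<lambda>k. \<Sum>j<n. a k * mat_dpow n (?N p) (?L \<alpha>) k i j * c j v) =
      (\<lambda>k. a k * c i (dpow (T p) (L \<alpha>) k v))"
  proof
    fix k
    have "mat_dpow n (?N p) (?L \<alpha>) k i j = mat_dpow n (\<lambda>i j. c i (T p (e j))) (\<lambda>i j. c i (L \<alpha> (e j))) k i j"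
      if "j < n" for j
      by (rule mat_dpow_cong) (use i that in auto)
    then show "(\<Sum>j<n. a k * mat_dpow n (?N p) (?L \<alpha>) k i j * c j v) = a k * c i (dpow (T p) (L \<alpha>) k v)"
      using coords_dpow(2)[OF T_lin[OF p] L_lin[OF \<alpha>] v i] by (simp add: sum_distrib_left mult.assoc)
  qed
  finally have "d = (\<Sum>j<n. mat_dseries a n (?N p) (?L \<alpha>) i j * c j v)"
    by (rule sums_unique2[OF s])
  with D show ?thesis
    by (simp only:)
qed

end

section \<open>Inverses of operator families\<close>

context coord_space
begin

definition op_mat :: "('w \<Rightarrow> 'w) \<Rightarrow> 'k mat" where
  "op_mat T = mat n n (\<lambda>(i, j). c i (T (e j)))"

lemma op_mat_carrier: "op_mat T \<in> carrier_mat n n"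
  by (simp add: op_mat_def)

lemma op_mat_apply:
  assumes "lin T" "i < n"
  shows "c i (T (combine a)) = vec_index (op_mat T *\<^sub>v vec n a) i"
  using functional_combine[OF functional_comp[OF functional_c[OF assms(2)] assms(1)], of a] assms(2)
  by (simp add: op_mat_def scalar_prod_def lessThan_atLeast0 mult.commute flip: index_mult_mat_vec) (simp add: scalar_prod_def mult.commute)

text \<open>A nonzero determinant gives injectivity through the kernel and surjectivity through the
  adjugate.\<close>

lemma op_mat_det_iff:
  assumes "lin T"
  shows "bij_betw T V V \<longleftrightarrow> det (op_mat T) \<noteq> 0"
proof
  assume bij: "bij_betw T V V"
  show "det (op_mat T) \<noteq> 0"
  proof
    assume "det (op_mat T) = 0"
    then obtain v where v: "v \<in> carrier_vec n" "v \<noteq> 0\<^sub>v n" "op_mat T *\<^sub>v v = 0\<^sub>v n"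
      using det_0_iff_vec_prod_zero_field[OF op_mat_carrier] by blast
    have "v = vec n (\<lambda>i. vec_index v i)"
      using v(1) by (intro eq_vecI) auto
    then have "c i (T (combine (\<lambda>i. vec_index v i))) = 0" if "i < n" for i
      using op_mat_apply[OF assms that, of "\<lambda>i. vec_index v i"] v(3) that by simp
    then have "T (combine (\<lambda>i. vec_index v i)) = T 0"
      using lin_D(1)[OF assms] lin_D(4)[OF assms] by (intro coord_eqI) auto
    then have "combine (\<lambda>i. vec_index v i) = 0"
      using bij by (auto simp: bij_betw_def inj_on_def)
    then have "vec_index v i = 0" if "i < n" for i
      using c_combine[OF that, of "\<lambda>i. vec_index v i"] that by simp
    then have "v = 0\<^sub>v n"
      using v(1) by (intro eq_vecI) auto
    then show False using v(2) by simp
  qed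
next
  assume d: "det (op_mat T) \<noteq> 0"
  have "inj_on T V"
  proof (rule inj_onI)
    fix x y assume xy: "x \<in> V" "y \<in> V" "T x = T y"
    have "op_mat T *\<^sub>v vec n (\<lambda>i. c i (x - y)) = 0\<^sub>v n"
    proof (rule eq_vecI)
      fix i assume i: "i < dim_vec (0\<^sub>v n :: 'k vec)"
      have "T (x - y) = 0"
        using xy by (simp add: lin_D[OF assms])
      then show "vec_index (op_mat T *\<^sub>v vec n (\<lambda>i. c i (x - y))) i = vec_index (0\<^sub>v n) i"
        using op_mat_apply[OF assms, of i "\<lambda>i. c i (x - y)"] i xy by simp
    qed (simp add: op_mat_def)
    then have "vec n (\<lambda>i. c i (x - y)) = 0\<^sub>v n"
      using det_0_iff_vec_prod_zero_field[OF op_mat_carrier] d vec_carrier by metis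
    then have "c i (x - y) = 0" if "i < n" for i
      using that by (metis index_vec index_zero_vec(1))
    then have "x - y = 0"
      using xy by (intro coord_eqI) auto
    then show "x = y" by simp
  qed
  moreover have "\<exists>x\<in>V. T x = y" if "y \<in> V" for y
  proof -
    let ?B = "inverse (det (op_mat T)) \<cdot>\<^sub>m adj_mat (op_mat T)"
    have B: "?B \<in> carrier_mat n n" "op_mat T * ?B = 1\<^sub>m n"
      using adj_mat[OF op_mat_carrier, of T] d op_mat_carrier[of T]
      by (auto simp: mult_smult_distrib)
    let ?w = "?B *\<^sub>v vec n (\<lambda>i. c i y)"
    have w: "vec n (\<lambda>i. vec_index ?w i) = ?w"
      using B by (intro eq_vecI) auto
    have "op_mat T *\<^sub>v ?w = vec n (\<lambda>i. c i y)"
      using B op_mat_carrier[of T] assoc_mult_mat_vec[of "op_mat T" n n ?B n "vec n (\<lambda>i. c i y)"]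
      by (metis one_mult_mat_vec vec_carrier)
    then have "c i (T (combine (\<lambda>i. vec_index ?w i))) = c i y" if "i < n" for i
      using op_mat_apply[OF assms that, of "\<lambda>i. vec_index ?w i"] that by (simp only: w) simp
    then have "T (combine (\<lambda>i. vec_index ?w i)) = y"
      using that lin_D(1)[OF assms] by (intro coord_eqI) auto
    then show ?thesis by blast
  qed
  ultimately show "bij_betw T V V"
    using lin_D(1)[OF assms] by (fastforce simp: bij_betw_def)
qed

text \<open>Cramer's rule: the coordinates of a preimage are rational in the matrix entries, whence
  inverses depend smoothly on parameters.\<close>

lemma op_mat_inverse:
  assumes "lin T" "bij_betw T V V" "x \<in> V" "i < n"
  shows "c i x = (\<Sum>j<n. adj_mat (op_mat T) $$ (i, j) * inverse (det (op_mat T)) * c j (T x))"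
proof -
  have d: "det (op_mat T) \<noteq> 0"
    using op_mat_det_iff assms by blast
  have u: "op_mat T *\<^sub>v vec n (\<lambda>i. c i x) = vec n (\<lambda>j. c j (T x))"
  proof (rule eq_vecI)
    fix i assume "i < dim_vec (vec n (\<lambda>j. c j (T x)))"
    then show "vec_index (op_mat T *\<^sub>v vec n (\<lambda>i. c i x)) i = vec_index (vec n (\<lambda>j. c j (T x))) i"
      using op_mat_apply[OF assms(1), of i "\<lambda>i. c i x"] assms by simp
  qed (simp add: op_mat_def)
  have adj: "adj_mat (op_mat T) \<in> carrier_mat n n"
    "adj_mat (op_mat T) * op_mat T = det (op_mat T) \<cdot>\<^sub>m 1\<^sub>m n"
    using adj_mat[OF op_mat_carrier, of T] by auto
  have "adj_mat (op_mat T) *\<^sub>v (op_mat T *\<^sub>v vec n (\<lambda>i. c i x)) =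
      (det (op_mat T) \<cdot>\<^sub>m 1\<^sub>m n) *\<^sub>v vec n (\<lambda>i. c i x)"
    using adj op_mat_carrier[of T] by (metis assoc_mult_mat_vec vec_carrier)
  also have "vec_index \<dots> i = det (op_mat T) * c i x"
    using assms(4) by (simp add: scalar_prod_def mult_delta_left mult_delta_right)
  also have "vec_index (adj_mat (op_mat T) *\<^sub>v (op_mat T *\<^sub>v vec n (\<lambda>i. c i x))) i =
      (\<Sum>j<n. adj_mat (op_mat T) $$ (i, j) * c j (T x))"
    unfolding u using adj(1) assms(4) by (simp add: scalar_prod_def lessThan_atLeast0)
  finally have "(\<Sum>j<n. adj_mat (op_mat T) $$ (i, j) * c j (T x)) = det (op_mat T) * c i x" .
  moreover have "(\<Sum>j<n. adj_mat (op_mat T) $$ (i, j) * inverse (det (op_mat T)) * c j (T x)) =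
      inverse (det (op_mat T)) * (\<Sum>j<n. adj_mat (op_mat T) $$ (i, j) * c j (T x))"
    by (simp add: sum_distrib_left mult_ac)
  ultimately show ?thesis
    using d by simp
qed

lemma Ck_det:
  fixes A :: "('v \<Rightarrow> 'k) \<Rightarrow> 'k mat"
  assumes "open_region D U" "\<And>i j. i < m \<Longrightarrow> j < m \<Longrightarrow> Ck_on k (*) D U (\<lambda>q. A q $$ (i, j))"
    and "\<And>q. A q \<in> carrier_mat m m"
  shows "Ck_on k (*) D U (\<lambda>q. det (A q))"
proof -
  interpret open_region D U by fact
  have "Ck_on k (*) D U (\<lambda>q. \<Sum>p | p permutes {0..<m}. signof p * (\<Prod>i = 0..<m. A q $$ (i, p i)))"
    by (intro Ck_sum Ck_mult Ck_const Ck_prod assms(2)) (auto simp: permutes_in_image)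
  then show ?thesis
    using assms(3) by (simp add: det_def'[of _ m])
qed

text \<open>Stated for a family \<open>X\<close> whose image under \<open>T q\<close> is smooth,
  rather than for the inverse operator, so that it covers preimages known only through a
  choice.\<close>

lemma Ck_inverse_family:
  fixes T :: "('v \<Rightarrow> 'k) \<Rightarrow> 'w \<Rightarrow> 'w"
  assumes D: "open_region D U" and T: "\<And>q. q \<in> U \<Longrightarrow> lin (T q)" "\<And>q. q \<in> U \<Longrightarrow> bij_betw (T q) V V"
    and S: "\<And>i j. i < n \<Longrightarrow> j < n \<Longrightarrow> Ck_on k (*) D U (\<lambda>q. c i (T q (e j)))"
    and X: "\<And>q. q \<in> U \<Longrightarrow> X q \<in> V"
    and Y: "\<And>i. i < n \<Longrightarrow> Ck_on k (*) D U (\<lambda>q. c i (T q (X q)))"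
    and i: "i < n"
  shows "Ck_on k (*) D U (\<lambda>q. c i (X q))"
proof -
  interpret open_region D U by fact
  have M: "Ck_on k (*) D U (\<lambda>q. op_mat (T q) $$ (i, j))" if "i < n" "j < n" for i j
    using S[OF that] that by (simp add: op_mat_def)
  have "Ck_on k (*) D U (\<lambda>q. adj_mat (op_mat (T q)) $$ (i, j))" if "j < n" for j
  proof -
    obtain n' where n': "n = Suc n'"
      using i by (cases n) auto
    \<comment> \<open>The entry \<open>(i, j)\<close> of the adjugate is the signed minor with row
      \<open>j\<close> and column \<open>i\<close> deleted, a determinant of size
      \<open>n - 1\<close>.\<close>
    have "Ck_on k (*) D U (\<lambda>q. (- 1) ^ (j + i) * det (mat_delete (op_mat (T q)) j i))"
    proof (intro Ck_mult Ck_const Ck_det[OF D, where m = n'])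
      show "mat_delete (op_mat (T q)) j i \<in> carrier_mat n' n'" for q
        using op_mat_carrier[of "T q"] n' unfolding carrier_mat_def mat_delete_def by simp
      fix i' j' assume ij: "i' < n'" "j' < n'"
      then show "Ck_on k (*) D U (\<lambda>q. mat_delete (op_mat (T q)) j i $$ (i', j'))"
      proof -
        have "mat_delete (op_mat (T q)) j i $$ (i', j') =
            op_mat (T q) $$ (if i' < j then i' else Suc i', if j' < i then j' else Suc j')" for q
          using ij op_mat_carrier[of "T q"] n' unfolding carrier_mat_def mat_delete_def by simp
        moreover have "(if i' < j then i' else Suc i') < n" "(if j' < i then j' else Suc j') < n"
          using ij n' by auto
        ultimately show ?thesis
          using M by presburger
      qed
    qed
    then show ?thesis
      using that i by (simp add: adj_mat_def cofactor_def op_mat_def)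
  qed
  moreover have "Ck_on k (*) D U (\<lambda>q. inverse (det (op_mat (T q))))"
    using T op_mat_det_iff op_mat_carrier by (intro Ck_inverse Ck_det[OF D M]) blast+
  ultimately have "Ck_on k (*) D U (\<lambda>q. \<Sum>j<n. adj_mat (op_mat (T q)) $$ (i, j) * inverse (det (op_mat (T q))) * c j (T q (X q)))"
    by (intro Ck_sum Ck_mult Y) auto
  then show ?thesis
    by (subst Ck_cong[OF op_mat_inverse[OF T(1,2) X i]]) auto
qed

text \<open>Bijectivity is the nonvanishing of a determinant that is continuous in the
  parameter.\<close>

lemma openin_bij:
  fixes T :: "('v \<Rightarrow> 'k) \<Rightarrow> 'w \<Rightarrow> 'w"
  assumes D: "open_region D D" and T: "\<And>q. q \<in> D \<Longrightarrow> lin (T q)"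
    and S: "\<And>i j. i < n \<Longrightarrow> j < n \<Longrightarrow> continuous_on D (\<lambda>q. c i (T q (e j)))"
  shows "openin (top_of_set D) {q \<in> D. bij_betw (T q) V V}"
proof -
  have "Ck_on 0 (*) D D (\<lambda>q. det (op_mat (T q)))"
    by (rule Ck_det[OF D _ op_mat_carrier]) (use S in \<open>auto simp: op_mat_def\<close>)
  then have "openin (top_of_set D) (D \<inter> (\<lambda>q. det (op_mat (T q))) -` (- {0}))"
    by (intro continuous_openin_preimage_gen) auto
  also have "D \<inter> (\<lambda>q. det (op_mat (T q))) -` (- {0}) = {q \<in> D. bij_betw (T q) V V}"
    using op_mat_det_iff[OF T] by auto
  finally show ?thesis .
qed

end

section \<open>Interpolation of holomorphic functions\<close>

text \<open>Each derivative lowers the order of the zero by one, and the new cofactor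
  \<open>?R\<close> takes at \<mu> the value of \<open>R\<close> times \<open>Suc n\<close>; the
  factors accumulate to the factorial.\<close>

lemma pderiv_power_factor:
  fixes R :: "'a::{comm_ring_1,semiring_no_zero_divisors,ring_char_0} poly"
  assumes "k \<le> n"
  shows "poly ((pderiv ^^ k) ([:- \<mu>, 1:] ^ n * R)) \<mu> = (if k = n then fact n * poly R \<mu> else 0)"
  using assms
proof (induction n arbitrary: k R)
  case (Suc n)
  show ?case
  proof (cases k)
    case (Suc k')
    let ?R = "Polynomial.smult (of_nat (Suc n)) R + [:- \<mu>, 1:] * pderiv R"
    have "pderiv ([:- \<mu>, 1:] ^ Suc n * R) = [:- \<mu>, 1:] ^ n * ?R"
    proof -
      have *: "pderiv (X ^ Suc n * R) = X ^ n * (Polynomial.smult (of_nat (Suc n)) R + X * pderiv R)"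
        if "pderiv X = 1" for X :: "'a poly"
        using that by (simp only: pderiv_mult pderiv_power_Suc)
          (simp add: distrib_left mult_ac del: of_nat_Suc)
      show ?thesis
        by (rule *) (simp add: pderiv_pCons)
    qed
    then have "(pderiv ^^ k) ([:- \<mu>, 1:] ^ Suc n * R) = (pderiv ^^ k') ([:- \<mu>, 1:] ^ n * ?R)"
      using Suc by (simp only: funpow_Suc_right comp_apply)
    then show ?thesis
      using Suc.IH[of k' ?R] Suc.prems Suc by (simp add: algebra_simps)
  qed simp
qed simp

lemma higher_pderiv_add: "(pderiv ^^ k) (p + q) = (pderiv ^^ k) p + (pderiv ^^ k) q"
  by (induction k) (auto simp: pderiv_add)

lemma higher_pderiv_smult: "(pderiv ^^ k) (Polynomial.smult a p) = Polynomial.smult a ((pderiv ^^ k) p)"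
  by (induction k) (auto simp: pderiv_smult)

text \<open>Conditions are met one at a time. To fix the derivative of order \<open>m\<close> at the
  new point \<nu>, a multiple of \<open>?Z\<close> is added: it vanishes to order \<open>n\<close>
  at the old points and to order exactly \<open>m\<close> at \<nu>, so nothing achieved before is
  disturbed.\<close>

theorem Hermite_interpolation:
  fixes d :: "'a::field_char_0 \<Rightarrow> nat \<Rightarrow> 'a"
  assumes "finite S"
  shows "\<exists>Q. \<forall>\<mu>\<in>S. \<forall>k<n. poly ((pderiv ^^ k) Q) \<mu> = d \<mu> k"
  using assms
proof (induction S)
  case (insert \<nu> S)
  then obtain Q where Q: "\<forall>\<mu>\<in>S. \<forall>k<n. poly ((pderiv ^^ k) Q) \<mu> = d \<mu> k" by blast
  let ?W = "\<Prod>\<mu>\<in>S. [:- \<mu>, 1:] ^ n"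
  have W0: "poly ?W \<nu> \<noteq> 0"
    using insert by (auto simp: poly_prod)
  have "\<exists>Q. (\<forall>\<mu>\<in>S. \<forall>k<n. poly ((pderiv ^^ k) Q) \<mu> = d \<mu> k) \<and> (\<forall>k<m. poly ((pderiv ^^ k) Q) \<nu> = d \<nu> k)" for m
  proof (induction m)
    case 0
    then show ?case using Q by auto
  next
    case (Suc m)
    then obtain Q where Q: "\<forall>\<mu>\<in>S. \<forall>k<n. poly ((pderiv ^^ k) Q) \<mu> = d \<mu> k" "\<forall>k<m. poly ((pderiv ^^ k) Q) \<nu> = d \<nu> k"
      by blast
    \<comment> \<open>Closes the gap in the derivative of order \<open>m\<close> at \<nu>, where
      that derivative of \<open>?Z\<close> equals \<open>fact m * poly ?W \<nu>\<close>.\<close>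
    define b where "b = (d \<nu> m - poly ((pderiv ^^ m) Q) \<nu>) / (fact m * poly ?W \<nu>)"
    let ?Z = "[:- \<nu>, 1:] ^ m * ?W"
    have Z: "poly ((pderiv ^^ k) ?Z) \<nu> = (if k = m then fact m * poly ?W \<nu> else 0)" if "k \<le> m" for k
      by (rule pderiv_power_factor[OF that])
    have Z': "poly ((pderiv ^^ k) ?Z) \<mu> = 0" if "\<mu> \<in> S" "k < n" for k \<mu>
    proof -
      have eq: "?Z = [:- \<mu>, 1:] ^ n * ([:- \<nu>, 1:] ^ m * (\<Prod>\<mu>\<in>S - {\<mu>}. [:- \<mu>, 1:] ^ n))"
        using insert(1) that(1) by (simp add: prod.remove mult_ac)
      show ?thesis
        unfolding eq using pderiv_power_factor[of k n \<mu> "[:- \<nu>, 1:] ^ m * (\<Prod>\<mu>\<in>S - {\<mu>}. [:- \<mu>, 1:] ^ n)"] that by simp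
    qed
    have "poly ((pderiv ^^ k) (Q + Polynomial.smult b ?Z)) \<nu> = d \<nu> k" if "k < Suc m" for k
      using Q(2) W0 Z[of k] that by (cases "k = m") (auto simp: higher_pderiv_add higher_pderiv_smult b_def)
    moreover have "poly ((pderiv ^^ k) (Q + Polynomial.smult b ?Z)) \<mu> = d \<mu> k" if "\<mu> \<in> S" "k < n" for k \<mu>
      using Q(1) Z' that by (auto simp: higher_pderiv_add higher_pderiv_smult)
    ultimately show ?case by blast
  qed
  from this[of n] show ?case by auto
qed simp

lemma higher_deriv_poly: "(deriv ^^ k) (poly Q) = poly ((pderiv ^^ k) Q)" for Q :: "complex poly"
proof (induction k)
  case (Suc k)
  then show ?case
    by (auto intro!: DERIV_imp_deriv poly_DERIV)
qed simp

text \<open>The first \<open>n\<close> Taylor coefficients vanish; shifting the index by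
  \<open>n\<close> yields the cofactor as a power series that converges on the whole ball.\<close>

lemma zero_of_order_factor:
  assumes f: "f holomorphic_on ball \<mu> r" and d: "\<And>k. k < n \<Longrightarrow> (deriv ^^ k) f \<mu> = 0"
  obtains h where "h holomorphic_on ball \<mu> r" "\<And>z. z \<in> ball \<mu> r \<Longrightarrow> f z = (z - \<mu>) ^ n * h z"
proof -
  let ?a = "\<lambda>k. (deriv ^^ k) f \<mu> / fact k"
  let ?h = "\<lambda>z. \<Sum>k. ?a (k + n) * (z - \<mu>) ^ k"
  have s: "(\<lambda>k. ?a (k + n) * (z - \<mu>) ^ k) sums ?h z" if "z \<in> ball \<mu> r" for z
  proof (cases "z = \<mu>")
    case True
    then show ?thesis
      by (auto intro!: summable_sums summable_finite[of "{0}"] simp: power_0_left split: if_splits)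
  next
    case False
    have "summable (\<lambda>k. ?a k * (z - \<mu>) ^ k)"
      using holomorphic_power_series[OF f that] by (rule sums_summable)
    then have "summable (\<lambda>k. ?a (k + n) * (z - \<mu>) ^ (k + n) / (z - \<mu>) ^ n)"
      by (intro summable_divide) (rule summable_ignore_initial_segment)
    then show ?thesis
      using False by (auto simp: power_add intro!: summable_sums)
  qed
  show ?thesis
  proof
    show "?h holomorphic_on ball \<mu> r"
      using s by (rule power_series_holomorphic)
    fix z assume z: "z \<in> ball \<mu> r"
    have "(\<lambda>k. ?a (k + n) * (z - \<mu>) ^ (k + n)) sums f z"
      using sums_split_initial_segment[OF holomorphic_power_series[OF f z], of n] d by simp
    moreover have "(\<lambda>k. (z - \<mu>) ^ n * (?a (k + n) * (z - \<mu>) ^ k)) sums ((z - \<mu>) ^ n * ?h z)"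
      by (intro sums_mult s z)
    ultimately show "f z = (z - \<mu>) ^ n * ?h z"
      by (simp add: power_add mult_ac sums_iff)
  qed
qed

text \<open>Points are divided out one by one. Near the new point the local cofactor over the old
  factors is used, elsewhere the global quotient by \<open>(z - \<nu>)^n\<close>; the two agree away
  from \<nu> and glue to an entire function.\<close>

lemma entire_divide_zeros:
  assumes "finite S" "g holomorphic_on UNIV"
    and "\<And>\<mu>. \<mu> \<in> S \<Longrightarrow> \<exists>r>0. \<exists>h. h holomorphic_on ball \<mu> r \<and> (\<forall>z\<in>ball \<mu> r. g z = (z - \<mu>) ^ n * h z)"
  shows "\<exists>h. h holomorphic_on UNIV \<and> (\<forall>z. g z = (\<Prod>\<mu>\<in>S. (z - \<mu>) ^ n) * h z)"
  using assms(1,3)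
proof (induction S)
  case empty
  then show ?case using assms(2) by auto
next
  case (insert \<nu> S)
  then obtain h where h: "h holomorphic_on UNIV" "\<And>z. g z = (\<Prod>\<mu>\<in>S. (z - \<mu>) ^ n) * h z"
    by (metis insertI2)
  obtain r k where r: "r > 0" "k holomorphic_on ball \<nu> r" "\<And>z. z \<in> ball \<nu> r \<Longrightarrow> g z = (z - \<nu>) ^ n * k z"
    using insert.prems[of \<nu>] by auto
  have "open (- S)"
    using insert(1) finite_imp_closed by (simp add: open_closed[symmetric] closed_def)
  then obtain r' where r': "r' > 0" "ball \<nu> r' \<subseteq> - S"
    using insert(2) openE[of "- S" \<nu>] by auto
  let ?B = "ball \<nu> (min r r')" and ?W = "\<lambda>z. \<Prod>\<mu>\<in>S. (z - \<mu>) ^ n"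
  define h' where "h' = (\<lambda>z. if z \<in> ?B then k z / ?W z else h z / (z - \<nu>) ^ n)"
  have W: "?W z \<noteq> 0" if "z \<in> ?B" for z
    using that r'(2) insert(1) by auto
  have *: "h' z = h z / (z - \<nu>) ^ n" if "z \<noteq> \<nu>" for z
  proof (cases "z \<in> ?B")
    case True
    then have "?W z * h z = (z - \<nu>) ^ n * k z"
      using h(2)[of z] r(3)[of z] by auto
    then show ?thesis
      using W[OF True] that True by (simp add: h'_def field_simps)
  qed (auto simp: h'_def)
  have "h' holomorphic_on ?B"
    by (rule holomorphic_transform[of "\<lambda>z. k z / ?W z"])
      (use W r(2) in \<open>auto simp: h'_def intro!: holomorphic_intros intro: holomorphic_on_subset\<close>)
  moreover have "h' holomorphic_on (- {\<nu>})"
    by (rule holomorphic_transform[of "\<lambda>z. h z / (z - \<nu>) ^ n"])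
      (use * h(1) in \<open>auto intro!: holomorphic_intros intro: holomorphic_on_subset\<close>)
  ultimately have "h' holomorphic_on (?B \<union> - {\<nu>})"
    by (intro holomorphic_on_Un) auto
  moreover have "?B \<union> - {\<nu>} = UNIV"
    using r(1) r'(1) by auto
  moreover have "g z = (\<Prod>\<mu>\<in>insert \<nu> S. (z - \<mu>) ^ n) * h' z" for z
  proof (cases "z = \<nu>")
    case True
    then have "z \<in> ?B" using r(1) r'(1) by simp
    then show ?thesis
      using True r(3)[of z] W[of z] insert by (auto simp: h'_def)
  next
    case False
    then show ?thesis
      using insert h(2)[of z] * by auto
  qed
  ultimately show ?case by metis
qed

lemma summable_norm_fps:
  fixes f :: "complex fps"
  assumes "fps_conv_radius f = \<infinity>" "\<And>k. norm (x k) \<le> C * R ^ k" "R \<ge> 0"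
  shows "summable (\<lambda>k. fps_nth f k * x k)"
proof (rule summable_norm_cancel, rule entire_coeffs_bound[OF _ assms(2,3)])
  show "entire_coeffs (fps_nth f)"
    unfolding entire_coeffs_def
  proof (intro allI impI)
    fix R :: real assume "R \<ge> 0"
    then have "summable (\<lambda>k. norm (fps_nth f k * of_real R ^ k))"
      using assms(1) by (intro abs_summable_in_conv_radius) (auto simp: fps_conv_radius_def)
    then show "summable (\<lambda>k. norm (fps_nth f k) * R ^ k)"
      using \<open>R \<ge> 0\<close> by (simp add: norm_mult norm_power)
  qed
qed

lemma fps_conv_radius_entire:
  assumes "entire_coeffs (a :: nat \<Rightarrow> complex)"
  shows "fps_conv_radius (Abs_fps a) = \<infinity>"
  unfolding fps_conv_radius_def
proof (rule conv_radius_inftyI'')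
  fix z :: complex
  have "summable (\<lambda>n. norm (a n) * norm z ^ n)"
    using assms unfolding entire_coeffs_def by (rule allE[of _ "norm z"]) auto
  then show "summable (\<lambda>n. fps_nth (Abs_fps a) n * z ^ n)"
    by (intro summable_norm_cancel[of "\<lambda>n. _ n * z ^ n"]) (simp add: norm_mult norm_power)
qed

text \<open>Both sides are values of the functional \<open>z\<^sup>k \<mapsto> x\<^sub>k\<close>, extended to power series.\<close>

lemma poly_times_fps_sums:
  fixes p :: "complex poly" and f :: "complex fps"
  assumes "\<And>j. (\<lambda>k. fps_nth f k * x (k + j)) sums y j"
  shows "(\<lambda>k. fps_nth (fps_of_poly p * f) k * x k) sums (\<Sum>j\<le>Polynomial.degree p. Polynomial.coeff p j * y j)"
proof -
  have "(\<lambda>k. if k < j then 0 else fps_nth f (k - j) * x k) sums y j" for j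
    using sums_iff_shift'[of "\<lambda>k. if k < j then 0 else fps_nth f (k - j) * x k" j "y j"] assms[of j] by simp
  then have "(\<lambda>k. \<Sum>j\<le>Polynomial.degree p. Polynomial.coeff p j * (if k < j then 0 else fps_nth f (k - j) * x k)) sums
      (\<Sum>j\<le>Polynomial.degree p. Polynomial.coeff p j * y j)"
    by (intro sums_sum sums_mult)
  also have "(\<lambda>k. \<Sum>j\<le>Polynomial.degree p. Polynomial.coeff p j * (if k < j then 0 else fps_nth f (k - j) * x k)) =
      (\<lambda>k. fps_nth (fps_of_poly p * f) k * x k)"
  proof
    fix k
    have "(\<Sum>j\<le>Polynomial.degree p. Polynomial.coeff p j * (if k < j then 0 else fps_nth f (k - j) * x k)) =
        (\<Sum>j\<in>{..degree p} \<inter> {..k}. Polynomial.coeff p j * fps_nth f (k - j) * x k)"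
      by (intro sum.mono_neutral_cong_right) (auto simp: mult.assoc)
    also have "\<dots> = (\<Sum>j\<le>k. Polynomial.coeff p j * fps_nth f (k - j) * x k)"
      by (intro sum.mono_neutral_left) (auto simp: coeff_eq_0)
    finally show "(\<Sum>j\<le>Polynomial.degree p. Polynomial.coeff p j * (if k < j then 0 else fps_nth f (k - j) * x k)) =
        fps_nth (fps_of_poly p * f) k * x k"
      by (simp add: fps_mult_nth atLeast0AtMost sum_distrib_right)
  qed
  finally show ?thesis .
qed

text \<open>The order of a root is at most the degree and thus at most \<open>n\<close>, so raising
  all orders to \<open>n\<close> only adds a cofactor. This permits one uniform order at all
  eigenvalues, as in \<open>interpolates\<close>.\<close>

lemma poly_eq_prod_order_le:
  fixes P :: "complex poly"
  assumes "P \<noteq> 0" "Polynomial.degree P \<le> n"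
  shows "\<exists>W. (\<Prod>\<mu> | poly P \<mu> = 0. [:- \<mu>, 1:] ^ n) = P * W"
proof -
  have "Polynomial.order \<mu> P \<le> n" for \<mu>
    using order_degree[OF assms(1)] assms(2) by (meson order_trans)
  then have "[:- \<mu>, 1:] ^ n = [:- \<mu>, 1:] ^ Polynomial.order \<mu> P * [:- \<mu>, 1:] ^ (n - Polynomial.order \<mu> P)" for \<mu>
    by (simp flip: power_add)
  then have "(\<Prod>\<mu> | poly P \<mu> = 0. [:- \<mu>, 1:] ^ n) =
      (\<Prod>\<mu> | poly P \<mu> = 0. [:- \<mu>, 1:] ^ Polynomial.order \<mu> P) * (\<Prod>\<mu> | poly P \<mu> = 0. [:- \<mu>, 1:] ^ (n - Polynomial.order \<mu> P))"
    by (simp flip: prod.distrib)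
  also have "\<dots> = P * Polynomial.smult (inverse (Polynomial.lead_coeff P)) (\<Prod>\<mu> | poly P \<mu> = 0. [:- \<mu>, 1:] ^ (n - Polynomial.order \<mu> P))"
    using assms(1) complex_poly_decompose[of P]
    by (metis (no_types, lifting) leading_coeff_0_iff left_inverse mult_smult_left mult_smult_right smult_1_left smult_smult)
  finally show ?thesis by blast
qed

text \<open>If \<open>g\<close> vanishes on the roots of \<open>P\<close> to sufficiently high order, then \<open>P\<close> divides \<open>g\<close> among the entire
  functions; so a functional that annihilates the multiples of \<open>P\<close> annihilates \<open>g\<close>.\<close>

lemma annihilated_series:
  fixes P :: "complex poly" and g :: "complex fps"
  assumes "P \<noteq> 0" "Polynomial.degree P \<le> n" "fps_conv_radius g = \<infinity>"
    and z: "\<And>\<mu>. poly P \<mu> = 0 \<Longrightarrow>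
      \<exists>r>0. \<exists>h. h holomorphic_on ball \<mu> r \<and> (\<forall>z\<in>ball \<mu> r. eval_fps g z = (z - \<mu>) ^ n * h z)"
    and x: "\<And>k. norm (x k) \<le> C * R ^ k" "R \<ge> 0"
    and P: "\<And>k. (\<Sum>j\<le>Polynomial.degree P. Polynomial.coeff P j * x (k + j)) = 0"
  shows "(\<lambda>k. fps_nth g k * x k) sums 0"
proof -
  have "eval_fps g holomorphic_on UNIV"
    using holomorphic_on_eval_fps[of UNIV g] assms(3) by auto
  then obtain h where h: "h holomorphic_on UNIV" "\<And>z. eval_fps g z = (\<Prod>\<mu> | poly P \<mu> = 0. (z - \<mu>) ^ n) * h z"
    using entire_divide_zeros[OF poly_roots_finite[OF assms(1)] _ z] by blast
  obtain W where W: "(\<Prod>\<mu> | poly P \<mu> = 0. [:- \<mu>, 1:] ^ n) = P * W"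
    using poly_eq_prod_order_le[OF assms(1,2)] by blast
  define f where "f = fps_expansion (\<lambda>z. poly W z * h z) 0"
  have hol: "(\<lambda>z. poly W z * h z) holomorphic_on UNIV"
    using h(1) by (intro holomorphic_intros) auto
  have rad: "fps_conv_radius f = \<infinity>"
    using conv_radius_fps_expansion[of "\<lambda>z. poly W z * h z" 0 \<infinity>] hol by (auto simp: f_def)
  have ev: "eval_fps f z = poly W z * h z" for z
    using eval_fps_expansion[of "\<lambda>z. poly W z * h z" 0 \<infinity> z] hol by (auto simp: f_def)
  have g: "g = fps_of_poly P * f"
  proof (rule eval_fps_eqD)
    have rad': "fps_conv_radius (fps_of_poly P * f) = \<infinity>"
      using fps_conv_radius_mult[of "fps_of_poly P" f] rad by simp
    then show "fps_conv_radius g > 0" "fps_conv_radius (fps_of_poly P * f) > 0"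
      using assms(3) by auto
    have "eval_fps g z = eval_fps (fps_of_poly P * f) z" for z
    proof -
      have "eval_fps g z = poly (\<Prod>\<mu> | poly P \<mu> = 0. [:- \<mu>, 1:] ^ n) z * h z"
        unfolding h(2) by (simp add: poly_prod)
      then show ?thesis
        unfolding W by (simp add: eval_fps_mult rad ev mult.assoc)
    qed
    then show "\<forall>\<^sub>F z in nhds 0. eval_fps g z = eval_fps (fps_of_poly P * f) z"
      by simp
  qed
  have "summable (\<lambda>k. fps_nth f k * x (k + j))" for j
  proof (rule summable_norm_fps[OF rad _ x(2)])
    show "norm (x (k + j)) \<le> (C * R ^ j) * R ^ k" for k
      using x(1)[of "k + j"] by (simp add: power_add mult_ac)
  qed
  then have s: "(\<lambda>k. fps_nth f k * x (k + j)) sums (\<Sum>k. fps_nth f k * x (k + j))" for j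
    by (rule summable_sums)
  have "(\<lambda>k. \<Sum>j\<le>Polynomial.degree P. Polynomial.coeff P j * (fps_nth f k * x (k + j))) sums
      (\<Sum>j\<le>Polynomial.degree P. Polynomial.coeff P j * (\<Sum>k. fps_nth f k * x (k + j)))"
    by (intro sums_sum sums_mult s)
  moreover have "(\<Sum>j\<le>Polynomial.degree P. Polynomial.coeff P j * (fps_nth f k * x (k + j))) = 0" for k
    using P[of k] by (simp add: mult.left_commute[of _ "fps_nth f k"] flip: sum_distrib_left)
  ultimately have "(\<Sum>j\<le>Polynomial.degree P. Polynomial.coeff P j * (\<Sum>k. fps_nth f k * x (k + j))) = 0"
    by (simp add: sums_iff)
  then show ?thesis
    using poly_times_fps_sums[OF s, of P] g by simp
qed

section \<open>Spectrum and functional calculus\<close>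

lemma to_complex_of_real: "to_complex (r *\<^sub>R x) = of_real r * to_complex (x :: 'k::real_or_complex)"
  using to_complex_mult[of "r *\<^sub>R (1::'k)" x] by (simp add: to_complex_scaleR_one)

lemma bounded_linear_to_complex: "bounded_linear (to_complex :: 'k::real_or_complex \<Rightarrow> complex)"
proof (rule bounded_linear_intro[of _ 1])
  show "to_complex (r *\<^sub>R x) = r *\<^sub>R to_complex x" for r and x :: 'k
    by (subst to_complex_of_real, subst scaleR_conv_of_real, rule refl)
qed (simp_all add: to_complex_add norm_to_complex)

lemmas to_complex_sums = bounded_linear.sums[OF bounded_linear_to_complex]

lemma to_complex_1 [simp]: "to_complex (1 :: 'k::real_or_complex) = 1"
  using to_complex_scaleR_one[of 1, where 'a = 'k] by simp

lemma to_complex_0 [simp]: "to_complex (0 :: 'k::real_or_complex) = 0"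
  using to_complex_add[of "0 :: 'k" 0] by simp

lemma to_complex_diff: "to_complex (x - y) = to_complex x - to_complex (y :: 'k::real_or_complex)"
  using to_complex_add[of "x - y" y] by simp

lemma to_complex_sum: "to_complex (\<Sum>i\<in>A. f i) = (\<Sum>i\<in>A. to_complex (f i :: 'k::real_or_complex))"
  by (induction A rule: infinite_finite_induct) (auto simp: to_complex_add)

lemma to_complex_eq_iff [simp]: "to_complex x = to_complex y \<longleftrightarrow> x = (y :: 'k::real_or_complex)"
  using norm_to_complex[of "x - y"] by (auto simp: to_complex_diff)

lemma to_complex_eq_0_iff [simp]: "to_complex x = 0 \<longleftrightarrow> x = (0 :: 'k::real_or_complex)"
  using to_complex_eq_iff[of x 0] by simp

text \<open>A single value with nonzero imaginary part spans, together with 1, the complex plane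
  over the reals; nothing lies between the two cases.\<close>

lemma real_or_complex_cases:
  obtains (real) "\<And>x :: 'k::real_or_complex. cnj (to_complex x) = to_complex x"
    | (complex) "surj (to_complex :: 'k \<Rightarrow> complex)"
proof (cases "\<forall>x :: 'k. cnj (to_complex x) = to_complex x")
  case False
  then obtain x :: 'k where x: "Im (to_complex x) \<noteq> 0"
    by (auto simp: complex_eq_iff)
  have "\<exists>y :: 'k. to_complex y = z" for z
  proof
    let ?s = "Im z / Im (to_complex x)"
    show "to_complex ((Re z - ?s * Re (to_complex x)) *\<^sub>R 1 + ?s *\<^sub>R x) = z"
      using x by (auto simp: to_complex_add to_complex_of_real complex_eq_iff)
  qed
  then show ?thesis
    using complex by (metis surj_def)
qed blast

context vector_space
begin

lemma independent_sequence:
  fixes f :: "nat \<Rightarrow> 'b"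
  assumes "\<And>k. k < m \<Longrightarrow> f k \<notin> span (f ` {..<k})"
  shows "independent (f ` {..<m}) \<and> inj_on f {..<m}"
  using assms
proof (induction m)
  case 0
  then show ?case by (simp add: independent_empty)
next
  case (Suc m)
  have "f m \<notin> f ` {..<m}"
    using Suc.prems[of m] span_base[of "f m" "f ` {..<m}"] by auto
  moreover have "independent (insert (f m) (f ` {..<m}))"
    using Suc by (intro independent_insertI) auto
  ultimately show ?case
    using Suc by (auto simp: lessThan_Suc)
qed

end

section \<open>Minimal polynomials, eigenvalues and invertibility of operator series\<close>

context coord_space
begin

lemma span_e: "span (e ` {..<n}) = V"
proof
  show "span (e ` {..<n}) \<subseteq> V"
    using subspace_V by (intro span_minimal) (auto simp: e_in)
  show "V \<subseteq> span (e ` {..<n})"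
  proof
    fix v assume "v \<in> V"
    then have "v = (\<Sum>i<n. sc (c i v) (e i))"
      by (simp add: expand)
    also have "\<dots> \<in> span (e ` {..<n})"
      by (intro span_sum span_scale span_base) auto
    finally show "v \<in> span (e ` {..<n})" .
  qed
qed

lemma independent_e: "independent (e ` {..<n})" "inj_on e {..<n}"
proof -
  show inj: "inj_on e {..<n}"
    by (rule inj_onI) (use c_e in \<open>metis lessThan_iff zero_neq_one\<close>)
  show "independent (e ` {..<n})"
  proof
    assume "dependent (e ` {..<n})"
    then obtain u i where u: "(\<Sum>v\<in>e ` {..<n}. sc (u v) v) = 0" "i < n" "u (e i) \<noteq> 0"
      by (subst (asm) dependent_finite) auto
    have "combine (\<lambda>i. u (e i)) = 0"
      using u(1) inj by (simp add: combine_def sum.reindex)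
    then show False
      using c_combine[OF u(2), of "\<lambda>i. u (e i)"] u by simp
  qed
qed

lemma dim_V: "dim V = n"
proof -
  have "span V = V"
    using subspace_V by (simp add: span_eq_iff)
  from trans[OF span_e this[symmetric]] have "dim V = card (e ` {..<n})"
    by (rule dim_eq_card[OF _ independent_e(1)])
  then show ?thesis
    using independent_e(2) by (simp add: card_image)
qed

lemma finite_independent:
  assumes "independent S" "S \<subseteq> V"
  shows "finite S" "card S \<le> n"
  using independent_span_bound[of "e ` {..<n}" S] assms span_e independent_e(2)
  by (auto simp: card_image)

lemma extend_basis:
  assumes "S \<subseteq> V" "independent S"
  obtains B where "S \<subseteq> B" "finite B" "independent B" "span B = V"
proof -
  obtain B where B: "S \<subseteq> B" "B \<subseteq> V" "independent B" "V \<subseteq> span B"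
    using maximal_independent_subset_extend[OF assms] by metis
  have "span B = V"
    using B span_minimal[OF B(2) subspace_V] by auto
  with B show ?thesis
    using finite_independent(1) that by blast
qed

lemma functional_representation:
  assumes "independent B" "span B = V"
  shows "functional (\<lambda>x. representation B x b)"
  using assms by (auto simp: linear_between_def representation_add representation_scale)

text \<open>The first iterate of \<open>v\<close> that depends on the earlier ones yields the
  minimal polynomial of \<open>A\<close> at the single vector \<open>v\<close>. More than
  \<open>n\<close> independent iterates would exceed the dimension.\<close>

lemma minimal_polynomial:
  assumes A: "lin A" and v: "v \<in> V"
  obtains m p where "m \<le> n" "independent ((\<lambda>k. (A ^^ k) v) ` {..<m})" "inj_on (\<lambda>k. (A ^^ k) v) {..<m}"
    "(A ^^ m) v = (\<Sum>k<m. sc (p k) ((A ^^ k) v))" "v = 0 \<or> m > 0"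
proof -
  let ?f = "\<lambda>k. (A ^^ k) v"
  have ex: "\<exists>m\<le>n. ?f m \<in> span (?f ` {..<m})"
  proof (rule ccontr)
    assume "\<not> ?thesis"
    then have "?f k \<notin> span (?f ` {..<k})" if "k < Suc n" for k
      using that by auto
    from independent_sequence[OF this] have "independent (?f ` {..<Suc n})" "inj_on ?f {..<Suc n}"
      by auto
    moreover have "?f ` {..<Suc n} \<subseteq> V"
      using A v by auto
    ultimately show False
      using finite_independent(2)[of "?f ` {..<Suc n}"] card_image[of ?f "{..<Suc n}"] by simp
  qed
  define m where "m = (LEAST m. ?f m \<in> span (?f ` {..<m}))"
  have m: "?f m \<in> span (?f ` {..<m})" "m \<le> n"
    unfolding m_def using ex by (auto intro: LeastI2 Least_le order_trans)
  have *: "independent (?f ` {..<m})" "inj_on ?f {..<m}"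
    using independent_sequence[of m ?f] not_less_Least[of _ "\<lambda>m. ?f m \<in> span (?f ` {..<m})"]
    unfolding m_def by auto
  obtain u where "?f m = (\<Sum>w\<in>?f ` {..<m}. sc (u w) w)"
    using m(1) by (auto simp: span_finite)
  then have "?f m = (\<Sum>k<m. sc (u (?f k)) (?f k))"
    using *(2) by (simp add: sum.reindex)
  moreover have "v = 0 \<or> m > 0"
    using m(1) by (cases "m = 0") auto
  ultimately show ?thesis
    using that[OF m(2) *, of "\<lambda>k. u (?f k)"] by simp
qed

text \<open>The monic polynomial annihilating \<open>v\<close>, with coefficients moved to the
  complex numbers, where it has roots.\<close>

definition min_poly :: "nat \<Rightarrow> (nat \<Rightarrow> 'k) \<Rightarrow> complex poly" where
  "min_poly m p = Polynomial.monom 1 m - (\<Sum>k<m. Polynomial.monom (to_complex (p k)) k)"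

lemma coeff_min_poly:
  "poly.coeff (min_poly m p) k = (if k = m then 1 else if k < m then - to_complex (p k) else 0)"
proof -
  have "poly.coeff (\<Sum>k<m. Polynomial.monom (to_complex (p k)) k) j = (if j < m then to_complex (p j) else 0)" for j
    by (simp add: coeff_sum Polynomial.coeff_monom)
  then show ?thesis
    by (simp add: min_poly_def Polynomial.coeff_monom)
qed

lemma degree_min_poly: "Polynomial.degree (min_poly m p) = m" "min_poly m p \<noteq> 0"
proof -
  show "Polynomial.degree (min_poly m p) = m"
    by (intro antisym Polynomial.degree_le le_degree) (auto simp: coeff_min_poly)
  show "min_poly m p \<noteq> 0"
    using coeff_min_poly[of m p m] by force
qed

text \<open>Applying \<open>A^l\<close> to the relation for \<open>A^m v\<close> gives a linear
  recurrence for the numbers \<open>f (A^k v)\<close>. This is the hypothesis under which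
  \<open>annihilated_series\<close> concludes.\<close>

lemma min_poly_annihilates:
  assumes "lin A" "v \<in> V" "functional f" "(A ^^ m) v = (\<Sum>k<m. sc (p k) ((A ^^ k) v))"
  shows "(\<Sum>j\<le>m. poly.coeff (min_poly m p) j * to_complex (f ((A ^^ (l + j)) v))) = 0"
proof -
  have "(A ^^ (l + m)) v = (A ^^ l) ((A ^^ m) v)"
    by (simp add: funpow_add)
  also have "\<dots> = (\<Sum>k<m. sc (p k) ((A ^^ l) ((A ^^ k) v)))"
    unfolding assms(4) using assms(1,2) by (intro lin_sum lin_pow) auto
  finally have "f ((A ^^ (l + m)) v) = (\<Sum>k<m. p k * f ((A ^^ (l + k)) v))"
    using functional_sum[OF assms(3), of "{..<m}" "\<lambda>k. (A ^^ (l + k)) v" p] assms(1,2)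
    by (simp add: funpow_add)
  then show ?thesis
    by (simp add: lessThan_Suc_atMost[symmetric] coeff_min_poly sum_negf to_complex_sum to_complex_mult
        cong: sum.cong_simp)
qed

text \<open>If the minimal polynomial at \<open>v\<close> is \<open>(z - \<mu>) Q\<close>, then
  \<open>Q(A) v\<close> is an eigenvector of the complexification for \<mu>. In a basis extending
  the iterates of \<open>v\<close> its coordinates are the coefficients of \<open>Q\<close>, and it
  is nonzero because \<open>Q\<close> is monic.\<close>

lemma root_in_spectrum:
  assumes A: "lin A" and v: "v \<in> V"
    and ind: "independent ((\<lambda>k. (A ^^ k) v) ` {..<m})" and inj: "inj_on (\<lambda>k. (A ^^ k) v) {..<m}"
    and p: "(A ^^ m) v = (\<Sum>k<m. sc (p k) ((A ^^ k) v))"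
    and root: "poly (min_poly m p) \<mu> = 0"
  obtains B Q where "finite B" "independent B" "span B = V" "m > 0" "Polynomial.degree Q = m - 1"
    "poly.coeff Q (m - 1) = 1" "min_poly m p = [:- \<mu>, 1:] * Q" "(\<lambda>k. (A ^^ k) v) ` {..<m} \<subseteq> B" "\<mu> \<in> spectrum sc V A"
proof -
  let ?f = "\<lambda>k. (A ^^ k) v"
  obtain Q where Q: "min_poly m p = [:- \<mu>, 1:] * Q"
    using root by (auto simp: poly_eq_0_iff_dvd)
  have Q0: "Q \<noteq> 0"
    using Q degree_min_poly(2)[of m p] by auto
  have "Polynomial.degree ([:- \<mu>, 1:] * Q) = Suc (Polynomial.degree Q)"
    using Q0 by (subst Polynomial.degree_mult_eq) auto
  then have m: "m = Suc (Polynomial.degree Q)"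
    using degree_min_poly(1)[of m p] Q by simp
  have coeff: "poly.coeff (min_poly m p) j = (if j = 0 then 0 else poly.coeff Q (j - 1)) - \<mu> * poly.coeff Q j" for j
    unfolding Q by (cases j) (auto simp: mult_pCons_left)
  have lead: "poly.coeff Q (m - 1) = 1"
    using coeff[of m] m by (simp add: coeff_min_poly coeff_eq_0)
  have fV: "?f ` {..<m} \<subseteq> V"
    using A v by auto
  obtain B where B: "?f ` {..<m} \<subseteq> B" "finite B" "independent B" "span B = V"
    using extend_basis[OF fV ind] .
  have fB: "?f k \<in> B" if "k < m" for k
    using B(1) that by auto
  have rep: "representation B (?f k) b = (if b = ?f k then 1 else 0)" if "k < m" for k b
    using representation_basis[OF B(3) fB[OF that]] by simp
  have rep_m: "representation B (?f m) b = (\<Sum>k<m. p k * (if b = ?f k then 1 else 0))" for b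
    unfolding p using functional_sum[OF functional_representation[OF B(3,4)], of "{..<m}" ?f p b] A v rep
    by simp
  \<comment> \<open>The coordinates of the eigenvector \<open>Q(A) v\<close>: the basis vector
    \<open>A^k v\<close> carries the coefficient of \<open>Q\<close> at \<open>k\<close>, all others
    carry 0.\<close>
  define d where "d = (\<lambda>b. if b \<in> ?f ` {..<m} then poly.coeff Q (the_inv_into {..<m} ?f b) else 0)"
  have d: "d (?f k) = poly.coeff Q k" if "k < m" for k
    using that the_inv_into_f_f[OF inj, of k] by (simp add: d_def)
  have sum_d: "(\<Sum>b'\<in>B. g b' * d b') = (\<Sum>k<m. g (?f k) * poly.coeff Q k)" for g
  proof -
    have "(\<Sum>b'\<in>B. g b' * d b') = (\<Sum>b'\<in>?f ` {..<m}. g b' * d b')"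
      using B(1,2) by (intro sum.mono_neutral_right) (auto simp: d_def)
    then show ?thesis
      using inj d by (simp add: sum.reindex)
  qed
  have eig: "(\<Sum>b'\<in>B. to_complex (representation B (A b') b) * d b') = \<mu> * d b" if "b \<in> B" for b
  proof -
    have "(\<Sum>b'\<in>B. to_complex (representation B (A b') b) * d b') =
        (\<Sum>k<m. to_complex (representation B (?f (Suc k)) b) * poly.coeff Q k)"
      unfolding sum_d by simp
    also have "\<dots> = (\<Sum>k<m - 1. (if b = ?f (Suc k) then 1 else 0) * poly.coeff Q k) + to_complex (representation B (?f m) b)"
    proof -
      have "(\<Sum>k<m. to_complex (representation B (?f (Suc k)) b) * poly.coeff Q k) =
          (\<Sum>k<m - 1. to_complex (representation B (?f (Suc k)) b) * poly.coeff Q k)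
          + to_complex (representation B (?f m) b)"
        using lead m by simp
      also have "(\<Sum>k<m - 1. to_complex (representation B (?f (Suc k)) b) * poly.coeff Q k) =
          (\<Sum>k<m - 1. (if b = ?f (Suc k) then 1 else 0) * poly.coeff Q k)"
        by (intro sum.cong refl) (subst rep, auto)
      finally show ?thesis .
    qed
    also have "\<dots> = \<mu> * d b"
    proof (cases "b \<in> ?f ` {..<m}")
      case True
      then obtain j where j: "j < m" "b = ?f j" by auto
      have eq: "b = ?f k \<longleftrightarrow> k = j" if "k < m" for k
        using inj j that by (auto simp: inj_on_def)
      have "to_complex (representation B (?f m) b) = to_complex (p j)"
        unfolding rep_m using j(1) by (subst sum.cong[OF refl, of _ _ "\<lambda>k. if k = j then p k else 0"]) (auto simp: eq)
      moreover have "(\<Sum>k<m - 1. (if b = ?f (Suc k) then 1 else 0) * poly.coeff Q k) = (if j = 0 then 0 else poly.coeff Q (j - 1))"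
      proof -
        have "(\<Sum>k<m - 1. (if b = ?f (Suc k) then 1 else 0) * poly.coeff Q k) =
            (\<Sum>k<m - 1. if Suc k = j then poly.coeff Q k else 0)"
        proof (intro sum.cong refl)
          fix k assume "k \<in> {..<m - 1}"
          then have "b = ?f (Suc k) \<longleftrightarrow> Suc k = j"
            by (intro eq) auto
          then show "(if b = ?f (Suc k) then 1 else 0) * poly.coeff Q k = (if Suc k = j then poly.coeff Q k else 0)"
            by (simp del: funpow.simps)
        qed
        also have "\<dots> = (if j = 0 then 0 else poly.coeff Q (j - 1))"
        proof (cases j)
          case (Suc i)
          then show ?thesis using j(1) by simp
        qed simp
        finally show ?thesis .
      qed
      moreover have "(if j = 0 then 0 else poly.coeff Q (j - 1)) + to_complex (p j) = \<mu> * poly.coeff Q j"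
        using coeff[of j] j(1) by (simp add: coeff_min_poly algebra_simps)
      ultimately show ?thesis
        using d j by simp
    next
      case False
      then have "b \<noteq> ?f k" if "k < m" for k
        using that by auto
      moreover from this have "b \<noteq> ?f (Suc k)" if "k < m - 1" for k
        using that by (metis Suc_lessI add_lessD1 less_diff_conv plus_1_eq_Suc add.commute)
      ultimately show ?thesis
        using False by (simp add: rep_m d_def)
    qed
    finally show ?thesis .
  qed
  have "\<exists>b\<in>B. d b \<noteq> 0"
    using fB[of "m - 1"] d[of "m - 1"] lead m by (intro bexI[of _ "?f (m - 1)"]) auto
  then have "\<mu> \<in> spectrum sc V A"
    using B eig unfolding spectrum_def by blast
  with B Q lead m that show ?thesis by auto
qed

definition scalar_fun :: "(nat \<Rightarrow> 'k) \<Rightarrow> complex \<Rightarrow> complex" where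
  "scalar_fun a z = (\<Sum>k. to_complex (a k) * z ^ k)"

lemma scalar_fun_sums:
  assumes "entire_coeffs a"
  shows "(\<lambda>k. to_complex (a k) * z ^ k) sums scalar_fun a z"
proof -
  have "summable (\<lambda>k. norm (a k) * norm z ^ k)"
    using assms unfolding entire_coeffs_def by simp
  then have "summable (\<lambda>k. norm (to_complex (a k) * z ^ k))"
    by (simp add: norm_mult norm_power norm_to_complex)
  then have "summable (\<lambda>k. to_complex (a k) * z ^ k)"
    by (rule summable_norm_cancel)
  then show ?thesis
    by (simp add: scalar_fun_def summable_sums)
qed

text \<open>For \<open>v\<close> nonzero take a root \<mu> of its minimal polynomial
  \<open>(z - \<mu>) Q\<close> and let \<open>f\<close> read off the coefficient of the last
  independent iterate. Applying \<open>f\<close> to \<open>Q(A) a(A) v\<close> gives the scalar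
  value of the series at \<mu>, which would have to vanish.\<close>

lemma inj_if_spectrum:
  assumes A: "lin A" and a: "entire_coeffs a"
    and nz: "\<And>\<mu>. \<mu> \<in> spectrum sc V A \<Longrightarrow> scalar_fun a \<mu> \<noteq> 0"
    and v: "v \<in> V" "opser a A v = 0"
  shows "v = 0"
proof (rule ccontr)
  assume "v \<noteq> 0"
  obtain m p where mp: "m \<le> n" "independent ((\<lambda>k. (A ^^ k) v) ` {..<m})" "inj_on (\<lambda>k. (A ^^ k) v) {..<m}"
    "(A ^^ m) v = (\<Sum>k<m. sc (p k) ((A ^^ k) v))" "v = 0 \<or> m > 0"
    using minimal_polynomial[OF A v(1)] .
  have "m > 0"
    using mp(5) \<open>v \<noteq> 0\<close> by simp
  note m = mp(2-4) this
  have "\<not> constant (poly (min_poly m p))"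
    using m(4) by (simp add: constant_degree degree_min_poly)
  then obtain \<mu> where root: "poly (min_poly m p) \<mu> = 0"
    using fundamental_theorem_of_algebra by blast
  obtain B Q where BQ': "finite B" "independent B" "span B = V" "m > 0" "Polynomial.degree Q = m - 1"
    "poly.coeff Q (m - 1) = 1" "min_poly m p = [:- \<mu>, 1:] * Q" "(\<lambda>k. (A ^^ k) v) ` {..<m} \<subseteq> B" "\<mu> \<in> spectrum sc V A"
    using root_in_spectrum[OF A v(1) m(1-3) root] .
  note BQ = BQ'(2,3,8,9,5-7)
  define f where "f = (\<lambda>x. representation B x ((A ^^ (m - 1)) v))"
  have f: "functional f"
    unfolding f_def by (rule functional_representation[OF BQ(1,2)])
  \<comment> \<open>\<open>y k\<close> is \<open>f\<close> at \<open>A^k Q(A) v\<close>. Since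
    \<open>Q(A) v\<close> is an eigenvector for \<mu> and \<open>Q\<close> is monic, it equals
    \<open>\<mu>^k\<close>.\<close>
  define y where "y = (\<lambda>k. \<Sum>j<m. poly.coeff Q j * to_complex (f ((A ^^ (k + j)) v)))"
  have coeff: "poly.coeff (min_poly m p) j = (if j = 0 then 0 else poly.coeff Q (j - 1)) - \<mu> * poly.coeff Q j" for j
    unfolding BQ(7) by (cases j) (auto simp: mult_pCons_left)
  have ystep: "y (Suc k) = \<mu> * y k" for k
  proof -
    let ?t = "\<lambda>j. to_complex (f ((A ^^ (k + j)) v))"
    have "0 = (\<Sum>j<Suc m. ((if j = 0 then 0 else poly.coeff Q (j - 1)) - \<mu> * poly.coeff Q j) * ?t j)"
      using min_poly_annihilates[OF A v(1) f m(3), of k] by (simp add: coeff lessThan_Suc_atMost)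
    also have "\<dots> = (\<Sum>j<Suc m. (if j = 0 then 0 else poly.coeff Q (j - 1)) * ?t j) - (\<Sum>j<Suc m. \<mu> * poly.coeff Q j * ?t j)"
      by (simp only: left_diff_distrib sum_subtractf)
    also have "(\<Sum>j<Suc m. (if j = 0 then 0 else poly.coeff Q (j - 1)) * ?t j) = y (Suc k)"
      by (subst sum.lessThan_Suc_shift) (simp add: y_def)
    also have "(\<Sum>j<Suc m. \<mu> * poly.coeff Q j * ?t j) = \<mu> * y k"
      using BQ(5) m(4) by (simp add: y_def sum_distrib_left mult.assoc coeff_eq_0)
    finally show ?thesis by simp
  qed
  have "f ((A ^^ j) v) = (if j = m - 1 then 1 else 0)" if "j < m" for j
  proof -
    have "(A ^^ (m - 1)) v = (A ^^ j) v \<longleftrightarrow> j = m - 1"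
      using inj_on_eq_iff[OF m(2), of "m - 1" j] m(4) that by auto
    moreover have "(A ^^ j) v \<in> B"
      using BQ(3) that by auto
    ultimately show ?thesis
      unfolding f_def using representation_basis[OF BQ(1)] by simp
  qed
  then have "y 0 = (\<Sum>j<m. if j = m - 1 then poly.coeff Q j else 0)"
    unfolding y_def by (intro sum.cong refl) auto
  then have y0: "y 0 = 1"
    using m(4) BQ(6) by simp
  have y: "y k = \<mu> ^ k" for k
    by (induction k) (auto simp: y0 ystep)
  have "(\<lambda>k. to_complex (a k * f ((A ^^ k) ((A ^^ j) v)))) sums to_complex (f ((A ^^ j) (opser a A v)))" for j
  proof -
    have "opser a A ((A ^^ j) v) = (A ^^ j) (opser a A v)"
      by (rule opser_commute[symmetric, OF a A lin_pow[OF A] _ v(1)])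
        (metis funpow_swap1)
    then show ?thesis
      using to_complex_sums[OF opser_functional[OF a f A, of "(A ^^ j) v"]] A v(1) by simp
  qed
  moreover have "f ((A ^^ j) (opser a A v)) = 0" for j
    using v lin_D(4)[OF lin_pow[OF A]] functional_D(3)[OF f] by simp
  ultimately have "(\<lambda>k. \<Sum>j<m. poly.coeff Q j * to_complex (a k * f ((A ^^ (k + j)) v))) sums (\<Sum>j<m. poly.coeff Q j * 0)"
    by (intro sums_sum sums_mult) (simp add: funpow_add)
  moreover have "(\<Sum>j<m. poly.coeff Q j * to_complex (a k * f ((A ^^ (k + j)) v))) = to_complex (a k) * \<mu> ^ k" for k
    unfolding y[symmetric] y_def sum_distrib_left by (intro sum.cong refl) (simp add: to_complex_mult)
  ultimately have "scalar_fun a \<mu> = 0"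
    using sums_unique2[OF scalar_fun_sums[OF a]] by simp
  then show False
    using nz BQ(4) by blast
qed

text \<open>The action of the complexification of \<open>T\<close> on the vector with coordinates \<open>d\<close> in the basis \<open>B\<close>.\<close>

definition cmult :: "'w set \<Rightarrow> ('w \<Rightarrow> 'w) \<Rightarrow> ('w \<Rightarrow> complex) \<Rightarrow> 'w \<Rightarrow> complex" where
  "cmult B T d b = (\<Sum>b'\<in>B. to_complex (representation B (T b') b) * d b')"

lemma cmult_comp:
  assumes "finite B" "independent B" "span B = V" "lin S" "lin T"
  shows "cmult B (\<lambda>x. S (T x)) d b = cmult B S (cmult B T d) b"
proof -
  have "representation B (S x) b = (\<Sum>b''\<in>B. representation B x b'' * representation B (S b'') b)" if "x \<in> V" for x
  proof -
    have "x = (\<Sum>b''\<in>B. sc (representation B x b'') b'')"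
      using sum_representation_eq[OF assms(2) _ assms(1) order_refl, of x] that assms(3) by simp
    then have "representation B (S x) b = representation B (S (\<Sum>b''\<in>B. sc (representation B x b'') b'')) b"
      by simp
    also have "\<dots> = (\<Sum>b''\<in>B. representation B x b'' * representation B (S b'') b)"
      using span_base assms(3)
      by (intro functional_sum[OF functional_comp[OF functional_representation[OF assms(2,3)] assms(4)]]) auto
    finally show ?thesis .
  qed
  moreover have "T b' \<in> V" if "b' \<in> B" for b'
    using lin_D(1)[OF assms(5)] span_base[OF that] assms(3) by blast
  ultimately have "cmult B (\<lambda>x. S (T x)) d b =
      (\<Sum>b'\<in>B. \<Sum>b''\<in>B. to_complex (representation B (T b') b'') * to_complex (representation B (S b'') b) * d b')"
    unfolding cmult_def by (intro sum.cong refl) (simp add: to_complex_sum to_complex_mult sum_distrib_right)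
  also have "\<dots> = cmult B S (cmult B T d) b"
    unfolding cmult_def sum_distrib_left by (subst sum.swap) (simp add: mult_ac)
  finally show ?thesis .
qed

text \<open>An eigenvector of \<open>A\<close> for \<mu> is one of \<open>a(A)\<close> for the
  scalar value at \<mu>. If this value were 0, the complexified inverse \<open>R\<close> would
  recover the eigenvector from 0.\<close>

lemma spectrum_nonzero_if_bij:
  assumes A: "lin A" and a: "entire_coeffs a" and bij: "bij_betw (opser a A) V V"
    and \<mu>: "\<mu> \<in> spectrum sc V A"
  shows "scalar_fun a \<mu> \<noteq> 0"
proof
  assume z: "scalar_fun a \<mu> = 0"
  obtain B d where B: "finite B" "independent B" "span B = V" and d: "\<exists>b\<in>B. d b \<noteq> 0"
    and eig: "\<And>b. b \<in> B \<Longrightarrow> cmult B A d b = \<mu> * d b"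
    using \<mu> unfolding spectrum_def cmult_def by blast
  have BV: "b \<in> V" if "b \<in> B" for b
    using span_base[OF that] B(3) by blast
  have pow: "cmult B (A ^^ k) d b = \<mu> ^ k * d b" if "b \<in> B" for k b
    using that
  proof (induction k arbitrary: b)
    case 0
    then show ?case
      unfolding cmult_def using B(1)
      by (subst sum.cong[OF refl, of _ _ "\<lambda>b'. if b = b' then d b' else 0"])
        (auto simp: representation_basis[OF B(2)])
  next
    case (Suc k)
    have "cmult B (A ^^ Suc k) d b = cmult B A (cmult B (A ^^ k) d) b"
      using cmult_comp[OF B A lin_pow[OF A], of k d b] by (simp add: comp_def)
    also have "\<dots> = cmult B A (\<lambda>b. \<mu> ^ k * d b) b"
      unfolding cmult_def[of B A] using Suc.IH by (intro sum.cong refl) simp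
    also have "\<dots> = \<mu> ^ k * cmult B A d b"
      by (simp add: cmult_def sum_distrib_left mult.left_commute)
    finally show ?case
      by (simp add: eig[OF Suc.prems] mult_ac comp_def)
  qed
  have S0: "cmult B (opser a A) d b = 0" if "b \<in> B" for b
  proof -
    have "(\<lambda>k. \<Sum>b'\<in>B. to_complex (a k * representation B ((A ^^ k) b') b) * d b') sums cmult B (opser a A) d b"
      unfolding cmult_def
      by (intro sums_sum sums_mult2 to_complex_sums opser_functional[OF a functional_representation[OF B(2,3)] A] BV)
    moreover have "(\<Sum>b'\<in>B. to_complex (a k * representation B ((A ^^ k) b') b) * d b') = to_complex (a k) * \<mu> ^ k * d b" for k
      using pow[OF that, of k] unfolding cmult_def
      by (simp add: to_complex_mult mult.assoc flip: sum_distrib_left)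
    ultimately have "(\<lambda>k. to_complex (a k) * \<mu> ^ k * d b) sums cmult B (opser a A) d b"
      by simp
    then show ?thesis
      using sums_unique2[OF sums_mult2[OF scalar_fun_sums[OF a]]] z by fastforce
  qed
  define R where "R = inv_into V (opser a A)"
  have RS: "R (opser a A x) = x" if "x \<in> V" for x
    unfolding R_def using bij that by (simp add: bij_betw_def)
  have surj: "\<exists>y\<in>V. opser a A y = x" if "x \<in> V" for x
    using bij that by (force simp: bij_betw_def)
  note L = lin_D[OF opser_lin[OF a A]]
  have R: "lin R"
    unfolding linear_between_def
  proof (intro conjI ballI allI)
    fix x assume "x \<in> V" then show "R x \<in> V" using surj RS by metis
  next
    fix x y assume "x \<in> V" "y \<in> V"
    then obtain x' y' where "x' \<in> V" "y' \<in> V" "x = opser a A x'" "y = opser a A y'" using surj by metis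
    then show "R (x + y) = R x + R y" using RS L(2) by (metis V_simps(2))
  next
    fix t x assume "x \<in> V"
    then obtain x' where "x' \<in> V" "x = opser a A x'" using surj by metis
    then show "R (sc t x) = sc t (R x)" using RS L(3) by (metis V_simps(3))
  qed
  have "d b = 0" if "b \<in> B" for b
  proof -
    have "d b = cmult B (\<lambda>x. R (opser a A x)) d b"
      using pow[OF that, of 0] RS BV by (simp add: cmult_def)
    also have "\<dots> = cmult B R (cmult B (opser a A) d) b"
      by (rule cmult_comp[OF B R opser_lin[OF a A]])
    also have "\<dots> = 0"
      unfolding cmult_def[of B R] using S0 by (intro sum.neutral) simp
    finally show ?thesis .
  qed
  then show False using d by blast
qed

lemma bij_if_inj:
  assumes T: "lin T" and inj: "\<And>v. v \<in> V \<Longrightarrow> T v = 0 \<Longrightarrow> v = 0"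
  shows "bij_betw T V V"
proof (subst op_mat_det_iff[OF T], rule)
  assume "det (op_mat T) = 0"
  then obtain v where v: "v \<in> carrier_vec n" "v \<noteq> 0\<^sub>v n" "op_mat T *\<^sub>v v = 0\<^sub>v n"
    using det_0_iff_vec_prod_zero_field[OF op_mat_carrier] by blast
  have w: "vec n (\<lambda>i. vec_index v i) = v"
    using v(1) by (intro eq_vecI) auto
  have "c i (T (combine (\<lambda>i. vec_index v i))) = 0" if "i < n" for i
    using op_mat_apply[OF T that, of "\<lambda>i. vec_index v i"] v(3) that by (simp add: w)
  then have "T (combine (\<lambda>i. vec_index v i)) = 0"
    using lin_D(1)[OF T] by (intro coord_eqI) auto
  then have "combine (\<lambda>i. vec_index v i) = 0"
    by (rule inj[OF combine_in])
  then have "vec_index v i = 0" if "i < n" for i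
    using c_combine[OF that, of "\<lambda>i. vec_index v i"] that by simp
  then have "v = 0\<^sub>v n"
    using v(1) by (intro eq_vecI) auto
  then show False using v(2) by simp
qed

text \<open>The portion of the spectral mapping theorem that is required: \<open>a(A)\<close> is
  singular exactly if the series vanishes at an eigenvalue of \<open>A\<close>.\<close>

theorem opser_bij_iff_spectrum:
  assumes "lin A" "entire_coeffs a"
  shows "bij_betw (opser a A) V V \<longleftrightarrow> (\<forall>\<mu>\<in>spectrum sc V A. scalar_fun a \<mu> \<noteq> 0)"
proof
  assume "bij_betw (opser a A) V V"
  then show "\<forall>\<mu>\<in>spectrum sc V A. scalar_fun a \<mu> \<noteq> 0"
    by (intro ballI spectrum_nonzero_if_bij[OF assms])
next
  assume nz: "\<forall>\<mu>\<in>spectrum sc V A. scalar_fun a \<mu> \<noteq> 0"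
  show "bij_betw (opser a A) V V"
    by (rule bij_if_inj[OF opser_lin[OF assms(2,1)]], rule inj_if_spectrum[OF assms]) (use nz in auto)
qed

end

section \<open>Existence of interpolants and their effect on series\<close>

context coord_space
begin

text \<open>The spectrum quantifies over all bases. The coordinates of an eigenvector are therefore
  transported to the fixed basis, where they form an eigenvector of one complex matrix; its
  characteristic polynomial has finitely many roots.\<close>

lemma finite_spectrum:
  assumes A: "lin A"
  shows "finite (spectrum sc V A)"
proof -
  let ?M = "map_mat to_complex (op_mat A)"
  have M: "?M \<in> carrier_mat n n"
    using op_mat_carrier[of A] by simp
  have "char_poly ?M \<noteq> 0"
    using degree_monic_char_poly[OF M] by auto
  moreover have "poly (char_poly ?M) \<mu> = 0" if \<mu>: "\<mu> \<in> spectrum sc V A" for \<mu>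
  proof -
    obtain B d where B: "finite B" "independent B" "span B = V" and d: "\<exists>b\<in>B. d b \<noteq> 0"
      and eig: "\<And>b. b \<in> B \<Longrightarrow> (\<Sum>b'\<in>B. to_complex (representation B (A b') b) * d b') = \<mu> * d b"
      using \<mu> unfolding spectrum_def by blast
    have BV: "b \<in> V" if "b \<in> B" for b
      using span_base[OF that] B(3) by blast
    define C where "C = (\<lambda>i. \<Sum>b\<in>B. to_complex (c i b) * d b)"
    have "(\<Sum>j<n. to_complex (c i (A (e j))) * C j) = \<mu> * C i" if i: "i < n" for i
    proof -
      have "(\<Sum>j<n. to_complex (c i (A (e j))) * C j) =
          (\<Sum>b\<in>B. (\<Sum>j<n. to_complex (c i (A (e j))) * to_complex (c j b)) * d b)"
        unfolding C_def sum_distrib_left sum_distrib_right by (subst sum.swap) (simp add: mult.assoc)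
      also have "\<dots> = (\<Sum>b'\<in>B. to_complex (c i (A b')) * d b')"
      proof (intro sum.cong refl)
        fix b assume "b \<in> B"
        then have "c i (A b) = (\<Sum>j<n. c j b * c i (A (e j)))"
          using functional_expand[OF functional_comp[OF functional_c[OF i] A] BV] by simp
        then show "(\<Sum>j<n. to_complex (c i (A (e j))) * to_complex (c j b)) * d b = to_complex (c i (A b)) * d b"
          by (simp add: to_complex_sum to_complex_mult mult.commute)
      qed
      also have "\<dots> = (\<Sum>b'\<in>B. \<Sum>b\<in>B. to_complex (representation B (A b') b) * to_complex (c i b) * d b')"
      proof (intro sum.cong refl)
        fix b' assume "b' \<in> B"
        then have "A b' \<in> span B"
          using lin_D(1)[OF A BV] B(3) by simp
        then have "c i (A b') = c i (\<Sum>b\<in>B. sc (representation B (A b') b) b)"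
          using sum_representation_eq[OF B(2) _ B(1) order_refl] by simp
        also have "\<dots> = (\<Sum>b\<in>B. representation B (A b') b * c i b)"
          by (rule functional_sum[OF functional_c[OF i]]) (rule BV)
        finally show "to_complex (c i (A b')) * d b' =
            (\<Sum>b\<in>B. to_complex (representation B (A b') b) * to_complex (c i b) * d b')"
          by (simp add: to_complex_sum to_complex_mult sum_distrib_right)
      qed
      also have "\<dots> = (\<Sum>b\<in>B. to_complex (c i b) * (\<Sum>b'\<in>B. to_complex (representation B (A b') b) * d b'))"
        unfolding sum_distrib_left by (subst sum.swap) (simp add: mult_ac)
      also have "\<dots> = (\<Sum>b\<in>B. to_complex (c i b) * (\<mu> * d b))"
        by (intro sum.cong refl) (simp add: eig)
      also have "\<dots> = \<mu> * C i"
        unfolding C_def sum_distrib_left by (intro sum.cong refl) (simp add: mult_ac)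
      finally show ?thesis .
    qed
    then have "?M *\<^sub>v vec n C = \<mu> \<cdot>\<^sub>v vec n C"
      by (intro eq_vecI) (auto simp: op_mat_def scalar_prod_def lessThan_atLeast0)
    moreover have "vec n C \<noteq> 0\<^sub>v n"
    proof
      assume "vec n C = 0\<^sub>v n"
      then have C0: "C i = 0" if "i < n" for i
        using that by (metis index_vec index_zero_vec(1))
      have "d b = 0" if b: "b \<in> B" for b
      proof -
        have "d b = (\<Sum>b'\<in>B. to_complex (representation B b' b) * d b')"
          using B(1) b by (subst sum.cong[OF refl, of _ _ "\<lambda>b'. if b = b' then d b' else 0"])
            (auto simp: representation_basis[OF B(2)])
        also have "\<dots> = (\<Sum>b'\<in>B. (\<Sum>i<n. to_complex (representation B (e i) b) * to_complex (c i b')) * d b')"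
        proof (intro sum.cong refl)
          fix b' assume "b' \<in> B"
          then have "representation B b' b = (\<Sum>i<n. c i b' * representation B (e i) b)"
            using functional_expand[OF functional_representation[OF B(2,3)] BV] by simp
          then show "to_complex (representation B b' b) * d b' =
              (\<Sum>i<n. to_complex (representation B (e i) b) * to_complex (c i b')) * d b'"
            by (simp add: to_complex_sum to_complex_mult mult.commute)
        qed
        also have "\<dots> = (\<Sum>i<n. to_complex (representation B (e i) b) * C i)"
          unfolding C_def sum_distrib_left sum_distrib_right by (subst sum.swap) (simp add: mult.assoc)
        also have "\<dots> = 0"
          using C0 by simp
        finally show ?thesis .
      qed
      then show False using d by blast
    qed
    ultimately have "eigenvalue ?M \<mu>"
      unfolding eigenvalue_def eigenvector_def using M by (intro exI[of _ "vec n C"]) auto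
    then show ?thesis
      using eigenvalue_root_char_poly[OF M] by simp
  qed
  ultimately show ?thesis
    using finite_subset[OF _ poly_roots_finite[of "char_poly ?M"], of "spectrum sc V A"] by auto
qed

lemma entire_coeffs_to_complex: "entire_coeffs a \<Longrightarrow> entire_coeffs (\<lambda>k. to_complex (a k))"
  by (simp add: entire_coeffs_def norm_to_complex)

lemma eval_scalar_fps: "eval_fps (Abs_fps (\<lambda>k. to_complex (a k))) z = scalar_fun a z"
  by (simp add: eval_fps_def scalar_fun_def)

text \<open>The entire function \<open>Q a - b\<close> equals \<open>(Q - f) a\<close> near each
  eigenvalue and so vanishes there to order \<open>n\<close>. The roots of the minimal polynomial at
  \<open>v\<close> are eigenvalues, hence \<open>annihilated_series\<close> shows that every
  functional kills \<open>Q(A) a(A) v - b(A) v\<close>.\<close>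

theorem interpolates_opser:
  assumes A: "lin A" and a: "entire_coeffs a" and b: "entire_coeffs b"
    and \<Omega>: "open \<Omega>" "spectrum sc V A \<subseteq> \<Omega>" and f: "f holomorphic_on \<Omega>"
    and fab: "\<And>z. z \<in> \<Omega> \<Longrightarrow> f z * scalar_fun a z = scalar_fun b z"
    and q: "interpolates sc V A f q" and v: "v \<in> V"
  shows "poly_op sc q A (opser a A v) = opser b A v"
proof -
  define Q where "Q = map_poly to_complex q"
  define w where "w = opser a A v"
  have Qc: "poly.coeff Q j = to_complex (poly.coeff q j)" for j
    by (simp add: Q_def coeff_map_poly)
  have Qd: "Polynomial.degree Q = Polynomial.degree q"
    unfolding Q_def by (rule degree_map_poly) simp
  let ?fa = "Abs_fps (\<lambda>k. to_complex (a k))" and ?fb = "Abs_fps (\<lambda>k. to_complex (b k))"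
  note ra = fps_conv_radius_entire[OF entire_coeffs_to_complex[OF a]]
  note rb = fps_conv_radius_entire[OF entire_coeffs_to_complex[OF b]]
  define g where "g = fps_of_poly Q * ?fa - ?fb"
  have rm: "fps_conv_radius (fps_of_poly Q * ?fa) = \<infinity>"
    using fps_conv_radius_mult[of "fps_of_poly Q" ?fa] ra by simp
  have rg: "fps_conv_radius g = \<infinity>"
    unfolding g_def using fps_conv_radius_diff[of "fps_of_poly Q * ?fa" ?fb] rm rb by simp
  have g: "eval_fps g z = poly Q z * scalar_fun a z - scalar_fun b z" for z
    unfolding g_def by (simp add: eval_fps_diff eval_fps_mult ra rb rm eval_scalar_fps)
  have hol_a: "scalar_fun a holomorphic_on S" for S
    using holomorphic_on_eval_fps[of S ?fa] ra by (simp add: eval_scalar_fps[abs_def])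
  obtain m p where mp: "m \<le> n" "independent ((\<lambda>k. (A ^^ k) v) ` {..<m})" "inj_on (\<lambda>k. (A ^^ k) v) {..<m}"
    "(A ^^ m) v = (\<Sum>k<m. sc (p k) ((A ^^ k) v))" "v = 0 \<or> m > 0"
    using minimal_polynomial[OF A v] .
  have zero: "\<exists>r>0. \<exists>h. h holomorphic_on ball \<mu> r \<and> (\<forall>z\<in>ball \<mu> r. eval_fps g z = (z - \<mu>) ^ n * h z)"
    if root: "poly (min_poly m p) \<mu> = 0" for \<mu>
  proof -
    have \<mu>: "\<mu> \<in> spectrum sc V A"
      using root_in_spectrum[OF A v mp(2-4) root] by auto
    then obtain r where r: "r > 0" "ball \<mu> r \<subseteq> \<Omega>"
      using \<Omega> openE by blast
    have hf: "f holomorphic_on ball \<mu> r" "poly Q holomorphic_on ball \<mu> r"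
      using f r by (auto intro: holomorphic_on_subset holomorphic_intros)
    have "(deriv ^^ k) (\<lambda>z. f z - poly Q z) \<mu> = 0" if "k < n" for k
      using higher_deriv_diff[OF hf open_ball, of \<mu> k] r q \<mu> that
      by (simp add: interpolates_def dim_V higher_deriv_poly Q_def)
    then obtain h where h: "h holomorphic_on ball \<mu> r" "\<And>z. z \<in> ball \<mu> r \<Longrightarrow> f z - poly Q z = (z - \<mu>) ^ n * h z"
      using zero_of_order_factor[of "\<lambda>z. f z - poly Q z" \<mu> r n] holomorphic_on_diff[OF hf] by auto
    have "eval_fps g z = (z - \<mu>) ^ n * (- h z * scalar_fun a z)" if "z \<in> ball \<mu> r" for z
    proof -
      have "eval_fps g z = - (f z - poly Q z) * scalar_fun a z"
        using fab[of z] r(2) that by (auto simp: g algebra_simps)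
      then show ?thesis
        unfolding h(2)[OF that] by simp
    qed
    moreover have "(\<lambda>z. - h z * scalar_fun a z) holomorphic_on ball \<mu> r"
      using h(1) hol_a by (intro holomorphic_intros)
    ultimately show ?thesis
      using r(1) by blast
  qed
  have "F (poly_op sc q A w) = F (opser b A v)" if F: "functional F" for F
  proof -
    let ?x = "\<lambda>k. to_complex (F ((A ^^ k) v))"
    obtain C R where CR: "R \<ge> 0" "\<And>k. norm (F ((A ^^ k) v)) \<le> C * R ^ k"
      using functional_pow_bound[OF F A v] by auto
    have "(\<lambda>k. fps_nth g k * ?x k) sums 0"
    proof (rule annihilated_series[OF degree_min_poly(2) _ rg zero])
      show "Polynomial.degree (min_poly m p) \<le> n"
        using mp(1) by (simp add: degree_min_poly)
      show "norm (?x k) \<le> C * R ^ k" for k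
        using CR(2) by (simp add: norm_to_complex)
      show "(\<Sum>j\<le>Polynomial.degree (min_poly m p). poly.coeff (min_poly m p) j * ?x (k + j)) = 0" for k
        unfolding degree_min_poly(1) by (rule min_poly_annihilates[OF A v F mp(4)])
    qed (use CR(1) in auto)
    moreover have "(\<lambda>k. fps_nth (fps_of_poly Q * ?fa) k * ?x k) sums
        (\<Sum>j\<le>Polynomial.degree Q. poly.coeff Q j * to_complex (F ((A ^^ j) w)))"
    proof (rule poly_times_fps_sums)
      fix j
      have "opser a A ((A ^^ j) v) = (A ^^ j) w"
        unfolding w_def by (rule opser_commute[symmetric, OF a A lin_pow[OF A] _ v]) (metis funpow_swap1)
      then show "(\<lambda>k. fps_nth ?fa k * ?x (k + j)) sums to_complex (F ((A ^^ j) w))"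
        using to_complex_sums[OF opser_functional[OF a F A, of "(A ^^ j) v"]] A v
        by (simp add: to_complex_mult funpow_add)
    qed
    moreover have "(\<lambda>k. fps_nth ?fb k * ?x k) sums to_complex (F (opser b A v))"
      using to_complex_sums[OF opser_functional[OF b F A v]] by (simp add: to_complex_mult)
    ultimately have "(\<lambda>k. fps_nth g k * ?x k) sums
        ((\<Sum>j\<le>Polynomial.degree Q. poly.coeff Q j * to_complex (F ((A ^^ j) w))) - to_complex (F (opser b A v)))"
      unfolding g_def using sums_diff by (simp add: left_diff_distrib) blast
    from sums_unique2[OF this \<open>(\<lambda>k. fps_nth g k * ?x k) sums 0\<close>]
    have "(\<Sum>j\<le>Polynomial.degree Q. poly.coeff Q j * to_complex (F ((A ^^ j) w))) = to_complex (F (opser b A v))"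
      by (simp only: right_minus_eq)
    moreover have "to_complex (F (poly_op sc q A w)) =
        (\<Sum>j\<le>Polynomial.degree Q. poly.coeff Q j * to_complex (F ((A ^^ j) w)))"
      unfolding poly_op_def Qd Qc
      using A by (subst functional_sum[OF F]) (auto simp: w_def to_complex_sum to_complex_mult)
    ultimately show ?thesis
      by simp
  qed
  moreover have "poly_op sc q A w \<in> V"
    unfolding poly_op_def using A subspace_V by (intro subspace_sum) (auto simp: w_def)
  ultimately show ?thesis
    unfolding w_def[symmetric] by (intro coord_eqI functional_c) (auto intro: functional_c)
qed

lemma higher_deriv_cnj:
  assumes "open \<Omega>" "\<And>z. z \<in> \<Omega> \<Longrightarrow> cnj z \<in> \<Omega>" "\<And>z. z \<in> \<Omega> \<Longrightarrow> f (cnj z) = cnj (f z)"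
    and "f holomorphic_on \<Omega>" "z \<in> \<Omega>"
  shows "(deriv ^^ k) f (cnj z) = cnj ((deriv ^^ k) f z)"
  using assms(5)
proof (induction k arbitrary: z)
  case (Suc k)
  let ?g = "(deriv ^^ k) f"
  have hol: "?g holomorphic_on \<Omega>"
    by (rule holomorphic_higher_deriv[OF assms(4,1)])
  have D: "(?g has_field_derivative deriv ?g z) (at z)"
    using holomorphic_derivI[OF hol assms(1) Suc.prems] .
  have "((\<lambda>w. cnj (?g (cnj w))) has_field_derivative cnj (deriv ?g z)) (at (cnj z))"
    using has_field_derivative_cnj_cnj[of ?g "deriv ?g z" "cnj z"] D by (simp add: comp_def)
  moreover have "\<forall>\<^sub>F w in nhds (cnj z). cnj (?g (cnj w)) = ?g w"
    using eventually_nhds_in_open[OF assms(1) assms(2)[OF Suc.prems]]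
    by eventually_elim (metis Suc.IH assms(2) complex_cnj_cnj)
  ultimately have "(?g has_field_derivative cnj (deriv ?g z)) (at (cnj z))"
    by (subst DERIV_cong_ev[OF refl _ refl, symmetric])
  then show ?case
    by (simp add: DERIV_imp_deriv)
qed (use assms in auto)

lemma cnj_spectrum:
  assumes "\<And>x :: 'k. cnj (to_complex x) = to_complex x" "\<mu> \<in> spectrum sc V A"
  shows "cnj \<mu> \<in> spectrum sc V A"
proof -
  obtain B d where B: "finite B" "independent B" "span B = V" and d: "\<exists>b\<in>B. d b \<noteq> 0"
    and eig: "\<And>b. b \<in> B \<Longrightarrow> (\<Sum>b'\<in>B. to_complex (representation B (A b') b) * d b') = \<mu> * d b"
    using assms(2) unfolding spectrum_def by blast
  have "(\<Sum>b'\<in>B. to_complex (representation B (A b') b) * cnj (d b')) = cnj \<mu> * cnj (d b)" if "b \<in> B" for b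
    using arg_cong[OF eig[OF that], of cnj] by (simp add: assms(1))
  then show ?thesis
    using B d unfolding spectrum_def by (intro CollectI exI[of _ B] exI[of _ "\<lambda>b. cnj (d b)"]) auto
qed

text \<open>Over real scalars the coefficients must be real. Averaging an interpolant with its
  conjugate achieves this and keeps the conditions, because the spectrum is stable under conjugation
  and \<open>f\<close> commutes with it. Over complex scalars any interpolant will do.\<close>

theorem interpolant_exists:
  assumes A: "lin A" and \<Omega>: "open \<Omega>" "\<And>z. z \<in> \<Omega> \<Longrightarrow> cnj z \<in> \<Omega>" "spectrum sc V A \<subseteq> \<Omega>"
    and f: "f holomorphic_on \<Omega>" "\<And>z. z \<in> \<Omega> \<Longrightarrow> f (cnj z) = cnj (f z)"
  shows "\<exists>q. interpolates sc V A f q"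
proof -
  obtain Q where Q: "\<And>\<mu> k. \<mu> \<in> spectrum sc V A \<Longrightarrow> k < n \<Longrightarrow> poly ((pderiv ^^ k) Q) \<mu> = (deriv ^^ k) f \<mu>"
    using Hermite_interpolation[OF finite_spectrum[OF A], of n "\<lambda>\<mu> k. (deriv ^^ k) f \<mu>"] by blast
  have "\<exists>Q'. (\<forall>j. poly.coeff Q' j \<in> range (to_complex :: 'k \<Rightarrow> complex)) \<and>
      (\<forall>\<mu>\<in>spectrum sc V A. \<forall>k<n. poly ((pderiv ^^ k) Q') \<mu> = (deriv ^^ k) f \<mu>)"
  proof (cases rule: real_or_complex_cases[where 'k = 'k])
    case real
    let ?C = "map_poly cnj Q"
    let ?Q = "Polynomial.smult (1 / 2) (Q + ?C)"
    have pd: "pderiv (map_poly cnj p) = map_poly cnj (pderiv p)" for p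
      by (rule poly_eqI) (simp add: coeff_pderiv coeff_map_poly)
    then have pdk: "(pderiv ^^ k) ?C = map_poly cnj ((pderiv ^^ k) Q)" for k
      by (induction k) auto
    have "poly ((pderiv ^^ k) ?Q) \<mu> = (deriv ^^ k) f \<mu>" if \<mu>: "\<mu> \<in> spectrum sc V A" and k: "k < n" for \<mu> k
    proof -
      have "poly ((pderiv ^^ k) ?C) \<mu> = cnj ((deriv ^^ k) f (cnj \<mu>))"
        unfolding pdk using Q[OF cnj_spectrum[OF real \<mu>] k] by simp
      also have "\<dots> = (deriv ^^ k) f \<mu>"
        using higher_deriv_cnj[OF \<Omega>(1,2) f(2,1)] \<mu> \<Omega>(3) by auto
      finally show ?thesis
        using Q[OF \<mu> k] by (simp add: higher_pderiv_smult higher_pderiv_add)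
    qed
    moreover have "poly.coeff ?Q j \<in> range (to_complex :: 'k \<Rightarrow> complex)" for j
    proof
      show "poly.coeff ?Q j = to_complex (Re (poly.coeff Q j) *\<^sub>R (1 :: 'k))"
        by (simp add: to_complex_scaleR_one coeff_map_poly complex_eq_iff)
    qed simp
    ultimately show ?thesis by blast
  next
    case complex
    then show ?thesis using Q by (intro exI[of _ Q]) auto
  qed
  then obtain Q' where Q': "\<And>j. poly.coeff Q' j \<in> range (to_complex :: 'k \<Rightarrow> complex)"
    "\<And>\<mu> k. \<mu> \<in> spectrum sc V A \<Longrightarrow> k < n \<Longrightarrow> poly ((pderiv ^^ k) Q') \<mu> = (deriv ^^ k) f \<mu>"
    by blast
  define q where "q = map_poly (inv_into UNIV (to_complex :: 'k \<Rightarrow> complex)) Q'"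
  have inj: "inj (to_complex :: 'k \<Rightarrow> complex)"
    by (rule injI) simp
  have i0: "inv_into UNIV (to_complex :: 'k \<Rightarrow> complex) 0 = 0"
    using inv_f_f[OF inj, of 0] by simp
  have "map_poly to_complex q = Q'"
    by (rule poly_eqI) (use Q'(1) i0 in \<open>simp add: q_def coeff_map_poly f_inv_into_f\<close>)
  then show ?thesis
    using Q'(2) by (intro exI[of _ q]) (simp add: interpolates_def dim_V)
qed

end

section \<open>The function coth\<close>

text \<open>The coefficients of \<open>sinh z / z\<close>, an even entire function whose zeros are
  the points that the spectrum has to avoid in \<open>U_can\<close>.\<close>

definition sinhc_coeff :: "nat \<Rightarrow> 'k::real_normed_field" where
  "sinhc_coeff k = (if even k then inverse (fact (Suc k)) else 0)"

text \<open>The coefficients of \<open>(cosh z - sinhc z) / z\<close>.\<close>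

definition coshc_coeff :: "nat \<Rightarrow> 'k::real_normed_field" where
  "coshc_coeff k = (if odd k then inverse (fact (Suc k)) - inverse (fact (Suc (Suc k))) else 0)"

lemma inverse_fact_le: "inverse (fact (k + l)) \<le> (1 / fact k :: real)"
  by (simp add: divide_inverse fact_mono)

lemma entire_sinhc_coeff: "entire_coeffs (sinhc_coeff :: nat \<Rightarrow> 'k::real_normed_field)"
  by (rule entire_coeffs_if_fact[of _ 1])
    (use inverse_fact_le[of _ 1] in \<open>auto simp: sinhc_coeff_def norm_inverse norm_fact simp del: fact_Suc\<close>)

lemma entire_coshc_coeff: "entire_coeffs (coshc_coeff :: nat \<Rightarrow> 'k::real_normed_field)"
proof (rule entire_coeffs_if_fact[of _ 2])
  fix k
  have "norm (inverse (fact (Suc k)) - inverse (fact (Suc (Suc k))) :: 'k) \<le> 1 / fact k + 1 / fact k"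
    by (rule order_trans[OF norm_triangle_ineq4], intro add_mono)
      (use inverse_fact_le[of k 1] inverse_fact_le[of k 2] in \<open>auto simp: norm_inverse norm_fact simp del: fact_Suc\<close>)
  then show "norm (coshc_coeff k :: 'k) \<le> 2 / fact k"
    by (auto simp: coshc_coeff_def)
qed

lemma to_complex_fact: "to_complex (inverse (fact k) :: 'k::real_or_complex) = inverse (fact k)"
proof -
  have "(inverse (fact k) :: 'k) = inverse (fact k :: real) *\<^sub>R 1"
    by (simp add: of_real_def[symmetric])
  then show ?thesis
    by (simp add: to_complex_scaleR_one)
qed

text \<open>Coefficientwise form of \<open>S + z C + z S = exp z\<close>, which holds because
  \<open>z C = cosh z - S\<close> and \<open>z S = sinh z\<close>.\<close>

lemma coeff_identity:
  "sinhc_coeff k + ((if k = 0 then 0 else coshc_coeff (k - 1)) + (if k = 0 then 0 else sinhc_coeff (k - 1)))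
    = (exp_coeff k :: 'k::real_normed_field)"
  by (cases k) (auto simp: sinhc_coeff_def coshc_coeff_def exp_coeff_def simp del: fact_Suc)

lemma to_complex_sinhc: "to_complex (sinhc_coeff k :: 'k::real_or_complex) = sinhc_coeff k"
  and to_complex_coshc: "to_complex (coshc_coeff k :: 'k::real_or_complex) = coshc_coeff k"
  by (auto simp: sinhc_coeff_def coshc_coeff_def to_complex_diff to_complex_fact simp del: fact_Suc)

context coord_space
begin

lemma sinhc_sums: "(\<lambda>k. sinhc_coeff k * z ^ k) sums scalar_fun sinhc_coeff z"
  and coshc_sums: "(\<lambda>k. coshc_coeff k * z ^ k) sums scalar_fun coshc_coeff z"
  using scalar_fun_sums[OF entire_sinhc_coeff, of z] scalar_fun_sums[OF entire_coshc_coeff, of z]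
  by (simp_all add: to_complex_sinhc to_complex_coshc)

lemma z_sinhc: "z * scalar_fun sinhc_coeff z = sinh z"
proof -
  have "(\<lambda>k. z * (sinhc_coeff k * z ^ k)) sums (z * scalar_fun sinhc_coeff z)"
    by (intro sums_mult sinhc_sums)
  also have "(\<lambda>k. z * (sinhc_coeff k * z ^ k)) = (\<lambda>k. if even (Suc k) then 0 else z ^ Suc k /\<^sub>R fact (Suc k))"
    by (auto simp: sinhc_coeff_def scaleR_conv_of_real simp del: fact_Suc)
  finally have "(\<lambda>k. if even k then 0 else z ^ k /\<^sub>R fact k) sums (z * scalar_fun sinhc_coeff z)"
    using sums_Suc[of "\<lambda>k. if even k then 0 else z ^ k /\<^sub>R fact k"] by simp
  then show ?thesis
    by (rule sums_unique2[OF _ sinh_converges])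
qed

lemma z_coshc: "z * scalar_fun coshc_coeff z = cosh z - scalar_fun sinhc_coeff z"
proof -
  have "(\<lambda>k. z * (coshc_coeff k * z ^ k)) sums (z * scalar_fun coshc_coeff z)"
    by (intro sums_mult coshc_sums)
  moreover define h where "h k = (if even k then z ^ k /\<^sub>R fact k else 0) - sinhc_coeff k * z ^ k" for k
  have "(\<lambda>k. z * (coshc_coeff k * z ^ k)) = (\<lambda>k. h (Suc k))"
    by (auto simp: h_def sinhc_coeff_def coshc_coeff_def scaleR_conv_of_real algebra_simps simp del: fact_Suc)
  moreover have "h 0 = 0"
    by (simp add: h_def sinhc_coeff_def)
  moreover have "h sums (cosh z - scalar_fun sinhc_coeff z)"
    unfolding h_def by (intro sums_diff cosh_converges sinhc_sums)
  ultimately show ?thesis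
    using sums_Suc_iff[of h "z * scalar_fun coshc_coeff z"] sums_unique2 by fastforce
qed

lemma sinhc_0: "scalar_fun sinhc_coeff 0 = 1"
proof -
  have "(\<lambda>k. sinhc_coeff k * 0 ^ k) sums (1 :: complex)"
    using sums_finite[of "{0}" "\<lambda>k. sinhc_coeff k * 0 ^ k :: complex"] by (simp add: sinhc_coeff_def)
  then show ?thesis
    using sums_unique2[OF sinhc_sums[of 0]] by simp
qed

text \<open>Away from 0 the zeros are those of \<open>sinh\<close>, that is, the solutions of
  \<open>exp (2 * z) = 1\<close>. At 0 the value is 1, which is why \<open>n = 0\<close> is
  excepted.\<close>

lemma sinhc_eq_0_iff:
  "scalar_fun sinhc_coeff z = 0 \<longleftrightarrow> z \<in> {\<i> * of_real pi * of_int n | n. n \<noteq> 0}"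
proof (cases "z = 0")
  case True
  then show ?thesis using sinhc_0 by auto
next
  case False
  then have "scalar_fun sinhc_coeff z = 0 \<longleftrightarrow> sinh z = 0"
    by (simp flip: z_sinhc)
  also have "\<dots> \<longleftrightarrow> exp (2 * z) = 1"
  proof -
    have "exp (2 * z) = exp z * exp z"
      by (simp only: mult_2 exp_add)
    then show ?thesis
      by (simp only: sinh_zero_iff square_eq_1_iff insert_iff empty_iff simp_thms)
  qed
  also have "\<dots> \<longleftrightarrow> z \<in> {\<i> * of_real pi * of_int n | n. n \<noteq> 0}"
    unfolding exp_eq_1 using False by (auto simp: complex_eq_iff)
  finally show ?thesis .
qed

lemma F_can_eq:
  assumes "scalar_fun sinhc_coeff z \<noteq> 0"
  shows "F_can z * scalar_fun sinhc_coeff z = scalar_fun coshc_coeff z"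
proof (cases "z = 0")
  case True
  have "(\<lambda>k. coshc_coeff k * 0 ^ k) sums (0 :: complex)"
    using sums_finite[of "{0}" "\<lambda>k. coshc_coeff k * 0 ^ k :: complex"] by (simp add: coshc_coeff_def)
  then show ?thesis
    using sums_unique2[OF coshc_sums[of 0]] True by (simp add: F_can_def)
next
  case False
  then have "sinh z \<noteq> 0"
    using assms by (simp flip: z_sinhc)
  moreover have "scalar_fun sinhc_coeff z = sinh z / z"
    using z_sinhc[of z] False by (simp add: field_simps)
  moreover have "scalar_fun coshc_coeff z = (cosh z - sinh z / z) / z"
    using z_coshc[of z] False calculation(2) by (simp add: field_simps)
  moreover have "(cosh z / sinh z - 1 / z) * (sinh z / z) = (cosh z - sinh z / z) / z"
    using False \<open>sinh z \<noteq> 0\<close> by (simp add: field_simps)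
  ultimately show ?thesis
    using False by (simp add: F_can_def)
qed

lemma F_can_cnj: "F_can (cnj z) = cnj (F_can z)"
  by (simp add: F_can_def cosh_field_def sinh_field_def exp_cnj)

abbreviation poles_F :: "complex set" where
  "poles_F \<equiv> {\<i> * of_real pi * of_int n | n. n \<noteq> 0}"

theorem sinhc_bij_iff:
  assumes "lin A"
  shows "bij_betw (opser sinhc_coeff A) V V \<longleftrightarrow> spectrum sc V A \<inter> poles_F = {}"
  unfolding opser_bij_iff_spectrum[OF assms entire_sinhc_coeff] using sinhc_eq_0_iff by blast

text \<open>On the open set where \<open>S\<close> does not vanish, a conjugation-stable
  neighbourhood of the spectrum, \<open>F\<close> is the holomorphic quotient \<open>C / S\<close>.
  So an interpolant exists, and whichever one \<open>SOME\<close> returns, its product with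
  \<open>S\<close> is \<open>C\<close>.\<close>

theorem fun_calc_F_can:
  assumes A: "lin A" and sp: "spectrum sc V A \<inter> poles_F = {}" and v: "v \<in> V"
  shows "fun_calc sc V F_can A (opser sinhc_coeff A v) = opser coshc_coeff A v"
proof -
  let ?\<Omega> = "{z. scalar_fun (sinhc_coeff :: nat \<Rightarrow> 'k) z \<noteq> 0}"
  have hol: "scalar_fun a holomorphic_on S" if "entire_coeffs a" for a S
    using holomorphic_on_eval_fps[of S "Abs_fps (\<lambda>k. to_complex (a k))"]
      fps_conv_radius_entire[OF entire_coeffs_to_complex[OF that]]
    by (simp add: eval_scalar_fps[abs_def])
  have op: "open ?\<Omega>"
    using holomorphic_on_imp_continuous_on[OF hol[OF entire_sinhc_coeff, of UNIV]]
    by (intro open_Collect_neq) auto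
  have "(\<lambda>z. scalar_fun coshc_coeff z / scalar_fun sinhc_coeff z) holomorphic_on ?\<Omega>"
    by (intro holomorphic_intros hol entire_sinhc_coeff entire_coshc_coeff) auto
  then have F: "F_can holomorphic_on ?\<Omega>"
    by (rule holomorphic_transform) (use F_can_eq in \<open>auto simp: field_simps\<close>)
  have cnj: "cnj z \<in> ?\<Omega>" if "z \<in> ?\<Omega>" for z
  proof (cases "z = 0")
    case False
    then have "sinh z \<noteq> 0" using that by (simp flip: z_sinhc)
    moreover have "sinh (cnj z) = cnj (sinh z)"
      by (simp add: sinh_field_def exp_cnj)
    ultimately have "sinh (cnj z) \<noteq> 0"
      by simp
    then show ?thesis by (auto simp flip: z_sinhc)
  qed (use that in simp)
  have sub: "spectrum sc V A \<subseteq> ?\<Omega>"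
    using sp sinhc_eq_0_iff by blast
  have "\<exists>q. interpolates sc V A F_can q"
    using interpolant_exists[OF A op cnj sub F F_can_cnj] .
  then have q: "interpolates sc V A F_can (SOME q. interpolates sc V A F_can q)"
    by (rule someI_ex)
  show ?thesis
    unfolding fun_calc_def
    by (rule interpolates_opser[OF A entire_sinhc_coeff entire_coshc_coeff op sub F _ q v]) (simp add: F_can_eq)
qed

lemma fun_calc_lin:
  assumes "lin A"
  shows "lin (fun_calc sc V f A)"
proof -
  define q where "q = (SOME q. interpolates sc V A f q)"
  have in_V: "poly_op sc q A v \<in> V" if "v \<in> V" for v
    unfolding poly_op_def using assms that subspace_V by (intro subspace_sum) auto
  show ?thesis
    unfolding fun_calc_def q_def[symmetric]
  proof (rule lin_if_coords)
    fix i assume i: "i < n"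
    have *: "c i (poly_op sc q A v) = (\<Sum>k\<le>Polynomial.degree q. poly.coeff q k * c i ((A ^^ k) v))" if "v \<in> V" for v
      unfolding poly_op_def using assms that by (intro functional_sum functional_c i) auto
    show "functional (\<lambda>v. c i (poly_op sc q A v))"
      using i assms by (auto simp: linear_between_def * lin_D[OF lin_pow] distrib_left sum.distrib sum_distrib_left mult_ac)
  qed (rule in_V)
qed

end

section \<open>Coordinates on the double\<close>

text \<open>The scalar field is a Euclidean space, and a real-linear map out of such a space is
  bounded.\<close>

lemma fin_dim_space_scale_continuous:
  fixes sc :: "'k::real_or_complex \<Rightarrow> 'g::real_normed_vector \<Rightarrow> 'g"
  assumes "fin_dim_space sc"
  shows "continuous_on S (\<lambda>a. sc a x)"
proof -
  interpret vector_space sc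
    using assms by (auto simp: fin_dim_space_def finite_dimensional_vector_space_def)
  have "Real_Vector_Spaces.linear (\<lambda>a. sc a x)"
  proof (rule linearI)
    show "sc (r *\<^sub>R a) x = r *\<^sub>R sc a x" for r a
    proof -
      have "sc (r *\<^sub>R a) x = sc (of_real r * a) x"
        by (simp only: scaleR_conv_of_real)
      also have "\<dots> = sc (of_real r) (sc a x)"
        by simp
      finally show ?thesis
        using assms by (simp only: fin_dim_space_def)
    qed
  qed (simp add: scale_left_distrib)
  then have "bounded_linear (\<lambda>a. sc a x)"
    by (rule linear_conv_bounded_linear[THEN iffD1])
  then show ?thesis
    by (rule linear_continuous_on)
qed

text \<open>The unit sphere of the maximum norm on \<open>n\<close> coordinates, written inside the
  functions on \<open>nat\<close> that vanish from \<open>n\<close> on: a closed subset of a product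
  of compact sets.\<close>

lemma compact_coordinate_sphere:
  "compact {a :: nat \<Rightarrow> 'k::real_or_complex. (\<forall>i. a i \<in> (if i < n then cball 0 1 else {0})) \<and> (\<exists>i<n. norm (a i) = 1)}"
proof -
  let ?K = "\<lambda>i. if i < n then cball 0 1 else {0 :: 'k}"
  have "compactin (product_topology (\<lambda>i. euclidean) UNIV) (Pi\<^sub>E UNIV ?K)"
    by (subst compactin_PiE) (auto simp: compact_cball)
  then have "compact (Pi\<^sub>E UNIV ?K)"
    by (simp add: euclidean_product_topology)
  moreover have "closed {a :: nat \<Rightarrow> 'k. \<exists>i\<in>{..<n}. norm (a i) = 1}"
  proof -
    have "closed {a :: nat \<Rightarrow> 'k. norm (a i) = 1}" for i
      by (intro closed_Collect_eq continuous_intros continuous_on_product_coordinates)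
    then have "closed (\<Union>i\<in>{..<n}. {a :: nat \<Rightarrow> 'k. norm (a i) = 1})"
      by (intro closed_UN) auto
    moreover have "(\<Union>i\<in>{..<n}. {a :: nat \<Rightarrow> 'k. norm (a i) = 1}) = {a. \<exists>i\<in>{..<n}. norm (a i) = 1}"
      by auto
    ultimately show ?thesis by simp
  qed
  ultimately have "compact (Pi\<^sub>E UNIV ?K \<inter> {a. \<exists>i\<in>{..<n}. norm (a i) = 1})"
    by (rule compact_Int_closed)
  also have "Pi\<^sub>E UNIV ?K \<inter> {a. \<exists>i\<in>{..<n}. norm (a i) = 1} =
      {a. (\<forall>i. a i \<in> ?K i) \<and> (\<exists>i<n. norm (a i) = 1)}"
    unfolding PiE_UNIV_domain Pi_def by blast
  finally show ?thesis .
qed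

text \<open>Continuity of the coordinates is the equivalence of norms in finite dimension: the norm
  attains a positive minimum on the compact coordinate sphere, and scaling turns it into a bound for
  every coordinate.\<close>

lemma fin_dim_coord_space:
  fixes sc :: "'k::real_or_complex \<Rightarrow> 'g::real_normed_vector \<Rightarrow> 'g"
  assumes fd: "fin_dim_space sc"
  obtains n e c where "coord_space sc UNIV n e c"
proof -
  obtain B where "finite_dimensional_vector_space sc B"
    using fd by (auto simp: fin_dim_space_def)
  then interpret finite_dimensional_vector_space sc B .
  obtain e where e: "bij_betw e {0..<card B} B"
    using ex_bij_betw_nat_finite[OF finite_Basis] by blast
  define n where "n = card B"
  define c where "c = (\<lambda>i x. representation B x (e i))"
  have eB: "e i \<in> B" if "i < n" for i
    using e that by (auto simp: bij_betw_def n_def)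
  have e_inj: "e i = e j \<longleftrightarrow> i = j" if "i < n" "j < n" for i j
    using e that by (auto simp: bij_betw_def inj_on_def n_def)
  have exp: "(\<Sum>i<n. sc (c i x) (e i)) = x" for x
  proof -
    have "(\<Sum>i<n. sc (c i x) (e i)) = (\<Sum>b\<in>B. sc (representation B x b) b)"
      using sum.reindex_bij_betw[OF e, of "\<lambda>b. sc (representation B x b) b"] by (simp add: c_def n_def lessThan_atLeast0)
    also have "\<dots> = x"
      by (rule sum_representation_eq[OF independent_Basis _ finite_Basis order_refl]) (simp add: span_Basis)
    finally show ?thesis .
  qed
  have c_add: "c i (x + y) = c i x + c i y" for i x y
    by (simp add: c_def representation_add[OF independent_Basis] span_Basis)
  have c_scale: "c i (sc a x) = a * c i x" for i a x
    by (simp add: c_def representation_scale[OF independent_Basis] span_Basis)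
  have c_e: "c i (e j) = (if i = j then 1 else 0)" if "i < n" "j < n" for i j
    using that e_inj by (simp add: c_def representation_basis[OF independent_Basis eB])
  have cont: "continuous_on UNIV (\<lambda>a. \<Sum>i<n. sc (a i) (e i))"
  proof (intro continuous_on_sum)
    fix i
    show "continuous_on UNIV (\<lambda>a. sc (a i) (e i))"
      by (rule continuous_on_compose2[OF fin_dim_space_scale_continuous[OF fd, of UNIV "e i"]])
        (auto intro: continuous_on_product_coordinates)
  qed
  have sc_real: "sc (of_real r) x = r *\<^sub>R x" for r x
    using fd by (simp add: fin_dim_space_def)
  have c_sum: "c i (\<Sum>j<n. sc (a j) (e j)) = a i" if "i < n" for i a
  proof -
    have "c i (\<Sum>j\<in>A. sc (a j) (e j)) = (\<Sum>j\<in>A. a j * c i (e j))" if "finite A" for A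
      using that by (induction A) (auto simp: c_add c_scale, simp add: c_def representation_zero)
    then show ?thesis
      using that by (simp add: c_e mult_delta_right)
  qed
  have "\<exists>m>0. \<forall>x. \<forall>i<n. m * norm (c i x) \<le> norm x"
  proof (cases "n = 0")
    case False
    let ?S = "{a :: nat \<Rightarrow> 'k. (\<forall>i. a i \<in> (if i < n then cball 0 1 else {0})) \<and> (\<exists>i<n. norm (a i) = 1)}"
    let ?g = "\<lambda>a. norm (\<Sum>i<n. sc (a i) (e i))"
    have "(\<lambda>i. if i = 0 then 1 else 0) \<in> ?S"
      using False by auto
    then have "?S \<noteq> {}"
      by (rule ex_in_conv[THEN iffD1, OF exI])
    from continuous_attains_inf[OF compact_coordinate_sphere this
        continuous_on_norm[OF continuous_on_subset[OF cont subset_UNIV]]]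
    obtain b where b: "b \<in> ?S" "\<And>a. a \<in> ?S \<Longrightarrow> ?g b \<le> ?g a"
      by (elim bexE) blast
    have "?g b > 0"
    proof (rule ccontr)
      assume "\<not> ?g b > 0"
      then have z: "(\<Sum>i<n. sc (b i) (e i)) = 0" by simp
      obtain i where "i < n" "norm (b i) = 1" using b(1) by auto
      then show False
        using c_sum[of i b] z by (simp add: c_def representation_zero)
    qed
    moreover have "?g b * norm (c i x) \<le> norm x" if "i < n" for i x
    proof -
      define M where "M = Max ((\<lambda>i. norm (c i x)) ` {..<n})"
      have M: "norm (c i x) \<le> M" if "i < n" for i
        unfolding M_def using that by (intro Max_ge) auto
      show ?thesis
      proof (cases "M \<le> 0")
        case True
        then show ?thesis using M[OF that] by (smt (verit) mult_eq_0_iff norm_ge_zero)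
      next
        case False
        have "M \<in> (\<lambda>i. norm (c i x)) ` {..<n}"
          unfolding M_def using \<open>n \<noteq> 0\<close> by (intro Max_in) auto
        then obtain j where j: "j < n" "norm (c j x) = M" by auto
        \<comment> \<open>Rescales the coordinates of \<open>x\<close> so that the largest one has
          norm 1, which puts them on the sphere.\<close>
        define a where "a = (\<lambda>i. if i < n then of_real (1 / M) * c i x else 0)"
        have "a \<in> ?S"
          using M j False
          by (intro CollectI conjI allI exI[of _ j]) (auto simp: a_def norm_mult norm_divide divide_simps)
        then have "?g b \<le> ?g a"
          by (rule b(2))
        also have "(\<Sum>i<n. sc (a i) (e i)) = sc (of_real (1 / M)) (\<Sum>i<n. sc (c i x) (e i))"
          by (simp add: a_def scale_sum_right)
        also have "\<dots> = (1 / M) *\<^sub>R x"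
          unfolding exp by (rule sc_real)
        finally have "?g b * M \<le> norm x"
          using False by (simp add: field_simps)
        moreover have "?g b * norm (c i x) \<le> ?g b * M"
          by (intro mult_left_mono M that) auto
        ultimately show ?thesis by simp
      qed
    qed
    ultimately show ?thesis by blast
  qed (auto intro: exI[of _ 1])
  then obtain m where m: "m > 0" "\<And>x i. i < n \<Longrightarrow> m * norm (c i x) \<le> norm x"
    by blast
  have c_cont: "continuous_on UNIV (c i)" if "i < n" for i
  proof -
    have "bounded_linear (c i)"
    proof (rule bounded_linear_intro[where K = "1 / m"])
      show "c i (r *\<^sub>R x) = r *\<^sub>R c i x" for r x
        by (simp flip: sc_real add: c_scale) (simp add: scaleR_conv_of_real)
      show "norm (c i x) \<le> norm x * (1 / m)" for x
        using m(2)[OF that, of x] m(1) by (simp add: field_simps)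
    qed (rule c_add)
    then show ?thesis
      by (rule linear_continuous_on)
  qed
  have "coord_space sc UNIV n e c"
    by unfold_locales
      (use exp c_add c_scale c_e cont c_cont hausdorff in \<open>auto simp: subspace_UNIV\<close>)
  then show ?thesis by (rule that)
qed

section \<open>Dual spaces and sums with a dual\<close>

context
  fixes sc :: "'k::real_or_complex \<Rightarrow> 'g::ab_group_add \<Rightarrow> 'g"
  assumes vs: "vector_space sc"
begin

lemma dual_iff: "\<xi> \<in> dual sc \<longleftrightarrow> (\<forall>x y. \<xi> (x + y) = \<xi> x + \<xi> y) \<and> (\<forall>a x. \<xi> (sc a x) = a * \<xi> x)"
proof -
  have "vector_space ((*) :: 'k \<Rightarrow> _)"
    by standard (auto simp: algebra_simps)
  with vs show ?thesis
    by (simp add: dual_def Vector_Spaces.linear_iff)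
qed

lemma dual_simps:
  assumes "\<xi> \<in> dual sc"
  shows "\<xi> (x + y) = \<xi> x + \<xi> y" "\<xi> (sc a x) = a * \<xi> x" "\<xi> 0 = 0" "\<xi> (- x) = - \<xi> x" "\<xi> (x - y) = \<xi> x - \<xi> y"
proof -
  interpret vector_space sc by (rule vs)
  note * = assms[unfolded dual_iff]
  show "\<xi> (x + y) = \<xi> x + \<xi> y" "\<xi> (sc a x) = a * \<xi> x" for x y a
    using * by auto
  show z: "\<xi> 0 = 0"
    using * by (metis scale_zero_left mult_zero_left)
  show m: "\<xi> (- x) = - \<xi> x" for x
    using * z by (metis add.right_inverse neg_eq_iff_add_eq_0 add.commute)
  show "\<xi> (x - y) = \<xi> x - \<xi> y"
    using * m by (metis diff_conv_add_uminus)
qed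

lemma dual_closed:
  "0 \<in> dual sc" "\<xi> \<in> dual sc \<Longrightarrow> \<eta> \<in> dual sc \<Longrightarrow> \<xi> + \<eta> \<in> dual sc"
  "\<xi> \<in> dual sc \<Longrightarrow> \<eta> \<in> dual sc \<Longrightarrow> \<xi> - \<eta> \<in> dual sc" "\<xi> \<in> dual sc \<Longrightarrow> - \<xi> \<in> dual sc"
  "\<xi> \<in> dual sc \<Longrightarrow> fun_scale a \<xi> \<in> dual sc"
  by (auto simp: dual_iff algebra_simps fun_scale_def)

end

lemma vector_space_fun_scale: "vector_space (fun_scale :: 'k::real_or_complex \<Rightarrow> ('v \<Rightarrow> 'k) \<Rightarrow> _)"
  by standard (auto simp: fun_scale_def algebra_simps fun_eq_iff)

lemma vector_space_sum_scale:
  assumes "vector_space sc"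
  shows "vector_space (sum_scale sc :: 'k::real_or_complex \<Rightarrow> 'v::ab_group_add \<times> ('w \<Rightarrow> 'k) \<Rightarrow> _)"
proof -
  interpret vector_space sc by fact
  interpret f: vector_space "fun_scale :: 'k \<Rightarrow> ('w \<Rightarrow> 'k) \<Rightarrow> _" by (rule vector_space_fun_scale)
  show ?thesis
    by standard (auto simp: sum_scale_def scale_right_distrib scale_left_distrib
        f.scale_right_distrib f.scale_left_distrib)
qed

text \<open>The basis of the dual summand is the dual basis \<open>c2\<close>, so the coordinates of
  a functional are its values on \<open>e2\<close>. The two spaces may differ: besides the doubles,
  the fibre of the algebroid combines \<open>l\<close> with the dual of \<open>g\<close>.\<close>

lemma coord_space_sum:
  fixes sc1 :: "'k::real_or_complex \<Rightarrow> 'v::real_normed_vector \<Rightarrow> 'v"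
    and sc2 :: "'k \<Rightarrow> 'w::real_normed_vector \<Rightarrow> 'w"
  assumes "coord_space sc1 UNIV n1 e1 c1" "coord_space sc2 UNIV n2 e2 c2"
  shows "coord_space (sum_scale sc1) (UNIV \<times> dual sc2) (n1 + n2)
    (\<lambda>i. if i < n1 then (e1 i, 0) else (0, c2 (i - n1)))
    (\<lambda>i X. if i < n1 then c1 i (fst X) else snd X (e2 (i - n1)))"
proof -
  interpret A: coord_space sc1 UNIV n1 e1 c1 by fact
  interpret B: coord_space sc2 UNIV n2 e2 c2 by fact
  note dual = dual_simps[OF B.vector_space_axioms] dual_closed[OF B.vector_space_axioms]
  interpret S: vector_space "sum_scale sc1 :: 'k \<Rightarrow> 'v \<times> ('w \<Rightarrow> 'k) \<Rightarrow> _"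
    by (rule vector_space_sum_scale[OF A.vector_space_axioms])
  let ?e = "\<lambda>i. if i < n1 then (e1 i, 0) else (0, c2 (i - n1))"
  let ?c = "\<lambda>i X. if i < n1 then c1 i (fst X) else snd X (e2 (i - n1))"
  have c2: "c2 i \<in> dual sc2" if "i < n2" for i
    using that by (simp add: dual_iff[OF B.vector_space_axioms] B.c_scale)
  have sum: "(\<Sum>i<n1 + n2. sum_scale sc1 (a i) (?e i)) =
      (\<Sum>i<n1. sc1 (a i) (e1 i), \<Sum>i<n2. fun_scale (a (n1 + i)) (c2 i))" for a
  proof -
    have "(\<Sum>i<n1 + n2. sum_scale sc1 (a i) (?e i)) =
        (\<Sum>i<n1. sum_scale sc1 (a i) (?e i)) + (\<Sum>i<n2. sum_scale sc1 (a (n1 + i)) (?e (n1 + i)))"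
      using sum.lessThan_Suc by (induction n2) (simp_all add: add.assoc)
    also have "\<dots> = (\<Sum>i<n1. sc1 (a i) (e1 i), \<Sum>i<n2. fun_scale (a (n1 + i)) (c2 i))"
      by (rule prod_eqI) (simp_all add: fst_sum snd_sum sum_scale_def fun_scale_def zero_fun_def[symmetric])
    finally show ?thesis .
  qed
  show ?thesis
  proof unfold_locales
    show "S.subspace (UNIV \<times> dual sc2)"
      by (auto simp: S.subspace_def dual sum_scale_def zero_prod_def)
    show "?e i \<in> UNIV \<times> dual sc2" if "i < n1 + n2" for i
      using that c2 by (auto simp: dual)
    show "?c i (X + Y) = ?c i X + ?c i Y" if "i < n1 + n2" "X \<in> UNIV \<times> dual sc2" "Y \<in> UNIV \<times> dual sc2" for i X Y
      using that by (auto simp: A.c_add)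
    show "?c i (sum_scale sc1 a X) = a * ?c i X" if "i < n1 + n2" "X \<in> UNIV \<times> dual sc2" for i X a
      using that by (auto simp: sum_scale_def fun_scale_def A.c_scale)
    show "(\<Sum>i<n1 + n2. sum_scale sc1 (?c i X) (?e i)) = X" if "X \<in> UNIV \<times> dual sc2" for X
    proof -
      have \<xi>: "snd X \<in> dual sc2" using that by auto
      have "(\<Sum>i<n2. fun_scale (snd X (e2 i)) (c2 i)) = snd X"
      proof
        fix y
        have "B.functional (snd X)"
          using \<xi> by (simp add: linear_between_def dual)
        then have "snd X y = (\<Sum>i<n2. c2 i y * snd X (e2 i))"
          by (intro B.functional_expand) auto
        then show "(\<Sum>i<n2. fun_scale (snd X (e2 i)) (c2 i)) y = snd X y"
          by (simp add: sum_fun_apply fun_scale_def mult.commute)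
      qed
      then show ?thesis
        unfolding sum using A.expand[of "fst X"] by (simp add: prod_eq_iff)
    qed
    show "?c i (?e j) = (if i = j then 1 else 0)" if "i < n1 + n2" "j < n1 + n2" for i j
      using that by (auto simp: A.c_e B.c_e)
    show "continuous_on UNIV (\<lambda>a. \<Sum>i<n1 + n2. sum_scale sc1 (a i) (?e i))"
      unfolding sum
    proof (intro continuous_on_Pair)
      show "continuous_on UNIV (\<lambda>a. \<Sum>i<n1. sc1 (a i) (e1 i))"
        by (rule A.sum_continuous)
      show "continuous_on UNIV (\<lambda>a. \<Sum>i<n2. fun_scale (a (n1 + i)) (c2 i))"
        by (rule continuous_on_coordinatewise_then_product)
          (auto simp: sum_fun_apply fun_scale_def intro!: continuous_intros)
    qed
    show "continuous_on (UNIV \<times> dual sc2) (?c i)" if "i < n1 + n2" for i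
    proof (cases "i < n1")
      case True
      have "continuous_on (UNIV \<times> dual sc2) (\<lambda>X. c1 i (fst X))"
        by (rule continuous_on_compose2[OF A.c_cont[OF True]]) (auto intro: continuous_intros)
      then show ?thesis using True by simp
    next
      case False
      have "continuous_on (UNIV \<times> dual sc2) (\<lambda>X. snd X (e2 (i - n1)))"
        by (rule continuous_on_compose2[OF continuous_on_product_coordinates[of "e2 (i - n1)"]])
          (auto intro: continuous_intros)
      then show ?thesis using False by simp
    qed
    show "closed (UNIV \<times> dual sc2 :: ('v \<times> ('w \<Rightarrow> 'k)) set)"
    proof (intro closed_Times closed_UNIV)
      have "dual sc2 = {\<xi>. \<forall>x y. \<xi> (x + y) = \<xi> x + \<xi> y} \<inter> {\<xi>. \<forall>a x. \<xi> (sc2 a x) = a * \<xi> x}"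
        by (auto simp: dual_iff[OF B.vector_space_axioms])
      also have "closed \<dots>"
        by (intro closed_Int closed_Collect_all closed_Collect_eq continuous_intros continuous_on_product_coordinates)
      finally show "closed (dual sc2)" .
    qed
    show "\<exists>A B. open A \<and> open B \<and> X \<in> A \<and> Y \<in> B \<and> A \<inter> B = {}" if "X \<noteq> Y" for X Y :: "'v \<times> ('w \<Rightarrow> 'k)"
    proof (cases "fst X = fst Y")
      case False
      then obtain A B where "open A" "open B" "fst X \<in> A" "fst Y \<in> B" "A \<inter> B = {}"
        using hausdorff[of "fst X" "fst Y"] by auto
      then show ?thesis
        by (intro exI[of _ "fst -` A"] exI[of _ "fst -` B"]) (auto intro!: open_vimage continuous_intros)
    next
      case True
      then have "snd X \<noteq> snd Y"
        using that prod_eqI by blast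
      then obtain z where "snd X z \<noteq> snd Y z"
        by (auto simp: fun_eq_iff)
      then obtain A B where AB: "open A" "open B" "snd X z \<in> A" "snd Y z \<in> B" "A \<inter> B = {}"
        using hausdorff[of "snd X z" "snd Y z"] by auto
      have "continuous_on UNIV (\<lambda>X :: 'v \<times> ('w \<Rightarrow> 'k). snd X z)"
        by (rule continuous_on_compose2[OF continuous_on_product_coordinates[of z]]) (auto intro: continuous_intros)
      with AB show ?thesis
        by (intro exI[of _ "(\<lambda>X. snd X z) -` A"] exI[of _ "(\<lambda>X. snd X z) -` B"]) (auto intro!: open_vimage)
    qed
  qed
qed

section \<open>Doubles of Lie quasi-bialgebras\<close>

lemma vector_space_tensor3_scale: "vector_space (tensor3_scale :: 'k::real_or_complex \<Rightarrow> ('k, 'v) tensor3 \<Rightarrow> _)"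
  by standard (auto simp: tensor3_scale_def algebra_simps fun_eq_iff)

lemma span_tensor3_induct [consumes 1, case_names zero add scale base]:
  fixes T :: "('k::real_or_complex, 'v) tensor3"
  assumes "T \<in> module.span tensor3_scale S"
    and "P (\<lambda>_ _ _. 0)"
    and "\<And>A B. P A \<Longrightarrow> P B \<Longrightarrow> P (\<lambda>\<xi> \<eta> \<zeta>. A \<xi> \<eta> \<zeta> + B \<xi> \<eta> \<zeta>)"
    and "\<And>a A. P A \<Longrightarrow> P (\<lambda>\<xi> \<eta> \<zeta>. a * A \<xi> \<eta> \<zeta>)"
    and "\<And>A. A \<in> S \<Longrightarrow> P A"
  shows "P T"
proof -
  interpret vector_space "tensor3_scale :: 'k \<Rightarrow> ('k, 'v) tensor3 \<Rightarrow> _"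
    by (rule vector_space_tensor3_scale)
  have plus: "A + B = (\<lambda>\<xi> \<eta> \<zeta>. A \<xi> \<eta> \<zeta> + B \<xi> \<eta> \<zeta>)" for A B :: "('k, 'v) tensor3"
    by (simp add: fun_eq_iff)
  have "subspace (Collect P)"
    unfolding subspace_def using assms(2-4) by (simp add: plus tensor3_scale_def zero_fun_def)
  then show ?thesis
    using span_induct[OF assms(1), of P] assms(5) by auto
qed

lemma span_pure_tensors_linear:
  fixes T :: "('k::real_or_complex, 'v) tensor3"
  assumes "T \<in> module.span tensor3_scale (pure_tensors A B C)"
  shows "T (\<zeta> + \<zeta>') \<xi> \<eta> = T \<zeta> \<xi> \<eta> + T \<zeta>' \<xi> \<eta>" "T \<xi> (\<zeta> + \<zeta>') \<eta> = T \<xi> \<zeta> \<eta> + T \<xi> \<zeta>' \<eta>"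
    "T \<xi> \<eta> (\<zeta> + \<zeta>') = T \<xi> \<eta> \<zeta> + T \<xi> \<eta> \<zeta>'"
    "T (fun_scale a \<zeta>) \<xi> \<eta> = a * T \<zeta> \<xi> \<eta>" "T \<xi> (fun_scale a \<zeta>) \<eta> = a * T \<xi> \<zeta> \<eta>"
    "T \<xi> \<eta> (fun_scale a \<zeta>) = a * T \<xi> \<eta> \<zeta>"
  using assms by (induction rule: span_tensor3_induct) (auto simp: pure_tensors_def fun_scale_def algebra_simps)

lemma Alt_swap: "Alt T \<eta> \<xi> \<zeta> = - Alt T \<xi> \<eta> \<zeta>" "Alt T \<xi> \<zeta> \<eta> = - Alt T \<xi> \<eta> \<zeta>"
  unfolding Alt_def minus_divide_left
  by (rule arg_cong[where f = "\<lambda>a. a / 6"], simp add: algebra_simps)+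

lemma (in coord_space) dual_expand:
  assumes "V = UNIV" "\<zeta> \<in> dual sc"
  shows "(\<Sum>i<n. fun_scale (\<zeta> (e i)) (c i)) = \<zeta>"
proof
  fix y
  have "functional \<zeta>"
    using assms by (simp add: linear_between_def dual_simps[OF vector_space_axioms])
  then have "\<zeta> y = (\<Sum>i<n. c i y * \<zeta> (e i))"
    using assms(1) by (intro functional_expand) auto
  then show "(\<Sum>i<n. fun_scale (\<zeta> (e i)) (c i)) y = \<zeta> y"
    by (simp add: sum_fun_apply fun_scale_def mult.commute)
qed

lemma (in coord_space) c_dual: "V = UNIV \<Longrightarrow> i < n \<Longrightarrow> c i \<in> dual sc"
  by (simp add: dual_iff[OF vector_space_axioms] c_scale)

lemma (in coord_space) dual_separates:
  assumes "V = UNIV" "\<And>\<zeta>. \<zeta> \<in> dual sc \<Longrightarrow> \<zeta> x = \<zeta> y"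
  shows "x = y"
  using assms c_dual by (intro coord_eqI) auto

text \<open>Finite-dimensional reflexivity with an explicit witness: a linear form on the dual is
  evaluation at the vector with coordinates \<open>f (c i)\<close>.\<close>

lemma (in coord_space) bidual:
  assumes "V = UNIV" and f: "linear_between fun_scale (dual sc) (*) UNIV f" and \<zeta>: "\<zeta> \<in> dual sc"
  shows "\<zeta> (combine (\<lambda>i. f (c i))) = f \<zeta>"
proof -
  interpret F: vector_space "fun_scale :: 'k \<Rightarrow> ('w \<Rightarrow> 'k) \<Rightarrow> _" by (rule vector_space_fun_scale)
  have "F.subspace (dual sc)"
    by (auto simp: F.subspace_def dual_closed[OF vector_space_axioms])
  then have "f (\<Sum>i<n. fun_scale (\<zeta> (e i)) (c i)) = (\<Sum>i<n. \<zeta> (e i) * f (c i))"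
    by (intro linear_between_sum[OF f _ vector_space_fun_scale vs_mult]) (auto simp: c_dual assms(1))
  moreover have "functional \<zeta>"
    using assms by (simp add: linear_between_def dual_simps[OF vector_space_axioms])
  ultimately show ?thesis
    using functional_combine[of \<zeta> "\<lambda>i. f (c i)"] dual_expand[OF assms(1) \<zeta>] by (simp add: mult.commute)
qed

lemma (in coord_space) contract_eq:
  assumes "V = UNIV" "linear_between fun_scale (dual sc) (*) UNIV (T \<xi> \<eta>)" "\<zeta> \<in> dual sc"
  shows "\<zeta> (contract sc T \<xi> \<eta>) = T \<xi> \<eta> \<zeta>"
proof -
  have "\<forall>\<zeta>\<in>dual sc. \<zeta> (contract sc T \<xi> \<eta>) = T \<xi> \<eta> \<zeta>"
    unfolding contract_def
  proof (rule theI)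
    show "\<forall>\<zeta>\<in>dual sc. \<zeta> (combine (\<lambda>i. T \<xi> \<eta> (c i))) = T \<xi> \<eta> \<zeta>"
      using bidual[OF assms(1,2)] by blast
    show "x = combine (\<lambda>i. T \<xi> \<eta> (c i))" if "\<forall>\<zeta>\<in>dual sc. \<zeta> x = T \<xi> \<eta> \<zeta>" for x
      using that bidual[OF assms(1,2)] by (intro dual_separates assms(1)) simp
  qed
  then show ?thesis using assms(3) by blast
qed

text \<open>The canonical symmetric pairing of a double, invariant under the adjoint action. The
  same expression serves for \<open>l\<close> and for \<open>g\<close>.\<close>

definition form :: "'g \<times> ('g \<Rightarrow> 'k::plus) \<Rightarrow> 'g \<times> ('g \<Rightarrow> 'k) \<Rightarrow> 'k" where
  "form X Y = snd X (fst Y) + snd Y (fst X)"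

locale quasi_bialgebra =
  fixes G :: "('k::real_or_complex, 'g::real_normed_vector) quasi_bialg" and n e c
  assumes lqb: "lie_quasi_bialgebra G" and coords: "coord_space (scl G) UNIV n e c"
begin

abbreviation "sc \<equiv> scl G"
abbreviation "br \<equiv> brk G"
abbreviation "dsp \<equiv> dual (scl G)"
abbreviation "dbl \<equiv> double_carrier G"
abbreviation "dbr \<equiv> double_brk G"

sublocale gg: coord_space sc UNIV n e c
  by (rule coords)

sublocale dd: coord_space "sum_scale sc" dbl "n + n"
  "\<lambda>i. if i < n then (e i, 0) else (0, c (i - n))" "\<lambda>i X. if i < n then c i (fst X) else snd X (e (i - n))"
  unfolding double_carrier_def by (rule coord_space_sum[OF coords coords])

lemmas dual_sc = dual_simps[OF gg.vector_space_axioms]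
lemmas dual_cl [simp, intro] = dual_closed[OF gg.vector_space_axioms]

lemma dbl_iff [simp]: "(x, \<xi>) \<in> dbl \<longleftrightarrow> \<xi> \<in> dsp"
  by (simp add: double_carrier_def)

lemma snd_dbl [simp, intro]: "X \<in> dbl \<Longrightarrow> snd X \<in> dsp"
  by (auto simp: double_carrier_def)

lemma br_linear:
  "linear_between sc UNIV sc UNIV (br x)" "linear_between sc UNIV sc UNIV (\<lambda>y. br y x)"
  using lqb by (auto simp: lie_quasi_bialgebra_def lie_algebra_on_def)

lemma br_simps:
  "br x (y + z) = br x y + br x z" "br x (sc a y) = sc a (br x y)" "br x 0 = 0" "br x (- y) = - br x y"
  "br x (y - z) = br x y - br x z"
  "br (y + z) x = br y x + br z x" "br (sc a y) x = sc a (br y x)" "br 0 x = 0" "br (- y) x = - br y x"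
  "br (y - z) x = br y x - br z x"
  using gg.lin_D[OF br_linear(1)] gg.lin_D[OF br_linear(2)] by auto

lemma br_self: "br x x = 0"
  using lqb by (auto simp: lie_quasi_bialgebra_def lie_algebra_on_def)

lemma br_skew: "br y x = - br x y"
proof -
  have "br (x + y) (x + y) = 0" by (rule br_self)
  moreover have "br (x + y) (x + y) = br x x + br y y + (br x y + br y x)"
    by (simp add: br_simps add_ac)
  ultimately have "br x y + br y x = 0"
    by (simp add: br_self)
  then show ?thesis by (simp add: eq_neg_iff_add_eq_0 add.commute)
qed

lemma cobr_antisym: "cobr G x \<in> antisym_maps sc"
  using lqb by (auto simp: lie_quasi_bialgebra_def)

lemma antisym_mapsD:
  assumes "t \<in> antisym_maps sc"
  shows "\<xi> \<in> dsp \<Longrightarrow> \<eta> \<in> dsp \<Longrightarrow> t (\<xi> + \<eta>) = t \<xi> + t \<eta>" "\<xi> \<in> dsp \<Longrightarrow> t (fun_scale a \<xi>) = sc a (t \<xi>)"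
    "\<xi> \<in> dsp \<Longrightarrow> \<eta> \<in> dsp \<Longrightarrow> \<eta> (t \<xi>) = - \<xi> (t \<eta>)"
    "t 0 = 0" "\<xi> \<in> dsp \<Longrightarrow> t (- \<xi>) = - t \<xi>" "\<xi> \<in> dsp \<Longrightarrow> \<eta> \<in> dsp \<Longrightarrow> t (\<xi> - \<eta>) = t \<xi> - t \<eta>"
proof -
  show *: "\<xi> \<in> dsp \<Longrightarrow> \<eta> \<in> dsp \<Longrightarrow> t (\<xi> + \<eta>) = t \<xi> + t \<eta>" "\<xi> \<in> dsp \<Longrightarrow> t (fun_scale a \<xi>) = sc a (t \<xi>)"
    "\<xi> \<in> dsp \<Longrightarrow> \<eta> \<in> dsp \<Longrightarrow> \<eta> (t \<xi>) = - \<xi> (t \<eta>)" for \<xi> \<eta> a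
    using assms by (auto simp: antisym_maps_def linear_between_def)
  show z: "t 0 = 0"
    using *(1)[of 0 0] by simp
  show m: "t (- \<xi>) = - t \<xi>" if "\<xi> \<in> dsp" for \<xi>
    using *(1)[of \<xi> "- \<xi>"] that z by (simp add: eq_neg_iff_add_eq_0 add.commute)
  show "\<xi> \<in> dsp \<Longrightarrow> \<eta> \<in> dsp \<Longrightarrow> t (\<xi> - \<eta>) = t \<xi> - t \<eta>"
    using *(1)[of \<xi> "- \<eta>"] m[of \<eta>] by simp
qed

lemmas antisym_lin = antisym_mapsD(1,2,4-6)
lemmas cobr_lin = antisym_lin[OF cobr_antisym]
lemmas cobr_skew = antisym_mapsD(3)[OF cobr_antisym]

lemma cobr_linear:
  assumes "\<xi> \<in> dsp"
  shows "cobr G (x + y) \<xi> = cobr G x \<xi> + cobr G y \<xi>" "cobr G (sc a x) \<xi> = sc a (cobr G x \<xi>)"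
    "cobr G 0 \<xi> = 0" "cobr G (- x) \<xi> = - cobr G x \<xi>" "cobr G (x - y) \<xi> = cobr G x \<xi> - cobr G y \<xi>"
proof -
  have l: "linear_between sc UNIV sc UNIV (\<lambda>x. cobr G x \<xi>)"
    using lqb assms by (auto simp: lie_quasi_bialgebra_def)
  show "cobr G (x + y) \<xi> = cobr G x \<xi> + cobr G y \<xi>" "cobr G (sc a x) \<xi> = sc a (cobr G x \<xi>)"
    "cobr G 0 \<xi> = 0" "cobr G (- x) \<xi> = - cobr G x \<xi>" "cobr G (x - y) \<xi> = cobr G x \<xi> - cobr G y \<xi>"
    using gg.lin_D[OF l] by auto
qed

lemma coad_dual [simp, intro]: "\<xi> \<in> dsp \<Longrightarrow> coad br x \<xi> \<in> dsp"
  by (subst dual_iff[OF gg.vector_space_axioms]) (simp add: coad_def br_simps dual_sc)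

lemma cobr_dual [simp, intro]: "\<xi> \<in> dsp \<Longrightarrow> \<eta> \<in> dsp \<Longrightarrow> (\<lambda>z. \<eta> (cobr G z \<xi>)) \<in> dsp"
  by (subst dual_iff[OF gg.vector_space_axioms]) (simp add: cobr_linear dual_sc)

lemma in_Alt_span_phi: "in_Alt_span sc (pure_tensors UNIV UNIV UNIV) (phi G)"
  using lqb by (auto simp: lie_quasi_bialgebra_def)

lemma phi_swap:
  assumes "\<xi> \<in> dsp" "\<eta> \<in> dsp" "\<zeta> \<in> dsp"
  shows "phi G \<eta> \<xi> \<zeta> = - phi G \<xi> \<eta> \<zeta>" "phi G \<xi> \<zeta> \<eta> = - phi G \<xi> \<eta> \<zeta>"
proof -
  obtain T where "\<forall>\<xi>\<in>dsp. \<forall>\<eta>\<in>dsp. \<forall>\<zeta>\<in>dsp. phi G \<xi> \<eta> \<zeta> = Alt T \<xi> \<eta> \<zeta>"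
    using in_Alt_span_phi unfolding in_Alt_span_def by blast
  then show "phi G \<eta> \<xi> \<zeta> = - phi G \<xi> \<eta> \<zeta>" "phi G \<xi> \<zeta> \<eta> = - phi G \<xi> \<eta> \<zeta>"
    using Alt_swap[of T] assms by metis+
qed

lemma phi_linear:
  assumes "\<xi> \<in> dsp" "\<eta> \<in> dsp"
  shows "linear_between fun_scale dsp (*) UNIV (phi G \<xi> \<eta>)"
proof -
  obtain T where T: "T \<in> module.span tensor3_scale (pure_tensors UNIV UNIV UNIV)"
    "\<forall>\<xi>\<in>dsp. \<forall>\<eta>\<in>dsp. \<forall>\<zeta>\<in>dsp. phi G \<xi> \<eta> \<zeta> = Alt T \<xi> \<eta> \<zeta>"
    using in_Alt_span_phi unfolding in_Alt_span_def by blast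
  show ?thesis
    using assms T(2)
    by (simp add: linear_between_def Alt_def span_pure_tensors_linear[OF T(1)] add_divide_distrib
        diff_divide_distrib distrib_left right_diff_distrib)
qed

lemma phi_contract: "\<xi> \<in> dsp \<Longrightarrow> \<eta> \<in> dsp \<Longrightarrow> \<zeta> \<in> dsp \<Longrightarrow> \<zeta> (contract sc (phi G) \<xi> \<eta>) = phi G \<xi> \<eta> \<zeta>"
  by (rule gg.contract_eq[OF refl phi_linear])

lemma dbl_lie: "lie_algebra_on (sum_scale sc) dbl dbr"
  using lqb by (auto simp: lie_quasi_bialgebra_def)

lemma dbr_lin: "X \<in> dbl \<Longrightarrow> dd.lin (dbr X)" "X \<in> dbl \<Longrightarrow> dd.lin (\<lambda>Y. dbr Y X)"
  using dbl_lie by (auto simp: lie_algebra_on_def)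

lemma dbr_in [simp, intro]: "X \<in> dbl \<Longrightarrow> Y \<in> dbl \<Longrightarrow> dbr X Y \<in> dbl"
  using dd.lin_D(1)[OF dbr_lin(1)] .

lemma dbr_skew:
  assumes "X \<in> dbl" "Y \<in> dbl"
  shows "dbr Y X = - dbr X Y"
proof -
  have self: "dbr X X = 0" if "X \<in> dbl" for X
    using dbl_lie that by (auto simp: lie_algebra_on_def)
  have "dbr (X + Y) (X + Y) = 0"
    using assms by (intro self) auto
  moreover have "dbr (X + Y) (X + Y) = (dbr X X + dbr X Y) + (dbr Y X + dbr Y Y)"
    using assms by (simp add: dd.lin_D(2)[OF dbr_lin(1)] dd.lin_D(2)[OF dbr_lin(2)] add_ac)
  ultimately have "dbr X Y + dbr Y X = 0"
    using assms self by simp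
  then show ?thesis by (simp add: eq_neg_iff_add_eq_0 add.commute)
qed

lemma dbr_derivation:
  assumes "X \<in> dbl" "Y \<in> dbl" "Z \<in> dbl"
  shows "dbr X (dbr Y Z) = dbr (dbr X Y) Z + dbr Y (dbr X Z)"
proof -
  have "dbr X (dbr Y Z) + dbr Y (dbr Z X) + dbr Z (dbr X Y) = 0"
    using dbl_lie assms by (auto simp: lie_algebra_on_def)
  moreover have "dbr Y (dbr Z X) = - dbr Y (dbr X Z)"
    using assms dbr_skew[of X Z] by (simp add: dd.lin_D[OF dbr_lin(1)])
  moreover have "dbr Z (dbr X Y) = - dbr (dbr X Y) Z"
    using assms by (intro dbr_skew) auto
  ultimately show ?thesis by (simp add: algebra_simps)
qed

lemma bilin_form: "dd.bilin form"
  unfolding dd.bilin_def linear_between_def form_def sum_scale_def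
  by (auto simp: dual_sc[OF snd_dbl] fun_scale_def algebra_simps)

lemma form_commute: "form X Y = form Y (X :: 'g \<times> ('g \<Rightarrow> 'k))"
  by (simp add: form_def)

text \<open>The terms cancel in groups: those in the bracket by its antisymmetry, those in
  \<open>cobr\<close> because each \<open>cobr G x\<close> is skew, the cubic ones because
  \<open>phi\<close> is alternating.\<close>

lemma form_invariant:
  assumes "X \<in> dbl" "Y \<in> dbl" "Z \<in> dbl"
  shows "form (dbr X Y) Z = - form Y (dbr X Z)"
proof -
  obtain x \<xi> y \<eta> z \<zeta> where X: "X = (x, \<xi>)" and Y: "Y = (y, \<eta>)" and Z: "Z = (z, \<zeta>)"
    by (cases X; cases Y; cases Z)
  have d: "\<xi> \<in> dsp" "\<eta> \<in> dsp" "\<zeta> \<in> dsp"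
    using assms by (auto simp: X Y Z)
  note ds = dual_sc[OF d(1)] dual_sc[OF d(2)] dual_sc[OF d(3)]
  have "\<eta> (cobr G x \<zeta>) = - \<zeta> (cobr G x \<eta>)"
    using d by (intro cobr_skew)
  moreover have "\<xi> (br z y) = - \<xi> (br y z)"
    using br_skew[of z y] by (simp only: ds)
  moreover have "\<zeta> (contract sc (phi G) \<xi> \<eta>) = - \<eta> (contract sc (phi G) \<xi> \<zeta>)"
    using d phi_contract phi_swap(2)[OF d] by simp
  ultimately show ?thesis
    by (simp only: X Y Z form_def double_brk_def coad_def ds fst_conv snd_conv case_prod_conv
        plus_fun_apply uminus_apply minus_apply) (simp add: algebra_simps)
qed

lemma Ad_exp_eq:
  assumes "X \<in> dbl" "Y \<in> dbl"
  shows "Ad_exp G X Y = dd.opser exp_coeff (dbr X) Y"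
  unfolding Ad_exp_def by (rule dd.exp_op_eq_opser[OF dbr_lin(1)[OF assms(1)] assms(2)])

lemma Ad_exp_lin:
  assumes "X \<in> dbl"
  shows "dd.lin (Ad_exp G X)"
proof -
  have "dd.lin (dd.opser exp_coeff (dbr X))"
    by (rule dd.opser_lin[OF entire_exp_coeff dbr_lin(1)[OF assms]])
  then show ?thesis
    by (simp add: linear_between_def Ad_exp_eq assms)
qed

lemma dbr_uminus: "X \<in> dbl \<Longrightarrow> Y \<in> dbl \<Longrightarrow> dbr (- X) Y = - dbr X Y"
  using dd.lin_D(5)[OF dbr_lin(2)] .

lemma Ad_exp_inverse:
  assumes "X \<in> dbl" "Y \<in> dbl"
  shows "Ad_exp G (- X) (Ad_exp G X Y) = Y"
proof -
  note L = dbr_lin(1)[OF assms(1)] and L' = dbr_lin(1)[OF dd.V_simps(5)[OF assms(1)]]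
  have "Ad_exp G (- X) (Ad_exp G X Y) =
      dd.opser (\<lambda>k. (- 1) ^ k * exp_coeff k) (dbr X) (dd.opser exp_coeff (dbr X) Y)"
    using assms by (simp add: Ad_exp_eq dd.opser_neg[OF entire_exp_coeff L L' dbr_uminus])
  then show ?thesis
    by (simp add: dd.opser_exp_neg(1)[OF L assms(2)])
qed

lemma Ad_exp_automorphism:
  assumes "X \<in> dbl" "Y \<in> dbl" "Z \<in> dbl"
  shows "Ad_exp G X (dbr Y Z) = dbr (Ad_exp G X Y) (Ad_exp G X Z)"
proof -
  have "dd.opser exp_coeff (dbr X) (dbr Y Z) =
      dbr (dd.opser exp_coeff (dbr X) Y) (dd.opser exp_coeff (dbr X) Z)"
    by (rule dd.exp_derivation_automorphism[where br = dbr, OF dbr_lin(1)[OF assms(1)] dbr_lin])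
      (auto intro: dbr_derivation assms)
  then show ?thesis
    using assms by (simp add: Ad_exp_eq)
qed

lemma form_Ad_exp:
  assumes "X \<in> dbl" "Y \<in> dbl" "Z \<in> dbl"
  shows "form (Ad_exp G X Y) Z = form Y (Ad_exp G (- X) Z)"
  using assms dd.opser_adjoint[OF bilin_form entire_exp_coeff dbr_lin(1)[OF assms(1)] assms(2,3)]
    form_invariant[OF assms(1)]
    dd.opser_neg[OF entire_exp_coeff dbr_lin(1)[OF assms(1)] dbr_lin(1)[OF dd.V_simps(5)[OF assms(1)]] dbr_uminus]
  by (simp add: Ad_exp_eq)

section \<open>Twists and the map between the doubles\<close>

context
  fixes t
  assumes t: "t \<in> antisym_maps sc"
begin

lemma tau_in [simp, intro]: "X \<in> dbl \<Longrightarrow> tau t X \<in> dbl"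
  by (auto simp: tau_def double_carrier_def)

lemma tau_linear: "dd.lin (tau t)"
  by (auto simp: linear_between_def tau_def double_carrier_def sum_scale_def antisym_lin[OF t]
      gg.scale_right_distrib)

lemma inj_tau: "inj (tau t)"
  by (auto intro!: injI simp: tau_def prod_eq_iff)

lemma twist_phi_contract:
  assumes "\<xi> \<in> dsp" "\<eta> \<in> dsp" "\<zeta> \<in> dsp"
  shows "\<zeta> (contract sc (phi (twist G t)) \<xi> \<eta>) = phi (twist G t) \<xi> \<eta> \<zeta>"
proof (rule gg.contract_eq[OF refl _ assms(3)])
  show "linear_between fun_scale dsp (*) UNIV (phi (twist G t) \<xi> \<eta>)"
    using assms(1,2) linear_betweenD[OF phi_linear[OF assms(1,2)]]
    by (simp add: linear_between_def twist_def antisym_lin[OF t] cobr_lin cobr_linear br_simps dual_sc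
        algebra_simps) (simp add: fun_scale_def)
qed

lemma twist_cobr_dual:
  assumes "\<xi> \<in> dsp" "\<eta> \<in> dsp"
  shows "\<eta> (cobr (twist G t) z \<xi>) = \<eta> (cobr G z \<xi>) + \<eta> (br z (t \<xi>)) - \<xi> (br z (t \<eta>))"
  using antisym_mapsD(3)[OF t coad_dual[OF assms(1)] assms(2), of z]
  by (simp add: twist_def dual_sc[OF assms(2)] coad_def)

text \<open>The dual components agree directly. In the \<open>g\<close>-component, tested against
  \<zeta>, skewness of \<open>t\<close> turns \<open>t\<close> of the dual part into terms at
  \<open>t \<zeta>\<close>; they cancel exactly the terms containing \<open>t \<zeta>\<close> in the
  cyclic sum that defines \<open>phi\<close> of the twist.\<close>

lemma tau_bracket:
  assumes "X \<in> dbl" "Y \<in> dbl"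
  shows "tau t (double_brk (twist G t) X Y) = dbr (tau t X) (tau t Y)" "double_brk (twist G t) X Y \<in> dbl"
proof -
  obtain x \<xi> y \<eta> where X: "X = (x, \<xi>)" and Y: "Y = (y, \<eta>)"
    by (cases X; cases Y)
  have d: "\<xi> \<in> dsp" "\<eta> \<in> dsp"
    using assms by (auto simp: X Y)
  note ds = dual_sc[OF d(1)] dual_sc[OF d(2)]
  have tw: "scl (twist G t) = sc" "brk (twist G t) = br"
    by (simp_all add: twist_def)
  have tsk: "\<zeta> (t \<xi>') = - \<xi>' (t \<zeta>)" if "\<zeta> \<in> dsp" "\<xi>' \<in> dsp" for \<zeta> \<xi>'
    using antisym_mapsD(3)[OF t] that by blast
  have csk: "\<zeta> (cobr G z \<xi>') = - \<xi>' (cobr G z \<zeta>)" if "\<zeta> \<in> dsp" "\<xi>' \<in> dsp" for \<zeta> \<xi>' z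
    using cobr_skew that by blast
  let ?b = "double_brk (twist G t) X Y"
  let ?w = "\<lambda>z. \<eta> (cobr (twist G t) z \<xi>)"
  have w: "?w = (\<lambda>z. \<eta> (cobr G z \<xi>)) - coad br (t \<xi>) \<eta> + coad br (t \<eta>) \<xi>"
    using d br_skew[of _ "t \<xi>"] br_skew[of _ "t \<eta>"]
    by (auto simp: twist_cobr_dual coad_def ds fun_eq_iff)
  have wd: "?w \<in> dsp"
    unfolding w using d by auto
  have snd_b: "snd ?b = - coad br x \<eta> + coad br y \<xi> + ?w"
    by (simp add: X Y double_brk_def tw)
  show "?b \<in> dbl"
    unfolding double_carrier_def mem_Times_iff snd_b using d wd by auto
  have s: "snd (tau t ?b) = snd (dbr (tau t X) (tau t Y))"
    unfolding tau_def[of t ?b] snd_conv snd_b w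
    by (simp add: X Y tau_def double_brk_def fun_eq_iff coad_def br_simps ds)
  have "\<zeta> (fst (tau t ?b)) = \<zeta> (fst (dbr (tau t X) (tau t Y)))" if \<zeta>: "\<zeta> \<in> dsp" for \<zeta>
  proof -
    note dz = dual_sc[OF \<zeta>]
    have 1: "\<zeta> (fst (tau t ?b)) = \<zeta> (br x y) + \<zeta> (cobr G x \<eta>) + \<zeta> (br x (t \<eta>)) - \<zeta> (cobr G y \<xi>) - \<zeta> (br y (t \<xi>))
        + \<zeta> (contract sc (phi (twist G t)) \<xi> \<eta>) + \<zeta> (t ?w)"
      using d wd \<zeta> by (simp add: tau_def snd_b antisym_lin[OF t])
        (simp add: X Y double_brk_def tw dz, simp add: twist_def dz antisym_lin[OF t])
    have 2: "\<zeta> (t ?w) = - (\<eta> (cobr G (t \<zeta>) \<xi>) + \<eta> (br (t \<zeta>) (t \<xi>)) - \<xi> (br (t \<zeta>) (t \<eta>)))"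
      using tsk[OF \<zeta> wd] twist_cobr_dual[OF d] by simp
    have 3: "\<zeta> (contract sc (phi (twist G t)) \<xi> \<eta>) = phi G \<xi> \<eta> \<zeta> + \<zeta> (br (t \<xi>) (t \<eta>)) + \<zeta> (cobr G (t \<xi>) \<eta>)
        + \<xi> (br (t \<eta>) (t \<zeta>)) + \<xi> (cobr G (t \<eta>) \<zeta>) + \<eta> (br (t \<zeta>) (t \<xi>)) + \<eta> (cobr G (t \<zeta>) \<xi>)"
      using twist_phi_contract[OF d \<zeta>] d \<zeta> by (simp add: twist_def dz ds add_ac)
    have 4: "\<zeta> (fst (dbr (tau t X) (tau t Y))) = \<zeta> (br x y) + \<zeta> (br x (t \<eta>)) + \<zeta> (br (t \<xi>) y) + \<zeta> (br (t \<xi>) (t \<eta>))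
        + \<zeta> (cobr G x \<eta>) + \<zeta> (cobr G (t \<xi>) \<eta>) - \<zeta> (cobr G y \<xi>) - \<zeta> (cobr G (t \<eta>) \<xi>) + phi G \<xi> \<eta> \<zeta>"
      using d \<zeta> by (simp add: X Y tau_def double_brk_def br_simps cobr_linear dz phi_contract)
    have 5: "\<xi> (br (t \<zeta>) (t \<eta>)) = - \<xi> (br (t \<eta>) (t \<zeta>))" "\<zeta> (br (t \<xi>) y) = - \<zeta> (br y (t \<xi>))"
      using br_skew[of "t \<zeta>" "t \<eta>"] br_skew[of "t \<xi>" y] by (simp_all only: ds dz)
    show ?thesis
      unfolding 1 2 3 4 5 using csk[OF \<zeta> d(1), of "t \<eta>"] by simp
  qed
  then have "fst (tau t ?b) = fst (dbr (tau t X) (tau t Y))"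
    by (rule gg.dual_separates[OF refl])
  with s show "tau t ?b = dbr (tau t X) (tau t Y)"
    by (rule prod_eqI[rotated])
qed

end

end

section \<open>Canonically compatible reductive decompositions\<close>

locale canonical_reduction = quasi_bialgebra G n e c
  for G :: "('k::real_or_complex, 'g::real_normed_vector) quasi_bialg" and n e c +
  fixes R :: "('k, 'g, 'l::real_normed_vector) decomposition" and nl el cl
  assumes red: "reductive_decomposition G R" and can: "canonically_compatible G R"
    and lcoords: "coord_space (lscl R) UNIV nl el cl"
begin

abbreviation "lsc \<equiv> lscl R"
abbreviation "lbr \<equiv> lbrk R"
abbreviation "dl \<equiv> dual (lscl R)"
abbreviation "lift \<equiv> lift_dual R"
abbreviation "res \<equiv> restr_dual R"
abbreviation "ldbl \<equiv> double_carrier (sub_quasi_bialg G R)"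

sublocale ll: coord_space lsc UNIV nl el cl
  by (rule lcoords)

lemma ldbl_eq: "ldbl = UNIV \<times> dl"
  by (simp add: double_carrier_def sub_quasi_bialg_def)

sublocale ld: coord_space "sum_scale lsc" ldbl "nl + nl"
  "\<lambda>i. if i < nl then (el i, 0) else (0, cl (i - nl))" "\<lambda>i X. if i < nl then cl i (fst X) else snd X (el (i - nl))"
  unfolding ldbl_eq by (rule coord_space_sum[OF lcoords lcoords])

lemma ldbl_iff [simp]: "(z, \<alpha>) \<in> ldbl \<longleftrightarrow> \<alpha> \<in> dl"
  by (simp add: ldbl_eq)

lemma snd_ldbl [simp, intro]: "X \<in> ldbl \<Longrightarrow> snd X \<in> dl"
  by (auto simp: ldbl_eq)

lemmas ldual_sc = dual_simps[OF ll.vector_space_axioms]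
lemmas ldual_cl [simp, intro] = dual_closed[OF ll.vector_space_axioms]

lemma lbr_linear: "linear_between lsc UNIV lsc UNIV (lbr x)" "linear_between lsc UNIV lsc UNIV (\<lambda>y. lbr y x)"
  using red by (auto simp: reductive_decomposition_def lie_algebra_on_def)

lemma lbr_simps:
  "lbr x (y + z) = lbr x y + lbr x z" "lbr x (lsc a y) = lsc a (lbr x y)" "lbr 0 x = 0"
  "lbr (y + z) x = lbr y x + lbr z x" "lbr (lsc a y) x = lsc a (lbr y x)"
  using ll.lin_D[OF lbr_linear(1)] ll.lin_D[OF lbr_linear(2)] by auto

lemma lcoad_dual [simp, intro]: "\<alpha> \<in> dl \<Longrightarrow> coad lbr z \<alpha> \<in> dl"
  by (subst dual_iff[OF ll.vector_space_axioms]) (simp add: coad_def lbr_simps ldual_sc)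

lemma incl_linear: "linear_between lsc UNIV sc UNIV (incl R)"
  using red by (simp add: reductive_decomposition_def Vector_Spaces.linear_iff linear_between_def)

lemma incl_simps:
  "incl R (x + y) = incl R x + incl R y" "incl R (lsc a x) = sc a (incl R x)" "incl R 0 = 0"
  "incl R (- x) = - incl R x" "incl R (x - y) = incl R x - incl R y"
proof -
  note f = linear_betweenD[OF incl_linear, simplified]
  show *: "incl R (x + y) = incl R x + incl R y" "incl R (lsc a x) = sc a (incl R x)" for x y a
    by (rule f)+
  show "incl R 0 = 0"
    using *(2)[of 0 0] by simp
  show m: "incl R (- x) = - incl R x" for x
    using *(2)[of "-1" x] by simp
  show "incl R (x - y) = incl R x - incl R y"
    using *(1)[of x "- y"] m by simp
qed

lemma incl_inj [simp]: "incl R x = incl R y \<longleftrightarrow> x = y"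
  using red by (auto simp: reductive_decomposition_def inj_def)

lemma incl_eq_0 [simp]: "incl R x = 0 \<longleftrightarrow> x = 0"
  using incl_inj[of x 0] by (simp add: incl_simps)

lemma compl_subspace: "gg.subspace (compl R)"
  using red by (simp add: reductive_decomposition_def)

lemma compl_simps [simp, intro]:
  "0 \<in> compl R" "x \<in> compl R \<Longrightarrow> y \<in> compl R \<Longrightarrow> x + y \<in> compl R"
  "x \<in> compl R \<Longrightarrow> y \<in> compl R \<Longrightarrow> x - y \<in> compl R" "x \<in> compl R \<Longrightarrow> - x \<in> compl R"
  "x \<in> compl R \<Longrightarrow> sc a x \<in> compl R"
  using compl_subspace by (auto simp: gg.subspace_0 gg.subspace_add gg.subspace_diff gg.subspace_neg gg.subspace_scale)

lemma incl_in_compl: "incl R z \<in> compl R \<longleftrightarrow> z = 0"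
proof
  assume "incl R z \<in> compl R"
  then have "incl R z \<in> range (incl R) \<inter> compl R" by auto
  also have "range (incl R) \<inter> compl R = {0}"
    using red by (simp add: reductive_decomposition_def)
  finally show "z = 0" by simp
qed (simp add: incl_simps)

lemma proj_eqI:
  assumes "x - incl R z \<in> compl R"
  shows "proj_l R x = z"
  unfolding proj_l_def
proof (rule the_equality)
  fix z' assume "x - incl R z' \<in> compl R"
  from compl_simps(3)[OF assms this] have "incl R (z' - z) \<in> compl R"
    by (simp add: incl_simps)
  then show "z' = z"
    by (simp add: incl_in_compl)
qed (rule assms)

lemma proj_decomp: "x - incl R (proj_l R x) \<in> compl R"
proof -
  obtain z y where zy: "y \<in> compl R" "x = incl R z + y"
    using red unfolding reductive_decomposition_def by blast
  then have "x - incl R z \<in> compl R" by simp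
  with proj_eqI[OF this] show ?thesis by simp
qed

lemma proj_simps:
  "proj_l R (x + y) = proj_l R x + proj_l R y" "proj_l R (sc a x) = lsc a (proj_l R x)"
  "proj_l R (incl R z) = z" "y \<in> compl R \<Longrightarrow> proj_l R y = 0"
proof -
  have "x + y - incl R (proj_l R x + proj_l R y) = (x - incl R (proj_l R x)) + (y - incl R (proj_l R y))"
    by (simp add: incl_simps)
  from compl_simps(2)[OF proj_decomp proj_decomp, of x y, folded this]
  show "proj_l R (x + y) = proj_l R x + proj_l R y"
    by (rule proj_eqI)
  have "sc a x - incl R (lsc a (proj_l R x)) = sc a (x - incl R (proj_l R x))"
    by (simp add: incl_simps gg.scale_right_diff_distrib)
  from compl_simps(5)[OF proj_decomp, of a x, folded this]
  show "proj_l R (sc a x) = lsc a (proj_l R x)"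
    by (rule proj_eqI)
  show "proj_l R (incl R z) = z" "y \<in> compl R \<Longrightarrow> proj_l R y = 0"
    by (auto intro!: proj_eqI simp: incl_simps)
qed

lemma in_compl_iff: "x \<in> compl R \<longleftrightarrow> proj_l R x = 0"
  using proj_decomp[of x] proj_simps(4) by (auto simp: incl_simps)

lemma lift_dual [simp, intro]: "\<alpha> \<in> dl \<Longrightarrow> lift \<alpha> \<in> dsp"
  by (subst dual_iff[OF gg.vector_space_axioms]) (simp add: lift_dual_def proj_simps ldual_sc)

lemma res_dual [simp, intro]: "\<xi> \<in> dsp \<Longrightarrow> res \<xi> \<in> dl"
  by (subst dual_iff[OF ll.vector_space_axioms]) (simp add: restr_dual_def incl_simps dual_sc)

lemma lift_simps:
  "lift (\<alpha> + \<beta>) = lift \<alpha> + lift \<beta>" "lift (fun_scale a \<alpha>) = fun_scale a (lift \<alpha>)" "lift 0 = 0"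
  "lift (- \<alpha>) = - lift \<alpha>" "lift (\<alpha> - \<beta>) = lift \<alpha> - lift \<beta>" "lift \<alpha> (incl R z) = \<alpha> z"
  "res (lift \<alpha>) = \<alpha>"
  by (auto simp: lift_dual_def restr_dual_def fun_scale_def fun_eq_iff proj_simps)

lemma lift_compl: "\<alpha> \<in> dl \<Longrightarrow> y \<in> compl R \<Longrightarrow> lift \<alpha> y = 0"
  by (simp add: lift_dual_def proj_simps ldual_sc)

lemma res_simps:
  "res (\<xi> + \<eta>) = res \<xi> + res \<eta>" "res (fun_scale a \<xi>) = fun_scale a (res \<xi>)" "res 0 = 0"
  "res (- \<xi>) = - res \<xi>" "res (\<xi> - \<eta>) = res \<xi> - res \<eta>"
  by (auto simp: restr_dual_def fun_scale_def fun_eq_iff)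

section \<open>Functionals that vanish on one of the two summands\<close>

definition lperp :: "('g \<Rightarrow> 'k) set" where
  "lperp = {\<xi> \<in> dsp. res \<xi> = 0}"

lemma lperp_D: "\<xi> \<in> lperp \<Longrightarrow> \<xi> \<in> dsp" "\<xi> \<in> lperp \<Longrightarrow> res \<xi> = 0" "\<xi> \<in> lperp \<Longrightarrow> \<xi> (incl R z) = 0"
  by (auto simp: lperp_def restr_dual_def fun_eq_iff)

lemma lperp_annihilator: "lperp = annihilator sc (range (incl R))"
  by (auto simp: lperp_def annihilator_def restr_dual_def fun_eq_iff)

lemma lperp_part: "\<xi> \<in> dsp \<Longrightarrow> \<xi> - lift (res \<xi>) \<in> lperp"
  by (simp add: lperp_def res_simps lift_simps)

lemma lift_annihilator: "\<alpha> \<in> dl \<Longrightarrow> lift \<alpha> \<in> annihilator sc (compl R)"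
  by (auto simp: annihilator_def lift_compl)

text \<open>The double annihilator of \<open>l\<close> is \<open>l\<close>: every functional differs
  from the lift of its restriction by an element of \<open>lperp\<close>.\<close>

lemma range_incl_iff:
  assumes "\<And>\<zeta>. \<zeta> \<in> lperp \<Longrightarrow> \<zeta> x = 0"
  shows "x = incl R (proj_l R x)"
proof (rule gg.dual_separates[OF refl])
  fix \<zeta> assume \<zeta>: "\<zeta> \<in> dsp"
  have "(\<zeta> - lift (res \<zeta>)) x = 0"
    by (rule assms[OF lperp_part[OF \<zeta>]])
  then show "\<zeta> x = \<zeta> (incl R (proj_l R x))"
    by (simp add: lift_dual_def restr_dual_def)
qed

lemma cobr_incl: "\<xi> \<in> dsp \<Longrightarrow> cobr G (incl R z) \<xi> = 0"
  using can by (simp add: canonically_compatible_def)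

lemma cobr_lift: "\<alpha> \<in> dl \<Longrightarrow> \<beta> \<in> dl \<Longrightarrow> lift \<alpha> (cobr G x (lift \<beta>)) = 0"
  using can lift_annihilator by (auto simp: canonically_compatible_def)

lemma phi_lperp: "\<xi> \<in> lperp \<Longrightarrow> \<eta> \<in> lperp \<Longrightarrow> \<zeta> \<in> lperp \<Longrightarrow> phi G \<xi> \<eta> \<zeta> = 0"
  using can by (simp add: canonically_compatible_def Let_def lperp_annihilator)

text \<open>Lifts vanish on \<open>m\<close> and elements of \<open>lperp\<close> on
  \<open>l\<close>, so only a component with two factors in \<open>l\<close> and one in
  \<open>m\<close> could contribute, and the allowed span has none. All six orders of the arguments
  are carried along because \<open>Alt\<close> permutes them.\<close>

lemma phi_lift_lift_lperp:
  assumes "\<alpha> \<in> dl" "\<beta> \<in> dl" "\<zeta> \<in> lperp"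
  shows "phi G (lift \<alpha>) (lift \<beta>) \<zeta> = 0"
proof -
  let ?L = "range (incl R)" and ?M = "compl R"
  let ?S = "pure_tensors ?L ?L ?L \<union> pure_tensors ?L ?M ?M \<union> pure_tensors ?M ?M ?M"
  have "in_Alt_span sc ?S (phi G)"
    using can by (simp add: canonically_compatible_def Let_def)
  then obtain T where T: "T \<in> module.span tensor3_scale ?S"
    "\<forall>\<xi>\<in>dsp. \<forall>\<eta>\<in>dsp. \<forall>\<zeta>\<in>dsp. phi G \<xi> \<eta> \<zeta> = Alt T \<xi> \<eta> \<zeta>"
    unfolding in_Alt_span_def by blast
  let ?a = "lift \<alpha>" and ?b = "lift \<beta>"
  have "T ?a ?b \<zeta> = 0 \<and> T ?b ?a \<zeta> = 0 \<and> T ?a \<zeta> ?b = 0 \<and> T ?b \<zeta> ?a = 0 \<and> T \<zeta> ?a ?b = 0 \<and> T \<zeta> ?b ?a = 0"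
    using T(1)
  proof (induction rule: span_tensor3_induct)
    case (base A)
    then show ?case
      using lift_compl[OF assms(1)] lift_compl[OF assms(2)] lperp_D(3)[OF assms(3)]
      unfolding pure_tensors_def by auto
  qed auto
  then have "Alt T ?a ?b \<zeta> = 0"
    by (simp add: Alt_def)
  then show ?thesis
    using T(2) assms lperp_D(1)[OF assms(3)] by simp
qed

section \<open>The double of the subalgebra inside the large double\<close>

definition lphi :: "('l \<Rightarrow> 'k) \<Rightarrow> ('l \<Rightarrow> 'k) \<Rightarrow> 'l" where
  "lphi = contract lsc (phi (sub_quasi_bialg G R))"

lemma lphi_dual:
  assumes "\<alpha> \<in> dl" "\<beta> \<in> dl" "\<gamma> \<in> dl"
  shows "\<gamma> (lphi \<alpha> \<beta>) = phi G (lift \<alpha>) (lift \<beta>) (lift \<gamma>)"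
proof -
  have "linear_between fun_scale dl (*) UNIV (phi (sub_quasi_bialg G R) \<alpha> \<beta>)"
    using linear_betweenD[OF phi_linear[OF lift_dual[OF assms(1)] lift_dual[OF assms(2)]]]
    by (simp add: linear_between_def sub_quasi_bialg_def lift_simps)
  from ll.contract_eq[where T = "phi (sub_quasi_bialg G R)" and \<xi> = \<alpha> and \<eta> = \<beta>, OF refl this assms(3)]
  show ?thesis
    unfolding lphi_def by (simp add: sub_quasi_bialg_def)
qed

text \<open>The contraction of two lifts is killed by \<open>lperp\<close>, hence lies in
  \<open>l\<close>, where lifts test it in the same way as the restricted tensor does.\<close>

lemma incl_lphi:
  assumes "\<alpha> \<in> dl" "\<beta> \<in> dl"
  shows "contract sc (phi G) (lift \<alpha>) (lift \<beta>) = incl R (lphi \<alpha> \<beta>)"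
proof -
  let ?x = "contract sc (phi G) (lift \<alpha>) (lift \<beta>)"
  have x: "\<zeta> ?x = phi G (lift \<alpha>) (lift \<beta>) \<zeta>" if "\<zeta> \<in> dsp" for \<zeta>
    using phi_contract[OF lift_dual[OF assms(1)] lift_dual[OF assms(2)] that] .
  have "\<gamma> (proj_l R ?x) = \<gamma> (lphi \<alpha> \<beta>)" if "\<gamma> \<in> dl" for \<gamma>
    using x[OF lift_dual[OF that]] lphi_dual[OF assms that] by (simp add: lift_dual_def)
  then have "proj_l R ?x = lphi \<alpha> \<beta>"
    by (rule ll.dual_separates[OF refl])
  moreover have "?x = incl R (proj_l R ?x)"
    using x phi_lift_lift_lperp[OF assms] lperp_D(1) by (intro range_incl_iff) simp
  ultimately show ?thesis by simp
qed

definition emb :: "'l \<times> ('l \<Rightarrow> 'k) \<Rightarrow> 'g \<times> ('g \<Rightarrow> 'k)" where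
  "emb X = (incl R (fst X), lift (snd X))"

lemma emb_in [simp, intro]: "X \<in> ldbl \<Longrightarrow> emb X \<in> dbl"
  by (simp add: emb_def)

lemma emb_linear: "linear_between (sum_scale lsc) ldbl (sum_scale sc) dbl emb"
  unfolding linear_between_def by (auto simp: emb_def incl_simps lift_simps sum_scale_def)

lemma emb_simps: "emb (X + Y) = emb X + emb Y" "emb (sum_scale lsc a X) = sum_scale sc a (emb X)" "emb (- X) = - emb X"
  by (auto simp: emb_def incl_simps lift_simps sum_scale_def)

lemma emb_inj [simp]: "emb X = emb Y \<longleftrightarrow> X = Y"
  using lift_simps(7) by (auto simp: emb_def prod_eq_iff) metis

lemma form_emb: "form (emb X) (emb Y) = form X Y"
  by (simp add: form_def emb_def lift_simps)

lemma contract_0: "\<xi> \<in> dsp \<Longrightarrow> contract sc (phi G) \<xi> 0 = 0"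
proof (rule gg.dual_separates[OF refl])
  fix \<zeta> assume *: "\<xi> \<in> dsp" "\<zeta> \<in> dsp"
  have "phi G \<xi> \<zeta> (fun_scale 0 0) = 0"
    using linear_betweenD(3)[OF phi_linear[OF *], of 0 0] by simp
  then have "phi G \<xi> \<zeta> 0 = 0"
    by (simp add: fun_scale_def zero_fun_def)
  then show "\<zeta> (contract sc (phi G) \<xi> 0) = \<zeta> 0"
    using phi_contract[of \<xi> 0 \<zeta>] phi_swap(2)[of \<xi> \<zeta> 0] * by (simp add: dual_sc)
qed

lemma lphi_0: "\<alpha> \<in> dl \<Longrightarrow> lphi \<alpha> 0 = 0"
  using incl_lphi[of \<alpha> 0] contract_0 by (simp add: lift_simps)

lemma ad_l_eq:
  assumes "\<alpha> \<in> dl"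
  shows "ad_l G R p (z, \<alpha>) = (lphi p \<alpha>, coad lbr z p)"
proof -
  have "coad lbr 0 \<alpha> = 0"
    using assms by (simp add: coad_def lbr_simps ldual_sc fun_eq_iff)
  moreover have "(\<lambda>_ :: 'l. \<alpha> 0) = 0"
    using assms by (simp add: ldual_sc fun_eq_iff)
  ultimately show ?thesis
    by (simp add: ad_l_def double_brk_def lphi_def) (simp add: sub_quasi_bialg_def lbr_simps)
qed

lemma coad_lift:
  assumes "p \<in> dl"
  shows "coad br (incl R z) (lift p) = lift (coad lbr z p)"
proof
  fix x
  let ?y = "x - incl R (proj_l R x)"
  have "br (incl R z) x = br (incl R z) (incl R (proj_l R x)) + br (incl R z) ?y"
    by (simp flip: br_simps)
  also have "\<dots> = incl R (lbr z (proj_l R x)) + br (incl R z) ?y"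
    using red by (simp add: reductive_decomposition_def)
  finally have eq: "br (incl R z) x = incl R (lbr z (proj_l R x)) + br (incl R z) ?y" .
  have "br (incl R z) ?y \<in> compl R"
    using red proj_decomp[of x] by (simp add: reductive_decomposition_def)
  then have "proj_l R (br (incl R z) x) = lbr z (proj_l R x)"
    unfolding eq by (simp add: proj_simps)
  then show "coad br (incl R z) (lift p) x = lift (coad lbr z p) x"
    by (simp add: coad_def lift_dual_def)
qed

text \<open>Here compatibility enters: \<open>cobr\<close> vanishes on \<open>l\<close> and between
  lifts, the contraction of two lifts stays in \<open>l\<close>, and invariance of \<open>m\<close>
  makes \<open>coad\<close> of a lift a lift. So the adjoint action of a lift in the large double
  restricts to \<open>ad_l\<close>, and series in the two operators correspond.\<close>

lemma emb_ad_l: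
  assumes "p \<in> dl" "X \<in> ldbl"
  shows "emb (ad_l G R p X) = dbr (0, lift p) (emb X)"
proof -
  obtain z \<alpha> where X: "X = (z, \<alpha>)" and \<alpha>: "\<alpha> \<in> dl"
    using assms(2) by (cases X) auto
  have "(\<lambda>x. lift \<alpha> (cobr G x (lift p))) = 0"
    using cobr_lift[OF \<alpha> assms(1)] by (simp add: fun_eq_iff)
  moreover have "coad br 0 (lift \<alpha>) = 0"
    using \<alpha> by (simp add: coad_def br_simps dual_sc[OF lift_dual] fun_eq_iff)
  ultimately show ?thesis
    using assms(1) \<alpha>
    by (simp add: X ad_l_eq emb_def double_brk_def br_simps cobr_linear cobr_incl incl_lphi coad_lift)
qed

lemma ad_l_in [simp, intro]: "p \<in> dl \<Longrightarrow> X \<in> ldbl \<Longrightarrow> ad_l G R p X \<in> ldbl"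
  by (cases X) (simp add: ad_l_eq)

lemma lift_in_dbl [simp, intro]: "p \<in> dl \<Longrightarrow> (0, lift p) \<in> dbl"
  by simp

lemma ad_l_lin:
  assumes "p \<in> dl"
  shows "ld.lin (ad_l G R p)"
  unfolding linear_between_def
proof (intro conjI ballI allI)
  note L = dd.lin_D[OF dbr_lin(1)[OF lift_in_dbl[OF assms]]]
  fix X assume X: "X \<in> ldbl"
  show "ad_l G R p X \<in> ldbl" using assms X by simp
  show "ad_l G R p (X + Y) = ad_l G R p X + ad_l G R p Y" if "Y \<in> ldbl" for Y
    using L(2)[of "emb X" "emb Y"] assms X that by (simp flip: emb_inj add: emb_ad_l emb_simps)
  show "ad_l G R p (sum_scale lsc a X) = sum_scale lsc a (ad_l G R p X)" for a
    using L(3)[of "emb X" a] assms X by (simp flip: emb_inj add: emb_ad_l emb_simps)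
qed

lemma bilin_lform: "ld.bilin form"
  unfolding ld.bilin_def linear_between_def form_def sum_scale_def
  by (auto simp: ldual_sc[OF snd_ldbl] fun_scale_def algebra_simps)

lemma ad_l_skew:
  assumes "p \<in> dl" "X \<in> ldbl" "Y \<in> ldbl"
  shows "form (ad_l G R p X) Y = - form X (ad_l G R p Y)"
  using form_invariant[of "(0, lift p)" "emb X" "emb Y"] assms
  by (simp flip: form_emb add: emb_ad_l)

text \<open>\<open>ad\<^sub>p\<close> exchanges \<open>l\<close> and \<open>l\<^sup>*\<close>, so it anticommutes with the following reflection.\<close>

definition reflect :: "'l \<times> ('l \<Rightarrow> 'k) \<Rightarrow> 'l \<times> ('l \<Rightarrow> 'k)" where
  "reflect X = (fst X, - snd X)"

lemma reflect_lin: "ld.lin reflect"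
  unfolding linear_between_def by (auto simp: reflect_def sum_scale_def fun_scale_def)

lemma ad_l_reflect:
  assumes "p \<in> dl" "X \<in> ldbl"
  shows "reflect (ad_l G R p X) = - ad_l G R p (reflect X)"
proof -
  obtain z \<alpha> where X: "X = (z, \<alpha>)" and \<alpha>: "\<alpha> \<in> dl"
    using assms(2) by (cases X) auto
  have X': "X = (z, 0) + (0, \<alpha>)" "reflect X = (z, 0) - (0, \<alpha>)"
    by (simp_all add: X reflect_def)
  have z: "coad lbr 0 p = 0"
    using assms(1) by (simp add: coad_def lbr_simps ldual_sc fun_eq_iff)
  show ?thesis
    using assms(1) \<alpha> unfolding X'(2)
    by (subst ld.lin_D(6)[OF ad_l_lin]) (auto simp: X ad_l_eq lphi_0 z reflect_def)
qed

lemma reflect_opser: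
  assumes "p \<in> dl" "X \<in> ldbl" "entire_coeffs a"
  shows "reflect (ld.opser a (ad_l G R p) X) = ld.opser (\<lambda>k. (- 1) ^ k * a k) (ad_l G R p) (reflect X)"
proof -
  let ?A = "ad_l G R p"
  have m: "ld.lin (\<lambda>X. - ?A X)"
    using ad_l_lin[OF assms(1)] by (auto simp: linear_between_def sum_scale_def fun_scale_def ld.scale_minus_right)
      (simp add: ld.scale_minus_right[unfolded sum_scale_def fun_scale_def])?
  have "reflect (ld.opser a ?A X) = ld.opser a (\<lambda>X. - ?A X) (reflect X)"
    by (rule ld.opser_intertwine[OF ld.coord_space_axioms assms(3) ad_l_lin[OF assms(1)] m reflect_lin _ assms(2)])
      (rule ad_l_reflect[OF assms(1)])
  also have "\<dots> = ld.opser (\<lambda>k. (- 1) ^ k * a k) ?A (reflect X)"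
    by (rule ld.opser_neg[OF assms(3) ad_l_lin[OF assms(1)] m]) (use ld.lin_D(1)[OF reflect_lin assms(2)] in auto)
  finally show ?thesis .
qed

lemma self_neg: "(x :: 'k) = - x \<Longrightarrow> x = 0"
  by (metis add.inverse_neutral add_left_cancel add.right_inverse mult_2 mult_eq_0_iff zero_neq_numeral)

lemma snd_eq_0_if_reflect:
  assumes "reflect X = X"
  shows "snd X = 0"
proof
  fix z
  have "snd X z = - snd X z"
    using assms by (metis reflect_def snd_conv uminus_apply)
  then show "snd X z = 0 z"
    using self_neg by simp
qed

lemma fst_eq_0_if_reflect:
  assumes "reflect X = - X" "X \<in> ldbl"
  shows "fst X = 0"
proof -
  have "fst X = - fst X"
    using assms(1) by (metis reflect_def fst_conv fst_uminus)
  then have "\<gamma> (fst X) = 0" if "\<gamma> \<in> dl" for \<gamma>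
    using self_neg ldual_sc(4)[OF that] by metis
  then show ?thesis
    by (intro ll.dual_separates[OF refl]) (simp add: ldual_sc)
qed

text \<open>Even series commute with the reflection and odd ones anticommute, while its eigenvectors
  for the values 1 and -1 lie in \<open>l\<close> and in the dual of \<open>l\<close>.\<close>

lemma opser_parity:
  assumes p: "p \<in> dl" and \<alpha>: "\<alpha> \<in> dl" and a: "entire_coeffs a"
  shows "(\<And>k. odd k \<Longrightarrow> a k = 0) \<Longrightarrow> snd (ld.opser a (ad_l G R p) (z, 0)) = 0"
    and "(\<And>k. odd k \<Longrightarrow> a k = 0) \<Longrightarrow> fst (ld.opser a (ad_l G R p) (0, \<alpha>)) = 0"
    and "(\<And>k. even k \<Longrightarrow> a k = 0) \<Longrightarrow> snd (ld.opser a (ad_l G R p) (0, \<alpha>)) = 0"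
proof -
  note L = ld.opser_lin[OF a ad_l_lin[OF p]]
  have r: "reflect (z, 0) = (z, 0)" "reflect (0, \<alpha>) = - (0, \<alpha>)"
    by (simp_all add: reflect_def)
  have even: "(\<lambda>k. (- 1) ^ k * a k) = a" if "\<And>k. odd k \<Longrightarrow> a k = 0"
    using that by (auto simp: fun_eq_iff minus_one_power_iff)
  have odd: "(\<lambda>k. (- 1) ^ k * a k) = (\<lambda>k. - a k)" if "\<And>k. even k \<Longrightarrow> a k = 0"
    using that by (auto simp: fun_eq_iff minus_one_power_iff)
  show "snd (ld.opser a (ad_l G R p) (z, 0)) = 0" if "\<And>k. odd k \<Longrightarrow> a k = 0"
    using reflect_opser[OF p _ a, of "(z, 0)"] by (intro snd_eq_0_if_reflect) (simp add: even[OF that] r)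
  show "fst (ld.opser a (ad_l G R p) (0, \<alpha>)) = 0" if "\<And>k. odd k \<Longrightarrow> a k = 0"
  proof (rule fst_eq_0_if_reflect)
    show "reflect (ld.opser a (ad_l G R p) (0, \<alpha>)) = - ld.opser a (ad_l G R p) (0, \<alpha>)"
      using reflect_opser[OF p _ a, of "(0, \<alpha>)"] \<alpha> ld.lin_D(5)[OF L, of "(0, \<alpha>)"]
      unfolding r(2) by (simp add: even[OF that])
  qed auto
  show "snd (ld.opser a (ad_l G R p) (0, \<alpha>)) = 0" if e: "\<And>k. even k \<Longrightarrow> a k = 0"
  proof (rule snd_eq_0_if_reflect)
    have ea: "entire_coeffs (\<lambda>k. - a k)"
      using a by (simp add: entire_coeffs_def)
    have "reflect (ld.opser a (ad_l G R p) (0, \<alpha>)) = ld.opser (\<lambda>k. - a k) (ad_l G R p) (- (0, \<alpha>))"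
      using reflect_opser[OF p _ a, of "(0, \<alpha>)"] \<alpha> unfolding r(2) by (simp add: odd[OF e])
    also have "\<dots> = - ld.opser (\<lambda>k. - a k) (ad_l G R p) (0, \<alpha>)"
      using ld.lin_D(5)[OF ld.opser_lin[OF ea ad_l_lin[OF p]], of "(0, \<alpha>)"] \<alpha> by simp
    also have "ld.opser (\<lambda>k. - a k) (ad_l G R p) (0, \<alpha>) = - ld.opser a (ad_l G R p) (0, \<alpha>)"
    proof -
      have "(\<lambda>k. a k * f ((ad_l G R p ^^ k) (0, \<alpha>))) sums f (ld.opser a (ad_l G R p) (0, \<alpha>))"
        if "ld.functional f" for f
        using ld.opser_functional[OF a that ad_l_lin[OF p]] \<alpha> by simp
      from sums_minus[OF this[OF ld.functional_c]]
      show ?thesis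
        using \<alpha> by (intro ld.opser_eqI[OF ea ad_l_lin[OF p]]) auto
    qed
    finally show "reflect (ld.opser a (ad_l G R p) (0, \<alpha>)) = ld.opser a (ad_l G R p) (0, \<alpha>)"
      by simp
  qed
qed

end

section \<open>The adjoint action and the orthogonal splitting of the double\<close>

context canonical_reduction
begin

text \<open>The orthogonal of the image of \<open>emb\<close> with respect to \<open>form\<close>.
  The adjoint action of a lift preserves this image and the form, hence also
  \<open>cmpl\<close>.\<close>

definition cmpl :: "('g \<times> ('g \<Rightarrow> 'k)) set" where
  "cmpl = compl R \<times> lperp"

lemma cmpl_dbl: "X \<in> cmpl \<Longrightarrow> X \<in> dbl"
  by (auto simp: cmpl_def lperp_def)

lemma cmpl_iff:
  assumes "X \<in> dbl"
  shows "X \<in> cmpl \<longleftrightarrow> (\<forall>Y\<in>ldbl. form (emb Y) X = 0)"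
proof
  assume "X \<in> cmpl"
  then show "\<forall>Y\<in>ldbl. form (emb Y) X = 0"
    by (auto simp: cmpl_def form_def emb_def lift_compl lperp_D(3))
next
  assume *: "\<forall>Y\<in>ldbl. form (emb Y) X = 0"
  obtain x \<xi> where X: "X = (x, \<xi>)" "\<xi> \<in> dsp"
    using assms by (cases X) auto
  have "\<xi> (incl R z) = 0" for z
    using *[rule_format, of "(z, 0)"] by (simp add: X form_def emb_def lift_simps)
  then have "\<xi> \<in> lperp"
    using X(2) by (auto simp: lperp_def restr_dual_def fun_eq_iff)
  moreover have "\<alpha> (proj_l R x) = 0" if "\<alpha> \<in> dl" for \<alpha>
    using *[rule_format, of "(0, \<alpha>)"] that X(2) by (simp add: X(1) form_def emb_def incl_simps lift_dual_def dual_sc)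
  then have "proj_l R x = 0"
    by (intro ll.dual_separates[OF refl]) (simp add: ldual_sc)
  ultimately show "X \<in> cmpl"
    by (simp add: cmpl_def X in_compl_iff)
qed

lemma form_emb_cmpl: "Y \<in> ldbl \<Longrightarrow> X \<in> cmpl \<Longrightarrow> form (emb Y) X = 0"
  using cmpl_iff cmpl_dbl by blast

abbreviation Ad_inv :: "('l \<Rightarrow> 'k) \<Rightarrow> 'g \<times> ('g \<Rightarrow> 'k) \<Rightarrow> 'g \<times> ('g \<Rightarrow> 'k)" where
  "Ad_inv p \<equiv> Ad_exp G (0, lift p)"

context
  fixes p assumes p: "p \<in> dl"
begin

lemma Ad_sp_eq: "Ad_sp G R p = Ad_exp G (- (0, lift p))"
  by (simp add: Ad_sp_def)

lemma Ad_sp_lin: "dd.lin (Ad_sp G R p)"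
  unfolding Ad_sp_eq using p by (intro Ad_exp_lin) auto

lemma Ad_inv_lin: "dd.lin (Ad_inv p)"
  using p by (intro Ad_exp_lin) auto

lemma Ad_sp_in [simp, intro]: "X \<in> dbl \<Longrightarrow> Ad_sp G R p X \<in> dbl"
  by (rule dd.lin_D(1)[OF Ad_sp_lin])

lemma Ad_inv_in [simp, intro]: "X \<in> dbl \<Longrightarrow> Ad_inv p X \<in> dbl"
  by (rule dd.lin_D(1)[OF Ad_inv_lin])

lemma Ad_sp_Ad_inv [simp]: "X \<in> dbl \<Longrightarrow> Ad_sp G R p (Ad_inv p X) = X"
  unfolding Ad_sp_eq using p by (intro Ad_exp_inverse) auto

lemma Ad_inv_Ad_sp [simp]: "X \<in> dbl \<Longrightarrow> Ad_inv p (Ad_sp G R p X) = X"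
  unfolding Ad_sp_eq using Ad_exp_inverse[of "- (0, lift p)" X] p by simp

lemma form_Ad_sp: "X \<in> dbl \<Longrightarrow> Y \<in> dbl \<Longrightarrow> form (Ad_sp G R p X) Y = form X (Ad_inv p Y)"
  unfolding Ad_sp_eq using form_Ad_exp[of "- (0, lift p)" X Y] p by simp

lemma form_Ad_inv: "X \<in> dbl \<Longrightarrow> Y \<in> dbl \<Longrightarrow> form (Ad_inv p X) Y = form X (Ad_sp G R p Y)"
  unfolding Ad_sp_eq using form_Ad_exp[of "(0, lift p)" X Y] p by simp

lemma Ad_inv_emb:
  assumes "X \<in> ldbl"
  shows "Ad_inv p (emb X) = emb (ld.opser exp_coeff (ad_l G R p) X)"
proof -
  have "emb (ld.opser exp_coeff (ad_l G R p) X) = dd.opser exp_coeff (dbr (0, lift p)) (emb X)"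
    by (rule ld.opser_intertwine[OF dd.coord_space_axioms entire_exp_coeff ad_l_lin[OF p]
          dbr_lin(1)[OF lift_in_dbl[OF p]] emb_linear emb_ad_l[OF p] assms])
  then show ?thesis
    using p assms by (simp add: Ad_exp_eq)
qed

lemma Ad_sp_emb:
  assumes "X \<in> ldbl"
  shows "Ad_sp G R p (emb (ld.opser exp_coeff (ad_l G R p) X)) = emb X"
  using assms by (simp flip: Ad_inv_emb)

lemma Ad_sp_emb_in:
  assumes "X \<in> ldbl"
  obtains Y where "Y \<in> ldbl" "Ad_sp G R p (emb X) = emb Y"
proof
  let ?Y = "ld.opser (\<lambda>k. (- 1) ^ k * exp_coeff k) (ad_l G R p) X"
  show "?Y \<in> ldbl" by simp
  have "ld.opser exp_coeff (ad_l G R p) ?Y = X"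
    by (rule ld.opser_exp_neg(2)[OF ad_l_lin[OF p] assms])
  then show "Ad_sp G R p (emb X) = emb ?Y"
    using Ad_sp_emb[of ?Y] by simp
qed

lemma Ad_inv_emb_in:
  assumes "X \<in> ldbl"
  obtains Y where "Y \<in> ldbl" "Ad_inv p (emb X) = emb Y"
  using Ad_inv_emb[OF assms] ld.opser_in that by blast

lemma Ad_sp_cmpl:
  assumes "X \<in> cmpl"
  shows "Ad_sp G R p X \<in> cmpl"
proof (subst cmpl_iff, intro Ad_sp_in cmpl_dbl assms, rule ballI)
  fix Y assume Y: "Y \<in> ldbl"
  obtain Z where Z: "Z \<in> ldbl" "Ad_inv p (emb Y) = emb Z"
    using Ad_inv_emb_in[OF Y] .
  show "form (emb Y) (Ad_sp G R p X) = 0"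
    using form_Ad_inv[of "emb Y" X] Y Z form_emb_cmpl[OF Z(1) assms] cmpl_dbl[OF assms] by simp
qed

lemma Ad_inv_cmpl:
  assumes "X \<in> cmpl"
  shows "Ad_inv p X \<in> cmpl"
proof (subst cmpl_iff, intro Ad_inv_in cmpl_dbl assms, rule ballI)
  fix Y assume Y: "Y \<in> ldbl"
  obtain Z where Z: "Z \<in> ldbl" "Ad_sp G R p (emb Y) = emb Z"
    using Ad_sp_emb_in[OF Y] .
  show "form (emb Y) (Ad_inv p X) = 0"
    using form_Ad_sp[of "emb Y" X] Y Z form_emb_cmpl[OF Z(1) assms] cmpl_dbl[OF assms] by simp
qed

lemma Ad_sp_gg_lin: "gg.lin (Ad_sp_gg G R p)"
  unfolding linear_between_def
proof (intro conjI ballI allI UNIV_I)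
  note L = dd.lin_D[OF Ad_sp_lin]
  show "Ad_sp_gg G R p (x + y) = Ad_sp_gg G R p x + Ad_sp_gg G R p y" for x y
    using L(2)[of "(x, 0)" "(y, 0)"] by (simp add: Ad_sp_gg_def)
  show "Ad_sp_gg G R p (sc a x) = sc a (Ad_sp_gg G R p x)" for a x
  proof -
    have "sum_scale sc a (x, 0 :: 'g \<Rightarrow> 'k) = (sc a x, 0)"
      by (simp add: sum_scale_def fun_scale_def zero_fun_def)
    then have "Ad_sp G R p (sc a x, 0) = sum_scale sc a (Ad_sp G R p (x, 0))"
      using L(3)[of "(x, 0)" a] by simp
    then show ?thesis
      by (simp add: Ad_sp_gg_def) (simp add: sum_scale_def)
  qed
qed

end

section \<open>The isomorphism on the fibres\<close>

definition Rmap :: "('l \<Rightarrow> 'k) \<Rightarrow> ('g \<Rightarrow> 'k) \<Rightarrow> 'g" where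
  "Rmap p \<xi> = inv_into UNIV (Ad_sp_gg G R p) (fst (Ad_sp G R p (0, \<xi>)))"

definition Fmap :: "('l \<Rightarrow> 'k) \<Rightarrow> 'l \<times> ('l \<Rightarrow> 'k) \<Rightarrow> 'l \<times> ('l \<Rightarrow> 'k)" where
  "Fmap p = fun_calc (sum_scale lsc) ldbl F_can (ad_l G R p)"

lemma l_can_eq: "l_can G R p \<eta> = incl R (fst (Fmap p (0, res \<eta>))) - Rmap p (\<eta> - lift (res \<eta>))"
  by (simp add: l_can_def Let_def Fmap_def Rmap_def)

abbreviation Smap :: "('l \<Rightarrow> 'k) \<Rightarrow> 'l \<times> ('l \<Rightarrow> 'k) \<Rightarrow> 'l \<times> ('l \<Rightarrow> 'k)" where
  "Smap p \<equiv> ld.opser sinhc_coeff (ad_l G R p)"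

lemma Smap_lin: "p \<in> dl \<Longrightarrow> ld.lin (Smap p)"
  by (rule ld.opser_lin[OF entire_sinhc_coeff ad_l_lin])

text \<open>Trades the spectral condition for invertibility of \<open>S\<close>, on which the fibre
  computations and the openness of \<open>U_can\<close> rely.\<close>

lemma U_iff:
  "p \<in> U_can G R \<longleftrightarrow> p \<in> dl \<and> bij_betw (Smap p) ldbl ldbl \<and> bij (Ad_sp_gg G R p)"
  using ld.sinhc_bij_iff[OF ad_l_lin] by (auto simp: U_can_def)

lemma Smap_parity:
  assumes "p \<in> dl" "\<alpha> \<in> dl"
  shows "snd (Smap p (z, 0)) = 0" "fst (Smap p (0, \<alpha>)) = 0"
  by (rule opser_parity[OF assms entire_sinhc_coeff], simp add: sinhc_coeff_def)+

section \<open>The canonical matrix over a point of its domain\<close>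

context
  fixes p assumes pU: "p \<in> U_can G R"
begin

lemma p_dl [simp]: "p \<in> dl"
  using pU by (simp add: U_iff)

lemma bij_Smap: "bij_betw (Smap p) ldbl ldbl"
  using pU by (simp add: U_iff)

lemma bij_Ad_sp_gg: "bij (Ad_sp_gg G R p)"
  using pU by (simp add: U_iff)

lemma Smap_inj: "X \<in> ldbl \<Longrightarrow> Smap p X = 0 \<Longrightarrow> X = 0"
  using bij_Smap ld.lin_D(4)[OF Smap_lin[OF p_dl]] by (auto simp: bij_betw_def inj_on_def)

lemma Smap_surj:
  assumes "Y \<in> ldbl"
  obtains X where "X \<in> ldbl" "Smap p X = Y"
proof -
  have "Y \<in> Smap p ` ldbl"
    using assms bij_betw_imp_surj_on[OF bij_Smap] by simp
  then show ?thesis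
    using that by (elim imageE) simp
qed

lemma Fmap_Smap: "X \<in> ldbl \<Longrightarrow> Fmap p (Smap p X) = ld.opser coshc_coeff (ad_l G R p) X"
  unfolding Fmap_def using ld.sinhc_bij_iff[OF ad_l_lin[OF p_dl]] bij_Smap
  by (intro ld.fun_calc_F_can ad_l_lin) auto

lemma Fmap_lin: "ld.lin (Fmap p)"
  unfolding Fmap_def by (intro ld.fun_calc_lin ad_l_lin p_dl)

lemma Smap_split:
  assumes "X \<in> ldbl"
  shows "Smap p X = (fst (Smap p (fst X, 0)), snd (Smap p (0, snd X)))"
proof -
  have "X = (fst X, 0) + (0, snd X)" by simp
  then have "Smap p X = Smap p (fst X, 0) + Smap p (0, snd X)"
    using ld.lin_D(2)[OF Smap_lin[OF p_dl], of "(fst X, 0)" "(0, snd X)"] assms by simp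
  then show ?thesis
    using Smap_parity[OF p_dl snd_ldbl[OF assms]] by (simp add: prod_eq_iff)
qed

text \<open>\<open>S\<close> is even, hence block diagonal for \<open>l\<close> and its dual; as it
  is bijective, so is each block.\<close>

lemma Smap_inv_l: obtains w where "Smap p (w, 0) = (z, 0)"
proof -
  obtain X where X: "X \<in> ldbl" "Smap p X = (z, 0)"
    using Smap_surj[of "(z, 0)"] by auto
  have "Smap p (0, snd X) = 0"
    using Smap_split[OF X(1)] X Smap_parity(2)[OF p_dl snd_ldbl[OF X(1)]] by (simp add: prod_eq_iff)
  then have "snd X = 0"
    using Smap_inj[of "(0, snd X)"] X(1) by (simp add: prod_eq_iff)
  then have e: "(fst X, 0) = X"
    by (simp add: prod_eq_iff)
  have "Smap p (fst X, 0) = (z, 0)"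
    unfolding e by (rule X(2))
  then show ?thesis by (rule that)
qed

lemma Smap_inv_dual:
  assumes "\<alpha> \<in> dl"
  obtains \<beta> where "\<beta> \<in> dl" "Smap p (0, \<beta>) = (0, \<alpha>)"
proof -
  obtain X where X: "X \<in> ldbl" "Smap p X = (0, \<alpha>)"
    using Smap_surj[of "(0, \<alpha>)"] assms by auto
  have "Smap p (fst X, 0) = 0"
    using Smap_split[OF X(1)] X Smap_parity(1)[OF p_dl assms] by (simp add: prod_eq_iff)
  then have "fst X = 0"
    using Smap_inj[of "(fst X, 0)"] by (simp add: prod_eq_iff)
  then have e: "(0, snd X) = X"
    by (simp add: prod_eq_iff)
  have "Smap p (0, snd X) = (0, \<alpha>)"
    unfolding e by (rule X(2))
  with X(1) show ?thesis by (intro that[of "snd X"]) auto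
qed

text \<open>The interpolating polynomial need not be odd. Parity is obtained from
  \<open>F(A) S = C\<close>, with \<open>S\<close> even and \<open>C\<close> odd.\<close>

lemma snd_Fmap: "\<alpha> \<in> dl \<Longrightarrow> snd (Fmap p (0, \<alpha>)) = 0"
proof -
  assume "\<alpha> \<in> dl"
  then obtain \<beta> where \<beta>: "\<beta> \<in> dl" "Smap p (0, \<beta>) = (0, \<alpha>)"
    using Smap_inv_dual by blast
  have "snd (ld.opser coshc_coeff (ad_l G R p) (0, \<beta>)) = 0"
    by (rule opser_parity(3)[OF p_dl \<beta>(1) entire_coshc_coeff]) (simp add: coshc_coeff_def)
  then show ?thesis
    using Fmap_Smap[of "(0, \<beta>)"] \<beta> by simp
qed

text \<open>As series in the skew operator \<open>A\<close>, the even \<open>S\<close> is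
  self-adjoint and the odd \<open>C\<close> is skew. They commute, so \<open>F(A)\<close>, the
  product of \<open>C\<close> with the inverse of \<open>S\<close>, is skew.\<close>

lemma Fmap_skew:
  assumes "X \<in> ldbl" "Y \<in> ldbl"
  shows "form (Fmap p X) Y = - form X (Fmap p Y)"
proof -
  let ?A = "ad_l G R p" and ?C = "ld.opser coshc_coeff (ad_l G R p)"
  obtain X' where X': "X' \<in> ldbl" "Smap p X' = X"
    using Smap_surj[OF assms(1)] .
  obtain Y' where Y': "Y' \<in> ldbl" "Smap p Y' = Y"
    using Smap_surj[OF assms(2)] .
  have eqs: "(\<lambda>k. (- 1) ^ k * sinhc_coeff k :: 'k) = sinhc_coeff" "(\<lambda>k. (- 1) ^ k * coshc_coeff k :: 'k) = (\<lambda>k. - coshc_coeff k)"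
    by (auto simp: sinhc_coeff_def coshc_coeff_def fun_eq_iff)
  have ec: "entire_coeffs (\<lambda>k. - coshc_coeff k :: 'k)"
    using entire_coshc_coeff[where 'k = 'k] by (simp add: entire_coeffs_def)
  have neg: "ld.opser (\<lambda>k. - coshc_coeff k) ?A Z = - ?C Z" if "Z \<in> ldbl" for Z
    using that sums_minus[OF ld.opser_functional[OF entire_coshc_coeff ld.functional_c ad_l_lin[OF p_dl] that]]
    by (intro ld.opser_eqI[OF ec ad_l_lin[OF p_dl]]) auto
  note adj = ld.opser_adjoint[OF bilin_lform _ ad_l_lin[OF p_dl] _ _ ad_l_skew[OF p_dl]]
  have "form (?C X') Y = - form X' (?C Y)"
    using adj[OF entire_coshc_coeff X'(1) assms(2)] assms(2) X'(1)
    by (simp add: eqs neg ld.functional_D(4)[of "form X'"] bilin_lform[unfolded ld.bilin_def])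
  also have "?C Y = Smap p (?C Y')"
    unfolding Y'(2)[symmetric]
    by (rule ld.opser_commute[OF entire_sinhc_coeff ad_l_lin[OF p_dl] ld.opser_lin[OF entire_coshc_coeff ad_l_lin[OF p_dl]] _ Y'(1)])
      (rule ld.opser_commute[OF entire_coshc_coeff ad_l_lin[OF p_dl] ad_l_lin[OF p_dl], symmetric], auto)
  also have "form X' (Smap p (?C Y')) = form (Smap p X') (?C Y')"
    using adj[OF entire_sinhc_coeff X'(1), of "?C Y'"] by (simp add: eqs)
  finally show ?thesis
    using Fmap_Smap[OF X'(1)] Fmap_Smap[OF Y'(1)] X' Y' by simp
qed

lemma Ad_sp_gg_inv [simp]: "Ad_sp_gg G R p (inv_into UNIV (Ad_sp_gg G R p) x) = x"
  using bij_Ad_sp_gg by (simp add: bij_is_surj f_inv_into_f)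

lemma Ad_sp_gg_eq_0: "Ad_sp_gg G R p x = 0 \<Longrightarrow> x = 0"
  using bij_Ad_sp_gg gg.lin_D(4)[OF Ad_sp_gg_lin[OF p_dl]] by (metis bij_def injD)

text \<open>The adjoint action preserves the image of \<open>emb\<close> and its orthogonal, so its
  \<open>g\<close>-block respects the decomposition; injectivity then excludes an
  \<open>l\<close>-part of \<open>x\<close>.\<close>

lemma Ad_sp_gg_compl_iff:
  assumes "Ad_sp_gg G R p x \<in> compl R"
  shows "x \<in> compl R"
proof -
  note L = gg.lin_D[OF Ad_sp_gg_lin[OF p_dl]]
  define z where "z = proj_l R x"
  have x: "x = incl R z + (x - incl R z)" by simp
  have m: "x - incl R z \<in> compl R"
    unfolding z_def by (rule proj_decomp)
  then have "(x - incl R z, 0) \<in> cmpl"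
    by (simp add: cmpl_def lperp_def res_simps)
  from Ad_sp_cmpl[OF p_dl this] have m': "Ad_sp_gg G R p (x - incl R z) \<in> compl R"
    by (simp add: Ad_sp_gg_def cmpl_def mem_Times_iff)
  have "(z, 0) \<in> ldbl" by simp
  obtain Y where "Y \<in> ldbl" and Y: "Ad_sp G R p (emb (z, 0)) = emb Y"
    using Ad_sp_emb_in[OF p_dl \<open>(z, 0) \<in> ldbl\<close>] .
  have z': "Ad_sp_gg G R p (incl R z) = incl R (fst Y)"
    using Y by (simp add: Ad_sp_gg_def emb_def lift_simps)
  have "Ad_sp_gg G R p x = incl R (fst Y) + Ad_sp_gg G R p (x - incl R z)"
    using L(2)[of "incl R z" "x - incl R z"] z' by simp
  then have "incl R (fst Y) \<in> compl R"
    using compl_simps(3)[OF assms m'] by simp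
  then have "Ad_sp_gg G R p (incl R z) = 0"
    using z' incl_in_compl by (simp add: incl_simps)
  then have "incl R z = 0"
    by (rule Ad_sp_gg_eq_0)
  then show ?thesis using m by (simp add: incl_simps)
qed

lemma Rmap_compl: "\<xi> \<in> lperp \<Longrightarrow> Rmap p \<xi> \<in> compl R"
proof (rule Ad_sp_gg_compl_iff)
  assume "\<xi> \<in> lperp"
  then have "(0, \<xi>) \<in> cmpl" by (simp add: cmpl_def)
  from Ad_sp_cmpl[OF p_dl this] show "Ad_sp_gg G R p (Rmap p \<xi>) \<in> compl R"
    by (auto simp: Rmap_def cmpl_def)
qed

lemma Ad_sp_graph:
  assumes "\<xi> \<in> lperp"
  shows "fst (Ad_sp G R p (- Rmap p \<xi>, \<xi>)) = 0" "snd (Ad_sp G R p (- Rmap p \<xi>, \<xi>)) \<in> lperp"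
proof -
  note L = dd.lin_D[OF Ad_sp_lin[OF p_dl]]
  have "(- Rmap p \<xi>, \<xi>) \<in> cmpl"
    using Rmap_compl[OF assms] assms by (simp add: cmpl_def)
  from Ad_sp_cmpl[OF p_dl this] show "snd (Ad_sp G R p (- Rmap p \<xi>, \<xi>)) \<in> lperp"
    by (auto simp: cmpl_def)
  have "(- Rmap p \<xi>, \<xi>) = (0, \<xi>) - (Rmap p \<xi>, 0)" by simp
  then have "Ad_sp G R p (- Rmap p \<xi>, \<xi>) = Ad_sp G R p (0, \<xi>) - Ad_sp G R p (Rmap p \<xi>, 0)"
    using L(6)[of "(0, \<xi>)" "(Rmap p \<xi>, 0)"] lperp_D(1)[OF assms] by simp
  moreover have "fst (Ad_sp G R p (Rmap p \<xi>, 0)) = fst (Ad_sp G R p (0, \<xi>))"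
    using Ad_sp_gg_inv[of "fst (Ad_sp G R p (0, \<xi>))"] by (simp add: Rmap_def Ad_sp_gg_def)
  ultimately show "fst (Ad_sp G R p (- Rmap p \<xi>, \<xi>)) = 0" by simp
qed

text \<open>Characterises \<open>- Rmap p \<xi>\<close> as the only element of \<open>g\<close>
  whose addition to \<xi> removes the \<open>g\<close>-component of the image. Linearity of
  \<open>Rmap\<close> and the preimages under \<phi> are obtained from this.\<close>

lemma Rmap_unique:
  assumes "\<xi> \<in> dsp" "fst (Ad_sp G R p (x, \<xi>)) = 0"
  shows "x = - Rmap p \<xi>"
proof -
  note L = dd.lin_D[OF Ad_sp_lin[OF p_dl]]
  have "(x, \<xi>) = (0, \<xi>) - (- x, 0)" by simp
  then have "Ad_sp G R p (x, \<xi>) = Ad_sp G R p (0, \<xi>) - Ad_sp G R p (- x, 0)"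
    using L(6)[of "(0, \<xi>)" "(- x, 0)"] assms(1) by simp
  then have "Ad_sp_gg G R p (- x) = fst (Ad_sp G R p (0, \<xi>))"
    using assms(2) by (simp add: Ad_sp_gg_def)
  then have "- x = Rmap p \<xi>"
    unfolding Rmap_def using bij_Ad_sp_gg by (metis bij_is_inj inv_into_f_f UNIV_I)
  then show ?thesis
    by (metis minus_minus)
qed

lemma Rmap_linear:
  assumes "\<xi> \<in> lperp" "\<eta> \<in> lperp"
  shows "Rmap p (\<xi> + \<eta>) = Rmap p \<xi> + Rmap p \<eta>" "Rmap p (fun_scale a \<xi>) = sc a (Rmap p \<xi>)"
proof -
  note L = dd.lin_D[OF Ad_sp_lin[OF p_dl]]
  note d = lperp_D(1)[OF assms(1)] lperp_D(1)[OF assms(2)]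
  have "Ad_sp G R p ((- Rmap p \<xi>, \<xi>) + (- Rmap p \<eta>, \<eta>)) = Ad_sp G R p (- Rmap p \<xi>, \<xi>) + Ad_sp G R p (- Rmap p \<eta>, \<eta>)"
    using d by (intro L(2)) auto
  then have "fst (Ad_sp G R p (- Rmap p \<xi> - Rmap p \<eta>, \<xi> + \<eta>)) = 0"
    using Ad_sp_graph(1)[OF assms(1)] Ad_sp_graph(1)[OF assms(2)] by simp
  from Rmap_unique[OF _ this] have "- Rmap p \<xi> - Rmap p \<eta> = - Rmap p (\<xi> + \<eta>)"
    using d by auto
  then show "Rmap p (\<xi> + \<eta>) = Rmap p \<xi> + Rmap p \<eta>"
    by (simp add: algebra_simps neg_eq_iff_add_eq_0)
  have "Ad_sp G R p (sum_scale sc a (- Rmap p \<xi>, \<xi>)) = sum_scale sc a (Ad_sp G R p (- Rmap p \<xi>, \<xi>))"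
    using d by (intro L(3)) auto
  then have "fst (Ad_sp G R p (- sc a (Rmap p \<xi>), fun_scale a \<xi>)) = 0"
    using Ad_sp_graph(1)[OF assms(1)] by (simp add: sum_scale_def)
  from Rmap_unique[OF _ this] have "- sc a (Rmap p \<xi>) = - Rmap p (fun_scale a \<xi>)"
    using d by auto
  then show "Rmap p (fun_scale a \<xi>) = sc a (Rmap p \<xi>)"
    by simp
qed

text \<open>The adjoint action preserves the form and sends the graph of \<open>- Rmap p\<close>
  over \<open>lperp\<close> into \<open>lperp\<close>, which is isotropic; so the graph is
  isotropic, which is skewness.\<close>

lemma Rmap_skew:
  assumes "\<xi> \<in> lperp" "\<eta> \<in> lperp"
  shows "\<eta> (Rmap p \<xi>) = - \<xi> (Rmap p \<eta>)"
proof -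
  note d = lperp_D(1)[OF assms(1)] lperp_D(1)[OF assms(2)]
  let ?u = "(- Rmap p \<xi>, \<xi>)" and ?v = "(- Rmap p \<eta>, \<eta>)"
  have "form ?u ?v = form (Ad_sp G R p ?u) (Ad_sp G R p ?v)"
    using d form_Ad_inv[OF p_dl, of "Ad_sp G R p ?u" ?v] by simp
  also have "\<dots> = 0"
    unfolding form_def using Ad_sp_graph[OF assms(1)] Ad_sp_graph[OF assms(2)] lperp_D(1) by (simp add: dual_sc)
  finally show ?thesis
    using d by (simp add: form_def dual_sc[OF d(1)] dual_sc[OF d(2)] add.commute eq_neg_iff_add_eq_0)
      (metis add.commute add.inverse_inverse eq_neg_iff_add_eq_0 minus_add_distrib)
qed

text \<open>The matrix is a skew operator on the dual of \<open>l\<close> plus a skew operator on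
  \<open>lperp\<close>. There are no mixed pairings, because \<open>Rmap\<close> takes values in
  \<open>m\<close>, where lifts vanish.\<close>

lemma l_can_antisym: "l_can G R p \<in> antisym_maps sc"
  unfolding antisym_maps_def linear_between_def
proof (intro CollectI conjI ballI allI UNIV_I)
  note F = ld.lin_D[OF Fmap_lin]
  fix \<xi> \<eta> assume d: "\<xi> \<in> dsp" "\<eta> \<in> dsp"
  note q = lperp_part[OF d(1)] lperp_part[OF d(2)]
  have e: "\<xi> + \<eta> - lift (res (\<xi> + \<eta>)) = (\<xi> - lift (res \<xi>)) + (\<eta> - lift (res \<eta>))"
    by (simp add: res_simps lift_simps)
  have "Fmap p (0, res (\<xi> + \<eta>)) = Fmap p (0, res \<xi>) + Fmap p (0, res \<eta>)"
    using F(2)[of "(0, res \<xi>)" "(0, res \<eta>)"] d by (simp add: res_simps)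
  then show "l_can G R p (\<xi> + \<eta>) = l_can G R p \<xi> + l_can G R p \<eta>"
    unfolding l_can_eq e Rmap_linear(1)[OF q] by (simp add: incl_simps)
  have s: "form (Fmap p (0, res \<xi>)) (0, res \<eta>) = - form (0, res \<xi>) (Fmap p (0, res \<eta>))"
    using d by (intro Fmap_skew) auto
  have *: "\<eta> (l_can G R p \<xi>) = res \<eta> (fst (Fmap p (0, res \<xi>))) - (\<eta> - lift (res \<eta>)) (Rmap p (\<xi> - lift (res \<xi>)))"
    if "\<xi> \<in> dsp" "\<eta> \<in> dsp" for \<xi> \<eta>
    using lift_compl[OF res_dual[OF that(2)] Rmap_compl[OF lperp_part[OF that(1)]]]
    unfolding l_can_eq dual_sc[OF that(2)] by (simp add: restr_dual_def)
  show "\<eta> (l_can G R p \<xi>) = - \<xi> (l_can G R p \<eta>)"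
    unfolding *[OF d] *[OF d(2,1)] using s Rmap_skew[OF q] snd_Fmap[OF res_dual[OF d(1)]] snd_Fmap[OF res_dual[OF d(2)]]
    by (simp add: form_def)
next
  note F = ld.lin_D[OF Fmap_lin]
  fix a \<xi> assume d: "\<xi> \<in> dsp"
  note q = lperp_part[OF d]
  have e: "fun_scale a \<xi> - lift (res (fun_scale a \<xi>)) = fun_scale a (\<xi> - lift (res \<xi>))"
    by (simp add: res_simps lift_simps) (simp add: fun_scale_def fun_eq_iff algebra_simps)
  have "sum_scale lsc a (0, res \<xi>) = (0, res (fun_scale a \<xi>))"
    by (simp add: sum_scale_def res_simps)
  then have "Fmap p (0, res (fun_scale a \<xi>)) = sum_scale lsc a (Fmap p (0, res \<xi>))"
    using F(3)[of "(0, res \<xi>)" a] d by simp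
  then show "l_can G R p (fun_scale a \<xi>) = sc a (l_can G R p \<xi>)"
    unfolding l_can_eq e Rmap_linear(2)[OF q q]
    by (simp add: sum_scale_def incl_simps gg.scale_right_diff_distrib)
qed

lemma phi_map_decomp:
  assumes "Smap p (w, 0) = (z, 0)" "\<xi> \<in> lperp"
  shows "phi_map G R p (incl R z, lift (coad lbr z p) + \<xi>) =
      (incl R w, snd (Ad_sp G R p (- Rmap p \<xi>, \<xi>)))"
proof -
  let ?A = "ad_l G R p" and ?\<beta> = "coad lbr z p"
  note A = ad_l_lin[OF p_dl]
  have \<beta>: "?\<beta> \<in> dl" by simp
  have Az: "?A (z, 0) = (0, ?\<beta>)"
    by (simp add: ad_l_eq lphi_0)
  \<comment> \<open>As \<open>A\<close> commutes with \<open>S\<close>, the functional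
    \<open>?\<beta>\<close> is \<open>A z = S (A w)\<close>. It thus lies in the range of
    \<open>S\<close>, where \<open>F(A)\<close> is known.\<close>
  have F: "Fmap p (0, ?\<beta>) = ?A (ld.opser coshc_coeff ?A (w, 0))"
  proof -
    have "(0, ?\<beta>) = Smap p (?A (w, 0))"
      unfolding Az[symmetric] assms(1)[symmetric]
      by (rule ld.opser_commute[OF entire_sinhc_coeff A A]) auto
    then have "Fmap p (0, ?\<beta>) = ld.opser coshc_coeff ?A (?A (w, 0))"
      using Fmap_Smap[of "?A (w, 0)"] by simp
    then show ?thesis
      using ld.opser_commute[OF entire_coshc_coeff A A, of "(w, 0)"] by simp
  qed
  have sum: "(z, 0) + (Fmap p (0, ?\<beta>) + (0, ?\<beta>)) = ld.opser exp_coeff ?A (w, 0)"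
  proof -
    have "?A (Smap p (w, 0)) = (0, ?\<beta>)"
      using assms(1) Az by simp
    then have "(z, 0) + (Fmap p (0, ?\<beta>) + (0, ?\<beta>)) = Smap p (w, 0) +
        (?A (ld.opser coshc_coeff ?A (w, 0)) + ?A (Smap p (w, 0)))"
      using F assms(1) by simp
    \<comment> \<open>Multiplication by \<open>A\<close> shifts the coefficients;
      \<open>coeff_identity\<close> then adds the three series up to the exponential.\<close>
    also have "\<dots> = ld.opser exp_coeff ?A (w, 0)"
      by (simp add: ld.opser_shift entire_sinhc_coeff entire_coshc_coeff A)
        (simp add: entire_sinhc_coeff entire_coshc_coeff A ld.entire_coeffs_shift entire_coeffs_add coeff_identity
          flip: ld.opser_add_coeffs)
    finally show ?thesis .
  qed
  have "tau (l_can G R p) (incl R z, lift ?\<beta> + \<xi>) = emb (ld.opser exp_coeff ?A (w, 0)) + (- Rmap p \<xi>, \<xi>)"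
    unfolding sum[symmetric] using snd_Fmap[OF \<beta>] lperp_D(2)[OF assms(2)]
    by (simp add: tau_def emb_def l_can_eq res_simps lift_simps incl_simps)
  then have "phi_map G R p (incl R z, lift ?\<beta> + \<xi>) = Ad_sp G R p (emb (ld.opser exp_coeff ?A (w, 0))) + Ad_sp G R p (- Rmap p \<xi>, \<xi>)"
    unfolding phi_map_def using lperp_D(1)[OF assms(2)]
    by (simp add: dd.lin_D(2)[OF Ad_sp_lin[OF p_dl]])
  also have "\<dots> = emb (w, 0) + (0, snd (Ad_sp G R p (- Rmap p \<xi>, \<xi>)))"
    using Ad_sp_emb[OF p_dl, of "(w, 0)"] Ad_sp_graph(1)[OF assms(2)] by (simp add: prod_eq_iff)
  finally show ?thesis
    by (simp add: emb_def lift_simps)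
qed

end

lemma g_star_0: "g_star G R 0 = range (incl R) \<times> lperp"
  by (auto simp: g_star_def lperp_def coad_def zero_fun_def)

lemma g_star_dbl: "X \<in> g_star G R p \<Longrightarrow> X \<in> dbl"
  by (auto simp: g_star_def)

end

section \<open>Smoothness of the canonical matrix\<close>

context coord_space
begin

lemma Ck_functional:
  assumes "open_region D U" "functional f" "\<And>q. q \<in> U \<Longrightarrow> \<sigma> q \<in> V"
    and "\<And>i. i < n \<Longrightarrow> Ck_on k (*) D U (\<lambda>q. c i (\<sigma> q))"
  shows "Ck_on k (*) D U (\<lambda>q. f (\<sigma> q))"
proof -
  interpret open_region D U by fact
  have "Ck_on k (*) D U (\<lambda>q. \<Sum>i<n. c i (\<sigma> q) * f (e i))"
    by (intro Ck_sum Ck_mult Ck_const assms(4)) auto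
  then show ?thesis
    by (subst Ck_cong[OF functional_expand[OF assms(2,3)]])
qed

lemma Ck_apply:
  assumes "open_region D U" "\<And>q. q \<in> U \<Longrightarrow> functional (F q)" "\<And>q. q \<in> U \<Longrightarrow> \<sigma> q \<in> V"
    and "\<And>j. j < n \<Longrightarrow> Ck_on k (*) D U (\<lambda>q. F q (e j))"
    and "\<And>i. i < n \<Longrightarrow> Ck_on k (*) D U (\<lambda>q. c i (\<sigma> q))"
  shows "Ck_on k (*) D U (\<lambda>q. F q (\<sigma> q))"
proof -
  interpret open_region D U by fact
  have "Ck_on k (*) D U (\<lambda>q. \<Sum>i<n. c i (\<sigma> q) * F q (e i))"
    by (intro Ck_sum Ck_mult assms) auto
  then show ?thesis
    by (subst Ck_cong[OF functional_expand[OF assms(2,3)]])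
qed

end

lemma (in operator_family) Ck_opser_apply:
  assumes "entire_coeffs a" "functional f" "\<And>q. q \<in> U \<Longrightarrow> \<sigma> q \<in> V"
    and "\<And>i. i < n \<Longrightarrow> Ck_on k (*) D U (\<lambda>q. c i (\<sigma> q))"
  shows "Ck_on k (*) D U (\<lambda>q. f (opser a (T q) (\<sigma> q)))"
proof (rule Ck_functional[OF open_region_axioms assms(2)])
  show "opser a (T q) (\<sigma> q) \<in> V" for q by simp
  show "Ck_on k (*) D U (\<lambda>q. c i (opser a (T q) (\<sigma> q)))" if "i < n" for i
    by (rule Ck_apply[OF open_region_axioms _ assms(3) _ assms(4)])
      (use assms(1) that U_subset in \<open>auto intro!: functional_comp functional_c opser_lin T_lin Ck_opser e_in\<close>)
qed

context canonical_reduction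
begin

lemma open_region_dl: "open_region dl dl"
  by unfold_locales auto

text \<open>By reflexivity a linear form on the dual is an evaluation, and evaluations are
  continuous for pointwise convergence.\<close>

lemma linear_continuous_on_dl:
  assumes "linear_between fun_scale dl (*) UNIV f"
  shows "continuous_on dl f"
proof -
  have "continuous_on dl (\<lambda>q. q (ll.combine (\<lambda>i. f (cl i))))"
    by (rule continuous_on_subset[OF continuous_on_product_coordinates]) auto
  then show ?thesis
    by (rule continuous_on_eq) (rule ll.bidual[OF refl assms])
qed

lemma ad_l_parameter:
  assumes "q \<in> dl" "\<alpha> \<in> dl" "X \<in> ldbl"
  shows "ad_l G R (q + fun_scale t \<alpha>) X = ad_l G R q X + sum_scale lsc t (ad_l G R \<alpha> X)"
proof -
  note L = dd.lin_D[OF dbr_lin(2)[OF emb_in[OF assms(3)]]]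
  have "(0, lift (q + fun_scale t \<alpha>)) = (0, lift q) + sum_scale sc t (0 :: 'g, lift \<alpha>)"
    by (simp add: lift_simps sum_scale_def)
  then have "dbr (0, lift (q + fun_scale t \<alpha>)) (emb X) =
      dbr (0, lift q) (emb X) + sum_scale sc t (dbr (0, lift \<alpha>) (emb X))"
    using L(2)[of "(0, lift q)" "sum_scale sc t (0, lift \<alpha>)"] L(3)[of "(0, lift \<alpha>)" t] assms by simp
  then show ?thesis
    using assms by (simp flip: emb_inj add: emb_ad_l emb_simps)
qed

lemma dbr_lift_parameter:
  assumes "q \<in> dl" "\<alpha> \<in> dl" "X \<in> dbl"
  shows "dbr (0, lift (q + fun_scale t \<alpha>)) X = dbr (0, lift q) X + sum_scale sc t (dbr (0, lift \<alpha>) X)"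
proof -
  note L = dd.lin_D[OF dbr_lin(2)[OF assms(3)]]
  have "(0, lift (q + fun_scale t \<alpha>)) = (0, lift q) + sum_scale sc t (0 :: 'g, lift \<alpha>)"
    by (simp add: lift_simps sum_scale_def)
  then show ?thesis
    using L(2)[of "(0, lift q)" "sum_scale sc t (0, lift \<alpha>)"] L(3)[of "(0, lift \<alpha>)" t] assms by simp
qed

lemma linear_if_affine:
  assumes "\<And>q \<alpha> t. q \<in> dl \<Longrightarrow> \<alpha> \<in> dl \<Longrightarrow> f (q + fun_scale t \<alpha>) = f q + t * (f \<alpha> :: 'k)"
  shows "linear_between fun_scale dl (*) UNIV f"
proof -
  have s1: "fun_scale 1 \<alpha> = \<alpha>" for \<alpha> :: "'l \<Rightarrow> 'k"
    by (simp add: fun_scale_def)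
  have "f 0 = 0"
    using assms[of 0 0 1] by (simp add: s1)
  then show ?thesis
    using assms[of _ _ 1] assms[of 0] by (simp add: linear_between_def s1)
qed

lemma operator_family_ad_l:
  assumes "open_region dl U"
  shows "operator_family (sum_scale lsc) ldbl (nl + nl)
    (\<lambda>i. if i < nl then (el i, 0) else (0, cl (i - nl)))
    (\<lambda>i X. if i < nl then cl i (fst X) else snd X (el (i - nl))) dl U (ad_l G R) (ad_l G R)"
  (is "operator_family _ _ _ ?e ?c _ _ _ _")
proof -
  interpret open_region dl U by fact
  show ?thesis
  proof unfold_locales
    show "continuous_on dl (\<lambda>q. ?c i (ad_l G R q (?e j)))" if ij: "i < nl + nl" "j < nl + nl" for i j
    proof (rule linear_continuous_on_dl[OF linear_if_affine])
      fix q \<alpha> t assume d: "q \<in> dl" "\<alpha> \<in> dl"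
      have "ad_l G R (q + fun_scale t \<alpha>) (?e j) = ad_l G R q (?e j) + sum_scale lsc t (ad_l G R \<alpha> (?e j))"
        using ad_l_parameter[OF d ld.e_in[OF ij(2)]] .
      then show "?c i (ad_l G R (q + fun_scale t \<alpha>) (?e j)) = ?c i (ad_l G R q (?e j)) + t * ?c i (ad_l G R \<alpha> (?e j))"
        using ld.c_add[OF ij(1)] ld.c_scale[OF ij(1)] d ld.e_in[OF ij(2)] by (simp only: ad_l_in ld.V_simps)
    qed
  qed (auto simp: ad_l_lin ad_l_parameter)
qed

lemma operator_family_dbr_lift:
  assumes "open_region dl U"
  shows "operator_family (sum_scale sc) dbl (n + n)
    (\<lambda>i. if i < n then (e i, 0) else (0, c (i - n)))
    (\<lambda>i X. if i < n then c i (fst X) else snd X (e (i - n))) dl U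
    (\<lambda>q. dbr (0, lift q)) (\<lambda>q. dbr (0, lift q))"
  (is "operator_family _ _ _ ?e ?c _ _ _ _")
proof -
  interpret open_region dl U by fact
  show ?thesis
  proof unfold_locales
    show "continuous_on dl (\<lambda>q. ?c i (dbr (0, lift q) (?e j)))" if ij: "i < n + n" "j < n + n" for i j
    proof (rule linear_continuous_on_dl[OF linear_if_affine])
      fix q \<alpha> t assume d: "q \<in> dl" "\<alpha> \<in> dl"
      have "dbr (0, lift (q + fun_scale t \<alpha>)) (?e j) = dbr (0, lift q) (?e j) + sum_scale sc t (dbr (0, lift \<alpha>) (?e j))"
        using dbr_lift_parameter[OF d dd.e_in[OF ij(2)]] .
      then show "?c i (dbr (0, lift (q + fun_scale t \<alpha>)) (?e j)) = ?c i (dbr (0, lift q) (?e j)) + t * ?c i (dbr (0, lift \<alpha>) (?e j))"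
        using dd.c_add[OF ij(1)] dd.c_scale[OF ij(1)] d dd.e_in[OF ij(2)] by (simp only: dbr_in lift_in_dbl dd.V_simps)
    qed
  qed (auto simp: dbr_lin dbr_lift_parameter)
qed

text \<open>The coefficients of \<open>exp (- z)\<close>. With them \<open>Ad_sp\<close> becomes a
  series in the adjoint action of \<open>lift q\<close>, the operator family that also yields its
  inverse.\<close>

definition sgn_exp :: "nat \<Rightarrow> 'k" where
  "sgn_exp k = (- 1) ^ k * exp_coeff k"

lemma entire_sgn_exp: "entire_coeffs sgn_exp"
  unfolding sgn_exp_def[abs_def] by (rule entire_coeffs_sign[OF entire_exp_coeff])

lemma Ad_sp_opser:
  assumes "q \<in> dl" "X \<in> dbl"
  shows "Ad_sp G R q X = dd.opser sgn_exp (dbr (0, lift q)) X"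
proof -
  have *: "(0, lift q) \<in> dbl" "- (0, lift q) \<in> dbl"
    using assms by auto
  show ?thesis
    unfolding Ad_sp_eq[OF assms(1)] Ad_exp_eq[OF *(2) assms(2)] sgn_exp_def[abs_def]
    by (rule dd.opser_neg[OF entire_exp_coeff dbr_lin(1)[OF *(1)] dbr_lin(1)[OF *(2)] _ assms(2)])
      (rule dbr_uminus[OF *(1)])
qed

lemma Ad_inv_opser:
  assumes "q \<in> dl" "X \<in> dbl"
  shows "Ad_inv q X = dd.opser exp_coeff (dbr (0, lift q)) X"
  using assms by (simp add: Ad_exp_eq)

lemma dd_functional_fst: "i < n \<Longrightarrow> dd.functional (\<lambda>X. c i (fst X))"
  by (auto simp: linear_between_def sum_scale_def)

lemma Ck_Ad_sp:
  assumes U: "open_region dl U" and f: "dd.functional f" and \<sigma>: "\<And>q. q \<in> U \<Longrightarrow> \<sigma> q \<in> dbl"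
    and s: "\<And>i. i < n + n \<Longrightarrow> Ck_on k (*) dl U (\<lambda>q. (if i < n then c i (fst (\<sigma> q)) else snd (\<sigma> q) (e (i - n))))"
  shows "Ck_on k (*) dl U (\<lambda>q. f (Ad_sp G R q (\<sigma> q)))" "Ck_on k (*) dl U (\<lambda>q. f (Ad_inv q (\<sigma> q)))"
proof -
  interpret open_region dl U by fact
  interpret operator_family "sum_scale sc" dbl "n + n"
    "\<lambda>i. if i < n then (e i, 0) else (0, c (i - n))"
    "\<lambda>i X. if i < n then c i (fst X) else snd X (e (i - n))" dl U
    "\<lambda>q. dbr (0, lift q)" "\<lambda>q. dbr (0, lift q)"
    by (rule operator_family_dbr_lift[OF U])
  show "Ck_on k (*) dl U (\<lambda>q. f (Ad_sp G R q (\<sigma> q)))"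
    using Ck_opser_apply[OF entire_sgn_exp f \<sigma> s]
    by (subst Ck_cong[OF arg_cong[where f = f, OF Ad_sp_opser]]) (use \<sigma> U_subset in auto)
  show "Ck_on k (*) dl U (\<lambda>q. f (Ad_inv q (\<sigma> q)))"
    using Ck_opser_apply[OF entire_exp_coeff f \<sigma> s]
    by (subst Ck_cong[OF arg_cong[where f = f, OF Ad_inv_opser]]) (use \<sigma> U_subset in auto)
qed

lemma Ck_Ad_sp_const:
  assumes "open_region dl U" "dd.functional f" "X \<in> dbl"
  shows "Ck_on k (*) dl U (\<lambda>q. f (Ad_sp G R q X))" "Ck_on k (*) dl U (\<lambda>q. f (Ad_inv q X))"
  using Ck_Ad_sp[OF assms(1,2), of "\<lambda>_. X"] assms(3) open_region.Ck_const[OF assms(1)] by auto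

lemma Ck_Ad_sp_gg: "open_region dl U \<Longrightarrow> i < n \<Longrightarrow> Ck_on k (*) dl U (\<lambda>q. c i (Ad_sp_gg G R q x))"
  unfolding Ad_sp_gg_def using Ck_Ad_sp_const(1)[OF _ dd_functional_fst, of U i "(x, 0)"] by simp

lemma Ck_opser_ad_l:
  assumes "open_region dl U" "entire_coeffs a" "ld.functional f" "X \<in> ldbl"
  shows "Ck_on k (*) dl U (\<lambda>q. f (ld.opser a (ad_l G R q) X))"
  using operator_family.Ck_opser_apply[OF operator_family_ad_l[OF assms(1)] assms(2,3), of "\<lambda>_. X"] assms(4)
    open_region.Ck_const[OF assms(1)] by auto

lemma openin_U: "openin (top_of_set dl) (U_can G R)"
proof -
  have "openin (top_of_set dl) {q \<in> dl. bij_betw (Smap q) ldbl ldbl}"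
    using Ck_opser_ad_l[OF open_region_dl entire_sinhc_coeff ld.functional_c ld.e_in, of _ _ 0]
    by (intro ld.openin_bij[OF open_region_dl Smap_lin]) auto
  moreover have "openin (top_of_set dl) {q \<in> dl. bij_betw (Ad_sp_gg G R q) UNIV UNIV}"
    using Ck_Ad_sp_gg[OF open_region_dl, of _ 0]
    by (intro gg.openin_bij[OF open_region_dl Ad_sp_gg_lin]) auto
  ultimately have "openin (top_of_set dl)
      ({q \<in> dl. bij_betw (Smap q) ldbl ldbl} \<inter> {q \<in> dl. bij_betw (Ad_sp_gg G R q) UNIV UNIV})"
    by (rule openin_Int)
  also have "\<dots> = U_can G R"
    by (auto simp: U_iff)
  finally show ?thesis .
qed

lemma open_region_U: "open_region dl (U_can G R)"
  using openin_U by unfold_locales auto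

lemma Ck_Rmap:
  assumes "\<xi> \<in> dsp" "i < n"
  shows "Ck_on k (*) dl (U_can G R) (\<lambda>q. c i (Rmap q \<xi>))"
proof (rule gg.Ck_inverse_family[OF open_region_U, where T = "Ad_sp_gg G R"])
  show "gg.lin (Ad_sp_gg G R q)" "bij (Ad_sp_gg G R q)" if "q \<in> U_can G R" for q
    using that Ad_sp_gg_lin by (auto simp: U_iff)
  show "Ck_on k (*) dl (U_can G R) (\<lambda>q. c i (Ad_sp_gg G R q (e j)))" if "i < n" "j < n" for i j
    using Ck_Ad_sp_gg[OF open_region_U that(1)] .
  show "Ck_on k (*) dl (U_can G R) (\<lambda>q. c i (Ad_sp_gg G R q (Rmap q \<xi>)))" if "i < n" for i
    using Ck_Ad_sp_const(1)[OF open_region_U dd_functional_fst[OF that], of "(0, \<xi>)"] assms(1)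
    by (subst open_region.Ck_cong[OF open_region_U, where g = "\<lambda>q. c i (fst (Ad_sp G R q (0, \<xi>)))"])
      (auto simp: Rmap_def[of _ \<xi>])
qed (use assms in auto)

text \<open>Whichever polynomial interpolates at \<open>q\<close>, the value is \<open>C\<close>
  applied to the preimage \<open>X q\<close> under \<open>S\<close>. The preimage is smooth by
  Cramer's rule, and \<open>C\<close> is an entire series.\<close>

lemma Ck_Fmap:
  assumes "\<alpha> \<in> dl" "ld.functional f"
  shows "Ck_on k (*) dl (U_can G R) (\<lambda>q. f (Fmap q (0, \<alpha>)))"
proof -
  define X where "X q = inv_into ldbl (Smap q) (0, \<alpha>)" for q
  have X: "X q \<in> ldbl" "Smap q (X q) = (0, \<alpha>)" if "q \<in> U_can G R" for q
  proof -
    have "(0, \<alpha>) \<in> Smap q ` ldbl"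
      using bij_betw_imp_surj_on[OF bij_Smap[OF that]] assms(1) by simp
    then show "X q \<in> ldbl" "Smap q (X q) = (0, \<alpha>)"
      unfolding X_def by (rule inv_into_into, rule f_inv_into_f)
  qed
  have "Ck_on k (*) dl (U_can G R) (\<lambda>q. (if i < nl then cl i (fst (X q)) else snd (X q) (el (i - nl))))"
    if "i < nl + nl" for i
  proof (rule ld.Ck_inverse_family[OF open_region_U, where T = Smap, OF _ bij_Smap])
    fix i assume i: "i < nl + nl"
    show "Ck_on k (*) dl (U_can G R) (\<lambda>q. if i < nl then cl i (fst (Smap q (X q))) else snd (Smap q (X q)) (el (i - nl)))"
      by (subst open_region.Ck_cong[OF open_region_U,
            where g = "\<lambda>q. if i < nl then cl i (fst (0, \<alpha>)) else snd (0, \<alpha>) (el (i - nl))"])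
        (simp_all add: X open_region.Ck_const[OF open_region_U])
  qed (use that X Smap_lin p_dl Ck_opser_ad_l[OF open_region_U entire_sinhc_coeff ld.functional_c ld.e_in] in auto)
  from operator_family.Ck_opser_apply[OF operator_family_ad_l[OF open_region_U] entire_coshc_coeff assms(2) X(1) this]
  have "Ck_on k (*) dl (U_can G R) (\<lambda>q. f (ld.opser coshc_coeff (ad_l G R q) (X q)))"
    by simp
  moreover have "f (Fmap q (0, \<alpha>)) = f (ld.opser coshc_coeff (ad_l G R q) (X q))" if "q \<in> U_can G R" for q
    using Fmap_Smap[OF that X(1)[OF that]] X(2)[OF that] by simp
  ultimately show ?thesis
    by (subst open_region.Ck_cong[OF open_region_U])
qed

lemma Ck_l_can:
  assumes "\<xi> \<in> dsp" "i < n"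
  shows "Ck_on k (*) dl (U_can G R) (\<lambda>q. c i (l_can G R q \<xi>))"
proof -
  have f: "ld.functional (\<lambda>X. c i (incl R (fst X)))"
    using assms(2) by (auto simp: linear_between_def sum_scale_def incl_simps)
  from open_region.Ck_diff[OF open_region_U Ck_Fmap[OF res_dual[OF assms(1)] f]
      Ck_Rmap[OF lperp_D(1)[OF lperp_part[OF assms(1)]] assms(2)]]
  show ?thesis
    unfolding l_can_eq using assms by simp
qed

end

section \<open>Lie algebra isomorphisms\<close>

text \<open>Injectivity lets the Lie axioms be checked in the target. Thus neither the twisted
  bracket on a fibre nor the bracket on the kernel of the anchor needs a direct proof of the Jacobi
  identity.\<close>

lemma lie_algebra_iso_pullback:
  assumes vs: "vector_space sc" and V: "module.subspace sc V" and W: "lie_algebra_on sc' W br'"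
    and f: "linear_between sc V sc' W f" and bij: "bij_betw f V W"
    and br: "\<And>x y. x \<in> V \<Longrightarrow> y \<in> V \<Longrightarrow> br x y \<in> V"
    and hom: "\<And>x y. x \<in> V \<Longrightarrow> y \<in> V \<Longrightarrow> f (br x y) = br' (f x) (f y)"
  shows "lie_algebra_iso sc V br sc' W br' f"
proof -
  interpret vector_space sc by (rule vs)
  note fD = linear_betweenD[OF f]
  have Vs: "x \<in> V \<Longrightarrow> y \<in> V \<Longrightarrow> x + y \<in> V" "x \<in> V \<Longrightarrow> sc a x \<in> V" "0 \<in> V" for x y a
    using V by (auto simp: subspace_def)
  have inj: "x = y" if "x \<in> V" "y \<in> V" "f x = f y" for x y
    using bij that by (auto simp: bij_betw_def inj_on_def)
  have L: "linear_between sc' W sc' W (br' u)" "linear_between sc' W sc' W (\<lambda>v. br' v u)" "br' u u = 0" if "u \<in> W" for u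
    using W that by (auto simp: lie_algebra_on_def)
  have J: "br' u (br' v w) + br' v (br' w u) + br' w (br' u v) = 0" if "u \<in> W" "v \<in> W" "w \<in> W" for u v w
    using W that by (auto simp: lie_algebra_on_def)
  have f0: "f 0 = 0"
    using fD(2)[OF Vs(3) Vs(3)] by simp
  have "lie_algebra_on sc V br"
    unfolding lie_algebra_on_def
  proof (intro conjI ballI V)
    fix x assume x: "x \<in> V"
    show "linear_between sc V sc V (br x)"
      unfolding linear_between_def
      using x by (auto intro!: inj br Vs simp: hom fD br Vs linear_betweenD[OF L(1)])
    show "linear_between sc V sc V (\<lambda>y. br y x)"
      unfolding linear_between_def
      using x by (auto intro!: inj br Vs simp: hom fD br Vs linear_betweenD[OF L(2)])
    show "br x x = 0"
      using x by (intro inj br Vs) (simp_all add: hom fD L(3) f0)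
    fix y z assume yz: "y \<in> V" "z \<in> V"
    show "br x (br y z) + br y (br z x) + br z (br x y) = 0"
      using x yz by (intro inj Vs br) (simp_all add: hom fD br Vs J f0)
  qed
  then show ?thesis
    unfolding lie_algebra_iso_def using W f bij hom by blast
qed

lemma lie_algebra_iso_inverse:
  assumes vs: "vector_space sc" and iso: "lie_algebra_iso sc V br sc' W br' f"
    and g: "\<And>y. y \<in> W \<Longrightarrow> g y \<in> V" "\<And>y. y \<in> W \<Longrightarrow> f (g y) = y"
  shows "lie_algebra_iso sc' W br' sc V br g"
proof -
  interpret vector_space sc by (rule vs)
  have lie: "lie_algebra_on sc V br" "lie_algebra_on sc' W br'" and f: "linear_between sc V sc' W f"
    and bij: "bij_betw f V W" and hom: "\<And>x y. x \<in> V \<Longrightarrow> y \<in> V \<Longrightarrow> f (br x y) = br' (f x) (f y)"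
    using iso by (auto simp: lie_algebra_iso_def)
  note fD = linear_betweenD[OF f]
  have Vs: "x + y \<in> V" "sc a x \<in> V" if "x \<in> V" "y \<in> V" for x y a
    using lie(1) that by (auto simp: lie_algebra_on_def subspace_def)
  have gf: "g (f x) = x" if "x \<in> V" for x
    using bij that fD(1)[OF that] g by (auto simp: bij_betw_def inj_on_def)
  have br: "br x y \<in> V" if "x \<in> V" "y \<in> V" for x y
    using lie(1) that by (auto simp: lie_algebra_on_def linear_between_def)
  have lin: "linear_between sc' W sc V g"
    unfolding linear_between_def
  proof (intro conjI ballI allI)
    fix x y assume "x \<in> W" "y \<in> W"
    then show "g (x + y) = g x + g y"
      using gf[OF Vs(1), of "g x" "g y"] g by (simp add: fD)
  next
    fix a x assume "x \<in> W"
    then show "g (sc' a x) = sc a (g x)"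
      using gf[OF Vs(2), of "g x" "g x" a] g by (simp add: fD)
  qed (rule g)
  have "bij_betw g W V"
    by (rule bij_betw_byWitness[where f' = f]) (use g gf fD in auto)
  moreover have "g (br' x y) = br (g x) (g y)" if "x \<in> W" "y \<in> W" for x y
    using gf[OF br, of "g x" "g y"] g that by (simp add: hom)
  ultimately show ?thesis
    using lie lin by (auto simp: lie_algebra_iso_def)
qed

section \<open>The Lie algebra structure on the fibres\<close>

context canonical_reduction
begin

lemma g_star_iff: "(x, \<xi>) \<in> g_star G R p \<longleftrightarrow> (\<exists>z. x = incl R z \<and> \<xi> \<in> dsp \<and> res \<xi> = coad lbr z p)"
  by (auto simp: g_star_def)

lemma lbr_skew: "lbr y x = - lbr x y"
proof -
  have "incl R (lbr y x) = incl R (- lbr x y)"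
    using red br_skew[of "incl R x" "incl R y"] by (simp add: reductive_decomposition_def incl_simps)
  then show ?thesis by simp
qed

lemma incl_lbr: "br (incl R y) (incl R z) = incl R (lbr y z)"
  using red by (simp add: reductive_decomposition_def)

lemma g_star_subspace: "p \<in> dl \<Longrightarrow> dd.subspace (g_star G R p)"
  unfolding dd.subspace_def
proof (intro conjI ballI allI)
  assume p: "p \<in> dl"
  have add: "coad lbr (y + z) p = coad lbr y p + coad lbr z p" and scale: "coad lbr (lsc a z) p = fun_scale a (coad lbr z p)"
    and zero: "coad lbr 0 p = 0" for y z a
    using p by (auto simp: coad_def lbr_simps ldual_sc fun_scale_def)
  show "0 \<in> g_star G R p"
    unfolding zero_prod_def g_star_iff by (intro exI[of _ 0]) (simp add: incl_simps res_simps zero)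
  fix X Y a assume "X \<in> g_star G R p" "Y \<in> g_star G R p"
  then obtain y \<eta> z \<zeta> where "X = (incl R y, \<eta>)" "\<eta> \<in> dsp" "res \<eta> = coad lbr y p"
    "Y = (incl R z, \<zeta>)" "\<zeta> \<in> dsp" "res \<zeta> = coad lbr z p"
    by (auto simp: g_star_def)
  then show "X + Y \<in> g_star G R p"
    by (simp add: g_star_iff res_simps) (intro exI[of _ "y + z"], simp add: incl_simps add)
next
  assume p: "p \<in> dl"
  have scale: "coad lbr (lsc a z) p = fun_scale a (coad lbr z p)" for z a
    using p by (auto simp: coad_def lbr_simps ldual_sc fun_scale_def)
  fix a X assume "X \<in> g_star G R p"
  then obtain y \<eta> where "X = (incl R y, \<eta>)" "\<eta> \<in> dsp" "res \<eta> = coad lbr y p"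
    by (auto simp: g_star_def)
  then show "sum_scale sc a X \<in> g_star G R p"
    by (simp add: g_star_iff res_simps sum_scale_def) (intro exI[of _ "lsc a y"], simp add: incl_simps scale)
qed

text \<open>\<open>phi\<close> vanishes on three elements of \<open>lperp\<close>, so the
  contraction lies in \<open>l\<close>; and \<open>cobr\<close> vanishes on \<open>l\<close>, so the
  dual component of the bracket kills \<open>l\<close>.\<close>

lemma g_star_0_bracket:
  assumes "X \<in> g_star G R 0" "Y \<in> g_star G R 0"
  shows "dbr X Y \<in> g_star G R 0"
proof -
  obtain y \<eta> z \<zeta> where X: "X = (incl R y, \<eta>)" "\<eta> \<in> lperp" and Y: "Y = (incl R z, \<zeta>)" "\<zeta> \<in> lperp"
    using assms unfolding g_star_0 by auto
  note d = lperp_D(1)[OF X(2)] lperp_D(1)[OF Y(2)]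
  have "contract sc (phi G) \<eta> \<zeta> = incl R (proj_l R (contract sc (phi G) \<eta> \<zeta>))"
    using phi_contract[OF d lperp_D(1)] phi_lperp[OF X(2) Y(2)] by (intro range_incl_iff) simp
  then have "fst (dbr X Y) = incl R (lbr y z + proj_l R (contract sc (phi G) \<eta> \<zeta>))"
    using d by (simp add: X(1) Y(1) double_brk_def cobr_incl incl_lbr incl_simps)
  moreover have "snd (dbr X Y) \<in> lperp"
  proof -
    have "snd (dbr X Y) (incl R x) = 0" for x
      using d lperp_D(3)[OF X(2)] lperp_D(3)[OF Y(2)]
      by (simp add: X(1) Y(1) double_brk_def coad_def incl_lbr cobr_incl dual_sc)
    moreover have "snd (dbr X Y) \<in> dsp"
      using d by (intro snd_dbl dbr_in) (auto simp: X(1) Y(1))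
    ultimately show ?thesis
      by (auto simp: lperp_def restr_dual_def fun_eq_iff)
  qed
  ultimately show ?thesis
    unfolding g_star_0 by (simp add: mem_Times_iff)
qed

lemma g_star_0_lie: "lie_algebra_on (sum_scale sc) (g_star G R 0) dbr"
proof -
  have sub: "X \<in> dbl" if "X \<in> g_star G R 0" for X
    using that by (rule g_star_dbl)
  have J: "dbr X (dbr Y Z) + dbr Y (dbr Z X) + dbr Z (dbr X Y) = 0" 
    if "X \<in> dbl" "Y \<in> dbl" "Z \<in> dbl" for X Y Z
    using dbl_lie that by (auto simp: lie_algebra_on_def)
  have S: "dbr X X = 0" if "X \<in> dbl" for X
    using dbl_lie that by (auto simp: lie_algebra_on_def)
  show ?thesis
    unfolding lie_algebra_on_def linear_between_def
    by (intro conjI ballI allI g_star_subspace g_star_0_bracket ldual_cl)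
      (auto simp: sub J S dd.lin_D[OF dbr_lin(1)] dd.lin_D[OF dbr_lin(2)])
qed

context
  fixes p assumes pU: "p \<in> U_can G R"
begin

lemma phi_map_lin: "dd.lin (phi_map G R p)"
  using Ad_sp_lin[OF p_dl[OF pU]] tau_linear[OF l_can_antisym[OF pU]]
  unfolding phi_map_def linear_between_def by auto

lemma phi_map_inj:
  assumes "X \<in> dbl" "Y \<in> dbl" "phi_map G R p X = phi_map G R p Y"
  shows "X = Y"
proof -
  note t = l_can_antisym[OF pU]
  have "Ad_inv p (phi_map G R p X) = Ad_inv p (phi_map G R p Y)"
    using assms by simp
  then have "tau (l_can G R p) X = tau (l_can G R p) Y"
    using assms p_dl[OF pU] tau_in[OF t] by (simp add: phi_map_def)
  then show ?thesis
    by (rule injD[OF inj_tau[OF t]])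
qed

lemma phi_map_bracket:
  assumes "X \<in> dbl" "Y \<in> dbl"
  shows "phi_map G R p (double_brk (twist G (l_can G R p)) X Y) = dbr (phi_map G R p X) (phi_map G R p Y)"
proof -
  note t = l_can_antisym[OF pU]
  have "- (0, lift p) \<in> dbl"
    using p_dl[OF pU] by simp
  then show ?thesis
    unfolding phi_map_def tau_bracket(1)[OF t assms] Ad_sp_eq[OF p_dl[OF pU]]
    using assms tau_in[OF t] by (intro Ad_exp_automorphism) auto
qed

text \<open>The second claim records that the \<open>l\<close>-component of the image is the
  preimage of \<open>z\<close> under \<open>S\<close>. Differentiating the canonical matrix requires
  it.\<close>

lemma phi_map_in:
  assumes "X \<in> g_star G R p"
  shows "phi_map G R p X \<in> g_star G R 0"
    and "X = (incl R z, \<xi>) \<Longrightarrow> Smap p (w, 0) = (z, 0) \<Longrightarrow> \<exists>\<eta>\<in>lperp. phi_map G R p X = (incl R w, \<eta>)"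
proof -
  have *: "\<exists>\<eta>\<in>lperp. phi_map G R p (incl R z, \<xi>) = (incl R w, \<eta>)"
    if "(incl R z, \<xi>) \<in> g_star G R p" "Smap p (w, 0) = (z, 0)" for z \<xi> w
  proof -
    have \<xi>: "\<xi> \<in> dsp" "res \<xi> = coad lbr z p"
      using that(1) by (auto simp: g_star_def)
    have "phi_map G R p (incl R z, lift (coad lbr z p) + (\<xi> - lift (res \<xi>))) =
        (incl R w, snd (Ad_sp G R p (- Rmap p (\<xi> - lift (res \<xi>)), \<xi> - lift (res \<xi>))))"
      by (rule phi_map_decomp[OF pU that(2) lperp_part[OF \<xi>(1)]])
    then show ?thesis
      using Ad_sp_graph(2)[OF pU lperp_part[OF \<xi>(1)]] by (simp add: \<xi>(2))
  qed
  obtain z' \<xi>' where X: "X = (incl R z', \<xi>')"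
    using assms by (auto simp: g_star_def)
  obtain w' where "Smap p (w', 0) = (z', 0)"
    using Smap_inv_l[OF pU] .
  then show "phi_map G R p X \<in> g_star G R 0"
    using *[of z' \<xi>' w'] assms unfolding X g_star_0 by auto
  show "X = (incl R z, \<xi>) \<Longrightarrow> Smap p (w, 0) = (z, 0) \<Longrightarrow> \<exists>\<eta>\<in>lperp. phi_map G R p X = (incl R w, \<eta>)"
    using * assms by simp
qed

lemma phi_map_surj:
  assumes "Y \<in> g_star G R 0"
  shows "\<exists>X\<in>g_star G R p. phi_map G R p X = Y"
proof -
  obtain w \<eta> where Y: "Y = (incl R w, \<eta>)" "\<eta> \<in> lperp"
    using assms unfolding g_star_0 by auto
  \<comment> \<open>The preimage is assembled in two parts: \<open>z = S w\<close> over the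
    \<open>l\<close>-component, and over \<eta> the pair \<open>Ad_inv p (0, \<eta>)\<close>, which
    uniqueness identifies as a point of the graph of \<open>- Rmap p\<close>.\<close>
  define z where "z = fst (Smap p (w, 0))"
  have z: "Smap p (w, 0) = (z, 0)"
    using Smap_parity(1)[OF p_dl[OF pU] ldual_cl(1)] by (simp add: z_def prod_eq_iff)
  obtain x \<xi> where A: "Ad_inv p (0, \<eta>) = (x, \<xi>)"
    by (cases "Ad_inv p (0, \<eta>)")
  have "(0, \<eta>) \<in> cmpl"
    using Y(2) by (simp add: cmpl_def)
  from Ad_inv_cmpl[OF p_dl[OF pU] this] have \<xi>: "\<xi> \<in> lperp"
    unfolding A by (simp add: cmpl_def)
  have E: "Ad_sp G R p (x, \<xi>) = (0, \<eta>)"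
    using Ad_sp_Ad_inv[OF p_dl[OF pU], of "(0, \<eta>)"] lperp_D(1)[OF Y(2)] by (simp add: A)
  then have "x = - Rmap p \<xi>"
    using lperp_D(1)[OF \<xi>] by (intro Rmap_unique[OF pU]) auto
  then have "phi_map G R p (incl R z, lift (coad lbr z p) + \<xi>) = Y"
    using phi_map_decomp[OF pU z \<xi>] E by (simp add: Y(1))
  moreover have "(incl R z, lift (coad lbr z p) + \<xi>) \<in> g_star G R p"
    using lperp_D[OF \<xi>] p_dl[OF pU] by (auto simp: g_star_iff res_simps lift_simps)
  ultimately show ?thesis by blast
qed

text \<open>Closure is transported from the fibre at 0: the image of the bracket lies there, hence
  is attained on the fibre at \<open>p\<close>, and injectivity on the whole double identifies the
  preimage with the bracket.\<close>

lemma g_star_bracket: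
  assumes "X \<in> g_star G R p" "Y \<in> g_star G R p"
  shows "double_brk (twist G (l_can G R p)) X Y \<in> g_star G R p"
proof -
  let ?b = "double_brk (twist G (l_can G R p)) X Y"
  note d = g_star_dbl[OF assms(1)] g_star_dbl[OF assms(2)]
  have "phi_map G R p ?b \<in> g_star G R 0"
    unfolding phi_map_bracket[OF d] using assms by (intro g_star_0_bracket phi_map_in)
  then obtain Z where Z: "Z \<in> g_star G R p" "phi_map G R p Z = phi_map G R p ?b"
    using phi_map_surj by blast
  have "Z = ?b"
    using phi_map_inj[OF g_star_dbl[OF Z(1)] tau_bracket(2)[OF l_can_antisym[OF pU] d] Z(2)] .
  with Z(1) show ?thesis by simp
qed

lemma phi_map_bij: "bij_betw (phi_map G R p) (g_star G R p) (g_star G R 0)"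
  unfolding bij_betw_def
proof (intro conjI inj_onI subset_antisym subsetI)
  show "X = Y" if "X \<in> g_star G R p" "Y \<in> g_star G R p" "phi_map G R p X = phi_map G R p Y" for X Y
    using phi_map_inj[OF g_star_dbl[OF that(1)] g_star_dbl[OF that(2)] that(3)] .
  show "Y \<in> g_star G R 0" if "Y \<in> phi_map G R p ` g_star G R p" for Y
    using that phi_map_in(1) by auto
  show "Y \<in> phi_map G R p ` g_star G R p" if "Y \<in> g_star G R 0" for Y
    using phi_map_surj[OF that] by auto
qed

theorem phi_map_iso:
  "lie_algebra_iso (sum_scale sc) (g_star G R p) (double_brk (twist G (l_can G R p)))
    (sum_scale sc) (g_star G R 0) dbr (phi_map G R p)"
proof (rule lie_algebra_iso_pullback[OF dd.vector_space_axioms g_star_subspace[OF p_dl[OF pU]] g_star_0_lie _ phi_map_bij])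
  show "linear_between (sum_scale sc) (g_star G R p) (sum_scale sc) (g_star G R 0) (phi_map G R p)"
    using phi_map_in(1) dd.lin_D[OF phi_map_lin] by (simp add: linear_between_def g_star_dbl)
qed (auto intro: g_star_bracket phi_map_bracket g_star_dbl)

end

section \<open>The derivative of the canonical matrix\<close>

lemma opser_parity_odd:
  assumes p: "p \<in> dl" and a: "entire_coeffs a" and e: "\<And>k. even k \<Longrightarrow> a k = 0"
  shows "fst (ld.opser a (ad_l G R p) (z, 0)) = 0"
proof (rule fst_eq_0_if_reflect)
  have odd: "(\<lambda>k. (- 1) ^ k * a k) = (\<lambda>k. - a k)"
    using e by (auto simp: fun_eq_iff minus_one_power_iff)
  have ea: "entire_coeffs (\<lambda>k. - a k)"
    using a by (simp add: entire_coeffs_def)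
  have "ld.opser (\<lambda>k. - a k) (ad_l G R p) (z, 0) = - ld.opser a (ad_l G R p) (z, 0)"
    using sums_minus[OF ld.opser_functional[OF a ld.functional_c ad_l_lin[OF p], of _ "(z, 0)"]]
    by (intro ld.opser_eqI[OF ea ad_l_lin[OF p]]) auto
  then show "reflect (ld.opser a (ad_l G R p) (z, 0)) = - ld.opser a (ad_l G R p) (z, 0)"
    using reflect_opser[OF p _ a, of "(z, 0)"] by (simp add: odd reflect_def)
qed simp

text \<open>The coefficients of \<open>(e^z - 1) / z\<close>, which governs the differential of the
  exponential map. Its even part is \<open>sinh z / z\<close>.\<close>

definition dexp_coeff :: "nat \<Rightarrow> 'k" where
  "dexp_coeff k = inverse (fact (Suc k))"

lemma entire_dexp_coeff: "entire_coeffs dexp_coeff"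
  by (rule entire_coeffs_if_fact[of _ 1])
    (use inverse_fact_le[of _ 1] in \<open>auto simp: dexp_coeff_def norm_inverse norm_fact simp del: fact_Suc\<close>)

lemma fst_dexp:
  assumes "p \<in> dl"
  shows "fst (ld.opser dexp_coeff (ad_l G R p) (w, 0)) = fst (Smap p (w, 0))"
proof -
  let ?o = "\<lambda>k. if odd k then dexp_coeff k else 0"
  have eo: "entire_coeffs ?o"
    by (rule entire_coeffs_if_fact[of _ 1])
      (use inverse_fact_le[of _ 1] in \<open>auto simp: dexp_coeff_def norm_inverse norm_fact simp del: fact_Suc\<close>)
  have "dexp_coeff = (\<lambda>k. sinhc_coeff k + ?o k)"
    by (auto simp: dexp_coeff_def sinhc_coeff_def fun_eq_iff)
  then have "ld.opser dexp_coeff (ad_l G R p) (w, 0) = Smap p (w, 0) + ld.opser ?o (ad_l G R p) (w, 0)"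
    using ld.opser_add_coeffs[OF entire_sinhc_coeff eo ad_l_lin[OF assms], of "(w, 0)"] by simp
  then show ?thesis
    using opser_parity_odd[OF assms eo, of w] by simp
qed

text \<open>The logarithmic derivative of \<open>Ad_sp\<close> in the direction \<alpha>:
  differentiating \<open>Ad_sp\<close> amounts to a bracket with
  \<open>emb (Theta p \<alpha>)\<close> from the left. Both minus signs come from the exponent
  \<open>- sp\<close>.\<close>

definition Theta :: "('l \<Rightarrow> 'k) \<Rightarrow> ('l \<Rightarrow> 'k) \<Rightarrow> 'l \<times> ('l \<Rightarrow> 'k)" where
  "Theta p \<alpha> = ld.opser dexp_coeff (ad_l G R (- p)) (0, - \<alpha>)"

lemma Ad_sp_DERIV:
  assumes p: "p \<in> dl" and \<alpha>: "\<alpha> \<in> dl" and f: "dd.functional f" and v: "v \<in> dbl"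
  shows "((\<lambda>t. f (Ad_sp G R (p + fun_scale t \<alpha>) v)) has_field_derivative
    f (dbr (emb (Theta p \<alpha>)) (Ad_sp G R p v))) (at 0)"
proof -
  interpret F: operator_family "sum_scale sc" dbl "n + n"
    "\<lambda>i. if i < n then (e i, 0) else (0, c (i - n))"
    "\<lambda>i X. if i < n then c i (fst X) else snd X (e (i - n))" dl dl
    "\<lambda>q. dbr (0, lift q)" "\<lambda>q. dbr (0, lift q)"
    by (rule operator_family_dbr_lift[OF open_region_dl])
  let ?T = "dbr (0, lift (- p))" and ?x = "(0 :: 'g, lift (- \<alpha>))"
  have m: "- p \<in> dl" "- \<alpha> \<in> dl"
    using p \<alpha> by auto
  have xin: "?x \<in> dbl" "(0, lift (- p)) \<in> dbl"
    using lift_in_dbl[OF m(2)] lift_in_dbl[OF m(1)] .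
  have x: "emb (0, - \<alpha>) = ?x"
    by (simp only: emb_def fst_conv snd_conv incl_simps)
  have Theta: "emb (Theta p \<alpha>) = dd.opser dexp_coeff ?T ?x"
    unfolding x[symmetric] Theta_def
    using ld.opser_intertwine[OF dd.coord_space_axioms entire_dexp_coeff ad_l_lin[OF m(1)]
          dbr_lin(1)[OF xin(2)] emb_linear emb_ad_l[OF m(1)], of "(0, - \<alpha>)"] m
    by (simp only: ldbl_iff)
  have Ad: "Ad_sp G R q u = dd.opser exp_coeff (dbr (0, lift (- q))) u" if "q \<in> dl" "u \<in> dbl" for q u
    using that lift_in_dbl[of "- q"] Ad_exp_eq[of "(0, lift (- q))" u]
    by (simp add: Ad_sp_def lift_simps)
  have line: "- (p + fun_scale t \<alpha>) = - p + fun_scale t (- \<alpha>)" for t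
    by (simp add: fun_scale_def fun_eq_iff)
  have in_dl: "p + fun_scale t \<alpha> \<in> dl" for t
    using p \<alpha> by simp
  have D: "((\<lambda>t. (if i < n then c i (fst (Ad_sp G R (p + fun_scale t \<alpha>) v)) else snd (Ad_sp G R (p + fun_scale t \<alpha>) v) (e (i - n))))
      has_field_derivative (if i < n then c i (fst (dbr (emb (Theta p \<alpha>)) (Ad_sp G R p v)))
        else snd (dbr (emb (Theta p \<alpha>)) (Ad_sp G R p v)) (e (i - n)))) (at 0)" if i: "i < n + n" for i
  proof -
    have "(\<lambda>m. exp_coeff m * (\<lambda>X. if i < n then c i (fst X) else snd X (e (i - n))) (dpow ?T (dbr ?x) m v)) sums
        (\<lambda>X. if i < n then c i (fst X) else snd X (e (i - n))) (dbr (dd.opser (\<lambda>k. inverse (fact (Suc k))) ?T ?x) (dd.opser exp_coeff ?T v))"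
      by (rule dd.dexp_derivation[OF dbr_lin(1)[OF xin(2)] dd.functional_c[OF i] dbr_lin(1) dbr_lin(2) _ xin(1) v])
        (assumption | rule dbr_derivation[OF xin(2)])+
    from F.opser_DERIV[OF entire_exp_coeff v i m this]
    show ?thesis
      unfolding Theta dexp_coeff_def[abs_def] Ad[OF p v] Ad[OF in_dl v] line by simp
  qed
  have ex: "f u = (\<Sum>i<n + n. (if i < n then c i (fst u) else snd u (e (i - n))) * f (if i < n then (e i, 0) else (0, c (i - n))))"
    if "u \<in> dbl" for u
    by (rule dd.functional_expand[OF f that])
  have Th: "emb (Theta p \<alpha>) \<in> dbl"
    unfolding Theta by simp
  have "((\<lambda>t. \<Sum>i<n + n. (if i < n then c i (fst (Ad_sp G R (p + fun_scale t \<alpha>) v)) else snd (Ad_sp G R (p + fun_scale t \<alpha>) v) (e (i - n)))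
      * f (if i < n then (e i, 0) else (0, c (i - n)))) has_field_derivative
      (\<Sum>i<n + n. (if i < n then c i (fst (dbr (emb (Theta p \<alpha>)) (Ad_sp G R p v)))
        else snd (dbr (emb (Theta p \<alpha>)) (Ad_sp G R p v)) (e (i - n))) * f (if i < n then (e i, 0) else (0, c (i - n))))) (at 0)"
    by (intro DERIV_sum DERIV_cmult_right D) auto
  then show ?thesis
    using p v Th ex[OF Ad_sp_in[OF in_dl v]] ex[of "dbr (emb (Theta p \<alpha>)) (Ad_sp G R p v)"] by simp
qed

end

section \<open>Differentiating the isotropy relation between fibres\<close>

context canonical_reduction
begin

context
  fixes p assumes pU: "p \<in> U_can G R"
begin

lemma l_can_DERIV:
  assumes "\<alpha> \<in> dl" "\<xi> \<in> dsp" "i < n"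
  shows "((\<lambda>s. c i (l_can G R (p + fun_scale s \<alpha>) \<xi>)) has_field_derivative
    c i (dir_deriv sc (\<lambda>q. l_can G R q \<xi>) p \<alpha>)) (at 0)"
proof -
  define w where "w j = dir_deriv (*) (\<lambda>q. c j (l_can G R q \<xi>)) p \<alpha>" for j
  have D: "((\<lambda>s. c j (l_can G R (p + fun_scale s \<alpha>) \<xi>)) has_field_derivative w j) (at 0)" if "j < n" for j
    unfolding w_def
    by (rule open_region.Ck_SucD(1)[OF open_region_U Ck_l_can[OF assms(2) that, of "Suc 0"] assms(1) pU])
  have "dir_deriv sc (\<lambda>q. l_can G R q \<xi>) p \<alpha> = gg.combine w"
    by (rule gg.dir_deriv_coords(2)[OF open_region_U UNIV_I pU assms(1)])
      (simp add: diff_quot_scalar_iff D)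
  then show ?thesis
    using D[OF assms(3)] gg.c_combine[OF assms(3)] by simp
qed

lemma functional_form: "X \<in> dbl \<Longrightarrow> dd.functional (form X)"
  using bilin_form by (simp add: dd.bilin_def)

lemma form_g_star_0: "X \<in> g_star G R 0 \<Longrightarrow> Y \<in> g_star G R 0 \<Longrightarrow> form X Y = 0"
  unfolding g_star_0 by (auto simp: form_def lperp_D)

text \<open>Moving the series across the form turns the action of \<open>- p\<close> into that of
  \<open>p\<close>. The pairing with \<alpha> sees only the \<open>l\<close>-component of the series
  at \<open>w\<close>, to which only the even part \<open>S\<close> contributes.\<close>

lemma Theta_snd:
  assumes "\<alpha> \<in> dl"
  shows "Theta p \<alpha> \<in> ldbl" "snd (Theta p \<alpha>) w = - \<alpha> (fst (Smap p (w, 0)))"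
proof -
  note d = p_dl[OF pU]
  have m: "- p \<in> dl" "(0, - \<alpha>) \<in> ldbl" "(w, 0) \<in> ldbl"
    using d assms by auto
  show *: "Theta p \<alpha> \<in> ldbl"
    unfolding Theta_def by (rule ld.opser_in)
  have neg: "ad_l G R p X = - ad_l G R (- p) X" if "X \<in> ldbl" for X
  proof -
    have "dbr (- (0, lift p)) (emb X) = - dbr (0, lift p) (emb X)"
      by (rule dbr_uminus[OF lift_in_dbl[OF d] emb_in[OF that]])
    moreover have "- (0 :: 'g, lift p) = (0, lift (- p))"
      by (simp only: lift_simps uminus_Pair minus_zero)
    ultimately have "emb (ad_l G R (- p) X) = emb (- ad_l G R p X)"
      by (simp only: emb_ad_l[OF d that] emb_ad_l[OF m(1) that] emb_simps)
    then show ?thesis by simp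
  qed
  have "snd (Theta p \<alpha>) w = form (Theta p \<alpha>) (w, 0)"
    by (simp add: form_def)
  also have "\<dots> = form (0, - \<alpha>) (ld.opser (\<lambda>k. (- 1) ^ k * dexp_coeff k) (ad_l G R (- p)) (w, 0))"
    unfolding Theta_def
    by (rule ld.opser_adjoint[OF bilin_lform entire_dexp_coeff ad_l_lin[OF m(1)] m(2,3) ad_l_skew[OF m(1)]])
  also have "ld.opser (\<lambda>k. (- 1) ^ k * dexp_coeff k) (ad_l G R (- p)) (w, 0) = ld.opser dexp_coeff (ad_l G R p) (w, 0)"
    by (rule ld.opser_neg[OF entire_dexp_coeff ad_l_lin[OF m(1)] ad_l_lin[OF d] neg m(3), symmetric])
  also have "form (0, - \<alpha>) (ld.opser dexp_coeff (ad_l G R p) (w, 0)) = - \<alpha> (fst (Smap p (w, 0)))"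
    by (simp add: form_def fst_dexp[OF d] snd_ldbl[THEN ldual_sc(3)])
  finally show "snd (Theta p \<alpha>) w = - \<alpha> (fst (Smap p (w, 0)))" .
qed

text \<open>The relation \<open>form Y (Ad_sp (q s) (f s)) = 0\<close> is differentiated at 0 by the
  product rule. The variation of \<open>f\<close> contributes the derivative sought and a bracket in
  \<open>l\<close>; the variation of \<open>Ad_sp\<close> contributes the \<open>l\<close>-component
  \<open>w\<close> of the twisted bracket.\<close>

lemma l_can_deriv_eq:
  assumes X: "(incl R z, \<xi>) \<in> g_star G R p" and X': "(incl R z', \<xi>') \<in> g_star G R p" and \<alpha>: "\<alpha> \<in> dl"
    and b: "double_brk (twist G (l_can G R p)) (incl R z, \<xi>) (incl R z', \<xi>') = (incl R w, \<eta>)"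
  shows "\<xi> (dir_deriv sc (\<lambda>q. l_can G R q \<xi>') p \<alpha>) = \<alpha> (lbr z z') - \<alpha> w"
proof -
  interpret open_region dl "U_can G R" by (rule open_region_U)
  note d = p_dl[OF pU] and t = l_can_antisym[OF pU]
  \<comment> \<open>The variation in direction \<alpha> of the constraint
    \<open>res \<xi>' = coad lbr z' p\<close>. Adding \<open>s\<close> times its lift to \<xi>',
    with \<open>z'\<close> fixed, keeps the moving element in the fibre at
    \<open>q s\<close>.\<close>
  define \<beta> where "\<beta> = coad lbr z' \<alpha>"
  define q where "q s = p + fun_scale s \<alpha>" for s
  define W where "W = dir_deriv sc (\<lambda>q. l_can G R q \<xi>') p \<alpha>"
  \<comment> \<open>\<open>tau\<close> of the moving element, with \<open>s\<close> pulled out by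
    linearity of the canonical matrix. This reading holds while \<open>q s\<close> lies in
    \<open>U_can\<close>, hence for small \<open>s\<close>.\<close>
  define f where "f s = (incl R z' + l_can G R (q s) \<xi>' + sc s (l_can G R (q s) (lift \<beta>)), \<xi>' + fun_scale s (lift \<beta>))" for s
  define F where "F = (W + l_can G R p (lift \<beta>), lift \<beta>)"
  define Y where "Y = phi_map G R p (incl R z, \<xi>)"
  define E where "E j = (if j < n then (e j, 0) else (0, c (j - n)))" for j
  define C where "C j = (\<lambda>X. if j < n then c j (fst X) else snd X (e (j - n)))" for j
  have \<beta>: "\<beta> \<in> dl" "lift \<beta> \<in> dsp"
    using \<alpha> by (auto simp: \<beta>_def)
  have \<xi>: "\<xi> \<in> dsp" "res \<xi> = coad lbr z p" "\<xi>' \<in> dsp" "res \<xi>' = coad lbr z' p"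
    using X X' by (auto simp: g_star_iff)
  have q_dl: "q s \<in> dl" for s
    using d \<alpha> by (simp add: q_def)
  have q0: "q 0 = p"
    by (simp add: q_def)
  have f_in: "f s \<in> dbl" for s
    using \<xi> \<beta> by (simp add: f_def)
  have F_in: "F \<in> dbl"
    using \<beta> by (simp add: F_def)
  have Y0: "Y \<in> g_star G R 0"
    unfolding Y_def by (rule phi_map_in(1)[OF pU X])
  then have Y_in: "Y \<in> dbl"
    by (rule g_star_dbl)
  have phi: "phi_map G R (q s) (incl R z', \<xi>' + fun_scale s (lift \<beta>)) = Ad_sp G R (q s) (f s)" if "q s \<in> U_can G R" for s
    using antisym_lin(1,2)[OF l_can_antisym[OF that]] \<xi> \<beta>
    by (simp add: phi_map_def tau_def f_def add.assoc)
  have star: "(incl R z', \<xi>' + fun_scale s (lift \<beta>)) \<in> g_star G R (q s)" for s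
  proof -
    have "res (\<xi>' + fun_scale s (lift \<beta>)) = coad lbr z' (q s)"
    proof -
      have "res (\<xi>' + fun_scale s (lift \<beta>)) = res \<xi>' + fun_scale s \<beta>"
        by (auto simp: restr_dual_def lift_dual_def proj_simps fun_scale_def)
      then show ?thesis
        by (auto simp: \<xi>(4) \<beta>_def q_def coad_def fun_scale_def fun_eq_iff)
    qed
    then show ?thesis
      using \<xi> \<beta> by (auto simp: g_star_iff)
  qed
  have zero: "form Y (Ad_sp G R (q s) (f s)) = 0" if "q s \<in> U_can G R" for s
    using form_g_star_0[OF Y0 phi_map_in(1)[OF that star]] by (simp add: phi[OF that])
  have EC: "E j \<in> dbl" "dd.functional (C j)" if "j < n + n" for j
    using dd.e_in[OF that] dd.functional_c[OF that] by (simp_all add: E_def C_def)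
  have expand: "g u = (\<Sum>j<n + n. C j u * g (E j))" if "dd.functional g" "u \<in> dbl" for g u
    using dd.functional_expand[OF that] by (simp add: E_def C_def)
  have Th: "emb (Theta p \<alpha>) \<in> dbl"
    using Theta_snd(1)[OF \<alpha>] by simp
  have fun1: "dd.functional (\<lambda>u. form Y (Ad_sp G R (q s) u))" for s
    by (rule dd.functional_comp[OF functional_form[OF Y_in] Ad_sp_lin[OF q_dl]])
  have fun2: "dd.functional (\<lambda>u. form Y (dbr (emb (Theta p \<alpha>)) u))"
    by (rule dd.functional_comp[OF functional_form[OF Y_in] dbr_lin(1)[OF Th]])
  have fun3: "dd.functional (\<lambda>u. form Y (dbr (emb (Theta p \<alpha>)) (Ad_sp G R p u)))"
    by (rule dd.functional_comp[OF fun2 Ad_sp_lin[OF d]])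
  have Df: "((\<lambda>s. C j (f s)) has_field_derivative C j F) (at 0)" if j: "j < n + n" for j
  proof (cases "j < n")
    case True
    have L: "((\<lambda>s. c j (l_can G R (q s) \<zeta>)) has_field_derivative c j (dir_deriv sc (\<lambda>q. l_can G R q \<zeta>) p \<alpha>)) (at 0)"
      if "\<zeta> \<in> dsp" for \<zeta>
      unfolding q_def by (rule l_can_DERIV[OF \<alpha> that True])
    show ?thesis
      using True by (auto simp: C_def f_def F_def q0 W_def intro!: derivative_eq_intros L \<xi> \<beta>)
  next
    case False
    then show ?thesis
      by (auto simp: C_def f_def F_def fun_scale_def intro!: derivative_eq_intros)
  qed
  have DA: "((\<lambda>s. form Y (Ad_sp G R (q s) (E j))) has_field_derivative
      form Y (dbr (emb (Theta p \<alpha>)) (Ad_sp G R p (E j)))) (at 0)" if "j < n + n" for j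
    unfolding q_def by (rule Ad_sp_DERIV[OF d \<alpha> functional_form[OF Y_in] EC(1)[OF that]])
  have D: "((\<lambda>s. \<Sum>j<n + n. C j (f s) * form Y (Ad_sp G R (q s) (E j))) has_field_derivative
      (\<Sum>j<n + n. C j F * form Y (Ad_sp G R (q 0) (E j)) +
        form Y (dbr (emb (Theta p \<alpha>)) (Ad_sp G R p (E j))) * C j (f 0))) (at 0)"
    by (intro DERIV_sum DERIV_mult Df DA) auto
  have eq: "(\<Sum>j<n + n. C j (f s) * form Y (Ad_sp G R (q s) (E j))) = 0" if "q s \<in> U_can G R" for s
    by (rule trans[OF expand[OF fun1 f_in, symmetric] zero[OF that]])
  have ev: "\<forall>\<^sub>F s in nhds 0. (\<Sum>j<n + n. C j (f s) * form Y (Ad_sp G R (q s) (E j))) = 0"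
    unfolding eventually_nhds_conv_at
  proof
    show "\<forall>\<^sub>F s in at 0. (\<Sum>j<n + n. C j (f s) * form Y (Ad_sp G R (q s) (E j))) = 0"
      using line_in_U[OF pU \<alpha>] by (rule eventually_mono) (rule eq, simp add: q_def)
  qed (rule eq, use pU in \<open>simp add: q0\<close>)
  have "(\<Sum>j<n + n. C j F * form Y (Ad_sp G R (q 0) (E j)) +
        form Y (dbr (emb (Theta p \<alpha>)) (Ad_sp G R p (E j))) * C j (f 0)) = 0"
    by (rule DERIV_unique[OF DERIV_cong_ev[OF refl ev refl, THEN iffD1, OF D] DERIV_const])
  then have sum: "form Y (Ad_sp G R p F) + form Y (dbr (emb (Theta p \<alpha>)) (Ad_sp G R p (f 0))) = 0"
    using expand[OF fun1 F_in, of 0] expand[OF fun3 f_in, of 0] by (simp add: sum.distrib q0 mult.commute)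
  have X_in: "(incl R z, \<xi>) \<in> dbl" "(incl R z', \<xi>') \<in> dbl"
    using \<xi> by auto
  \<comment> \<open>The adjoint action is moved across the form, which returns \<open>Y\<close> to
    \<open>tau\<close> of the first element. The two terms with the canonical matrix at
    \<open>p\<close> then cancel by its skewness.\<close>
  have first: "form Y (Ad_sp G R p F) = \<xi> W + \<alpha> (lbr z' z)"
  proof -
    have "form Y (Ad_sp G R p F) = form (Ad_sp G R p F) Y"
      by (rule form_commute)
    also have "\<dots> = form F (Ad_inv p Y)"
      by (rule form_Ad_sp[OF d F_in Y_in])
    also have "Ad_inv p Y = (incl R z + l_can G R p \<xi>, \<xi>)"
      using Ad_inv_Ad_sp[OF d tau_in[OF t X_in(1)]] by (simp add: Y_def phi_map_def tau_def)
    also have "form F (incl R z + l_can G R p \<xi>, \<xi>) = \<xi> W + lift \<beta> (incl R z) + (\<xi> (l_can G R p (lift \<beta>)) + lift \<beta> (l_can G R p \<xi>))"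
      using dual_sc(1)[OF \<xi>(1)] dual_sc(1)[OF \<beta>(2)] by (simp add: form_def F_def)
    also have "\<xi> (l_can G R p (lift \<beta>)) + lift \<beta> (l_can G R p \<xi>) = 0"
      using antisym_mapsD(3)[OF t \<xi>(1) \<beta>(2)] by simp
    also have "lift \<beta> (incl R z) = \<alpha> (lbr z' z)"
      by (simp add: lift_dual_def proj_simps \<beta>_def coad_def)
    finally show ?thesis by simp
  qed
  \<comment> \<open>Invariance turns this into the pairing of \<open>Theta\<close> with the bracket
    of the two images, which is the image of the twisted bracket. Its \<open>l\<close>-component is
    \<open>w'\<close> with \<open>S w' = w\<close>, and the pairing with \<open>Theta\<close>
    applies \<open>S\<close> again.\<close>
  have second: "form Y (dbr (emb (Theta p \<alpha>)) (Ad_sp G R p (f 0))) = \<alpha> w"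
  proof -
    have f0: "Ad_sp G R p (f 0) = phi_map G R p (incl R z', \<xi>')"
      using phi[of 0] pU by (simp add: q0 fun_scale_def flip: zero_fun_def)
    have Y': "phi_map G R p (incl R z', \<xi>') \<in> dbl"
      by (rule g_star_dbl[OF phi_map_in(1)[OF pU X']])
    have br_star: "(incl R w, \<eta>) \<in> g_star G R p"
      using g_star_bracket[OF pU X X'] by (simp add: b)
    obtain w' where w': "Smap p (w', 0) = (w, 0)"
      using Smap_inv_l[OF pU] .
    obtain \<zeta> where \<zeta>: "\<zeta> \<in> lperp" "phi_map G R p (incl R w, \<eta>) = (incl R w', \<zeta>)"
      using phi_map_in(2)[OF pU br_star refl w'] by blast
    have "form Y (dbr (emb (Theta p \<alpha>)) (Ad_sp G R p (f 0))) = - form Y (dbr (phi_map G R p (incl R z', \<xi>')) (emb (Theta p \<alpha>)))"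
      unfolding f0 dbr_skew[OF Y' Th] by (rule dd.functional_D(4)[OF functional_form[OF Y_in] dbr_in[OF Y' Th]])
    also have "\<dots> = form (dbr (phi_map G R p (incl R z', \<xi>')) Y) (emb (Theta p \<alpha>))"
      using form_invariant[OF Y' Y_in Th] by simp
    also have "dbr (phi_map G R p (incl R z', \<xi>')) Y = - (incl R w', \<zeta>)"
      unfolding dbr_skew[OF Y_in Y'] unfolding Y_def phi_map_bracket[OF pU X_in, symmetric] b \<zeta>(2) ..
    also have "form (- (incl R w', \<zeta>)) (emb (Theta p \<alpha>)) = - snd (Theta p \<alpha>) w'"
      using lperp_D(3)[OF \<zeta>(1)] ldual_sc(4)[OF snd_ldbl[OF Theta_snd(1)[OF \<alpha>]]]
      by (simp add: form_def emb_def lift_dual_def proj_simps flip: incl_simps(4))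
    also have "\<dots> = \<alpha> w"
      using Theta_snd(2)[OF \<alpha>, of w'] w' by simp
    finally show ?thesis .
  qed
  have skew: "\<alpha> (lbr z' z) = - \<alpha> (lbr z z')"
    by (subst lbr_skew) (rule ldual_sc(4)[OF \<alpha>])
  have "\<xi> W = (\<xi> W + - \<alpha> (lbr z z') + \<alpha> w) + (\<alpha> (lbr z z') - \<alpha> w)"
    by simp
  then have "\<xi> W = \<alpha> (lbr z z') - \<alpha> w"
    unfolding sum[unfolded first second skew] by simp
  then show ?thesis
    unfolding W_def .
qed

end

end

section \<open>The kernel of the anchor\<close>

text \<open>Along the zero direction every difference quotient is 0, so no regularity of
  \<open>f\<close> enters. Uniqueness of this limit is passed in as a hypothesis, since the values
  lie in a type with just a topology.\<close>

lemma dir_deriv_zero: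
  fixes f :: "('v \<Rightarrow> 'k::real_or_complex) \<Rightarrow> 'w::{ab_group_add,topological_space}"
  assumes "vector_space sc" and unique: "\<And>w::'w. ((\<lambda>_::'k. 0) \<longlongrightarrow> w) (at 0) \<Longrightarrow> w = 0"
  shows "dir_deriv sc f p 0 = 0"
proof -
  interpret vector_space sc by (rule assms(1))
  have "fun_scale t (0 :: 'v \<Rightarrow> 'k) = 0" for t
    by (auto simp: fun_scale_def)
  then have dq: "diff_quot sc f p 0 = (\<lambda>_. 0)"
    by (auto simp: diff_quot_def)
  show ?thesis
    unfolding dir_deriv_def dq
  proof (rule the_equality)
    show "((\<lambda>_::'k. 0 :: 'w) \<longlongrightarrow> 0) (at 0)"
      by (rule tendsto_const)
  qed (rule unique)
qed

lemma tendsto_fun_zero_unique: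
  fixes w :: "'v \<Rightarrow> 'k::real_or_complex"
  assumes "((\<lambda>_::'k. 0) \<longlongrightarrow> w) (at 0)"
  shows "w = 0"
proof
  show "w x = 0 x" for x
    using assms tendsto_unique[OF at_zero_neq_bot, of "\<lambda>_. 0" "w x" 0] by (auto simp: tendsto_fun_iff)
qed

context canonical_reduction
begin

sublocale nf: coord_space "sum_scale lsc" "UNIV \<times> dsp" "nl + n"
  "\<lambda>i. if i < nl then (el i, 0) else (0, c (i - nl))" "\<lambda>i X. if i < nl then cl i (fst X) else snd X (e (i - nl))"
  by (rule coord_space_sum[OF lcoords coords])

lemma ker_anchor_iff: "u \<in> ker_anchor G R p \<longleftrightarrow> (incl R (fst u), snd u) \<in> g_star G R p"
  by (cases u) (auto simp: ker_anchor_def N_fibre_def N_anchor_def g_star_iff)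

lemma ker_anchor_in: "u \<in> ker_anchor G R p \<Longrightarrow> u \<in> UNIV \<times> dsp"
  by (cases u) (simp add: ker_anchor_def N_fibre_def)

lemma ker_anchor_subspace: "p \<in> dl \<Longrightarrow> nf.subspace (ker_anchor G R p)"
proof -
  assume "p \<in> dl"
  note g = g_star_subspace[OF this, unfolded dd.subspace_def]
  have "(0, 0) \<in> g_star G R p"
    using g by (simp add: zero_prod_def)
  moreover have "(incl R y + incl R z, \<xi> + \<eta>) \<in> g_star G R p"
    if "(incl R y, \<xi>) \<in> g_star G R p" "(incl R z, \<eta>) \<in> g_star G R p" for y z \<xi> \<eta>
    using bspec[OF bspec[OF conjunct1[OF conjunct2[OF g]] that(1)] that(2)] by simp
  moreover have "(sc a (incl R y), fun_scale a \<xi>) \<in> g_star G R p" if "(incl R y, \<xi>) \<in> g_star G R p" for a y \<xi>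
    using bspec[OF spec[OF conjunct2[OF conjunct2[OF g]], of a] that] by (simp add: sum_scale_def)
  ultimately show ?thesis
    unfolding nf.subspace_def by (auto simp: ker_anchor_iff incl_simps sum_scale_def)
qed

context
  fixes p assumes pU: "p \<in> U_can G R"
begin

text \<open>The anchors vanish at \<open>p\<close>, so all derivatives of the sections drop out and
  only their values matter. The pairing with the derivative of the canonical matrix is
  \<open>lbr z z' - w\<close>; it cancels the bracket in \<open>l\<close> and leaves
  \<open>- w\<close>.\<close>

lemma N_bracket_ker:
  assumes X: "(z, \<xi>) \<in> ker_anchor G R p" "\<sigma> p = (z, \<xi>)" and X': "(z', \<xi>') \<in> ker_anchor G R p" "\<sigma>' p = (z', \<xi>')"
    and b: "double_brk (twist G (l_can G R p)) (incl R z, \<xi>) (incl R z', \<xi>') = (incl R w, \<eta>)"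
  shows "N_bracket G R (l_can G R) \<sigma> \<sigma>' p = (- w, - \<eta>)"
proof -
  note t = l_can_antisym[OF pU]
  have g: "(incl R z, \<xi>) \<in> g_star G R p" "(incl R z', \<xi>') \<in> g_star G R p"
    using X(1) X'(1) by (simp_all add: ker_anchor_iff)
  have \<xi>: "\<xi> \<in> dsp" "\<xi>' \<in> dsp"
    using g by (auto simp: g_star_iff)
  have a: "N_anchor R p (z, \<xi>) = 0" "N_anchor R p (z', \<xi>') = 0"
    using X(1) X'(1) by (auto simp: ker_anchor_def)
  have d1: "dir_deriv lsc h p 0 = 0" for h :: "('l \<Rightarrow> 'k) \<Rightarrow> 'l"
    by (rule dir_deriv_zero[OF ll.vector_space_axioms]) (rule tendsto_unique[OF at_zero_neq_bot _ tendsto_const])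
  have d2: "dir_deriv fun_scale h p 0 = 0" for h :: "('l \<Rightarrow> 'k) \<Rightarrow> 'g \<Rightarrow> 'k"
    by (rule dir_deriv_zero[OF vector_space_fun_scale]) (rule tendsto_fun_zero_unique)
  have pair: "dl_pairing G R (l_can G R) p \<xi> \<xi>' = lbr z z' - w"
    unfolding dl_pairing_def
  proof (rule the_equality)
    have *: "\<alpha> (lbr z z' - w) = \<xi> (dir_deriv sc (\<lambda>q. l_can G R q \<xi>') p \<alpha>)" if "\<alpha> \<in> dl" for \<alpha>
      using l_can_deriv_eq[OF pU g that b] ldual_sc(5)[OF that] by simp
    then show "\<forall>\<alpha>\<in>dl. \<alpha> (lbr z z' - w) = \<xi> (dir_deriv sc (\<lambda>q. l_can G R q \<xi>') p \<alpha>)"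
      by blast
    show "y = lbr z z' - w" if "\<forall>\<alpha>\<in>dl. \<alpha> y = \<xi> (dir_deriv sc (\<lambda>q. l_can G R q \<xi>') p \<alpha>)" for y
      by (rule ll.dual_separates[OF refl]) (use that * in simp)
  qed
  have snd: "coad br (incl R z) \<xi>' - coad br (incl R z') \<xi> + (\<lambda>x. \<xi> (cobr G x \<xi>'))
      + coad br (l_can G R p \<xi>) \<xi>' - coad br (l_can G R p \<xi>') \<xi> = - \<eta>"
  proof
    fix x
    have "\<eta> x = - \<xi>' (br (incl R z) x) + \<xi> (br (incl R z') x) + \<xi>' (cobr (twist G (l_can G R p)) x \<xi>)"
      using arg_cong[OF b, of "\<lambda>X. snd X x"] by (simp add: double_brk_def coad_def twist_def)
    also have "\<xi>' (cobr (twist G (l_can G R p)) x \<xi>) = \<xi>' (cobr G x \<xi>) + \<xi>' (br x (l_can G R p \<xi>)) - \<xi> (br x (l_can G R p \<xi>'))"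
      by (rule twist_cobr_dual[OF t \<xi>])
    also have "\<xi>' (cobr G x \<xi>) = - \<xi> (cobr G x \<xi>')"
      by (rule cobr_skew[OF \<xi>])
    also have "\<xi>' (br x (l_can G R p \<xi>)) = - \<xi>' (br (l_can G R p \<xi>) x)"
      by (subst br_skew) (rule dual_sc(4)[OF \<xi>(2)])
    also have "\<xi> (br x (l_can G R p \<xi>')) = - \<xi> (br (l_can G R p \<xi>') x)"
      by (subst br_skew) (rule dual_sc(4)[OF \<xi>(1)])
    finally show "(coad br (incl R z) \<xi>' - coad br (incl R z') \<xi> + (\<lambda>x. \<xi> (cobr G x \<xi>'))
      + coad br (l_can G R p \<xi>) \<xi>' - coad br (l_can G R p \<xi>') \<xi>) x = (- \<eta>) x"
      by (simp add: coad_def)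
  qed
  show ?thesis
    unfolding N_bracket_def Let_def X(2) X'(2) a fst_conv snd_conv d1 d2 pair
    using snd by simp
qed

lemma ker_bracket_eq:
  assumes X: "(z, \<xi>) \<in> ker_anchor G R p" and X': "(z', \<xi>') \<in> ker_anchor G R p"
    and b: "double_brk (twist G (l_can G R p)) (incl R z, \<xi>) (incl R z', \<xi>') = (incl R w, \<eta>)"
  shows "ker_bracket G R (l_can G R) (U_can G R) p (z, \<xi>) (z', \<xi>') = (- w, - \<eta>)"
  unfolding ker_bracket_def
proof (rule the_equality)
  \<comment> \<open>Constant sections extend any two elements. They make the quantification over
    sections nonvacuous, which gives uniqueness of the described value.\<close>
  have const: "smooth_section (sum_scale lsc) dl (U_can G R) (\<lambda>_. N_fibre G) (\<lambda>_. u)" if "u \<in> ker_anchor G R p" for u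
    unfolding smooth_section_def
    using nf.Ck_coordsI[OF open_region_U, of "\<lambda>_. u"] open_region.Ck_const[OF open_region_U] ker_anchor_in[OF that]
    by (auto simp: N_fibre_def)
  fix y assume "\<forall>\<sigma> \<sigma>'. smooth_section (sum_scale lsc) dl (U_can G R) (\<lambda>_. N_fibre G) \<sigma> \<and>
      smooth_section (sum_scale lsc) dl (U_can G R) (\<lambda>_. N_fibre G) \<sigma>' \<and> \<sigma> p = (z, \<xi>) \<and> \<sigma>' p = (z', \<xi>') \<longrightarrow>
      N_bracket G R (l_can G R) \<sigma> \<sigma>' p = y"
  from this[rule_format, OF conjI[OF const[OF X] conjI[OF const[OF X'] conjI[OF refl refl]]]]
  show "y = (- w, - \<eta>)"
    using N_bracket_ker[where \<sigma> = "\<lambda>_. (z, \<xi>)" and \<sigma>' = "\<lambda>_. (z', \<xi>')", OF X refl X' refl b] by simp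
qed (use N_bracket_ker[OF X _ X' _ b] in blast)

lemma ker_bracket_cases:
  assumes "u \<in> ker_anchor G R p" "v \<in> ker_anchor G R p"
  obtains w \<eta> where "(incl R w, \<eta>) \<in> g_star G R p"
    "double_brk (twist G (l_can G R p)) (incl R (fst u), snd u) (incl R (fst v), snd v) = (incl R w, \<eta>)"
    "ker_bracket G R (l_can G R) (U_can G R) p u v = (- w, - \<eta>)"
proof -
  have "double_brk (twist G (l_can G R p)) (incl R (fst u), snd u) (incl R (fst v), snd v) \<in> g_star G R p"
    using assms by (intro g_star_bracket[OF pU]) (simp_all add: ker_anchor_iff)
  then obtain w \<eta> where *: "(incl R w, \<eta>) \<in> g_star G R p"
    "double_brk (twist G (l_can G R p)) (incl R (fst u), snd u) (incl R (fst v), snd v) = (incl R w, \<eta>)"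
    by (auto simp: g_star_def)
  have "ker_bracket G R (l_can G R) (U_can G R) p u v = (- w, - \<eta>)"
    using ker_bracket_eq[of "fst u" "snd u" "fst v" "snd v", OF _ _ *(2)] assms by simp
  from that[OF * this] show ?thesis .
qed

end

end

section \<open>The bundle isomorphism\<close>

context canonical_reduction
begin

context
  fixes p assumes pU: "p \<in> U_can G R"
begin

text \<open>The bracket on the kernel is minus the twisted one. The sign in front of
  \<open>phi_map\<close> compensates for it, since negating both arguments of a bracket does not
  change its value.\<close>

lemma ker_anchor_iso:
  "lie_algebra_iso (sum_scale lsc) (ker_anchor G R p) (ker_bracket G R (l_can G R) (U_can G R) p)
    (sum_scale sc) (g_star G R 0) dbr (\<lambda>u. - phi_map G R p (incl R (fst u), snd u))"
proof (rule lie_algebra_iso_pullback[OF nf.vector_space_axioms ker_anchor_subspace[OF p_dl[OF pU]] g_star_0_lie])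
  let ?f = "\<lambda>u. - phi_map G R p (incl R (fst u), snd u)"
  note L = dd.lin_D[OF phi_map_lin[OF pU]]
  have star: "(incl R (fst u), snd u) \<in> g_star G R p" if "u \<in> ker_anchor G R p" for u
    using that by (simp add: ker_anchor_iff)
  have neg: "- X \<in> g_star G R 0" if "X \<in> g_star G R 0" for X
    using dd.subspace_neg[OF g_star_subspace[OF ldual_cl(1)] that] .
  have dbl: "(incl R (fst u), snd u) \<in> dbl" if "u \<in> ker_anchor G R p" for u
    by (rule g_star_dbl[OF star[OF that]])
  have f_in: "?f u \<in> g_star G R 0" if "u \<in> ker_anchor G R p" for u
    by (rule neg[OF phi_map_in(1)[OF pU star[OF that]]])
  show "linear_between (sum_scale lsc) (ker_anchor G R p) (sum_scale sc) (g_star G R 0) ?f"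
    unfolding linear_between_def
  proof (intro conjI ballI allI f_in)
    fix u v assume "u \<in> ker_anchor G R p" "v \<in> ker_anchor G R p"
    from L(2)[OF dbl[OF this(1)] dbl[OF this(2)]] show "?f (u + v) = ?f u + ?f v"
      by (simp add: incl_simps)
  next
    fix a u assume "u \<in> ker_anchor G R p"
    from L(3)[OF dbl[OF this], of a] show "?f (sum_scale lsc a u) = sum_scale sc a (?f u)"
      by (simp add: incl_simps dd.scale_minus_right) (simp add: sum_scale_def incl_simps)
  qed
  show "bij_betw ?f (ker_anchor G R p) (g_star G R 0)"
    unfolding bij_betw_def
  proof (intro conjI inj_onI subset_antisym subsetI)
    fix u v assume u: "u \<in> ker_anchor G R p" "v \<in> ker_anchor G R p" and "?f u = ?f v"
    then have "phi_map G R p (incl R (fst u), snd u) = phi_map G R p (incl R (fst v), snd v)"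
      by simp
    from phi_map_inj[OF pU dbl[OF u(1)] dbl[OF u(2)] this] show "u = v"
      by (simp add: prod_eq_iff)
  next
    show "Y \<in> g_star G R 0" if "Y \<in> ?f ` ker_anchor G R p" for Y
      using that f_in by auto
    fix Y assume "Y \<in> g_star G R 0"
    from phi_map_surj[OF pU neg[OF this]] obtain X where X: "X \<in> g_star G R p" "phi_map G R p X = - Y"
      by blast
    then obtain z where z: "X = (incl R z, snd X)"
      by (auto simp: g_star_def)
    have "(z, snd X) \<in> ker_anchor G R p" "?f (z, snd X) = Y"
      using X z by (simp_all add: ker_anchor_iff flip: z)
    then show "Y \<in> ?f ` ker_anchor G R p"
      by (intro image_eqI[of _ _ "(z, snd X)"]) auto
  qed
  fix u v assume u: "u \<in> ker_anchor G R p" "v \<in> ker_anchor G R p"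
  obtain w \<eta> where w: "(incl R w, \<eta>) \<in> g_star G R p"
    "double_brk (twist G (l_can G R p)) (incl R (fst u), snd u) (incl R (fst v), snd v) = (incl R w, \<eta>)"
    "ker_bracket G R (l_can G R) (U_can G R) p u v = (- w, - \<eta>)"
    by (rule ker_bracket_cases[OF pU u])
  have m: "(incl R (- w), - \<eta>) = - (incl R w, \<eta>)"
    by (simp add: incl_simps)
  have "- (incl R w, \<eta>) \<in> g_star G R p"
    by (rule dd.subspace_neg[OF g_star_subspace[OF p_dl[OF pU]] w(1)])
  then show "ker_bracket G R (l_can G R) (U_can G R) p u v \<in> ker_anchor G R p"
    unfolding w(3) ker_anchor_iff fst_conv snd_conv m .
  have d: "phi_map G R p (incl R (fst u), snd u) \<in> dbl" "phi_map G R p (incl R (fst v), snd v) \<in> dbl"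
    using L(1) dbl u by auto
  have "?f (ker_bracket G R (l_can G R) (U_can G R) p u v) = phi_map G R p (incl R w, \<eta>)"
    unfolding w(3) fst_conv snd_conv m L(5)[OF g_star_dbl[OF w(1)]] by simp
  also have "\<dots> = dbr (phi_map G R p (incl R (fst u), snd u)) (phi_map G R p (incl R (fst v), snd v))"
    unfolding w(2)[symmetric] by (rule phi_map_bracket[OF pU dbl[OF u(1)] dbl[OF u(2)]])
  also have "\<dots> = dbr (?f u) (?f v)"
    using dd.lin_D(5)[OF dbr_lin(1)] dd.lin_D(5)[OF dbr_lin(2)] d by simp
  finally show "?f (ker_bracket G R (l_can G R) (U_can G R) p u v) = dbr (?f u) (?f v)" .
qed

lemma psi_map_cases:
  assumes "X \<in> g_star G R 0"
  obtains z \<xi> where "(incl R z, \<xi>) \<in> g_star G R p" "phi_map G R p (incl R z, \<xi>) = X" "psi_map G R p X = (- z, - \<xi>)"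
proof -
  let ?Y = "inv_into (g_star G R p) (phi_map G R p) X"
  have "X \<in> phi_map G R p ` g_star G R p"
    using phi_map_bij[OF pU] assms by (simp add: bij_betw_def)
  then have Y: "?Y \<in> g_star G R p" "phi_map G R p ?Y = X"
    by (rule inv_into_into, rule f_inv_into_f)
  then obtain z \<xi> where z: "?Y = (incl R z, \<xi>)"
    by (auto simp: g_star_def)
  have "inv_into UNIV (incl R) (- incl R z) = - z"
    using inv_into_f_f[of "incl R" UNIV "- z"] by (simp add: inj_def incl_simps)
  then have "psi_map G R p X = (- z, - \<xi>)"
    unfolding psi_map_def z by simp
  with that Y show ?thesis
    unfolding z by blast
qed

lemma psi_map_in: "X \<in> g_star G R 0 \<Longrightarrow> psi_map G R p X \<in> ker_anchor G R p"
  and psi_map_inverse: "X \<in> g_star G R 0 \<Longrightarrow> - phi_map G R p (incl R (fst (psi_map G R p X)), snd (psi_map G R p X)) = X"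
proof -
  assume X: "X \<in> g_star G R 0"
  obtain z \<xi> where *: "(incl R z, \<xi>) \<in> g_star G R p" "phi_map G R p (incl R z, \<xi>) = X" "psi_map G R p X = (- z, - \<xi>)"
    by (rule psi_map_cases[OF X])
  have m: "(incl R (- z), - \<xi>) = - (incl R z, \<xi>)"
    by (simp add: incl_simps)
  show "psi_map G R p X \<in> ker_anchor G R p"
    unfolding *(3) ker_anchor_iff fst_conv snd_conv m
    by (rule dd.subspace_neg[OF g_star_subspace[OF p_dl[OF pU]] *(1)])
  show "- phi_map G R p (incl R (fst (psi_map G R p X)), snd (psi_map G R p X)) = X"
    unfolding *(3) fst_conv snd_conv m dd.lin_D(5)[OF phi_map_lin[OF pU] g_star_dbl[OF *(1)]] *(2) by simp
qed

lemma psi_map_iso: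
  "lie_algebra_iso (sum_scale sc) (g_star G R 0) dbr (sum_scale lsc) (ker_anchor G R p)
    (ker_bracket G R (l_can G R) (U_can G R) p) (psi_map G R p)"
  by (rule lie_algebra_iso_inverse[OF nf.vector_space_axioms ker_anchor_iso psi_map_in psi_map_inverse])

lemma inv_psi_map:
  assumes "u \<in> ker_anchor G R p"
  shows "inv_into (g_star G R 0) (psi_map G R p) u = - phi_map G R p (incl R (fst u), snd u)"
proof -
  have inj: "inj_on (\<lambda>u. - phi_map G R p (incl R (fst u), snd u)) (ker_anchor G R p)"
    using ker_anchor_iso by (auto simp: lie_algebra_iso_def bij_betw_def)
  have f: "- phi_map G R p (incl R (fst u), snd u) \<in> g_star G R 0"
    using ker_anchor_iso assms by (auto simp: lie_algebra_iso_def linear_between_def)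
  have "psi_map G R p (- phi_map G R p (incl R (fst u), snd u)) = u"
    by (rule inj_onD[OF inj psi_map_inverse[OF f] psi_map_in[OF f] assms])
  then show ?thesis
    using inv_into_f_eq[OF _ f] psi_map_iso by (auto simp: lie_algebra_iso_def bij_betw_def)
qed

text \<open>Undoing \<open>tau\<close> means subtracting the canonical matrix at the dual component.
  This replaces \<open>inv_into\<close> by an explicit expression in families already known to be
  smooth.\<close>

lemma psi_map_eq:
  assumes "X \<in> g_star G R 0"
  shows "psi_map G R p X = (- proj_l R (fst (Ad_inv p X) - l_can G R p (snd (Ad_inv p X))), - snd (Ad_inv p X))"
proof -
  obtain z \<xi> where *: "(incl R z, \<xi>) \<in> g_star G R p" "phi_map G R p (incl R z, \<xi>) = X" "psi_map G R p X = (- z, - \<xi>)"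
    by (rule psi_map_cases[OF assms])
  have "Ad_inv p X = tau (l_can G R p) (incl R z, \<xi>)"
    using Ad_inv_Ad_sp[OF p_dl[OF pU] tau_in[OF l_can_antisym[OF pU] g_star_dbl[OF *(1)]]]
    unfolding phi_map_def[symmetric] *(2) .
  then show ?thesis
    by (simp add: *(3) tau_def proj_simps)
qed

end

lemma smooth_psi_map:
  assumes "smooth_section (sum_scale sc) dl (U_can G R) (\<lambda>_. g_star G R 0) \<sigma>"
  shows "smooth_section (sum_scale lsc) dl (U_can G R) (ker_anchor G R) (\<lambda>q. psi_map G R q (\<sigma> q))"
  unfolding smooth_section_def
proof (intro conjI ballI allI)
  interpret open_region dl "U_can G R" by (rule open_region_U)
  have \<sigma>: "\<sigma> q \<in> g_star G R 0" if "q \<in> U_can G R" for q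
    using assms that by (simp add: smooth_section_def)
  then have \<sigma>_in: "\<sigma> q \<in> dbl" if "q \<in> U_can G R" for q
    using g_star_dbl that by blast
  show "psi_map G R q (\<sigma> q) \<in> ker_anchor G R q" if "q \<in> U_can G R" for q
    by (rule psi_map_in[OF that \<sigma>[OF that]])
  fix k
  have Ck: "Ck_on k (sum_scale sc) dl (U_can G R) \<sigma>"
    using assms by (simp add: smooth_section_def)
  have A_in: "Ad_inv q (\<sigma> q) \<in> dbl" if "q \<in> U_can G R" for q
    by (rule Ad_inv_in[OF p_dl[OF that] \<sigma>_in[OF that]])
  have A: "Ck_on k (*) dl (U_can G R) (\<lambda>q. f (Ad_inv q (\<sigma> q)))" if "dd.functional f" for f
    by (rule Ck_Ad_sp(2)[OF open_region_U that \<sigma>_in dd.Ck_coordsD[OF open_region_U \<sigma>_in Ck]])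
  show "Ck_on k (sum_scale lsc) dl (U_can G R) (\<lambda>q. psi_map G R q (\<sigma> q))"
  proof (rule nf.Ck_coordsI[OF open_region_U])
    show "psi_map G R q (\<sigma> q) \<in> UNIV \<times> dsp" if "q \<in> U_can G R" for q
      by (rule ker_anchor_in[OF psi_map_in[OF that \<sigma>[OF that]]])
    fix i assume i: "i < nl + n"
    show "Ck_on k (*) dl (U_can G R) (\<lambda>q. if i < nl then cl i (fst (psi_map G R q (\<sigma> q))) else snd (psi_map G R q (\<sigma> q)) (e (i - nl)))"
    proof (cases "i < nl")
      case True
      let ?F = "\<lambda>q X. cl i (proj_l R (fst X - l_can G R q (snd X)))"
      have proj: "gg.functional (\<lambda>x. cl i (proj_l R x))"
        using True by (simp add: linear_between_def proj_simps)
      have "Ck_on k (*) dl (U_can G R) (\<lambda>q. ?F q (Ad_inv q (\<sigma> q)))"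
      proof (rule dd.Ck_apply[OF open_region_U _ A_in])
        show "dd.functional (?F q)" if "q \<in> U_can G R" for q
          using antisym_lin(1,2)[OF l_can_antisym[OF that]]
          by (auto simp: linear_between_def sum_scale_def gg.functional_D[OF proj] right_diff_distrib add_diff_add)
        show "Ck_on k (*) dl (U_can G R) (\<lambda>q. ?F q (if j < n then (e j, 0) else (0, c (j - n))))" if "j < n + n" for j
        proof (rule gg.Ck_functional[OF open_region_U proj UNIV_I])
          fix m assume m: "m < n"
          have "snd (if j < n then (e j, 0) else (0, c (j - n))) \<in> dsp"
            using snd_dbl[OF dd.e_in[OF that]] .
          from Ck_diff[OF Ck_const Ck_l_can[OF this m]] 
          show "Ck_on k (*) dl (U_can G R) (\<lambda>q. c m (fst (if j < n then (e j, 0) else (0, c (j - n)))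
              - l_can G R q (snd (if j < n then (e j, 0) else (0, c (j - n))))))"
            using m by simp
        qed
        show "Ck_on k (*) dl (U_can G R) (\<lambda>q. if j < n then c j (fst (Ad_inv q (\<sigma> q))) else snd (Ad_inv q (\<sigma> q)) (e (j - n)))" if "j < n + n" for j
          by (rule A[OF dd.functional_c[OF that]])
      qed
      from Ck_uminus[OF this] show ?thesis
        using True \<sigma> by (subst Ck_cong) (auto simp: psi_map_eq)
    next
      case False
      then have "n + (i - nl) < n + n"
        using i by simp
      from A[OF dd.functional_c[OF this]] have "Ck_on k (*) dl (U_can G R) (\<lambda>q. snd (Ad_inv q (\<sigma> q)) (e (i - nl)))"
        by simp
      from Ck_uminus[OF this] show ?thesis
        using False \<sigma> by (subst Ck_cong) (auto simp: psi_map_eq)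
    qed
  qed
qed

lemma smooth_inv_psi_map:
  assumes "smooth_section (sum_scale lsc) dl (U_can G R) (ker_anchor G R) \<sigma>"
  shows "smooth_section (sum_scale sc) dl (U_can G R) (\<lambda>_. g_star G R 0) (\<lambda>q. inv_into (g_star G R 0) (psi_map G R q) (\<sigma> q))"
  unfolding smooth_section_def
proof (intro conjI ballI allI)
  interpret open_region dl "U_can G R" by (rule open_region_U)
  let ?X = "\<lambda>q u. tau (l_can G R q) (incl R (fst u), snd u)"
  have \<sigma>: "\<sigma> q \<in> ker_anchor G R q" if "q \<in> U_can G R" for q
    using assms that by (simp add: smooth_section_def)
  have \<sigma>_in: "\<sigma> q \<in> UNIV \<times> dsp" if "q \<in> U_can G R" for q
    by (rule ker_anchor_in[OF \<sigma>[OF that]])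
  have X_in: "?X q (\<sigma> q) \<in> dbl" if "q \<in> U_can G R" for q
    using \<sigma>_in[OF that] by (intro tau_in l_can_antisym that) auto
  have inv: "inv_into (g_star G R 0) (psi_map G R q) (\<sigma> q) = - Ad_sp G R q (?X q (\<sigma> q))" if "q \<in> U_can G R" for q
    using inv_psi_map[OF that \<sigma>[OF that]] by (simp add: phi_map_def)
  show star: "inv_into (g_star G R 0) (psi_map G R q) (\<sigma> q) \<in> g_star G R 0" if "q \<in> U_can G R" for q
  proof (rule inv_into_into)
    show "\<sigma> q \<in> psi_map G R q ` g_star G R 0"
      using psi_map_iso[OF that] \<sigma>[OF that] by (auto simp: lie_algebra_iso_def bij_betw_def)
  qed
  fix k
  have Ck: "Ck_on k (sum_scale lsc) dl (U_can G R) \<sigma>"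
    using assms by (simp add: smooth_section_def)
  note C = nf.Ck_coordsD[OF open_region_U \<sigma>_in Ck]
  have X: "Ck_on k (*) dl (U_can G R) (\<lambda>q. if i < n then c i (fst (?X q (\<sigma> q))) else snd (?X q (\<sigma> q)) (e (i - n)))"
    if i: "i < n + n" for i
  proof (cases "i < n")
    case True
    let ?F = "\<lambda>q u. c i (incl R (fst u) + l_can G R q (snd u))"
    have "Ck_on k (*) dl (U_can G R) (\<lambda>q. ?F q (\<sigma> q))"
    proof (rule nf.Ck_apply[OF open_region_U _ \<sigma>_in _ C])
      show "nf.functional (?F q)" if "q \<in> U_can G R" for q
        using antisym_lin(1,2)[OF l_can_antisym[OF that]] True
        by (auto simp: linear_between_def sum_scale_def incl_simps algebra_simps)
      fix j assume j: "j < nl + n"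
      have "snd (if j < nl then (el j, 0) else (0, c (j - nl))) \<in> dsp"
        using nf.e_in[OF j] by auto
      from Ck_add[OF Ck_const Ck_l_can[OF this True]]
      show "Ck_on k (*) dl (U_can G R) (\<lambda>q. ?F q (if j < nl then (el j, 0) else (0, c (j - nl))))"
        using True by simp
    qed
    then show ?thesis
      using True by (simp add: tau_def)
  next
    case False
    define m where "m = i - n"
    have "nl + m < nl + n"
      using i False by (simp add: m_def)
    from C[OF _ this] have "Ck_on k (*) dl (U_can G R) (\<lambda>q. snd (\<sigma> q) (e m))"
      by simp
    then show ?thesis
      using False by (simp add: tau_def m_def)
  qed
  show "Ck_on k (sum_scale sc) dl (U_can G R) (\<lambda>q. inv_into (g_star G R 0) (psi_map G R q) (\<sigma> q))"
  proof (rule dd.Ck_coordsI[OF open_region_U])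
    show "inv_into (g_star G R 0) (psi_map G R q) (\<sigma> q) \<in> dbl" if "q \<in> U_can G R" for q
      by (rule g_star_dbl[OF star[OF that]])
    fix i assume i: "i < n + n"
    note f = dd.functional_c[OF i]
    from Ck_uminus[OF Ck_Ad_sp(1)[OF open_region_U f X_in X]]
    show "Ck_on k (*) dl (U_can G R) (\<lambda>q. if i < n then c i (fst (inv_into (g_star G R 0) (psi_map G R q) (\<sigma> q)))
        else snd (inv_into (g_star G R 0) (psi_map G R q) (\<sigma> q)) (e (i - n)))"
      using i by (subst Ck_cong) (auto simp: inv)
  qed
qed

lemma psi_map_bundle_iso:
  "lie_algebra_bundle_iso dl (U_can G R) (sum_scale sc) (\<lambda>_. g_star G R 0) (\<lambda>_. dbr)
    (sum_scale lsc) (ker_anchor G R) (ker_bracket G R (l_can G R) (U_can G R)) (psi_map G R)"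
  unfolding lie_algebra_bundle_iso_def
  using openin_U psi_map_iso smooth_psi_map smooth_inv_psi_map by blast

end

theorem proposition7p1:
  fixes G :: "('k::real_or_complex, 'g::real_normed_vector) quasi_bialg"
    and R :: "('k, 'g, 'l::real_normed_vector) decomposition"
  assumes "lie_quasi_bialgebra G"
    and "reductive_decomposition G R"
    and "canonically_compatible G R"
  shows "(\<forall>p \<in> U_can G R.
            lie_algebra_iso
              (sum_scale (scl G)) (g_star G R p) (double_brk (twist G (l_can G R p)))
              (sum_scale (scl G)) (g_star G R 0) (double_brk G)
              (phi_map G R p)) \<and>
         lie_algebra_bundle_iso (dual (lscl R)) (U_can G R)
           (sum_scale (scl G)) (\<lambda>_. g_star G R 0) (\<lambda>_. double_brk G)
           (sum_scale (lscl R)) (ker_anchor G R) (ker_bracket G R (l_can G R) (U_can G R))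
           (psi_map G R)"
proof -
  obtain n e c where coords: "coord_space (scl G) UNIV n e c"
    using fin_dim_coord_space assms(1) unfolding lie_quasi_bialgebra_def by blast
  obtain nl el cl where lcoords: "coord_space (lscl R) UNIV nl el cl"
    using fin_dim_coord_space assms(2) unfolding reductive_decomposition_def by blast
  interpret canonical_reduction G n e c R nl el cl
    by (intro canonical_reduction.intro quasi_bialgebra.intro canonical_reduction_axioms.intro assms coords lcoords)
  show ?thesis
    using phi_map_iso psi_map_bundle_iso by blast
qed

end
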